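(* Let $n>1$ and let $f:\mathbb{T}^n\to\mathbb{T}^n$ be a $C^2$ local diffeomorphism away from a non-degenerate critical set $\mathcal{C}$, which is non-uniformly expanding and whose orbits have slow recurrence to the critical set. Assume that there are $\sigma,\delta\in(0,1)$ such that the first $(\sigma,\delta)$-hyperbolic time map $h$ is defined $\lambda$-almost everywhere and satisfies $$\sum_{m\ge1}\sum_{j=0}^{m-1}\lambda\big(f^j(h^{-1}(m))\big)<\infty.$$ Then there exists a Borel measurable function $\zeta:\mathbb{T}^n\to\mathbb{R}^+=(0,\infty)$, locally constant at $\lambda$-almost every point, such that $f$ is stochastically stable under the random perturbation $(f_{\underline t},\theta_\epsilon^{\mathbb N})_{\epsilon>0}$ generated by the family $f_t(x)=f(x)+t\,\zeta(x)$.
   Context: Setting. $M=\mathbb{T}^n=(\mathbb{S}^1)^n$, $\lambda$ is normalized Lebesgue measure on $M$, $d$ the standard distance. "$C^2$ local diffeomorphism away from a non-degenerate critical set" means: $\mathcal{C}=\{x\in M:\det Df(x)=0\}$, $f$ is a $C^2$ local diffeomorphism on $M\setminus\mathcal C$, and there are constants $B>1$, $\beta>0$ such that for all $x,y\in M\setminus\mathcal C$ with $d(x,y)<\frac12 d(x,\mathcal C)$: (S1) $\frac1B d(x,\mathcal C)^\beta\le \frac{\|Df(x)v\|}{\|v\|}\le B\,d(x,\mathcal C)^{-\beta}$ for all $0\ne v\in T_xM$; (S2) $\big|\log\|Df(x)^{-1}\|-\log\|Df(y)^{-1}\|\big|\le B\frac{d(x,y)}{d(x,\mathcal C)^\beta}$;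 (S3) $\big|\log|\det Df(x)^{-1}|-\log|\det Df(y)^{-1}|\big|\le B\frac{d(x,y)}{d(x,\mathcal C)^\beta}$. Non-uniformly expanding: there is $c>0$ with $\limsup_{m\to\infty}\frac1m\sum_{j=0}^{m-1}\log\|Df(f^j(x))^{-1}\|\le -c$ for $\lambda$-a.e. $x$. Slow recurrence: for every $\gamma>0$ there is $\delta>0$ with $\limsup_{m\to\infty}\frac1m\sum_{j=0}^{m-1}-\log d_\delta(f^j(x),\mathcal C)\le\gamma$ for $\lambda$-a.e. $x$, where $d_\delta(x,\mathcal C)=d(x,\mathcal C)$ if $d(x,\mathcal C)<\delta$ and $d_\delta(x,\mathcal C)=1$ otherwise. Hyperbolic times: $m\ge1$ is a $(\sigma,\delta)$-hyperbolic time for $x$ if for all $1\le k\le m$, $\prod_{j=m-k}^{m-1}\|Df(f^j(x))^{-1}\|\le\sigma^k$ and $d_\delta(f^{m-k}(x),\mathcal C)\ge\sigma^{bk}$, with $b=\min\{1/2,1/(2\beta)\}$. The first hyperbolic time map $h$ assigns to $x$ its smallest $(\sigma,\delta)$-hyperbolic time $h(x)\in\mathbb Z^+$. Physical measures: by a known theorem of Alves-Bonatti-Viana, such an $f$ has finitely many $f$-invariant ergodic absolutely continuous probability measures $\mu_1,\dots,\mu_p$ (physical measures), whose basins cover $\lambda$-almost all of $M$; every absolutely continuous invariant probability measure is a convex combination of them. Random perturbations: $X$ is the closed unit ball of $\mathbb{R}^n$, $f_t(x)=f(x)+t\zeta(x)$ for $t\in X$ (addition on the torus), $\Omega=X^{\mathbb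 N}$, $f^m_{\underline t}=f_{t_m}\circ\cdots\circ f_{t_1}$ for $\underline t=(t_1,t_2,\dots)\in\Omega$, and $\theta_\epsilon=\lambda|_{B(0,\epsilon)}/\lambda(B(0,\epsilon))$ is the normalized Lebesgue measure on the $\epsilon$-ball at $0$ in $\mathbb{R}^n$. A probability measure $\mu^\epsilon$ on $M$ is stationary for $(f_{\underline t},\theta_\epsilon^{\mathbb N})$ if $\int\phi\,d\mu^\epsilon=\int\int\phi(f_t(x))\,d\mu^\epsilon(x)\,d\theta_\epsilon(t)$ for all $\phi\in C^0(M,\mathbb R)$. $f$ is stochastically stable under $(f_{\underline t},\theta_\epsilon^{\mathbb N})_{\epsilon>0}$ if every weak$^*$ accumulation point $\mu^0$, as $\epsilon\searrow0$, of a family $(\mu^\epsilon)_{\epsilon>0}$ of stationary measures is of the form $\mu^0=\sum_i\alpha_i\mu_i$ with $\alpha_i\ge0$, $\sum_i\alpha_i=1$. *)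

theory Defs
  imports "HOL-Probability.Probability"
begin

section \<open>The circle and the flat torus\<close>

quotient_type circle = real / "\<lambda>x y. x - y \<in> \<int>"
proof (intro equivpI reflpI sympI transpI)
  fix x y z :: real
  show "x - x \<in> \<int>" by simp
  show "y - x \<in> \<int>" if "x - y \<in> \<int>"
    using Ints_minus[OF that] by simp
  show "x - z \<in> \<int>" if "x - y \<in> \<int>" "y - z \<in> \<int>"
    using Ints_add[OF that] by simp
qed

lift_definition to_circle :: "real \<Rightarrow> circle" is "\<lambda>x. x" .

instantiation circle :: ab_group_add
begin

lift_definition zero_circle :: circle is 0 .

lift_definition plus_circle :: "circle \<Rightarrow> circle \<Rightarrow> circle" is "(+)"
  using Ints_add by (fastforce simp: algebra_simps)

lift_definition uminus_circle :: "circle \<Rightarrow> circle" is uminus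
  using Ints_minus by fastforce

lift_definition minus_circle :: "circle \<Rightarrow> circle \<Rightarrow> circle" is "(-)"
  by (metis (no_types, opaque_lifting) Ints_diff add_diff_eq diff_diff_eq2 diff_add_eq)

instance
  by (standard; transfer; simp)

end

lemma round_diff_Ints:
  fixes x y :: real
  assumes "x - y \<in> \<int>"
  shows "\<bar>x - of_int (round x)\<bar> = \<bar>y - of_int (round y)\<bar>"
proof -
  have *: "\<bar>a - of_int (round a)\<bar> \<le> \<bar>b - of_int (round b)\<bar>" if "a - b \<in> \<int>" for a b :: real
  proof -
    from that obtain k where "a - b = of_int k" by (auto elim: Ints_cases)
    then have "b - of_int (round b) = a - of_int (k + round b)" by simp
    then show ?thesis using round_diff_minimal[of a "k + round b"] by simp
  qed
  show ?thesis
    using *[OF assms] *[of y x] Ints_minus[OF assms] by simp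
qed

text \<open>The distance of two points of the circle is the distance of the difference of any two
  representatives to the nearest integer.\<close>

instantiation circle :: metric_space
begin

lift_definition dist_circle :: "circle \<Rightarrow> circle \<Rightarrow> real"
  is "\<lambda>x y. \<bar>(x - y) - of_int (round (x - y))\<bar>"
  by (rule round_diff_Ints)
     (metis (no_types, opaque_lifting) Ints_diff add_diff_eq diff_diff_eq2 diff_add_eq)

definition uniformity_circle :: "(circle \<times> circle) filter" where
  "uniformity_circle = (INF e\<in>{0 <..}. principal {(x, y). dist x y < e})"

definition open_circle :: "circle set \<Rightarrow> bool" where
  "open_circle U \<longleftrightarrow> (\<forall>x\<in>U. \<forall>\<^sub>F (x', y) in uniformity. x' = x \<longrightarrow> y \<in> U)"

instance
proof
  fix x y z :: circle
  show "dist x y = 0 \<longleftrightarrow> x = y"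
  proof transfer
    fix x y :: real
    have "x - y - of_int (round (x - y)) = 0 \<longleftrightarrow> x - y \<in> \<int>"
      by (metis Ints_cases Ints_of_int eq_iff_diff_eq_0 round_of_int)
    then show "\<bar>x - y - of_int (round (x - y))\<bar> = 0 \<longleftrightarrow> x - y \<in> \<int>" by simp
  qed
  show "dist x y \<le> dist x z + dist y z"
  proof transfer
    fix x y z :: real
    show "\<bar>x - y - of_int (round (x - y))\<bar>
        \<le> \<bar>x - z - of_int (round (x - z))\<bar> + \<bar>y - z - of_int (round (y - z))\<bar>"
      using round_diff_minimal[of "x - y" "round (x - z) - round (y - z)"] by simp
  qed
qed (simp_all only: uniformity_circle_def open_circle_def)

end

text \<open>The topology, the metric (the \<open>L\<^sup>2\<close> combination of the distances on the factors, i.e. the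
  flat metric), the addition and the Borel sets of the torus are those of the library for
  \<^typ>\<open>'a ^ 'n\<close>.\<close>

type_synonym 'n torus = "(circle, 'n) vec"

definition torus_of :: "real ^ 'n \<Rightarrow> 'n::finite torus" where
  "torus_of v = (\<chi> i. to_circle (v $ i))"

lemma torus_of_0: "torus_of 0 = 0"
  by (simp add: torus_of_def vec_eq_iff to_circle.abs_eq zero_circle_def)

lemma to_circle_eq_iff: "to_circle x = to_circle y \<longleftrightarrow> x - y \<in> \<int>"
  by transfer simp

lemma dist_to_circle_le: "dist (to_circle x) (to_circle y) \<le> dist x y"
proof transfer
  fix x y :: real
  show "\<bar>x - y - of_int (round (x - y))\<bar> \<le> dist x y"
    using round_diff_minimal[of "x - y" 0] by (simp add: dist_real_def)
qed

lemma continuous_to_circle: "continuous_on UNIV to_circle"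
  unfolding continuous_on_iff using dist_to_circle_le by (metis le_less_trans)

lemma continuous_torus_of: "continuous_on UNIV (torus_of :: real ^ 'n \<Rightarrow> 'n::finite torus)"
  unfolding torus_of_def
  by (intro continuous_on_vec_lambda continuous_on_compose2[OF continuous_to_circle]
      continuous_intros) auto

definition torus_lebesgue :: "'n::finite torus measure" where
  "torus_lebesgue = distr (uniform_measure lborel (cbox 0 1 :: (real ^ 'n) set)) borel torus_of"

lemma measurable_torus_of: "torus_of \<in> borel_measurable borel"
  by (rule borel_measurable_continuous_onI[OF continuous_torus_of])

lemma prob_space_torus_lebesgue: "prob_space (torus_lebesgue :: 'n::finite torus measure)"
proof -
  have "(\<Prod>b\<in>(Basis :: (real ^ 'n) set). (1 - 0) \<bullet> b) = 1"
    by (intro prod.neutral) (auto simp: Basis_vec_def inner_axis)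
  then have "emeasure lborel (cbox 0 1 :: (real ^ 'n) set) = 1"
    by (subst emeasure_lborel_cbox) (auto simp: Basis_vec_def inner_axis)
  then have "prob_space (uniform_measure lborel (cbox 0 1 :: (real ^ 'n) set))"
    by (intro prob_space_uniform_measure) auto
  then show ?thesis
    unfolding torus_lebesgue_def
    by (rule prob_space.prob_space_distr)
      (use measurable_torus_of in \<open>simp add: measurable_def\<close>)
qed


section \<open>Differentiability on the torus\<close>

text \<open>Tangent spaces are identified with \<^typ>\<open>real ^ 'n\<close>; \<open>F\<close> is \<open>f\<close> read in the coordinates
  centred at \<open>x\<close> and \<open>f x\<close>. Away from \<open>0\<close> the values of \<open>F\<close> are arbitrary representatives.\<close>

definition has_torus_derivative ::
    "('n::finite torus \<Rightarrow> 'n torus) \<Rightarrow> real ^ 'n ^ 'n \<Rightarrow> 'n torus \<Rightarrow> bool" where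
  "has_torus_derivative f A x \<longleftrightarrow>
     (\<exists>F. F 0 = 0 \<and> (\<forall>v. f (x + torus_of v) = f x + torus_of (F v)) \<and>
          (F has_derivative (\<lambda>v. A *v v)) (at 0))"

definition torus_derivative :: "('n::finite torus \<Rightarrow> 'n torus) \<Rightarrow> 'n torus \<Rightarrow> real ^ 'n ^ 'n" where
  "torus_derivative f x = (THE A. has_torus_derivative f A x)"

lemma torus_derivative_unique:
  assumes "has_torus_derivative f A x" "has_torus_derivative f B x"
  shows "A = B"
proof -
  from assms obtain F G where
    F: "F 0 = 0" "\<And>v. f (x + torus_of v) = f x + torus_of (F v)"
       "(F has_derivative (\<lambda>v. A *v v)) (at 0)" and
    G: "G 0 = 0" "\<And>v. f (x + torus_of v) = f x + torus_of (G v)"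
       "(G has_derivative (\<lambda>v. B *v v)) (at 0)"
    unfolding has_torus_derivative_def by metis
  have eq: "torus_of (F v) = torus_of (G v)" for v
    using F(2)[of v] G(2)[of v] by simp
  have int: "(F v - G v) $ i \<in> \<int>" for v i
    using eq[of v] by (simp add: torus_of_def vec_eq_iff to_circle_eq_iff)
  have "isCont (\<lambda>v. F v - G v) 0"
    using F(3) G(3) by (intro continuous_intros has_derivative_continuous)
  then have "\<forall>\<^sub>F v in nhds 0. dist (F v - G v) (F 0 - G 0) < 1"
    by (intro tendstoD) (simp_all add: continuous_at tendsto_nhds_iff)
  then have ev: "\<forall>\<^sub>F v in nhds 0. G v = F v"
  proof eventually_elim
    case (elim v)
    have "(F v - G v) $ i = 0" for i
    proof -
      have "\<bar>(F v - G v) $ i\<bar> < 1"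
        using elim F(1) G(1) component_le_norm_cart[of "F v - G v" i] by (simp add: dist_norm)
      with int[of v i] show ?thesis
        by (rule_tac Ints_nonzero_abs_less1)
    qed
    then show ?case by (simp add: vec_eq_iff)
  qed
  have "(F has_derivative (\<lambda>v. B *v v)) (at 0)"
    using has_derivative_transform_eventually[OF G(3), of F] ev F(1) G(1)
    by (simp add: eventually_at_filter eventually_mono)
  with F(3) have "(\<lambda>v. A *v v) = (\<lambda>v. B *v v)"
    by (rule has_derivative_unique)
  then show ?thesis by (metis matrix_eq)
qed

lemma torus_derivative_eq: "has_torus_derivative f A x \<Longrightarrow> torus_derivative f x = A"
  unfolding torus_derivative_def using torus_derivative_unique by blast

definition C2_torus_map_on :: "'n::finite torus set \<Rightarrow> ('n torus \<Rightarrow> 'n torus) \<Rightarrow> bool" where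
  "C2_torus_map_on U f \<longleftrightarrow> open U \<and>
     (\<forall>x\<in>U. \<exists>A. has_torus_derivative f A x) \<and>
     (\<exists>D2 :: 'n torus \<Rightarrow> (real ^ 'n) \<Rightarrow>\<^sub>L (real ^ 'n ^ 'n).
        (\<forall>x\<in>U. ((\<lambda>v. torus_derivative f (x + torus_of v)) has_derivative blinfun_apply (D2 x)) (at 0)) \<and>
        continuous_on U D2)"

definition C2_local_diffeo_on :: "'n::finite torus set \<Rightarrow> ('n torus \<Rightarrow> 'n torus) \<Rightarrow> bool" where
  "C2_local_diffeo_on U f \<longleftrightarrow>
     (\<forall>x\<in>U. \<exists>V g. x \<in> V \<and> V \<subseteq> U \<and> C2_torus_map_on V f \<and> open (f ` V) \<and>
                 C2_torus_map_on (f ` V) g \<and> (\<forall>y\<in>V. g (f y) = y))"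


section \<open>Non-degenerate critical sets\<close>

text \<open>Points where \<open>f\<close> is not differentiable are not critical; a map that is a local
  diffeomorphism off its critical set is therefore differentiable everywhere.\<close>

definition critical_set :: "('n::finite torus \<Rightarrow> 'n torus) \<Rightarrow> 'n torus set" where
  "critical_set f = {x. \<exists>A. has_torus_derivative f A x \<and> det A = 0}"

definition inv_norm :: "('n::finite torus \<Rightarrow> 'n torus) \<Rightarrow> 'n torus \<Rightarrow> real" where
  "inv_norm f x = onorm (\<lambda>v. matrix_inv (torus_derivative f x) *v v)"

text \<open>A map with empty critical set satisfies the three inequalities below vacuously, since
  \<^term>\<open>infdist x {} = 0\<close>. If the critical set is not empty, it is closed as the complement of a
  set on which \<open>f\<close> is a local diffeomorphism, so that \<^const>\<open>infdist\<close> vanishes exactly on it.\<close>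

definition C2_local_diffeo_away_from_critical ::
    "('n::finite torus \<Rightarrow> 'n torus) \<Rightarrow> real \<Rightarrow> real \<Rightarrow> bool" where
  "C2_local_diffeo_away_from_critical f B \<beta> \<longleftrightarrow>
     C2_local_diffeo_on (- critical_set f) f \<and> B > 1 \<and> \<beta> > 0 \<and>
     (\<forall>x y. x \<notin> critical_set f \<longrightarrow> y \<notin> critical_set f \<longrightarrow>
            dist x y < infdist x (critical_set f) / 2 \<longrightarrow>
        (\<forall>v. v \<noteq> 0 \<longrightarrow>
           1 / B * infdist x (critical_set f) powr \<beta> \<le> norm (torus_derivative f x *v v) / norm v \<and>
           norm (torus_derivative f x *v v) / norm v \<le> B * infdist x (critical_set f) powr (-\<beta>)) \<and>
        \<bar>ln (inv_norm f x) - ln (inv_norm f y)\<bar>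
           \<le> B * (dist x y / infdist x (critical_set f) powr \<beta>) \<and>
        \<bar>ln \<bar>det (matrix_inv (torus_derivative f x))\<bar> - ln \<bar>det (matrix_inv (torus_derivative f y))\<bar>\<bar>
           \<le> B * (dist x y / infdist x (critical_set f) powr \<beta>))"


section \<open>Non-uniform expansion, slow recurrence and hyperbolic times\<close>

text \<open>The norm of the inverse of a singular matrix and \<open>- log 0\<close> are infinite, hence the
  extended reals.\<close>

definition log_inv_norm :: "('n::finite torus \<Rightarrow> 'n torus) \<Rightarrow> 'n torus \<Rightarrow> ereal" where
  "log_inv_norm f x = (if x \<in> critical_set f then \<infinity> else ereal (ln (inv_norm f x)))"

definition nonuniformly_expanding :: "('n::finite torus \<Rightarrow> 'n torus) \<Rightarrow> bool" where
  "nonuniformly_expanding f \<longleftrightarrow>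
     (\<exists>c>0. AE x in torus_lebesgue.
        limsup (\<lambda>m. (\<Sum>j<m. log_inv_norm f ((f ^^ j) x)) / ereal (real m)) \<le> ereal (- c))"

text \<open>The distance to the empty set counts as infinite.\<close>

definition truncated_dist :: "real \<Rightarrow> 'a::metric_space \<Rightarrow> 'a set \<Rightarrow> real" where
  "truncated_dist \<delta> x C = (if C \<noteq> {} \<and> infdist x C < \<delta> then infdist x C else 1)"

definition neg_log_truncated_dist :: "real \<Rightarrow> 'a::metric_space \<Rightarrow> 'a set \<Rightarrow> ereal" where
  "neg_log_truncated_dist \<delta> x C =
     (if truncated_dist \<delta> x C = 0 then \<infinity> else ereal (- ln (truncated_dist \<delta> x C)))"

definition slow_recurrence :: "('n::finite torus \<Rightarrow> 'n torus) \<Rightarrow> bool" where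
  "slow_recurrence f \<longleftrightarrow>
     (\<forall>\<gamma>>0. \<exists>\<delta>>0. AE x in torus_lebesgue.
        limsup (\<lambda>m. (\<Sum>j<m. neg_log_truncated_dist \<delta> ((f ^^ j) x) (critical_set f)) / ereal (real m))
          \<le> ereal \<gamma>)"

text \<open>The second condition keeps \<open>f\<^sup>j x\<close> off the critical set for \<open>j < m\<close>, so the first one
  only involves invertible derivatives. Moreover \<open>f\<^sup>j\<close> is a local diffeomorphism at each point
  of the \<open>m\<close>-th level set of the first hyperbolic time, for \<open>j \<le> m\<close>; the level sets and their
  images under \<open>f\<^sup>j\<close> are then Borel.\<close>

definition hyperbolic_time ::
    "('n::finite torus \<Rightarrow> 'n torus) \<Rightarrow> real \<Rightarrow> real \<Rightarrow> real \<Rightarrow> 'n torus \<Rightarrow> nat \<Rightarrow> bool" where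
  "hyperbolic_time f \<beta> \<sigma> \<delta> x m \<longleftrightarrow> 1 \<le> m \<and>
     (\<forall>k. 1 \<le> k \<and> k \<le> m \<longrightarrow>
        (\<Prod>j=m-k..<m. inv_norm f ((f ^^ j) x)) \<le> \<sigma> ^ k \<and>
        truncated_dist \<delta> ((f ^^ (m - k)) x) (critical_set f)
          \<ge> \<sigma> powr (min (1 / 2) (1 / (2 * \<beta>)) * real k))"

text \<open>\<open>\<infinity>\<close> where there is no hyperbolic time.\<close>

definition first_hyperbolic_time ::
    "('n::finite torus \<Rightarrow> 'n torus) \<Rightarrow> real \<Rightarrow> real \<Rightarrow> real \<Rightarrow> 'n torus \<Rightarrow> enat" where
  "first_hyperbolic_time f \<beta> \<sigma> \<delta> x = Inf (enat ` {m. hyperbolic_time f \<beta> \<sigma> \<delta> x m})"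


section \<open>Physical measures and stochastic stability\<close>

definition ergodic_measure :: "('a::topological_space \<Rightarrow> 'a) \<Rightarrow> 'a measure \<Rightarrow> bool" where
  "ergodic_measure f \<mu> \<longleftrightarrow>
     (\<forall>A\<in>sets borel. f -` A = A \<longrightarrow> measure \<mu> A = 0 \<or> measure \<mu> A = 1)"

text \<open>By the theorem of Alves, Bonatti and Viana there are finitely many of these for the maps
  considered here, and their basins cover almost every point.\<close>

definition physical_measures :: "('n::finite torus \<Rightarrow> 'n torus) \<Rightarrow> 'n torus measure set" where
  "physical_measures f = {\<mu>. sets \<mu> = sets borel \<and> prob_space \<mu> \<and> distr \<mu> borel f = \<mu> \<and>
     ergodic_measure f \<mu> \<and> absolutely_continuous torus_lebesgue \<mu>}"

definition noise :: "real \<Rightarrow> (real ^ 'n) measure" where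
  "noise \<epsilon> = uniform_measure lborel (ball 0 \<epsilon>)"

definition stationary_measure ::
    "('t \<Rightarrow> 'a::topological_space \<Rightarrow> 'a) \<Rightarrow> 't measure \<Rightarrow> 'a measure \<Rightarrow> bool" where
  "stationary_measure F \<theta> \<mu> \<longleftrightarrow> sets \<mu> = sets borel \<and> prob_space \<mu> \<and>
     (\<forall>\<phi> :: 'a \<Rightarrow> real. continuous_on UNIV \<phi> \<longrightarrow>
        (\<integral>x. \<phi> x \<partial>\<mu>) = (\<integral>t. (\<integral>x. \<phi> (F t x) \<partial>\<mu>) \<partial>\<theta>))"

text \<open>\<open>\<mu>\<^sub>0\<close> is a cluster point of the family \<open>\<mu>\<close>, as the index decreases to \<open>0\<close>, in the
  weak-* topology: every basic weak-* neighbourhood is visited for arbitrarily small indices.\<close>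

definition weak_star_accumulation ::
    "(real \<Rightarrow> 'a::topological_space measure) \<Rightarrow> 'a measure \<Rightarrow> bool" where
  "weak_star_accumulation \<mu> \<mu>\<^sub>0 \<longleftrightarrow> sets \<mu>\<^sub>0 = sets borel \<and> prob_space \<mu>\<^sub>0 \<and>
     (\<forall>\<Phi> :: ('a \<Rightarrow> real) set. \<forall>\<eta>>0. finite \<Phi> \<longrightarrow> (\<forall>\<phi>\<in>\<Phi>. continuous_on UNIV \<phi>) \<longrightarrow>
        (\<exists>\<^sub>F \<epsilon> in at_right 0. \<forall>\<phi>\<in>\<Phi>. \<bar>(\<integral>x. \<phi> x \<partial>\<mu> \<epsilon>) - (\<integral>x. \<phi> x \<partial>\<mu>\<^sub>0)\<bar> < \<eta>))"

definition convex_combination_of :: "'a::topological_space measure set \<Rightarrow> 'a measure \<Rightarrow> bool" where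
  "convex_combination_of S \<mu> \<longleftrightarrow>
     (\<exists>P \<alpha>. finite P \<and> P \<subseteq> S \<and> (\<forall>\<nu>\<in>P. 0 \<le> \<alpha> \<nu>) \<and> (\<Sum>\<nu>\<in>P. \<alpha> \<nu>) = 1 \<and>
        (\<forall>A\<in>sets borel. measure \<mu> A = (\<Sum>\<nu>\<in>P. \<alpha> \<nu> * measure \<nu> A)))"

text \<open>Only small noise levels matter for accumulation as \<open>\<epsilon>\<close> decreases to \<open>0\<close>, so the family is
  only required to be stationary for all small enough \<open>\<epsilon> > 0\<close>. For \<open>\<epsilon> \<le> 1\<close> the noise lives on
  the closed unit ball, which is the parameter space.\<close>

definition stochastically_stable ::
    "('n::finite torus \<Rightarrow> 'n torus) \<Rightarrow> (real ^ 'n \<Rightarrow> 'n torus \<Rightarrow> 'n torus) \<Rightarrow> bool" where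
  "stochastically_stable f F \<longleftrightarrow>
     (\<forall>\<mu> \<mu>\<^sub>0. (\<forall>\<^sub>F \<epsilon> in at_right 0. stationary_measure F (noise \<epsilon>) (\<mu> \<epsilon>)) \<longrightarrow>
        weak_star_accumulation \<mu> \<mu>\<^sub>0 \<longrightarrow>
        convex_combination_of (physical_measures f) \<mu>\<^sub>0)"

definition adapted_perturbation ::
    "('n::finite torus \<Rightarrow> 'n torus) \<Rightarrow> ('n torus \<Rightarrow> real) \<Rightarrow> real ^ 'n \<Rightarrow> 'n torus \<Rightarrow> 'n torus" where
  "adapted_perturbation f \<zeta> t x = f x + torus_of (\<zeta> x *\<^sub>R t)"

end

theory Submission
  imports Defs
begin

text \<open>The summability hypothesis leaves no room for critical points. A point \<open>x\<close> with hyperbolic time \<open>m\<close>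
  lies in a plaque, which \<open>f ^^ m\<close> maps onto a ball of fixed radius with bounded distortion. If \<open>m\<close> is the
  first hyperbolic time of \<open>x\<close> (for slightly weaker constants), then the points of the plaque have no earlier
  one, so the sets \<open>(f ^^ (m - 1)) ` first i\<close> with \<open>i \<ge> m\<close> cover almost all of its image under
  \<open>f ^^ (m - 1)\<close>, whose volume is bounded below. The tails of the series tend to \<open>0\<close>, so the first
  hyperbolic times are bounded, which keeps almost every point away from the critical set.

  Without critical points, hyperbolic times have positive frequency by the lemma of Pliss. Hence there are
  finitely many ergodic absolutely continuous invariant measures, and the preimages under all iterates of
  a set of small volume have uniformly small volume.

  For the noise, take nested open sets \<open>A s\<close> of volume \<open>O(1 / 2 ^ s)\<close> such that every orbit visits \<open>A s\<close>
  within \<open>2 ^ s\<close> steps, and cut the shells \<open>A s - A (Suc s)\<close> into small cells. On the successive cells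
  \<open>\<zeta>\<close> is constant and grows so fast that for every \<open>\<epsilon>\<close> all cells but one fall into two classes: either the noise
  is negligible, and the perturbed orbit is shadowed by an orbit of \<open>f\<close>, or it wraps around the torus, and the
  orbit restarts with a law comparable to Lebesgue measure. A stationary measure is thus an average over
  excursions between restarts. As these are rare but begin with bounded densities, the limits are
  invariant and absolutely continuous. In particular \<open>\<zeta>\<close> is unbounded.\<close>

text \<open>The obstacle is the one cell on which the noise has intermediate size: there the
  perturbed orbit neither follows \<open>f\<close> nor restarts with a bounded density. Returns to
  this cell must be unlikely. The cell lies outside the next sweeping set, so an orbit of
  \<open>f\<close> cannot come back to it before entering that set; if the noise is too strong for
  this argument, its law has a bounded density, and the cell was chosen small against that bound.
  The exponents of the sweeping sets balance two quantities. An excursion lasts at most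
  \<open>2 ^ Suc s\<close> steps, because \<open>A (Suc s)\<close> is sweeping; a fixed proportion
  of the restarts leads to at least a multiple of \<open>2 ^ s\<close> steps, because a
  neighbourhood of \<open>A s\<close> has invariant measure of order \<open>1 / 2 ^ s\<close>. The
  latter bounds the mass of the restarts by a multiple of \<open>1 / 2 ^ s\<close>. Together they
  bound the stationary mass of a set by a multiple of the largest volume of its preimages, up to an
  error that vanishes with the noise. Halving a set while at most doubling its return time keeps the
  product bounded.\<close>

lemma surj_to_circle: "\<exists>x. 0 \<le> x \<and> x < 1 \<and> to_circle x = c"
proof -
 obtain y where y: "c = to_circle y" by (metis Quotient_circle Quotient_abs_rep to_circle.abs_eq)
 have "to_circle (frac y) = to_circle y" by (simp add: to_circle_eq_iff frac_def)
 thus ?thesis using y frac_lt_1[of y] frac_ge_0[of y] by metis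
qed

lemma compact_circle: "compact (UNIV :: circle set)"
proof -
 have "UNIV = to_circle ` {0..1}"
  using surj_to_circle by (auto simp: image_iff) (metis atLeastAtMost_iff less_eq_real_def)
 moreover have "compact (to_circle ` {0..1})"
  by (intro compact_continuous_image continuous_on_subset[OF continuous_to_circle]) auto
 ultimately show ?thesis by simp
qed

instance circle :: heine_borel
proof
 fix s :: "nat \<Rightarrow> circle"
 show "\<exists>l r. strict_mono r \<and> (s \<circ> r) \<longlonglongrightarrow> l"
  using compact_circle unfolding compact_eq_seq_compact_metric seq_compact_def by auto
qed

instance circle :: second_countable_topology
proof
 define B where "B = (\<lambda>(q::rat, r::rat). ball (to_circle (of_rat q)) (of_rat r)) ` UNIV"
 have "topological_basis B"
 proof (rule topological_basisI)
  show "open b" if "b \<in> B" for b using that by (auto simp: B_def)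
  fix U :: "circle set" and x assume "open U" "x \<in> U"
  then obtain e where e: "e > 0" "ball x e \<subseteq> U" using open_contains_ball by blast
  obtain y where y: "x = to_circle y" using surj_to_circle by metis
  obtain q where q: "y - e/4 < of_rat q" "of_rat q < y + e/4" using of_rat_dense[of "y - e/4" "y + e/4"] e by auto
  obtain r where r: "e/4 < of_rat r" "of_rat r < e/2" using of_rat_dense[of "e/4" "e/2"] e by auto
  have d: "dist x (to_circle (of_rat q)) < e/4"
   using dist_to_circle_le[of y "of_rat q"] q by (simp add: y dist_real_def)
  have "ball (to_circle (of_rat q)) (of_rat r) \<subseteq> ball x e"
  proof
   fix z assume "z \<in> ball (to_circle (of_rat q)) (of_rat r)"
   hence "dist (to_circle (of_rat q)) z < e/2" using r by simp
   thus "z \<in> ball x e" using d dist_triangle[of x z "to_circle (of_rat q)"] e(1) by (simp add: dist_commute)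
  qed
  moreover have "x \<in> ball (to_circle (of_rat q)) (of_rat r)" using d r by (simp add: dist_commute)
  ultimately show "\<exists>b\<in>B. x \<in> b \<and> b \<subseteq> U"
   using e(2) unfolding B_def by (intro bexI[of _ "ball (to_circle (of_rat q)) (of_rat r)"]) auto
 qed
 thus "\<exists>B::circle set set. countable B \<and> open = generate_topology B"
  using topological_basis_imp_subbasis[of B] by (intro exI[of _ B]) (auto simp: B_def)
qed

text \<open>Countable bases are what the Lindelof property, the regularity of finite Borel measures
  and the Borel sets of products ask for.\<close>

instance vec :: ("{second_countable_topology, metric_space}", finite) second_countable_topology
proof
 obtain B :: "'a set set" where B: "countable B" "topological_basis B" using ex_countable_basis by auto
 define T where "T = (\<lambda>u::'b \<Rightarrow> 'a set. {x::('a,'b) vec. \<forall>i. x $ i \<in> u i}) ` (Pi\<^sub>E UNIV (\<lambda>_. B))"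
 have "countable T" unfolding T_def by (intro countable_image countable_PiE) (auto simp: B)
 moreover have "topological_basis T"
 proof (rule topological_basisI)
  fix b assume "b \<in> T"
  then obtain u where u: "b = {x. \<forall>i. x $ i \<in> u i}" "\<And>i. u i \<in> B" by (auto simp: T_def PiE_iff)
  show "open b" unfolding u(1) by (rule open_vector_box) (use u(2) B(2) topological_basis_open in blast)
 next
  fix U :: "('a,'b) vec set" and x assume "open U" "x \<in> U"
  then obtain A where A: "\<And>i. open (A i)" "\<And>i. x $ i \<in> A i" "\<And>y. (\<forall>i. y $ i \<in> A i) \<Longrightarrow> y \<in> U"
   unfolding open_vec_def by meson
  have "\<forall>i. \<exists>b\<in>B. x $ i \<in> b \<and> b \<subseteq> A i"
   using topological_basisE[OF B(2) A(1,2)] by metis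
  then obtain u where u: "\<And>i. u i \<in> B" "\<And>i. x $ i \<in> u i" "\<And>i. u i \<subseteq> A i" by metis
  show "\<exists>b\<in>T. x \<in> b \<and> b \<subseteq> U"
  proof (intro bexI conjI)
   show "{x. \<forall>i. x $ i \<in> u i} \<in> T" unfolding T_def by (rule imageI) (auto simp: u)
   show "{x. \<forall>i. x $ i \<in> u i} \<subseteq> U" using A(3) u(3) by blast
  qed (use u in auto)
 qed
 ultimately show "\<exists>B::('a,'b) vec set set. countable B \<and> open = generate_topology B"
  using topological_basis_imp_subbasis by blast
qed

section \<open>Lifts, translations and distances on the torus\<close>

lemma surj_torus_of: "\<exists>v. (\<forall>i. 0 \<le> v $ i \<and> v $ i < 1) \<and> torus_of v = (x :: 'n::finite torus)"
proof -
 obtain g where "\<And>c. 0 \<le> g c \<and> g c < 1 \<and> to_circle (g c) = c" using surj_to_circle by metis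
 thus ?thesis by (intro exI[of _ "\<chi> i. g (x $ i)"]) (auto simp: torus_of_def)
qed

lemma compact_torus: "compact (UNIV :: 'n::finite torus set)"
proof -
 have "compact (torus_of ` (cbox 0 1 :: (real^'n) set))"
  by (intro compact_continuous_image continuous_on_subset[OF continuous_torus_of]) auto
 moreover have "torus_of ` (cbox 0 1 :: (real^'n) set) = UNIV"
 proof safe
  fix x :: "'n torus"
  obtain v where v: "\<forall>i. 0 \<le> v $ i \<and> v $ i < 1" "torus_of v = x" using surj_torus_of by metis
  show "x \<in> torus_of ` cbox 0 1"
   unfolding v(2)[symmetric] using v(1) by (intro imageI) (auto simp: mem_box_cart less_imp_le)
 qed auto
 ultimately show ?thesis by simp
qed

lemma compact_if_closed: "closed S \<Longrightarrow> compact (S :: 'n::finite torus set)"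
 using compact_Int_closed[OF compact_torus, of S] by simp

lemma torus_of_add: "torus_of (v + w) = torus_of v + torus_of w"
 by (simp add: torus_of_def vec_eq_iff to_circle.abs_eq plus_circle.abs_eq)

lemma torus_of_diff: "torus_of (v - w) = torus_of v - torus_of w"
 by (simp add: torus_of_def vec_eq_iff to_circle.abs_eq minus_circle.abs_eq)

lemma torus_of_eq_iff: "torus_of v = torus_of w \<longleftrightarrow> (\<forall>i. v $ i - w $ i \<in> \<int>)"
 by (simp add: torus_of_def vec_eq_iff to_circle_eq_iff)

lemma dist_circle_translate: "dist (a + x) (a + y) = dist x (y::circle)"
 by transfer (simp add: algebra_simps)

lemma dist_torus_translate: "dist (a + x) (a + y) = dist x (y::'n::finite torus)"
 by (simp add: dist_vec_def dist_circle_translate)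

lemma dist_torus_diff: "dist x y = dist (x - y) (0::'n::finite torus)"
 using dist_torus_translate[of y "x - y" 0] by simp

lemma dist_torus_of_le: "dist (torus_of v) (torus_of w) \<le> dist v w"
 unfolding dist_vec_def torus_of_def by (intro L2_set_mono) (auto intro: dist_to_circle_le)

lemma dist_to_circle_eq: "dist (to_circle x) (to_circle y) = \<bar>x - y - of_int (round (x - y))\<bar>"
 by transfer simp

lemma dist_to_circle_small: "\<bar>x - y\<bar> \<le> 1/2 \<Longrightarrow> dist (to_circle x) (to_circle y) = \<bar>x - y\<bar>"
proof -
 assume a: "\<bar>x - y\<bar> \<le> 1/2"
 show ?thesis
 proof (rule antisym)
  show "dist (to_circle x) (to_circle y) \<le> \<bar>x - y\<bar>"
   using dist_to_circle_le[of x y] by (simp add: dist_real_def)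
  show "\<bar>x - y\<bar> \<le> dist (to_circle x) (to_circle y)"
  proof (cases "round (x - y) = 0")
   case True thus ?thesis by (simp add: dist_to_circle_eq)
  next
   case False
   hence "\<bar>real_of_int (round (x - y))\<bar> \<ge> 1" by linarith
   thus ?thesis using a unfolding dist_to_circle_eq by linarith
  qed
 qed
qed

lemma dist_torus_of_small:
 assumes "dist v w \<le> 1/2"
 shows "dist (torus_of v) (torus_of w) = dist v (w :: real^'n::finite)"
proof -
 have "\<bar>v $ i - w $ i\<bar> \<le> 1/2" for i using dist_vec_nth_le[of v i w] assms by (simp add: dist_real_def)
 thus ?thesis unfolding dist_vec_def torus_of_def by (simp add: dist_to_circle_small dist_real_def)
qed

text \<open>Subtracting the nearest integer from each coordinate of any lift of \<open>x - z\<close>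
  gives a shortest lift. It is the way in which distances become norms in charts.\<close>

lemma torus_of_near:
 fixes x z :: "'n::finite torus"
 shows "\<exists>v. x = z + torus_of v \<and> norm v = dist x z"
proof -
 obtain u where u: "torus_of u = x - z" using surj_torus_of by metis
 define v where "v = (\<chi> i. u $ i - of_int (round (u $ i)))"
 have tv: "torus_of v = x - z" unfolding u[symmetric] torus_of_eq_iff by (auto simp: v_def)
 have "dist x z = dist (torus_of v) (torus_of 0)" using dist_torus_diff[of x z] tv by (simp add: torus_of_0)
 also have "\<dots> = norm v"
 proof -
  have "\<bar>v $ i\<bar> \<le> 1/2" for i
   using of_int_round_abs_le[of "u $ i"] by (simp add: v_def abs_minus_commute)
  hence "dist (to_circle (v $ i)) (to_circle (0 $ i)) = norm (v $ i)" for i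
   using dist_to_circle_small[of "v $ i" 0] by simp
  thus ?thesis by (simp add: dist_vec_def torus_of_def norm_vec_def)
 qed
 finally show ?thesis using tv by (intro exI[of _ v]) (simp add: algebra_simps)
qed

subsection \<open>Haar measure\<close>

lemma sets_torus_lebesgue [simp, measurable_cong]: "sets torus_lebesgue = sets borel"
 by (simp add: torus_lebesgue_def)

lemma space_torus_lebesgue [simp]: "space torus_lebesgue = UNIV"
 by (simp add: torus_lebesgue_def)

definition unit_cell :: "(real^'n::finite) set" where
 "unit_cell = {v. \<forall>i. 0 \<le> v $ i \<and> v $ i < 1}"

lemma unit_cell_borel [measurable]: "unit_cell \<in> sets borel"
proof -
 have "unit_cell = (\<Inter>i. {v::real^'n. 0 \<le> v $ i} \<inter> {v. v $ i < 1})" by (auto simp: unit_cell_def)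
 also have "\<dots> \<in> sets borel"
  by (intro sets.finite_INT) (auto intro!: borel_closed borel_open sets.Int closed_halfspace_component_ge_cart open_halfspace_component_lt_cart)
 finally show ?thesis .
qed

lemma emeasure_cbox01: "emeasure lborel (cbox 0 1 :: (real ^ 'n::finite) set) = 1"
proof -
 have "(\<Prod>b\<in>(Basis :: (real ^ 'n) set). (1 - 0) \<bullet> b) = 1"
  by (intro prod.neutral) (auto simp: Basis_vec_def inner_axis)
 thus ?thesis by (subst emeasure_lborel_cbox) (auto simp: Basis_vec_def inner_axis)
qed

lemma measurable_torus_of' [measurable]: "torus_of \<in> borel \<rightarrow>\<^sub>M borel"
 by (rule measurable_torus_of)

lemma vimage_torus_of_borel [measurable (raw)]:
 "S \<in> sets borel \<Longrightarrow> torus_of -` S \<in> sets (borel :: (real^'n::finite) measure)"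
 using measurable_sets[of torus_of borel borel S] by simp

text \<open>The half-open cell replaces the closed cube of the definition because its integer
  translates are disjoint. The two differ only by points on hyperplanes where a coordinate is
  \<open>1\<close>, a null set.\<close>

lemma emeasure_torus_lebesgue:
 assumes [measurable]: "S \<in> sets borel"
 shows "emeasure torus_lebesgue S = emeasure lborel (torus_of -` S \<inter> unit_cell)"
proof -
 have "emeasure torus_lebesgue S = emeasure lborel (cbox 0 1 \<inter> torus_of -` S)" unfolding torus_lebesgue_def
  using vimage_torus_of_borel[OF assms]
  by (subst emeasure_distr) (auto simp: emeasure_uniform_measure emeasure_cbox01 divide_ennreal_def)
 also have "\<dots> = emeasure lborel (torus_of -` S \<inter> unit_cell)"
 proof (rule emeasure_eq_AE)
  have *: "AE v::real^'n in lborel. v $ i \<noteq> 1" for i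
  proof (rule AE_I')
   have "{v :: real^'n. v $ i = 1} = {v. axis i 1 \<bullet> v = 1}" by (simp add: inner_axis inner_commute)
   hence "negligible {v :: real^'n. v $ i = 1}" "closed {v :: real^'n. v $ i = 1}"
    using negligible_hyperplane[of "axis i (1::real)" 1] closed_hyperplane[of "axis i (1::real)" 1] by auto
   thus "{v :: real^'n. v $ i = 1} \<in> null_sets lborel"
    by (simp add: negligible_iff_null_sets null_sets_completion_iff borel_closed)
  qed auto
  have "AE v::real^'n in lborel. \<forall>i. v $ i \<noteq> 1"
   using * by (subst AE_all_countable) (auto intro: countable_finite)
  thus "AE v in lborel. (v \<in> cbox 0 1 \<inter> torus_of -` S) = (v \<in> torus_of -` S \<inter> unit_cell)"
   by eventually_elim (auto simp: mem_box_cart unit_cell_def order_less_le less_imp_le)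
 qed (measurable, auto)
 finally show ?thesis .
qed

lemma torus_of_int: "(\<And>i. k $ i \<in> \<int>) \<Longrightarrow> torus_of (v + k) = torus_of v"
 by (simp add: torus_of_eq_iff)

definition cell :: "real^'n::finite \<Rightarrow> (real^'n) set" where
 "cell a = {v. \<forall>i. 0 \<le> v $ i - a $ i \<and> v $ i - a $ i < 1}"

lemma cell_0: "cell 0 = unit_cell"
 by (simp add: cell_def unit_cell_def)

lemma cell_eq_vimage: "cell a = (\<lambda>v. v - a) -` unit_cell"
 by (auto simp: cell_def unit_cell_def)

lemma cell_borel [measurable]: "cell (a::real^'n::finite) \<in> sets borel"
 using measurable_sets[of "\<lambda>v::real^'n. v - a" borel borel unit_cell] by (simp add: cell_eq_vimage)

lemma emeasure_lborel_vimage_plus: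
 assumes [measurable]: "S \<in> sets (borel :: 'a::euclidean_space measure)"
 shows "emeasure lborel ((+) c -` S) = emeasure lborel S"
proof -
 have "emeasure lborel ((+) c -` S) = emeasure (distr lborel borel ((+) c)) S" by (subst emeasure_distr) auto
 thus ?thesis by (simp add: lborel_distr_plus)
qed

text \<open>Any two cells are fundamental domains of the lattice: cut one by the translates of the other.\<close>

lemma emeasure_fundamental_domain:
 fixes P :: "(real^'n::finite) set"
 assumes P [measurable]: "P \<in> sets borel"
  and per: "\<And>v k. (\<And>i. k $ i \<in> \<int>) \<Longrightarrow> v + k \<in> P \<longleftrightarrow> v \<in> P"
 shows "emeasure lborel (P \<inter> cell a) = emeasure lborel (P \<inter> unit_cell)"
proof -
 define Z where "Z = {k::real^'n. \<forall>i. k $ i \<in> \<int>}"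
 have "countable Z"
 proof -
  have "Z \<subseteq> (\<lambda>g. \<chi> i. g i) ` (Pi\<^sub>E UNIV (\<lambda>_. \<int>))"
  proof
   fix k assume "k \<in> Z"
   thus "k \<in> (\<lambda>g. \<chi> i. g i) ` (Pi\<^sub>E UNIV (\<lambda>_. \<int>))"
    by (intro image_eqI[of _ _ "\<lambda>i. k $ i"]) (auto simp: Z_def)
  qed
  moreover have "countable (Pi\<^sub>E (UNIV::'n set) (\<lambda>_. \<int> :: real set))"
   by (intro countable_PiE) (auto simp: Ints_def)
  ultimately show ?thesis by (rule countable_subset[OF _ countable_image])
 qed
 have cov: "\<exists>k\<in>Z. v \<in> cell (b + k)" for v b :: "real^'n"
 proof
  have "0 \<le> v $ i - (b $ i + of_int \<lfloor>v $ i - b $ i\<rfloor>) \<and> v $ i - (b $ i + of_int \<lfloor>v $ i - b $ i\<rfloor>) < 1" for i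
   by linarith
  thus "v \<in> cell (b + (\<chi> i. of_int \<lfloor>v $ i - b $ i\<rfloor>))" unfolding cell_def by simp
 qed (simp add: Z_def)
 have dis: "k = k'" if H: "k \<in> Z" "k' \<in> Z" "v \<in> cell (b + k)" "v \<in> cell (b + k')" for k k' v b
 proof -
  have "k $ i = k' $ i" for i
  proof -
   obtain m m' where m: "k $ i = of_int m" "k' $ i = of_int m'"
    using H(1,2) unfolding Z_def by (metis (mono_tags) Ints_cases mem_Collect_eq)
   have "0 \<le> v $ i - b $ i - k $ i" "v $ i - b $ i - k $ i < 1"
    "0 \<le> v $ i - b $ i - k' $ i" "v $ i - b $ i - k' $ i < 1"
    using H(3,4) by (auto simp: cell_def algebra_simps)
   hence "of_int m - of_int m' < (1::real)" "of_int m' - of_int m < (1::real)" unfolding m by linarith+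
   hence "m = m'" by linarith
   thus ?thesis by (simp add: m)
  qed
  thus ?thesis by (simp add: vec_eq_iff)
 qed
 have split: "emeasure lborel S = (\<integral>\<^sup>+k. emeasure lborel (S \<inter> cell (b + k)) \<partial>count_space Z)"
  if [measurable]: "S \<in> sets borel" for S :: "(real^'n) set" and b
 proof -
  have "S = (\<Union>k\<in>Z. S \<inter> cell (b + k))" using cov by blast
  hence "emeasure lborel S = emeasure lborel (\<Union>k\<in>Z. S \<inter> cell (b + k))" by simp
  also have "\<dots> = (\<integral>\<^sup>+k. emeasure lborel (S \<inter> cell (b + k)) \<partial>count_space Z)"
  proof (rule emeasure_UN_countable)
   show "disjoint_family_on (\<lambda>k. S \<inter> cell (b + k)) Z"
    unfolding disjoint_family_on_def using dis by blast
  qed (use \<open>countable Z\<close> in auto)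
  finally show ?thesis .
 qed
 have shift: "(+) k -` (P \<inter> cell a \<inter> cell (0 + k)) = P \<inter> unit_cell \<inter> cell (a + (- k))"
  if "k \<in> Z" for k
 proof -
  have "k + v \<in> P \<longleftrightarrow> v \<in> P" for v using per[of k v] that by (simp add: Z_def add.commute)
  thus ?thesis by (auto simp: cell_def unit_cell_def algebra_simps)
 qed
 have "emeasure lborel (P \<inter> cell a) =
   (\<integral>\<^sup>+k. emeasure lborel (P \<inter> cell a \<inter> cell (0 + k)) \<partial>count_space Z)"
  by (rule split) simp
 also have "\<dots> = (\<integral>\<^sup>+k. emeasure lborel (P \<inter> unit_cell \<inter> cell (a + (- k))) \<partial>count_space Z)"
 proof (rule nn_integral_cong)
  fix k assume "k \<in> space (count_space Z)"
  thus "emeasure lborel (P \<inter> cell a \<inter> cell (0 + k)) =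
   emeasure lborel (P \<inter> unit_cell \<inter> cell (a + (- k)))"
   using emeasure_lborel_vimage_plus[of "P \<inter> cell a \<inter> cell (0 + k)" k] shift[of k] by simp
 qed
 \<comment> \<open>The lattice is symmetric, so replacing \<open>k\<close> by \<open>- k\<close>
   only permutes the sum.\<close>
 also have "\<dots> = (\<integral>\<^sup>+k. emeasure lborel (P \<inter> unit_cell \<inter> cell (a + k)) \<partial>count_space Z)"
 proof -
  have "bij_betw uminus Z Z" by (rule bij_betwI[where g = uminus]) (auto simp: Z_def)
  thus ?thesis by (rule nn_integral_bij_count_space)
 qed
 also have "\<dots> = emeasure lborel (P \<inter> unit_cell)" by (rule split[symmetric]) simp
 finally show ?thesis .
qed

lemma vimage_chart_borel [measurable (raw)]:
 fixes y :: "'n::finite torus"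
 assumes "S \<in> sets borel"
 shows "(\<lambda>v. y + torus_of v) -` S \<in> sets borel"
proof -
 obtain w where w: "y = torus_of w" using surj_torus_of by metis
 have "(\<lambda>v. y + torus_of v) = (\<lambda>v. torus_of (w + v))" by (simp add: w torus_of_add)
 thus ?thesis using assms measurable_sets[of "\<lambda>v. torus_of (w + v)" borel borel S] by simp
qed

text \<open>The cell \<open>a\<close> is free: \<open>a = 0\<close> yields the invariance of
  Lebesgue measure under translations, and the cell centred at the origin yields the volume of sets
  in small balls.\<close>

lemma emeasure_torus_chart:
 fixes y :: "'n::finite torus"
 assumes S [measurable]: "S \<in> sets borel"
 shows "emeasure lborel ((\<lambda>v. y + torus_of v) -` S \<inter> cell a) = emeasure torus_lebesgue S"
proof -
 obtain w where w: "y = torus_of w" using surj_torus_of by metis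
 have per: "torus_of (v + k) \<in> S \<longleftrightarrow> torus_of v \<in> S" if "\<And>i. k $ i \<in> \<int>" for v k
  using torus_of_int[OF that] by simp
 have eq: "(\<lambda>v. y + torus_of v) -` S \<inter> cell a = (+) w -` (torus_of -` S \<inter> cell (w + a))"
  by (auto simp: w torus_of_add cell_def)
 have "emeasure lborel ((\<lambda>v. y + torus_of v) -` S \<inter> cell a) = emeasure lborel (torus_of -` S \<inter> cell (w + a))"
  unfolding eq by (rule emeasure_lborel_vimage_plus) measurable
 also have "\<dots> = emeasure lborel (torus_of -` S \<inter> unit_cell)"
  by (rule emeasure_fundamental_domain) (use per in auto)
 finally show ?thesis by (simp add: emeasure_torus_lebesgue)
qed

lemma measurable_torus_plus [measurable]: "(\<lambda>x::'n::finite torus. y + x) \<in> borel_measurable borel"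
 by (rule borel_measurable_continuous_onI)
  (unfold continuous_on_iff, metis dist_torus_translate)

lemma torus_lebesgue_translate:
 assumes S [measurable]: "S \<in> sets (borel :: 'n::finite torus measure)"
 shows "emeasure torus_lebesgue ((\<lambda>x. y + x) -` S) = emeasure torus_lebesgue S"
proof -
 have m: "(\<lambda>x. y + x) -` S \<in> sets borel" using measurable_sets[OF measurable_torus_plus S, of y] by simp
 have "emeasure torus_lebesgue ((\<lambda>x. y + x) -` S) = emeasure lborel ((\<lambda>v. y + torus_of v) -` S \<inter> cell 0)"
  by (subst emeasure_torus_lebesgue[OF m]) (simp add: vimage_def cell_0)
 also have "\<dots> = emeasure torus_lebesgue S" by (rule emeasure_torus_chart) simp
 finally show ?thesis .
qed

subsection \<open>Change of variables over an arbitrary finite index type\<close>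

text \<open>The library proves the substitution rule for matrices over well-ordered index types only;
 it is transported along a copy of the index type that carries an arbitrary order.\<close>

typedef 'a ordered_copy = "UNIV :: 'a set" by simp

instance ordered_copy :: (finite) finite
proof
 have "finite (range (Abs_ordered_copy :: 'a \<Rightarrow> _))" by simp
 moreover have "range (Abs_ordered_copy :: 'a \<Rightarrow> _) = UNIV"
  by (metis Rep_ordered_copy_inverse UNIV_eq_I rangeI)
 ultimately show "finite (UNIV :: 'a ordered_copy set)" by simp
qed

definition copy_rank :: "'a::finite ordered_copy \<Rightarrow> nat" where
 "copy_rank = (SOME g. inj g)"

lemma inj_copy_rank: "inj copy_rank"
proof -
 obtain g :: "'a ordered_copy \<Rightarrow> nat" where "inj g"
  using finite_imp_inj_to_nat_seg[of "UNIV :: 'a ordered_copy set"] by auto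
 thus ?thesis unfolding copy_rank_def by (rule someI[of inj])
qed

instantiation ordered_copy :: (finite) wellorder
begin
definition less_eq_ordered_copy :: "'a ordered_copy \<Rightarrow> 'a ordered_copy \<Rightarrow> bool" where
 "less_eq_ordered_copy x y \<longleftrightarrow> copy_rank x \<le> copy_rank y"
definition less_ordered_copy :: "'a ordered_copy \<Rightarrow> 'a ordered_copy \<Rightarrow> bool" where
 "less_ordered_copy x y \<longleftrightarrow> copy_rank x < copy_rank y"
instance
proof
 fix P :: "'a ordered_copy \<Rightarrow> bool" and a
 assume H: "\<And>x. (\<And>y. y < x \<Longrightarrow> P y) \<Longrightarrow> P x"
 show "P a" by (induction "copy_rank a" arbitrary: a rule: less_induct)
   (metis H less_ordered_copy_def)
qed (use inj_copy_rank in \<open>auto simp: less_eq_ordered_copy_def less_ordered_copy_def inj_def\<close>)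
end

definition relabel :: "'b^'n::finite \<Rightarrow> 'b^'n ordered_copy" where
 "relabel v = (\<chi> i. v $ Rep_ordered_copy i)"

definition unlabel :: "'b^'n ordered_copy \<Rightarrow> 'b^'n::finite" where
 "unlabel v = (\<chi> i. v $ Abs_ordered_copy i)"

lemma unlabel_relabel [simp]: "unlabel (relabel v) = v" "relabel (unlabel w) = w"
 by (simp_all add: relabel_def unlabel_def vec_eq_iff Rep_ordered_copy_inverse Abs_ordered_copy_inverse)

lemma bij_Rep_ordered_copy: "bij Rep_ordered_copy"
 by (rule bijI') (auto simp: Rep_ordered_copy_inject intro: Abs_ordered_copy_inverse[symmetric])

lemma bounded_linear_relabel: "bounded_linear (relabel :: real^'n::finite \<Rightarrow> _)"
 unfolding linear_conv_bounded_linear[symmetric] by (rule linearI) (simp_all add: relabel_def vec_eq_iff)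

lemma bounded_linear_unlabel: "bounded_linear (unlabel :: _ \<Rightarrow> real^'n::finite)"
 unfolding linear_conv_bounded_linear[symmetric] by (rule linearI) (simp_all add: unlabel_def vec_eq_iff)

lemma measurable_relabel [measurable]: "(relabel :: real^'n::finite \<Rightarrow> _) \<in> borel_measurable borel"
 using bounded_linear_relabel by (intro borel_measurable_continuous_onI linear_continuous_on)

lemma measurable_unlabel [measurable]: "(unlabel :: _ \<Rightarrow> real^'n::finite) \<in> borel_measurable borel"
 using bounded_linear_unlabel by (intro borel_measurable_continuous_onI linear_continuous_on)

lemma prod_Basis_cart: "(\<Prod>b\<in>(Basis::(real^'n::finite) set). g b) = (\<Prod>i\<in>UNIV. g (axis i 1))"
proof -
 have *: "(Basis::(real^'n) set) = range (\<lambda>i. axis i 1)" by (auto simp: Basis_vec_def)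
 show ?thesis unfolding * by (subst prod.reindex) (auto simp: inj_def axis_eq_axis)
qed

lemma lborel_relabel: "distr lborel borel (relabel :: real^'n::finite \<Rightarrow> _) = lborel"
proof (rule lborel_eqI[symmetric])
 fix l u :: "real^'n ordered_copy"
 assume le: "\<And>b. b \<in> Basis \<Longrightarrow> l \<bullet> b \<le> u \<bullet> b"
 have "relabel -` box l u = box (unlabel l) (unlabel u :: real^'n)"
 proof (intro set_eqI iffI)
  fix v :: "real^'n" assume "v \<in> relabel -` box l u"
  hence *: "l $ i < v $ Rep_ordered_copy i \<and> v $ Rep_ordered_copy i < u $ i" for i
   by (simp add: mem_box_cart relabel_def)
  show "v \<in> box (unlabel l) (unlabel u)"
   using *[of "Abs_ordered_copy _"] by (auto simp: mem_box_cart unlabel_def Abs_ordered_copy_inverse)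
 next
  fix v :: "real^'n" assume "v \<in> box (unlabel l) (unlabel u)"
  hence *: "l $ Abs_ordered_copy i < v $ i \<and> v $ i < u $ Abs_ordered_copy i" for i
   by (simp add: mem_box_cart unlabel_def)
  show "v \<in> relabel -` box l u"
   using *[of "Rep_ordered_copy _"] by (auto simp: mem_box_cart relabel_def Rep_ordered_copy_inverse)
 qed
 hence "emeasure (distr lborel borel relabel) (box l u) = emeasure lborel (box (unlabel l) (unlabel u :: real^'n))"
  by (subst emeasure_distr) auto
 also have "\<dots> = ennreal (\<Prod>b\<in>Basis. (unlabel u - unlabel l :: real^'n) \<bullet> b)"
 proof (rule emeasure_lborel_box)
  fix b :: "real^'n" assume "b \<in> Basis"
  then obtain i where b: "b = axis i 1" by (auto simp: Basis_vec_def)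
  show "unlabel l \<bullet> b \<le> unlabel u \<bullet> b" using le[of "axis (Abs_ordered_copy i) 1"]
   by (simp add: b inner_axis unlabel_def)
 qed
 also have "(\<Prod>b\<in>Basis. (unlabel u - unlabel l :: real^'n) \<bullet> b) = (\<Prod>i\<in>UNIV. (u - l) $ Abs_ordered_copy i)"
  unfolding prod_Basis_cart by (simp add: inner_axis unlabel_def)
 also have "\<dots> = (\<Prod>i\<in>UNIV. (u - l) $ i)"
  by (rule prod.reindex_bij_witness[of _ Rep_ordered_copy Abs_ordered_copy])
   (auto simp: Rep_ordered_copy_inverse Abs_ordered_copy_inverse)
 also have "\<dots> = (\<Prod>b\<in>Basis. (u - l) \<bullet> b)" unfolding prod_Basis_cart by (simp add: inner_axis)
 finally show "emeasure (distr lborel borel relabel) (box l u) = ennreal (\<Prod>b\<in>Basis. (u - l) \<bullet> b)" .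
qed simp

definition relabel_matrix :: "real^'n^'n \<Rightarrow> real^'n::finite ordered_copy^'n ordered_copy" where
 "relabel_matrix A = (\<chi> i j. A $ Rep_ordered_copy i $ Rep_ordered_copy j)"

text \<open>Conjugation by the bijection \<open>Rep_ordered_copy\<close> matches the permutations of
  the two index types and preserves their signs.\<close>

lemma det_relabel: "det (relabel_matrix A) = det (A :: real^'n::finite^'n)"
proof -
 let ?R = "Rep_ordered_copy :: 'n ordered_copy \<Rightarrow> 'n"
 let ?m = "map_permutation UNIV ?R"
 have inj: "inj ?R" using bij_Rep_ordered_copy by (rule bij_is_inj)
 have bij: "bij_betw ?m {p. p permutes UNIV} {p. p permutes UNIV}"
 proof -
  have "?m = (\<lambda>p x. if x \<in> UNIV then ?R (p (inv_into UNIV ?R x)) else x)"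
   using bij_is_surj[OF bij_Rep_ordered_copy] by (auto simp: map_permutation_def restrict_id_def fun_eq_iff)
  thus ?thesis using bij_betw_permutations[OF bij_Rep_ordered_copy] by simp
 qed
 have "det A = (\<Sum>p\<in>{p. p permutes UNIV}. of_int (sign (?m p)) * (\<Prod>i\<in>UNIV. A $ i $ ?m p i))"
  unfolding det_def by (rule sum.reindex_bij_betw[OF bij, symmetric])
 also have "\<dots> = (\<Sum>p\<in>{p. p permutes UNIV}. of_int (sign p) * (\<Prod>i\<in>UNIV. relabel_matrix A $ i $ p i))"
 proof (rule sum.cong[OF refl])
  fix p :: "'n ordered_copy \<Rightarrow> 'n ordered_copy" assume "p \<in> {p. p permutes UNIV}"
  hence s: "sign (?m p) = sign p" by (intro sign_map_permutation) (use inj in auto)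
  have "(\<Prod>i\<in>UNIV. A $ i $ ?m p i) = (\<Prod>i\<in>UNIV. A $ ?R i $ ?m p (?R i))"
   by (rule prod.reindex_bij_betw[OF bij_Rep_ordered_copy, symmetric])
  also have "\<dots> = (\<Prod>i\<in>UNIV. relabel_matrix A $ i $ p i)"
   by (simp add: relabel_matrix_def map_permutation_apply[OF inj])
  finally show "of_int (sign (?m p)) * (\<Prod>i\<in>UNIV. A $ i $ ?m p i) =
    of_int (sign p) * (\<Prod>i\<in>UNIV. relabel_matrix A $ i $ p i)" by (simp add: s)
 qed
 finally show ?thesis by (simp add: det_def)
qed

lemma relabel_matrix_mult: "relabel_matrix A *v w = relabel (A *v unlabel w)"
proof -
 have "(\<Sum>j\<in>UNIV. A $ Rep_ordered_copy i $ Rep_ordered_copy j * w $ j) =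
   (\<Sum>j\<in>UNIV. A $ Rep_ordered_copy i $ j * w $ Abs_ordered_copy j)" for i
  by (rule sum.reindex_bij_witness[of _ Abs_ordered_copy Rep_ordered_copy])
   (auto simp: Rep_ordered_copy_inverse Abs_ordered_copy_inverse)
 thus ?thesis by (simp add: matrix_vector_mult_def relabel_def unlabel_def relabel_matrix_def vec_eq_iff)
qed

lemma emeasure_injective_image_wellorder:
 fixes g :: "real^'m::{finite,wellorder} \<Rightarrow> real^'m::_"
 assumes S: "S \<in> sets borel" and gS: "g ` S \<in> sets borel" and fin: "emeasure lborel (g ` S) < \<infinity>"
  and der: "\<And>v. v \<in> S \<Longrightarrow> (g has_derivative (\<lambda>h. A v *v h)) (at v)" and inj: "inj_on g S"
 shows "emeasure lborel (g ` S) = (\<integral>\<^sup>+v\<in>S. ennreal \<bar>det (A v)\<bar> \<partial>lborel)"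
proof -
 have m: "g ` S \<in> lmeasurable" using gS fin by (auto simp: fmeasurable_def)
 have "((\<lambda>x. \<bar>det (matrix ((*v) (A x)))\<bar>) has_integral measure lebesgue (g ` S)) S"
  using has_measure_differentiable_image[of S g "\<lambda>v. (*v) (A v)" "measure lebesgue (g ` S)"] m S inj
   has_derivative_at_withinI[OF der] by auto
 hence "((\<lambda>x. \<bar>det (A x)\<bar>) has_integral measure lebesgue (g ` S)) S" by simp
 from nn_integral_has_integral_lebesgue'[OF _ this] show ?thesis
  using gS fin by (simp add: emeasure_eq_ennreal_measure measure_completion less_top)
qed

lemma emeasure_injective_image:
 fixes g :: "real^'n::finite \<Rightarrow> real^'n"
 assumes S: "S \<in> sets borel" and gS: "g ` S \<in> sets borel" and fin: "emeasure lborel (g ` S) < \<infinity>"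
  and der: "\<And>v. v \<in> S \<Longrightarrow> (g has_derivative (\<lambda>h. A v *v h)) (at v)" and inj: "inj_on g S"
  and meas [measurable]: "(\<lambda>v. ennreal \<bar>det (A v)\<bar> * indicator S v) \<in> borel_measurable borel"
 shows "emeasure lborel (g ` S) = (\<integral>\<^sup>+v\<in>S. ennreal \<bar>det (A v)\<bar> \<partial>lborel)"
proof -
 let ?g = "\<lambda>w. relabel (g (unlabel w))"
 let ?S = "unlabel -` S"
 have img: "?g ` ?S = unlabel -` (g ` S)"
 proof safe
  fix x v assume "unlabel x = g v" "v \<in> S"
  thus "x \<in> ?g ` ?S" by (intro image_eqI[of _ _ "relabel v"]) (auto simp flip: \<open>unlabel x = g v\<close>)
 qed auto
 have em: "emeasure lborel (unlabel -` T) = emeasure lborel T" if [measurable]: "T \<in> sets borel" for T :: "(real^'n) set"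
 proof -
  have u: "unlabel -` T \<in> sets borel" using measurable_sets[OF measurable_unlabel that] by simp
  have "emeasure lborel (unlabel -` T) = emeasure (distr lborel borel relabel) (unlabel -` T)"
   by (simp add: lborel_relabel)
  also have "\<dots> = emeasure lborel (relabel -` unlabel -` T)" using u by (subst emeasure_distr) auto
  finally show ?thesis by (simp add: vimage_def)
 qed
 have "emeasure lborel (?g ` ?S) = (\<integral>\<^sup>+w. ennreal \<bar>det (relabel_matrix (A (unlabel w)))\<bar> * indicator ?S w \<partial>lborel)"
 proof (rule emeasure_injective_image_wellorder)
  show "?S \<in> sets borel" using measurable_sets[OF measurable_unlabel S] by simp
  show "?g ` ?S \<in> sets borel" unfolding img using measurable_sets[OF measurable_unlabel gS] by simp
  show "emeasure lborel (?g ` ?S) < \<infinity>" unfolding img using fin gS by (simp add: em)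
  show "inj_on ?g ?S" using inj by (auto simp: inj_on_def) (metis unlabel_relabel)
  fix w assume "w \<in> ?S"
  hence "(g has_derivative (\<lambda>h. A (unlabel w) *v h)) (at (unlabel w))" using der by simp
  from has_derivative_compose[OF bounded_linear_imp_has_derivative[OF bounded_linear_unlabel] this]
  have "((\<lambda>x. g (unlabel x)) has_derivative (\<lambda>h. A (unlabel w) *v unlabel h)) (at w)" .
  from bounded_linear.has_derivative[OF bounded_linear_relabel this]
  show "(?g has_derivative (*v) (relabel_matrix (A (unlabel w)))) (at w)"
   by (simp add: relabel_matrix_mult[abs_def])
 qed
 also have "\<dots> = (\<integral>\<^sup>+w. (\<lambda>v. ennreal \<bar>det (A v)\<bar> * indicator S v) (unlabel w) \<partial>lborel)"
  by (simp add: det_relabel indicator_def)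
 also have "\<dots> = (\<integral>\<^sup>+v\<in>S. ennreal \<bar>det (A v)\<bar> \<partial>lborel)"
 proof -
  have "distr lborel borel (unlabel :: _ \<Rightarrow> real^'n) = lborel"
   by (rule measure_eqI) (simp_all add: emeasure_distr em)
  from nn_integral_distr[of unlabel lborel borel "\<lambda>v. ennreal \<bar>det (A v)\<bar> * indicator S v", unfolded this]
  show ?thesis by simp
 qed
 finally show ?thesis by (simp add: img em gS)
qed

subsection \<open>Charts of the torus\<close>

text \<open>The inverse chart at \<open>0\<close>: some shortest lift. It is controlled where its
  norm is less than \<open>1/2\<close>, hence the bounds by \<open>1/2\<close> in what
  follows.\<close>

definition centred :: "'n::finite torus \<Rightarrow> real^'n" where
 "centred x = (SOME v. x = torus_of v \<and> norm v = dist x 0)"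

lemma centred: "torus_of (centred x) = x" "norm (centred x) = dist x 0"
proof -
 have "\<exists>v. x = torus_of v \<and> norm v = dist x 0" using torus_of_near[of x 0] by simp
 from someI_ex[OF this] show "torus_of (centred x) = x" "norm (centred x) = dist x 0" unfolding centred_def by auto
qed

lemma torus_of_inj_lt1:
 assumes "torus_of v = torus_of w" "norm (v - w) < 1"
 shows "v = (w :: real^'n::finite)"
proof -
 have "v $ i - w $ i = 0" for i
 proof (rule Ints_nonzero_abs_less1)
  show "v $ i - w $ i \<in> \<int>" using assms(1) by (simp add: torus_of_eq_iff)
  show "\<bar>v $ i - w $ i\<bar> < 1" using component_le_norm_cart[of "v - w" i] assms(2) by simp
 qed
 thus ?thesis by (simp add: vec_eq_iff)
qed

lemma centred_torus_of: "norm v < 1/2 \<Longrightarrow> centred (torus_of v) = (v :: real^'n::finite)"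
proof (rule torus_of_inj_lt1)
 assume v: "norm v < 1/2"
 have "norm (centred (torus_of v)) \<le> norm v"
  using dist_torus_of_le[of v 0] by (simp add: centred torus_of_0 dist_norm)
 thus "norm (centred (torus_of v) - v) < 1" using norm_triangle_ineq4[of "centred (torus_of v)" v] v by simp
qed (simp add: centred)

lemma dist_chart_le: "dist (y + torus_of v) (y + torus_of w) \<le> dist v w"
 by (simp add: dist_torus_translate dist_torus_of_le)

lemma dist_chart_small: "dist v w \<le> 1/2 \<Longrightarrow> dist (y + torus_of v) (y + torus_of w) = dist v w"
 by (simp add: dist_torus_translate dist_torus_of_small)

lemma dist_chart0: "norm v \<le> 1/2 \<Longrightarrow> dist (y + torus_of v) y = norm v"
 using dist_chart_small[of v 0 y] by (simp add: torus_of_0)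

lemma dist_chart0_le: "dist (y + torus_of v) y \<le> norm v"
 using dist_chart_le[of y v 0] by (simp add: torus_of_0)

lemma continuous_chart: "continuous_on S (\<lambda>v. y + torus_of v)"
 unfolding continuous_on_iff using dist_chart_le by (metis le_less_trans)

lemma measurable_chart [measurable]: "(\<lambda>v. y + torus_of v) \<in> borel_measurable borel"
 by (intro borel_measurable_continuous_onI continuous_chart)

lemma chart_image_ball: "r \<le> 1/2 \<Longrightarrow> (\<lambda>v. y + torus_of v) ` ball 0 r = ball y r"
proof safe
 fix v :: "real^'a" assume "r \<le> 1/2" "v \<in> ball 0 r"
 thus "y + torus_of v \<in> ball y r" using dist_chart0_le[of y v] by (simp add: dist_commute)
next
 fix x assume "x \<in> ball y r"
 thus "x \<in> (\<lambda>v. y + torus_of v) ` ball 0 r" using torus_of_near[of x y] by (auto simp: dist_commute)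
qed

lemma chart_inj: "norm (v - w) < 1 \<Longrightarrow> y + torus_of v = y + torus_of w \<Longrightarrow> v = w"
 using torus_of_inj_lt1 by simp

lemma emeasure_torus_chart_ball:
 fixes y :: "'n::finite torus"
 assumes S [measurable]: "S \<in> sets borel" and sub: "S \<subseteq> ball y r" and r: "r \<le> 1/2"
 shows "emeasure torus_lebesgue S = emeasure lborel ((\<lambda>v. y + torus_of v) -` S \<inter> ball 0 r)"
proof -
 \<comment> \<open>The cell centred at the origin contains the ball since \<open>r\<close> is at
   most \<open>1/2\<close>, and a point of the cell that the chart sends into
   \<open>ball y r\<close> is itself in the ball.\<close>
 define a :: "real^'n" where "a = (\<chi> i. - 1/2)"
 have "(\<lambda>v. y + torus_of v) -` S \<inter> cell a = (\<lambda>v. y + torus_of v) -` S \<inter> ball 0 r"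
 proof safe
  fix v :: "real^'n" assume v: "v \<in> cell a" "y + torus_of v \<in> S"
  then obtain w where w: "w \<in> ball 0 r" "y + torus_of v = y + torus_of w"
   using sub chart_image_ball[OF r, of y] by blast
  have "v $ i = w $ i" for i
  proof -
   have "v $ i - w $ i \<in> \<int>" using w(2) by (simp add: torus_of_eq_iff)
   moreover have "\<bar>w $ i\<bar> < 1/2" using component_le_norm_cart[of w i] w(1) r by simp
   moreover have "-1/2 \<le> v $ i" "v $ i < 1/2"
   proof -
    have "0 \<le> v $ i - a $ i \<and> v $ i - a $ i < 1" using v(1) unfolding cell_def by blast
    thus "-1/2 \<le> v $ i" "v $ i < 1/2" by (auto simp: a_def)
   qed
   ultimately have "v $ i - w $ i \<in> \<int>" "\<bar>v $ i - w $ i\<bar> < 1" by auto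
   thus ?thesis using Ints_nonzero_abs_less1 by fastforce
  qed
  hence "v = w" by (simp add: vec_eq_iff)
  thus "v \<in> ball 0 r" using w(1) by simp
 next
  fix v :: "real^'n" assume v: "v \<in> ball 0 r"
  have "0 \<le> v $ i + 1/2 \<and> v $ i + 1/2 < 1" for i
  proof -
   have "\<bar>v $ i\<bar> < 1/2" using component_le_norm_cart[of v i] v r by simp
   thus ?thesis by linarith
  qed
  thus "v \<in> cell a" by (simp add: cell_def a_def)
 qed auto
 thus ?thesis using emeasure_torus_chart[OF S, of y a] by simp
qed

lemma emeasure_torus_ball:
 fixes y :: "'n::finite torus"
 shows "r \<le> 1/2 \<Longrightarrow> emeasure torus_lebesgue (ball y r) = emeasure lborel (ball (0::real^'n::finite) r)"
proof -
 assume r: "r \<le> 1/2"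
 have "(\<lambda>v. y + torus_of v) -` ball y r \<inter> ball (0::real^'n) r = ball 0 r"
  using chart_image_ball[OF r, of y] by auto
 thus ?thesis using emeasure_torus_chart_ball[of "ball y r" y r] r by simp
qed

lemma nn_integral_torus_chart_ball:
 fixes y :: "'n::finite torus"
 assumes h [measurable]: "h \<in> borel_measurable borel" and r: "r \<le> 1/2"
 shows "(\<integral>\<^sup>+x\<in>ball y r. h x \<partial>torus_lebesgue)
  = (\<integral>\<^sup>+v\<in>ball 0 r. h (y + torus_of v) \<partial>lborel)"
proof -
 let ?M = "density torus_lebesgue (indicator (ball y r))"
 let ?N = "distr (density lborel (indicator (ball 0 r))) borel (\<lambda>v::real^'n. y + torus_of v)"
 have ind [measurable]: "indicator (ball y r) \<in> borel_measurable (torus_lebesgue :: 'n torus measure)"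
  by (intro borel_measurable_indicator) simp
 have ind0 [measurable]: "indicator (ball 0 r) \<in> borel_measurable (borel :: (real^'n) measure)"
  by (intro borel_measurable_indicator) simp
 have "?M = ?N"
 proof (rule measure_eqI)
  fix S assume "S \<in> sets ?M"
  hence S [measurable]: "S \<in> sets borel" by simp
  have "emeasure ?M S = emeasure torus_lebesgue (S \<inter> ball y r)"
   by (subst emeasure_density) (auto simp: indicator_inter_arith[symmetric] Int_commute)
  also have "\<dots> = emeasure lborel ((\<lambda>v. y + torus_of v) -` (S \<inter> ball y r) \<inter> ball 0 r)"
   by (rule emeasure_torus_chart_ball) (use r in auto)
  also have "(\<lambda>v. y + torus_of v) -` (S \<inter> ball y r) \<inter> ball 0 r = (\<lambda>v. y + torus_of v) -` S \<inter> ball (0::real^'n) r"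
   using chart_image_ball[OF r, of y] by auto
  also have "emeasure lborel \<dots> = emeasure ?N S"
  proof -
   have [measurable]: "(\<lambda>v. y + torus_of v) -` S \<in> sets borel" by measurable
   show ?thesis by (subst emeasure_distr, simp, simp, subst emeasure_density)
     (auto simp: indicator_inter_arith[symmetric] Int_commute)
  qed
  finally show "emeasure ?M S = emeasure ?N S" .
 qed simp
 have "(\<integral>\<^sup>+x\<in>ball y r. h x \<partial>torus_lebesgue) = integral\<^sup>N ?M h"
  by (subst nn_integral_density) (auto simp: mult.commute)
 also have "\<dots> = integral\<^sup>N ?N h" using \<open>?M = ?N\<close> by simp
 also have "\<dots> = (\<integral>\<^sup>+v\<in>ball 0 r. h (y + torus_of v) \<partial>lborel)"
  by (subst nn_integral_distr, simp, simp, subst nn_integral_density) (auto simp: mult.commute)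
 finally show ?thesis .
qed

subsection \<open>Derivatives on the torus\<close>

lemma has_torus_derivative_isCont:
 assumes "has_torus_derivative f A x"
 shows "isCont f x"
proof -
 obtain F where F: "F 0 = 0" "\<And>v. f (x + torus_of v) = f x + torus_of (F v)"
   "(F has_derivative (\<lambda>v. A *v v)) (at 0)"
  using assms unfolding has_torus_derivative_def by metis
 have c: "isCont F 0" using F(3) by (rule has_derivative_continuous)
 show ?thesis unfolding continuous_at_eps_delta
 proof (intro allI impI)
  fix e :: real assume "e > 0"
  then obtain d where d: "d > 0" "\<And>v. dist v 0 < d \<Longrightarrow> dist (F v) (F 0) < e"
   using c unfolding continuous_at_eps_delta by metis
  have "dist (f y) (f x) < e" if "dist y x < d" for y
  proof -
   obtain v where v: "y = x + torus_of v" "norm v = dist y x" using torus_of_near[of y x] by auto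
   have "dist (f y) (f x) \<le> norm (F v)" using dist_chart0_le[of "f x" "F v"] by (simp add: v F(2))
   also have "\<dots> < e" using d(2)[of v] v(2) that F(1) by simp
   finally show ?thesis .
  qed
  thus "\<exists>d>0. \<forall>x'. dist x' x < d \<longrightarrow> dist (f x') (f x) < e" using d(1) by blast
 qed
qed

lemma norm_le_onorm_inv:
 assumes "det (A :: real^'n::finite^'n) \<noteq> 0"
 shows "norm v \<le> onorm (\<lambda>v. matrix_inv A *v v) * norm (A *v v)"
proof -
 have "matrix_inv A ** A = mat 1" using assms invertible_det_nz[of A] matrix_inv_def[of A]
  unfolding invertible_def by (metis (mono_tags, lifting) someI_ex)
 hence "v = matrix_inv A *v (A *v v)" by (simp add: matrix_vector_mul_assoc)
 hence "norm v = norm (matrix_inv A *v (A *v v))" by simp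
 also have "\<dots> \<le> onorm (\<lambda>v. matrix_inv A *v v) * norm (A *v v)"
  by (rule onorm) (simp add: matrix_vector_mul_bounded_linear)
 finally show ?thesis .
qed

text \<open>Differentiability at the single point \<open>x\<close> suffices for this lower bound on
  distances; no inverse function is involved. The margin between \<open>\<kappa>\<close> and the
  norm of the inverse matrix absorbs the remainder.\<close>

lemma has_torus_derivative_expand:
 assumes f: "has_torus_derivative f A x" and A: "det A \<noteq> 0"
  and k: "onorm (\<lambda>v. matrix_inv A *v v) < \<kappa>"
 shows "\<forall>\<^sub>F y in nhds x. dist y x \<le> \<kappa> * dist (f y) (f x)"
proof -
 define N where "N = onorm (\<lambda>v. matrix_inv A *v v)"
 have N0: "N \<ge> 0" unfolding N_def by (intro onorm_pos_le) (simp add: matrix_vector_mul_bounded_linear)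
 obtain F where F: "F 0 = 0" "\<And>v. f (x + torus_of v) = f x + torus_of (F v)"
   "(F has_derivative (\<lambda>v. A *v v)) (at 0)"
  using f unfolding has_torus_derivative_def by metis
 have kpos: "\<kappa> > 0" using k N0 N_def by simp
 \<comment> \<open>Chosen for \<open>N \<le> \<kappa> * (1 - N * e)\<close>, the inequality needed
   once the remainder \<open>e * norm v\<close> has been moved to the left.\<close>
 define e where "e = (\<kappa> - N) / (\<kappa> * (N + 1))"
 have e: "e > 0" using k kpos N0 by (simp add: e_def N_def)
 obtain d1 where d1: "d1 > 0" "\<And>v. norm v < d1 \<Longrightarrow> norm (F v - F 0 - A *v v) \<le> e * norm v"
  using F(3) e unfolding has_derivative_at_alt by (metis diff_zero)
 have c: "isCont F 0" using F(3) by (rule has_derivative_continuous)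
 obtain d2 where d2: "d2 > 0" "\<And>v. dist v 0 < d2 \<Longrightarrow> dist (F v) (F 0) < 1/2"
  using c unfolding continuous_at_eps_delta by (metis half_gt_zero zero_less_one)
 have "dist y x \<le> \<kappa> * dist (f y) (f x)" if "dist y x < min d1 d2" for y
 proof -
  obtain v where v: "y = x + torus_of v" "norm v = dist y x" using torus_of_near[of y x] by auto
  have Fv: "norm (F v) < 1/2" using d2(2)[of v] v(2) that F(1) by simp
  hence df: "dist (f y) (f x) = norm (F v)" using dist_chart0[of "F v" "f x"] by (simp add: v F(2))
  have "norm v \<le> N * norm (A *v v)" using norm_le_onorm_inv[OF A, of v] by (simp add: N_def)
  also have "norm (A *v v) \<le> norm (F v) + e * norm v"
   using d1(2)[of v] v(2) that F(1) norm_triangle_ineq2[of "A *v v" "F v"] by (simp add: norm_minus_commute)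
  finally have "norm v \<le> N * (norm (F v) + e * norm v)" using N0 by (simp add: mult_left_mono)
  hence "(1 - N * e) * norm v \<le> N * norm (F v)" by (simp add: algebra_simps)
  moreover have "N \<le> \<kappa> * (1 - N * e)"
  proof -
   have "\<kappa> * (1 - N * e) = \<kappa> - N * (\<kappa> - N) / (N + 1)"
   proof -
    have "\<kappa> * (N * e) = N * ((\<kappa> / \<kappa>) * (\<kappa> - N) / (N + 1))"
     unfolding e_def by (simp add: mult.commute)
    thus ?thesis using kpos by (simp add: right_diff_distrib)
   qed
   moreover have "N * (\<kappa> - N) / (N + 1) \<le> \<kappa> - N"
   proof -
    have "N * (\<kappa> - N) \<le> (\<kappa> - N) * (N + 1)" using k by (simp add: N_def algebra_simps)
    thus ?thesis using N0 by (simp add: divide_le_eq)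
   qed
   ultimately show ?thesis by linarith
  qed
  moreover have pos: "1 - N * e > 0"
  proof -
   have "N * e = (N / (N + 1)) * ((\<kappa> - N) / \<kappa>)" using kpos N0 by (simp add: e_def)
   also have "\<dots> \<le> N / (N + 1) * 1" using N0 kpos by (intro mult_left_mono) auto
   also have "\<dots> < 1" using N0 by simp
   finally show ?thesis by simp
  qed
  ultimately have "(1 - N * e) * norm v \<le> \<kappa> * (1 - N * e) * norm (F v)"
   by (meson mult_right_mono norm_ge_zero order_trans)
  hence "norm v \<le> \<kappa> * norm (F v)" using pos by (simp add: mult.commute mult.left_commute)
  thus ?thesis using v(2) df by simp
 qed
 thus ?thesis unfolding eventually_nhds_metric using d1(1) d2(1) by (intro exI[of _ "min d1 d2"]) auto
qed

text \<open>The map \<open>F\<close> in the definition of the derivative may jump between lifts away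
  from \<open>0\<close>. Being continuous at \<open>0\<close>, it has small values nearby, so it
  agrees there with the shortest lift.\<close>

lemma has_derivative_in_charts:
 fixes f :: "'n::finite torus \<Rightarrow> 'n torus"
 assumes f: "has_torus_derivative f A (x + torus_of v)"
  and near: "dist (f (x + torus_of v)) y < 1/2"
 shows "((\<lambda>v. centred (f (x + torus_of v) - y)) has_derivative (\<lambda>h. A *v h)) (at v)"
proof -
 let ?z = "x + torus_of v"
 obtain F where F: "F 0 = 0" "\<And>v. f (?z + torus_of v) = f ?z + torus_of (F v)"
   "(F has_derivative (\<lambda>v. A *v v)) (at 0)"
  using f unfolding has_torus_derivative_def by metis
 define c where "c = centred (f ?z - y)"
 have c: "norm c < 1/2" using near dist_torus_diff[of "f ?z" y] by (simp add: c_def centred)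
 have tc: "torus_of c = f ?z - y" by (simp add: c_def centred)
 have G: "((\<lambda>w. c + F (w - v)) has_derivative (\<lambda>h. A *v h)) (at v)"
 proof -
  have "((\<lambda>w. w - v) has_derivative (\<lambda>h. h)) (at v)" by (auto intro!: derivative_eq_intros)
  from has_derivative_compose[OF this, of F "\<lambda>v. A *v v"] F(3)
  have "((\<lambda>w. F (w - v)) has_derivative (\<lambda>h. A *v h)) (at v)" by simp
  thus ?thesis by (auto intro!: derivative_eq_intros)
 qed
 have "isCont (\<lambda>w. c + F (w - v)) v" using G by (rule has_derivative_continuous)
 hence "((\<lambda>w. norm (c + F (w - v))) \<longlongrightarrow> norm (c + F (v - v))) (nhds v)"
  by (intro tendsto_norm) (simp add: continuous_at tendsto_nhds_iff)
 hence "\<forall>\<^sub>F w in nhds v. norm (c + F (w - v)) < 1/2" using c F(1) by (intro order_tendstoD(2)) auto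
 hence ev: "\<forall>\<^sub>F w in nhds v. c + F (w - v) = centred (f (x + torus_of w) - y)"
 proof eventually_elim
  case (elim w)
  have "x + torus_of w = ?z + torus_of (w - v)" by (simp add: torus_of_diff)
  hence "f (x + torus_of w) - y = torus_of (c + F (w - v))"
   using F(2)[of "w - v"] by (simp only: torus_of_add tc) simp
  thus ?case using elim by (simp add: centred_torus_of)
 qed
 show ?thesis using has_derivative_transform_eventually[OF G, of "\<lambda>w. centred (f (x + torus_of w) - y)"] ev
   eventually_nhds_x_imp_x[OF ev] by (simp add: eventually_at_filter eventually_mono)
qed

lemma isCont_in_chart:
 fixes g :: "'n::finite torus \<Rightarrow> 'b::metric_space"
 assumes "isCont (\<lambda>v. g (x + torus_of v)) 0"
 shows "isCont g x"
 unfolding continuous_at_eps_delta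
proof (intro allI impI)
 fix e :: real assume "e > 0"
 then obtain d where d: "d > 0" "\<And>v. dist v 0 < d \<Longrightarrow> dist (g (x + torus_of v)) (g (x + torus_of 0)) < e"
  using assms unfolding continuous_at_eps_delta by metis
 have "dist (g y) (g x) < e" if "dist y x < d" for y using torus_of_near[of y x] d(2) that by (auto simp: torus_of_0)
 thus "\<exists>d>0. \<forall>x'. dist x' x < d \<longrightarrow> dist (g x') (g x) < e" using d(1) by blast
qed

lemma borel_measurable_off_closed:
 fixes g :: "'a::topological_space \<Rightarrow> 'b::topological_space"
 assumes "open U" "continuous_on U g"
 shows "(\<lambda>x. if x \<in> U then g x else c) \<in> borel_measurable borel"
proof (rule borel_measurableI)
 fix S :: "'b set" assume "open S"
 hence "open (U \<inter> g -` S)" using assms by (simp add: continuous_on_open_vimage Int_commute)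
 moreover have "(\<lambda>x. if x \<in> U then g x else c) -` S \<inter> space borel
   = (U \<inter> g -` S) \<union> (if c \<in> S then - U else {})" by (auto split: if_splits)
 ultimately show "(\<lambda>x. if x \<in> U then g x else c) -` S \<inter> space borel \<in> sets borel"
  using assms(1) by auto
qed

section \<open>Local inverses and the substitution rule for \<open>f\<close>\<close>

locale torus_map =
 fixes f :: "'n::finite torus \<Rightarrow> 'n torus" and B \<beta> :: real
 assumes local_diffeo: "C2_local_diffeo_away_from_critical f B \<beta>"
begin

abbreviation "C \<equiv> critical_set f"
abbreviation "Df \<equiv> torus_derivative f"
abbreviation "leb \<equiv> (torus_lebesgue :: 'n torus measure)"
abbreviation "vol \<equiv> measure leb"

lemma local_inverse:
 assumes "x \<notin> C"
 obtains V g where "x \<in> V" "V \<subseteq> - C" "open V" "C2_torus_map_on V f" "open (f ` V)"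
  "continuous_on (f ` V) g" "\<And>y. y \<in> V \<Longrightarrow> g (f y) = y"
proof -
 have "C2_local_diffeo_on (- C) f" using local_diffeo by (simp add: C2_local_diffeo_away_from_critical_def)
 then obtain V g where V: "x \<in> V" "V \<subseteq> - C" "C2_torus_map_on V f" "open (f ` V)"
  "C2_torus_map_on (f ` V) g" "\<And>y. y \<in> V \<Longrightarrow> g (f y) = y"
  using assms unfolding C2_local_diffeo_on_def by (metis ComplI)
 have "continuous_on (f ` V) g" using V(5) has_torus_derivative_isCont unfolding C2_torus_map_on_def
  by (metis continuous_at_imp_continuous_on)
 thus thesis using that V unfolding C2_torus_map_on_def by metis
qed

lemma open_noncritical: "open (- C)"
 by (subst open_subopen) (metis ComplD local_inverse)

lemma critical_borel [measurable]: "C \<in> sets borel"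
 using open_noncritical borel_comp by (metis borel_open double_complement)

lemma has_derivative_f: "has_torus_derivative f (Df x) x"
proof (cases "x \<in> C")
 case True
 then obtain A where "has_torus_derivative f A x" by (auto simp: critical_set_def)
 thus ?thesis by (simp add: torus_derivative_eq)
next
 case False
 then obtain V where "x \<in> V" "C2_torus_map_on V f" by (rule local_inverse)
 then obtain A where "has_torus_derivative f A x" unfolding C2_torus_map_on_def by blast
 thus ?thesis by (simp add: torus_derivative_eq)
qed

lemma det_nonzero: "x \<notin> C \<Longrightarrow> det (Df x) \<noteq> 0"
 using has_derivative_f[of x] by (auto simp: critical_set_def)

lemma continuous_f: "continuous_on S f"
 using has_torus_derivative_isCont[OF has_derivative_f] by (simp add: continuous_at_imp_continuous_on)

lemma continuous_iterate: "continuous_on S (f ^^ k)"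
proof (induction k)
 case (Suc k)
 have "continuous_on S (\<lambda>x. f ((f ^^ k) x))"
  by (rule continuous_on_compose2[OF continuous_f[of UNIV] Suc]) auto
 thus ?case by (simp add: o_def)
qed (simp add: id_def)

lemma measurable_f [measurable]: "f \<in> borel_measurable borel"
 by (rule borel_measurable_continuous_onI[OF continuous_f])

lemma measurable_iterate [measurable]: "(f ^^ k) \<in> borel_measurable borel"
 by (rule borel_measurable_continuous_onI[OF continuous_iterate])

lemma continuous_Df: "continuous_on (- C) Df"
proof (intro continuous_at_imp_continuous_on ballI)
 fix x assume "x \<in> - C"
 then obtain V where "x \<in> V" "C2_torus_map_on V f" by (metis ComplD local_inverse)
 then obtain D :: "(real ^ 'n) \<Rightarrow>\<^sub>L (real ^ 'n ^ 'n)" where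
  "((\<lambda>v. Df (x + torus_of v)) has_derivative blinfun_apply D) (at 0)"
  unfolding C2_torus_map_on_def by blast
 thus "isCont Df x" by (intro isCont_in_chart has_derivative_continuous)
qed

text \<open>The derivative is known to be continuous off \<open>C\<close> only; the constant value
  on \<open>C\<close> makes \<open>J\<close> a Borel function.\<close>

definition J :: "'n torus \<Rightarrow> ennreal" where
 "J x = ennreal (if x \<in> - C then \<bar>det (Df x)\<bar> else 0)"

lemma continuous_det_Df: "continuous_on (- C) (\<lambda>x. \<bar>det (Df x)\<bar>)"
 unfolding det_def by (intro continuous_intros continuous_Df)

lemma measurable_J [measurable]: "J \<in> borel_measurable borel"
 unfolding J_def[abs_def]
 using borel_measurable_off_closed[OF open_noncritical continuous_det_Df, of 0] by measurable

text \<open>Read \<open>f\<close> in the charts at \<open>x\<close> and \<open>f x\<close>: on a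
  ball mapped into \<open>ball (f x) (1/4)\<close> the chart map \<open>G\<close> is injective and
  differentiable, so the Euclidean substitution rule applies to it. The continuous local inverse
  makes images of open and Borel sets open and Borel.\<close>

lemma substitution_local:
 assumes "x \<notin> C"
 obtains r where "r > 0" "ball x r \<subseteq> - C" "inj_on f (ball x r)"
  "\<And>U. open U \<Longrightarrow> U \<subseteq> ball x r \<Longrightarrow> open (f ` U)"
  "\<And>S. S \<in> sets borel \<Longrightarrow> S \<subseteq> ball x r \<Longrightarrow> f ` S \<in> sets borel \<and>
   emeasure leb (f ` S) = (\<integral>\<^sup>+y\<in>S. J y \<partial>leb)"
proof -
 obtain V g where V: "x \<in> V" "V \<subseteq> - C" "open V" "open (f ` V)"
  "continuous_on (f ` V) g" "\<And>y. y \<in> V \<Longrightarrow> g (f y) = y"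
  using local_inverse[OF assms] by metis
 have "open (V \<inter> f -` ball (f x) (1/4))"
  using V(3) continuous_f[of V] by (simp add: continuous_on_open_vimage Int_commute)
 then obtain r0 where r0: "r0 > 0" "ball x r0 \<subseteq> V \<inter> f -` ball (f x) (1/4)"
  using V(1) open_contains_ball by (metis IntI centre_in_ball vimageI2 zero_less_divide_1_iff zero_less_numeral)
 define r where "r = min r0 (1/4)"
 have r: "r > 0" "r \<le> 1/4" "ball x r \<subseteq> V" "f ` ball x r \<subseteq> ball (f x) (1/4)" "r \<le> 1/2"
  using r0 by (auto simp: r_def)
 have inj: "inj_on f V" using V(6) by (metis inj_onI)
 have img: "f ` U = f ` V \<inter> g -` U" if "U \<subseteq> V" for U using that V(6) by force
 have meas: "f ` S \<in> sets borel" if S: "S \<in> sets borel" "S \<subseteq> V" for S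
 proof -
  have m: "(\<lambda>y. if y \<in> f ` V then g y else x) \<in> borel_measurable borel"
   by (rule borel_measurable_off_closed) (use V in auto)
  have "f ` S = f ` V \<inter> ((\<lambda>y. if y \<in> f ` V then g y else x) -` S)" using img[OF S(2)] by auto
  thus ?thesis using measurable_sets[OF m S(1)] V(4) by auto
 qed
 have subst: "emeasure leb (f ` S) = (\<integral>\<^sup>+y\<in>S. J y \<partial>leb)" if S: "S \<in> sets borel" "S \<subseteq> ball x r" for S
 proof -
  note [measurable] = S(1)
  define S' where "S' = (\<lambda>v. x + torus_of v) -` S \<inter> ball 0 r"
  have S' [measurable]: "S' \<in> sets borel" unfolding S'_def using vimage_chart_borel[OF S(1)] by auto
  define G where "G v = centred (f (x + torus_of v) - f x)" for v
  have fS: "f ` S \<in> sets borel" "f ` S \<subseteq> ball (f x) (1/4)" using meas S r by blast+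
  have Gnorm: "norm (G v) < 1/4" "f x + torus_of (G v) = f (x + torus_of v)" if "v \<in> S'" for v
  proof -
   have "x + torus_of v \<in> ball x r" using that S(2) by (auto simp: S'_def)
   hence "f (x + torus_of v) \<in> ball (f x) (1/4)" using r(4) by blast
   thus "norm (G v) < 1/4" unfolding G_def centred by (metis dist_commute dist_torus_diff mem_ball)
  qed (simp add: G_def centred)
  have GS': "G ` S' = (\<lambda>v. f x + torus_of v) -` (f ` S) \<inter> ball 0 (1/4)"
  proof (intro equalityI subsetI)
   fix w assume "w \<in> G ` S'"
   then obtain v where v: "v \<in> S'" "w = G v" by blast
   have "f x + torus_of (G v) \<in> f ` S" unfolding Gnorm(2)[OF v(1)] using v(1) by (simp add: S'_def)
   thus "w \<in> (\<lambda>v. f x + torus_of v) -` (f ` S) \<inter> ball 0 (1/4)"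
    using Gnorm(1)[OF v(1)] v(2) by simp
  next
   fix w :: "real^'n" assume "w \<in> (\<lambda>v. f x + torus_of v) -` (f ` S) \<inter> ball 0 (1/4)"
   then obtain y where w: "f x + torus_of w = f y" "y \<in> S" "w \<in> ball 0 (1/4)" by auto
   then obtain v where v: "v \<in> ball 0 r" "y = x + torus_of v" using S(2) chart_image_ball[of r x] r(5) by blast
   hence vS: "v \<in> S'" using w by (simp add: S'_def)
   have "w = G v"
   proof (rule chart_inj)
    show "f x + torus_of w = f x + torus_of (G v)" using Gnorm(2)[OF vS] w v by simp
    show "norm (w - G v) < 1" using norm_triangle_ineq4[of w "G v"] Gnorm(1)[OF vS] w(3) by simp
   qed
   thus "w \<in> G ` S'" using vS by blast
  qed
  have injG: "inj_on G S'"
  proof (rule inj_onI)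
   fix v w assume vw: "v \<in> S'" "w \<in> S'" "G v = G w"
   hence "f (x + torus_of v) = f (x + torus_of w)" using Gnorm(2) by metis
   hence "x + torus_of v = x + torus_of w" using vw(1,2) inj S(2) r(3) unfolding S'_def inj_on_def by blast
   thus "v = w" using vw(1,2) r(2) norm_triangle_ineq4[of v w] by (intro chart_inj) (auto simp: S'_def)
  qed
  have "emeasure leb (f ` S) = emeasure lborel (G ` S')"
   unfolding GS' by (rule emeasure_torus_chart_ball) (use fS in auto)
  also have "\<dots> = (\<integral>\<^sup>+v. ennreal \<bar>det (Df (x + torus_of v))\<bar> * indicator S' v \<partial>lborel)"
  proof (rule emeasure_injective_image)
   have "emeasure lborel (G ` S') \<le> emeasure lborel (ball (0::real^'n) (1/4))"
    by (intro emeasure_mono) (auto simp: GS')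
   also have "\<dots> < \<infinity>" using emeasure_lborel_ball_finite by (simp add: less_top)
   finally show "emeasure lborel (G ` S') < \<infinity>" .
   show "G ` S' \<in> sets borel" unfolding GS' using vimage_chart_borel[OF fS(1)] by auto
   show "(G has_derivative (*v) (Df (x + torus_of v))) (at v)" if "v \<in> S'" for v unfolding G_def
   proof (rule has_derivative_in_charts[OF has_derivative_f])
    show "dist (f (x + torus_of v)) (f x) < 1/2" using Gnorm[OF that] dist_chart0_le[of "f x" "G v"] by simp
   qed
   have eq: "(\<lambda>v. ennreal \<bar>det (Df (x + torus_of v))\<bar> * indicator S' v) = (\<lambda>v. J (x + torus_of v) * indicator S' v)"
    using S(2) r(3) V(2) by (auto simp: J_def S'_def indicator_def fun_eq_iff)
   show "(\<lambda>v. ennreal \<bar>det (Df (x + torus_of v))\<bar> * indicator S' v) \<in> borel_measurable borel"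
    unfolding eq by measurable
  qed (use injG in auto)
  also have "\<dots> = (\<integral>\<^sup>+v. (\<lambda>y. J y * indicator S y) (x + torus_of v) * indicator (ball 0 r) v \<partial>lborel)"
   by (intro nn_integral_cong) (use S(2) r(3) V(2) in \<open>auto simp: J_def S'_def indicator_def\<close>)
  also have "\<dots> = (\<integral>\<^sup>+y. (\<lambda>y. J y * indicator S y) y * indicator (ball x r) y \<partial>leb)"
   by (rule nn_integral_torus_chart_ball[symmetric]) (use r in auto)
  also have "\<dots> = (\<integral>\<^sup>+y\<in>S. J y \<partial>leb)"
   by (intro nn_integral_cong) (use S(2) in \<open>auto simp: indicator_def\<close>)
  finally show ?thesis .
 qed
 show thesis
 proof (rule that[OF r(1)])
  show "ball x r \<subseteq> - C" using r(3) V(2) by blast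
  show "inj_on f (ball x r)" using inj r(3) by (rule inj_on_subset)
  show "open (f ` U)" if "open U" "U \<subseteq> ball x r" for U
  proof -
   have "open (f ` V \<inter> g -` U)" using V(4,5) that(1) by (simp add: continuous_on_open_vimage Int_commute)
   thus ?thesis using img[of U] that(2) r(3) by simp
  qed
 qed (use subst meas r(3) in blast)
qed

text \<open>\<open>f\<close> is only locally injective. By the Lindelof property countably many of
  the good balls cover the complement of \<open>C\<close>; made disjoint, they cut \<open>S\<close>
  into pieces on which the local rule holds.\<close>

lemma substitution_pieces:
 assumes S: "S \<in> sets borel" "S \<inter> C = {}"
 obtains P :: "nat \<Rightarrow> 'n torus set" where "(\<Union>k. P k) = S" "disjoint_family P" "\<And>k. P k \<in> sets borel" "\<And>k. f ` P k \<in> sets borel"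
  "\<And>k. emeasure leb (f ` P k) = (\<integral>\<^sup>+y\<in>P k. J y \<partial>leb)"
proof -
 define good where "good x r \<longleftrightarrow> r > 0 \<and> (\<forall>S. S \<in> sets borel \<longrightarrow> S \<subseteq> ball x r \<longrightarrow> f ` S \<in> sets borel \<and>
   emeasure leb (f ` S) = (\<integral>\<^sup>+y\<in>S. J y \<partial>leb))" for x r
 have "\<exists>r. good x r" if "x \<notin> C" for x by (rule substitution_local[OF that]) (unfold good_def, blast)
 then obtain r where r: "\<And>x. x \<notin> C \<Longrightarrow> good x (r x)" by metis
 let ?F = "(\<lambda>x. ball x (r x)) ` (- C)"
 obtain F where F: "F \<subseteq> ?F" "countable F" "\<Union>F = \<Union>?F" using Lindelof[of ?F] by auto
 have cover: "- C \<subseteq> \<Union>F" unfolding F(3) using r by (force simp: good_def)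
 define b where "b = from_nat_into (insert {} F)"
 have b: "range b = insert {} F" using F(2) by (simp add: b_def range_from_nat_into)
 define P where "P k = S \<inter> disjointed b k" for k
 have bb: "b k \<in> insert {} F" for k using b by blast
 have "b k \<in> sets borel" for k using bb[of k] F(1) by auto
 hence Pm: "P k \<in> sets borel" for k using sets.range_disjointed_sets[of b borel] S(1) by (auto simp: P_def)
 have PF: "f ` P k \<in> sets borel \<and> emeasure leb (f ` P k) = (\<integral>\<^sup>+y\<in>P k. J y \<partial>leb)" for k
 proof (cases "P k = {}")
  case False
  have "P k \<subseteq> b k" using disjointed_subset[of b k] by (auto simp: P_def)
  then obtain x where "x \<notin> C" "P k \<subseteq> ball x (r x)" using False bb[of k] F(1) by blast
  thus ?thesis using r Pm unfolding good_def by blast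
 qed simp
 show thesis
 proof
  have "(\<Union>k. P k) = S \<inter> \<Union>(insert {} F)" using UN_disjointed_eq[of b] b by (simp add: P_def)
  thus "(\<Union>k. P k) = S" using cover S(2) by auto
  show "disjoint_family P" using disjoint_family_disjointed[of b] by (auto simp: P_def disjoint_family_on_def)
 qed (use Pm PF in auto)
qed

lemma substitution:
 assumes S: "S \<in> sets borel" "S \<inter> C = {}" "inj_on f S"
 shows "f ` S \<in> sets borel"
  and "emeasure leb (f ` S) = (\<integral>\<^sup>+y\<in>S. J y \<partial>leb)"
proof -
 obtain P :: "nat \<Rightarrow> 'n torus set" where P: "(\<Union>k. P k) = S" "disjoint_family P" "\<And>k. P k \<in> sets borel" "\<And>k. f ` P k \<in> sets borel"
  "\<And>k. emeasure leb (f ` P k) = (\<integral>\<^sup>+y\<in>P k. J y \<partial>leb)"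
  by (rule substitution_pieces[OF S(1,2)]) (rule that)
 note [measurable] = P(3)
 have fU: "f ` S = (\<Union>k. f ` P k)" unfolding P(1)[symmetric] by (rule image_UN)
 show "f ` S \<in> sets borel" unfolding fU using P(4) by auto
 have "disjoint_family (\<lambda>k. f ` P k)" unfolding disjoint_family_on_def
 proof (intro ballI impI)
  fix i j :: nat assume "i \<noteq> j"
  hence "P i \<inter> P j = {}" using P(2) by (simp add: disjoint_family_on_def)
  moreover have "P i \<subseteq> S" "P j \<subseteq> S" using P(1) by auto
  ultimately show "f ` P i \<inter> f ` P j = {}" using S(3) by (metis image_empty inj_on_image_Int)
 qed
 hence "emeasure leb (f ` S) = (\<Sum>k. emeasure leb (f ` P k))"
  unfolding fU by (intro suminf_emeasure[symmetric]) (use P(4) in auto)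
 also have "\<dots> = (\<Sum>k. \<integral>\<^sup>+y. J y * indicator (P k) y \<partial>leb)" using P(5) by simp
 also have "\<dots> = (\<integral>\<^sup>+y. (\<Sum>k. J y * indicator (P k) y) \<partial>leb)"
  by (rule nn_integral_suminf[symmetric]) auto
 also have "\<dots> = (\<integral>\<^sup>+y\<in>S. J y \<partial>leb)" using suminf_indicator[OF P(2)] P(1) by simp
 finally show "emeasure leb (f ` S) = (\<integral>\<^sup>+y\<in>S. J y \<partial>leb)" .
qed

text \<open>It suffices to compare two measures on sets: Lebesgue measure on the image, and the
  push-forward under \<open>f\<close> of the measure on \<open>S\<close> with density
  \<open>J\<close>.\<close>

lemma nn_integral_substitution:
 assumes S: "S \<in> sets borel" "S \<inter> C = {}" "inj_on f S" and u [measurable]: "u \<in> borel_measurable borel"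
 shows "(\<integral>\<^sup>+y\<in>f ` S. u y \<partial>leb) = (\<integral>\<^sup>+y\<in>S. u (f y) * J y \<partial>leb)"
proof -
 note [measurable] = S(1) substitution(1)[OF S]
 let ?M = "density leb (indicator (f ` S))"
 let ?N = "distr (density leb (\<lambda>y. J y * indicator S y)) borel f"
 have "?M = ?N"
 proof (rule measure_eqI)
  fix Y assume "Y \<in> sets ?M"
  hence Y [measurable]: "Y \<in> sets borel" by simp
  have fY [measurable]: "f -` Y \<in> sets borel" using measurable_sets[OF measurable_f Y] by simp
  have "emeasure ?M Y = emeasure leb (f ` S \<inter> Y)"
   by (subst emeasure_density) (auto simp: indicator_inter_arith[symmetric])
  also have "f ` S \<inter> Y = f ` (S \<inter> f -` Y)" by auto
  also have "emeasure leb \<dots> = (\<integral>\<^sup>+y\<in>S \<inter> f -` Y. J y \<partial>leb)"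
   by (rule substitution(2)) (use S in \<open>auto intro: inj_on_subset\<close>)
  also have "\<dots> = emeasure ?N Y" by (subst emeasure_distr, simp, simp, subst emeasure_density)
    (auto simp: indicator_inter_arith mult.assoc)
  finally show "emeasure ?M Y = emeasure ?N Y" .
 qed simp
 have "(\<integral>\<^sup>+y\<in>f ` S. u y \<partial>leb) = integral\<^sup>N ?M u"
  by (subst nn_integral_density) (auto simp: mult.commute)
 also have "\<dots> = integral\<^sup>N ?N u" using \<open>?M = ?N\<close> by simp
 also have "\<dots> = (\<integral>\<^sup>+y\<in>S. u (f y) * J y \<partial>leb)"
  by (subst nn_integral_distr, simp, simp, subst nn_integral_density) (auto simp: mult_ac)
 finally show ?thesis .
qed

end

subsection \<open>Regularity of the derivative\<close>

lemma finite_subcover_torus: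
 fixes U :: "'n::finite torus \<Rightarrow> 'n torus set"
 assumes "\<And>x. open (U x)" "\<And>x. x \<in> U x"
 obtains F where "finite F" "(\<Union>x\<in>F. U x) = UNIV"
proof -
 have "UNIV \<subseteq> (\<Union>x\<in>UNIV. U x)" using assms(2) by blast
 from compactE_image[OF compact_torus _ this] assms(1) obtain F where "finite F" "UNIV \<subseteq> (\<Union>x\<in>F. U x)"
  by metis
 thus thesis using that[of F] by blast
qed

text \<open>The local bound compares points only with the centre \<open>t\<close>. Bisection asks
  for it on short intervals around \<open>t\<close>, where the triangle inequality through
  \<open>c t\<close> loses nothing.\<close>

lemma lipschitz_by_local_bound:
 fixes c :: "real \<Rightarrow> 'a::metric_space"
 assumes "a \<le> b" and "L \<ge> 0"
  and loc: "\<And>t. a \<le> t \<Longrightarrow> t \<le> b \<Longrightarrow> \<exists>d>0. \<forall>s. a \<le> s \<longrightarrow> s \<le> b \<longrightarrow> \<bar>s - t\<bar> < d \<longrightarrow> dist (c s) (c t) \<le> L * \<bar>s - t\<bar>"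
 shows "dist (c a) (c b) \<le> L * (b - a)"
proof -
 define P where "P s t \<longleftrightarrow> (a \<le> s \<longrightarrow> t \<le> b \<longrightarrow> dist (c s) (c t) \<le> L * (t - s))" for s t
 have "P a b" using \<open>a \<le> b\<close>
 proof (induction rule: Bolzano)
  case (trans u v w)
  show ?case unfolding P_def
  proof (intro impI)
   assume "a \<le> u" "w \<le> b"
   hence "dist (c u) (c v) \<le> L * (v - u)" "dist (c v) (c w) \<le> L * (w - v)"
    using trans by (auto simp: P_def)
   thus "dist (c u) (c w) \<le> L * (w - u)" using dist_triangle[of "c u" "c w" "c v"] by (simp add: algebra_simps)
  qed
 next
  case (local x)
  then obtain d where d: "d > 0" "\<And>s. a \<le> s \<Longrightarrow> s \<le> b \<Longrightarrow> \<bar>s - x\<bar> < d \<Longrightarrow> dist (c s) (c x) \<le> L * \<bar>s - x\<bar>"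
   using loc[of x] by blast
  have "P u v" if "u \<le> x \<and> x \<le> v \<and> v - u < d" for u v unfolding P_def
  proof (intro impI)
   assume "a \<le> u" "v \<le> b"
   hence "dist (c u) (c x) \<le> L * (x - u)" "dist (c v) (c x) \<le> L * (v - x)"
    using d(2)[of u] d(2)[of v] that local by auto
   thus "dist (c u) (c v) \<le> L * (v - u)"
    using dist_triangle2[of "c u" "c v" "c x"] by (simp add: algebra_simps)
  qed
  thus ?case using d(1) by blast
 qed
 thus ?thesis by (simp add: P_def)
qed

lemma torus_lipschitzI:
 fixes g :: "'n::finite torus \<Rightarrow> 'a::metric_space"
 assumes L: "L \<ge> 0" and loc: "\<And>x. \<forall>\<^sub>F y in nhds x. dist (g y) (g x) \<le> L * dist y x"
 shows "dist (g x) (g y) \<le> L * dist x y"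
proof -
 obtain v where v: "y = x + torus_of v" "norm v = dist y x" using torus_of_near[of y x] by auto
 have dd: "dist (x + torus_of (s *\<^sub>R v)) (x + torus_of (t *\<^sub>R v)) \<le> norm v * \<bar>s - t\<bar>" for s t
  using dist_chart_le[of x "s *\<^sub>R v" "t *\<^sub>R v"]
  by (simp add: dist_norm mult.commute flip: scaleR_left_diff_distrib)
 have "dist (g (x + torus_of (0 *\<^sub>R v))) (g (x + torus_of (1 *\<^sub>R v))) \<le> (L * norm v) * (1 - 0)"
 proof (rule lipschitz_by_local_bound)
  fix t :: real
  obtain d where d: "d > 0" "\<And>y. dist y (x + torus_of (t *\<^sub>R v)) < d \<Longrightarrow>
    dist (g y) (g (x + torus_of (t *\<^sub>R v))) \<le> L * dist y (x + torus_of (t *\<^sub>R v))"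
   using loc[of "x + torus_of (t *\<^sub>R v)"] unfolding eventually_nhds_metric by blast
  have "dist (g (x + torus_of (s *\<^sub>R v))) (g (x + torus_of (t *\<^sub>R v))) \<le> L * norm v * \<bar>s - t\<bar>"
   if "\<bar>s - t\<bar> < d / (norm v + 1)" for s
  proof -
   have "norm v * \<bar>s - t\<bar> \<le> (norm v + 1) * \<bar>s - t\<bar>" by (simp add: mult_right_mono)
   also have "\<dots> < d" using that by (simp add: less_divide_eq mult.commute add_pos_nonneg add_nonneg_pos)
   finally have "dist (x + torus_of (s *\<^sub>R v)) (x + torus_of (t *\<^sub>R v)) < d" using dd[of s t] by linarith
   thus ?thesis
    using d(2)[of "x + torus_of (s *\<^sub>R v)"] mult_left_mono[OF dd[of s t] L] by (simp add: mult.assoc)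
  qed
  moreover have "d / (norm v + 1) > 0" using d(1) by (simp add: add_nonneg_pos)
  ultimately show "\<exists>d>0. \<forall>s. 0 \<le> s \<longrightarrow> s \<le> 1 \<longrightarrow> \<bar>s - t\<bar> < d \<longrightarrow>
   dist (g (x + torus_of (s *\<^sub>R v))) (g (x + torus_of (t *\<^sub>R v))) \<le> L * norm v * \<bar>s - t\<bar>" by blast
 qed (use L in auto)
 thus ?thesis using v by (simp add: torus_of_0 dist_commute)
qed

lemma norm_matrix_vector_le: "norm (A *v v) \<le> norm A * norm (v :: real^'n::finite)"
proof -
 have "norm (A *v v) \<le> L2_set (\<lambda>i. norm (A $ i) * norm v) UNIV" unfolding norm_vec_def[of "A *v v"]
  by (rule L2_set_mono) (simp_all add: matrix_vector_mul_component Cauchy_Schwarz_ineq2)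
 also have "\<dots> = norm A * norm v" by (simp add: L2_set_left_distrib norm_vec_def[of A])
 finally show ?thesis .
qed

lemma onorm_matrix_inv_pos:
 assumes "det (A :: real^'n::finite^'n) \<noteq> 0"
 shows "onorm (\<lambda>v. matrix_inv A *v v) > 0"
proof -
 define i :: 'n where "i = undefined"
 have "1 \<le> onorm (\<lambda>v. matrix_inv A *v v) * norm (A *v axis i 1)"
  using norm_le_onorm_inv[OF assms, of "axis i 1"] by simp
 thus ?thesis using mult_nonpos_nonneg[of "onorm (\<lambda>v. matrix_inv A *v v)" "norm (A *v axis i 1)"]
  by (meson norm_ge_zero not_le not_one_le_zero order_trans)
qed

lemma matrix_inv_right:
 assumes "det (A :: real^'n::finite^'n) \<noteq> 0" shows "A ** matrix_inv A = mat 1"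
 using assms invertible_det_nz[of A] matrix_inv_def[of A]
 unfolding invertible_def by (metis (mono_tags, lifting) someI_ex)

text \<open>The reciprocal of the norm of the inverse is the least stretching factor of the matrix
  over unit vectors, and this changes by at most the norm of \<open>A - A'\<close>.\<close>

lemma expansion_lipschitz:
 fixes A A' :: "real^'n::finite^'n"
 assumes A: "det A \<noteq> 0" and A': "det A' \<noteq> 0"
 shows "\<bar>1 / onorm (\<lambda>v. matrix_inv A *v v) - 1 / onorm (\<lambda>v. matrix_inv A' *v v)\<bar> \<le> norm (A - A')"
proof -
 have *: "1 / onorm (\<lambda>v. matrix_inv A' *v v) - norm (A - A') \<le> 1 / onorm (\<lambda>v. matrix_inv A *v v)"
  if A: "det A \<noteq> 0" and A': "det A' \<noteq> 0" for A A' :: "real^'n^'n"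
 proof (cases "1 / onorm (\<lambda>v. matrix_inv A' *v v) - norm (A - A') > 0")
  case True
  define c where "c = 1 / onorm (\<lambda>v. matrix_inv A' *v v) - norm (A - A')"
  have "norm (matrix_inv A *v w) \<le> 1 / c * norm w" for w
  proof -
   define v where "v = matrix_inv A *v w"
   have "w = A *v v" by (simp add: v_def matrix_vector_mul_assoc matrix_inv_right[OF A])
   have "norm v / onorm (\<lambda>v. matrix_inv A' *v v) \<le> norm (A' *v v)"
    using norm_le_onorm_inv[OF A', of v] onorm_matrix_inv_pos[OF A'] by (simp add: divide_le_eq mult.commute)
   also have "\<dots> \<le> norm (A *v v) + norm ((A - A') *v v)"
    using norm_triangle_ineq4[of "A *v v" "(A - A') *v v"] by (simp add: matrix_vector_mult_diff_rdistrib)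
   also have "\<dots> \<le> norm w + norm (A - A') * norm v"
    using norm_matrix_vector_le[of "A - A'" v] \<open>w = A *v v\<close> by simp
   finally have "c * norm v \<le> norm w" by (simp add: c_def algebra_simps)
   thus ?thesis using True by (simp add: v_def c_def field_simps)
  qed
  hence "onorm (\<lambda>v. matrix_inv A *v v) \<le> 1 / c"
   by (intro onorm_bound) (use True in \<open>auto simp: c_def\<close>)
  thus ?thesis using onorm_matrix_inv_pos[OF A] True unfolding c_def[symmetric] by (simp add: field_simps)
 next
  case False
  thus ?thesis using onorm_matrix_inv_pos[OF A] by (meson less_le_not_le not_less order_trans zero_less_divide_1_iff)
 qed
 show ?thesis using *[OF A A'] *[OF A' A] by (auto simp: norm_minus_commute abs_le_iff)
qed

text \<open>A class closed under sums and products, so that the determinant, a polynomial in the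
  entries, inherits the Lipschitz property from the matrix.\<close>

definition bdd_lipschitz :: "('a::metric_space \<Rightarrow> real) \<Rightarrow> bool" where
 "bdd_lipschitz g \<longleftrightarrow> (\<exists>L M. L \<ge> 0 \<and> M \<ge> 0 \<and> (\<forall>x. \<bar>g x\<bar> \<le> M) \<and> (\<forall>x y. \<bar>g x - g y\<bar> \<le> L * dist x y))"

lemma bdd_lipschitz_const: "bdd_lipschitz (\<lambda>_. c)"
 unfolding bdd_lipschitz_def by (intro exI[of _ 0] exI[of _ "\<bar>c\<bar>"]) auto

lemma bdd_lipschitz_add:
 assumes "bdd_lipschitz g" "bdd_lipschitz h" shows "bdd_lipschitz (\<lambda>x. g x + h x)"
proof -
 obtain L M L' M' where g: "L \<ge> 0" "M \<ge> 0" "\<And>x. \<bar>g x\<bar> \<le> M" "\<And>x y. \<bar>g x - g y\<bar> \<le> L * dist x y"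
  and h: "L' \<ge> 0" "M' \<ge> 0" "\<And>x. \<bar>h x\<bar> \<le> M'" "\<And>x y. \<bar>h x - h y\<bar> \<le> L' * dist x y"
  using assms unfolding bdd_lipschitz_def by metis
 have "\<bar>g x + h x\<bar> \<le> M + M'" for x using g(3)[of x] h(3)[of x] by linarith
 moreover have "\<bar>(g x + h x) - (g y + h y)\<bar> \<le> (L + L') * dist x y" for x y
  using g(4)[of x y] h(4)[of x y] by (simp add: distrib_right)
 ultimately show ?thesis unfolding bdd_lipschitz_def
  using g(1,2) h(1,2) by (intro exI[of _ "L + L'"] exI[of _ "M + M'"]) auto
qed

lemma bdd_lipschitz_mult:
 assumes "bdd_lipschitz g" "bdd_lipschitz h" shows "bdd_lipschitz (\<lambda>x. g x * h x)"
proof -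
 obtain L M L' M' where g: "L \<ge> 0" "M \<ge> 0" "\<And>x. \<bar>g x\<bar> \<le> M" "\<And>x y. \<bar>g x - g y\<bar> \<le> L * dist x y"
  and h: "L' \<ge> 0" "M' \<ge> 0" "\<And>x. \<bar>h x\<bar> \<le> M'" "\<And>x y. \<bar>h x - h y\<bar> \<le> L' * dist x y"
  using assms unfolding bdd_lipschitz_def by metis
 have "\<bar>g x * h x\<bar> \<le> M * M'" for x unfolding abs_mult using g(2,3) h(3) by (intro mult_mono) auto
 moreover have "\<bar>g x * h x - g y * h y\<bar> \<le> (L * M' + M * L') * dist x y" for x y
 proof -
  have "g x * h x - g y * h y = (g x - g y) * h x + g y * (h x - h y)" by (simp add: algebra_simps)
  hence "\<bar>g x * h x - g y * h y\<bar> \<le> \<bar>g x - g y\<bar> * \<bar>h x\<bar> + \<bar>g y\<bar> * \<bar>h x - h y\<bar>"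
   by (metis abs_mult abs_triangle_ineq)
  also have "\<dots> \<le> (L * dist x y) * M' + M * (L' * dist x y)" using g h by (intro add_mono mult_mono) auto
  finally show ?thesis by (simp add: algebra_simps)
 qed
 ultimately show ?thesis unfolding bdd_lipschitz_def
  using g(1,2) h(1,2) by (intro exI[of _ "L * M' + M * L'"] exI[of _ "M * M'"]) auto
qed

lemma bdd_lipschitz_sum: "(\<And>i. i \<in> I \<Longrightarrow> bdd_lipschitz (g i)) \<Longrightarrow> bdd_lipschitz (\<lambda>x. \<Sum>i\<in>I. g i x)"
 by (induction I rule: infinite_finite_induct) (auto intro: bdd_lipschitz_const bdd_lipschitz_add)

lemma bdd_lipschitz_prod: "(\<And>i. i \<in> I \<Longrightarrow> bdd_lipschitz (g i)) \<Longrightarrow> bdd_lipschitz (\<lambda>x. \<Prod>i\<in>I. g i x)"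
 by (induction I rule: infinite_finite_induct) (auto intro: bdd_lipschitz_const bdd_lipschitz_mult)

lemma abs_ln_diff_le:
 assumes "0 < m" "m \<le> a" "m \<le> b" shows "\<bar>ln a - ln b\<bar> \<le> \<bar>a - b\<bar> / (m::real)"
proof -
 have *: "ln a - ln b \<le> \<bar>a - b\<bar> / m" if "m \<le> a" "m \<le> b" for a b
 proof -
  have "ln a - ln b \<le> (a - b) / b" using that assms(1) by (intro ln_diff_le) auto
  also have "\<dots> \<le> \<bar>a - b\<bar> / b" using that assms(1) by (intro divide_right_mono) auto
  also have "\<dots> \<le> \<bar>a - b\<bar> / m" using that assms(1) by (intro divide_left_mono) auto
  finally show ?thesis .
 qed
 show ?thesis using *[OF assms(2,3)] *[OF assms(3,2)] by (simp add: abs_minus_commute abs_le_iff)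
qed

lemma det_matrix_inv:
 assumes "det (A :: real^'n::finite^'n) \<noteq> 0"
 shows "ln \<bar>det (matrix_inv A)\<bar> = - ln \<bar>det A\<bar>"
proof -
 have "det A * det (matrix_inv A) = 1" using matrix_inv_right[OF assms] by (metis det_I det_mul)
 hence "\<bar>det (matrix_inv A)\<bar> = inverse \<bar>det A\<bar>" using assms by (metis abs_inverse inverse_unique)
 thus ?thesis using assms by (simp add: ln_inverse)
qed

context torus_map begin

text \<open>Without critical points the value \<open>1\<close> stands for a distance that is never
  small; \<open>infdist\<close> to the empty set would be \<open>0\<close>.\<close>

definition crit_dist :: "'n torus \<Rightarrow> real" where
 "crit_dist x = (if C = {} then 1 else infdist x C)"

lemma crit_dist_pos: "x \<notin> C \<Longrightarrow> crit_dist x > 0"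
 using open_noncritical in_closed_iff_infdist_zero[of C x] infdist_nonneg[of x C]
 by (auto simp: crit_dist_def closed_def less_le)

lemma crit_dist_near:
 assumes "x \<notin> C" "dist x y < crit_dist x" shows "y \<notin> C"
 using assms infdist_le[of y C x] by (auto simp: crit_dist_def split: if_splits)

abbreviation "lnorm x \<equiv> ln (inv_norm f x)"
abbreviation "ldet x \<equiv> ln \<bar>det (Df x)\<bar>"

lemma inv_norm_pos: "x \<notin> C \<Longrightarrow> inv_norm f x > 0"
 unfolding inv_norm_def by (intro onorm_matrix_inv_pos det_nonzero)

lemma expansion_Df:
 "x \<notin> C \<Longrightarrow> y \<notin> C \<Longrightarrow> \<bar>1 / inv_norm f x - 1 / inv_norm f y\<bar> \<le> norm (Df x - Df y)"
 unfolding inv_norm_def by (intro expansion_lipschitz det_nonzero)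

lemma continuous_inv_norm: "continuous_on (- C) (inv_norm f)"
proof -
 have "continuous_on (- C) (\<lambda>x. 1 / inv_norm f x)" unfolding continuous_on_iff
 proof (intro ballI allI impI)
  fix x e assume x: "x \<in> - C" and "e > (0::real)"
  then obtain d where d: "d > 0" "\<And>y. y \<in> - C \<Longrightarrow> dist y x < d \<Longrightarrow> dist (Df y) (Df x) < e"
   using continuous_Df unfolding continuous_on_iff by metis
  have "dist (1 / inv_norm f y) (1 / inv_norm f x) < e" if "y \<in> - C" "dist y x < d" for y
   using d(2)[OF that] expansion_Df[of y x] that(1) x by (simp add: dist_norm)
  thus "\<exists>d>0. \<forall>y\<in>- C. dist y x < d \<longrightarrow> dist (1 / inv_norm f y) (1 / inv_norm f x) < e"
   using d(1) by blast
 qed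
 hence "continuous_on (- C) (\<lambda>x. 1 / (1 / inv_norm f x))"
 proof (rule continuous_on_divide[OF continuous_on_const])
  show "\<forall>x\<in>- C. 1 / inv_norm f x \<noteq> 0" using inv_norm_pos by fastforce
 qed
 thus ?thesis by simp
qed

text \<open>The continuous second derivative is bounded near each point, finitely many such
  neighbourhoods cover the torus, and \<open>torus_lipschitzI\<close> integrates the pointwise bound
  along segments.\<close>

lemma Df_lipschitz_if_no_critical:
 assumes "C = {}"
 obtains L where "L \<ge> 0" "\<And>x y. norm (Df x - Df y) \<le> L * dist x y"
proof -
 define good where "good x r L \<longleftrightarrow> r > 0 \<and> L \<ge> 0 \<and>
  (\<forall>y. dist x y < r \<longrightarrow> (\<forall>\<^sub>F w in nhds y. dist (Df w) (Df y) \<le> L * dist w y))" for x r L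
 have "\<exists>r L. good x r L" for x
 proof -
  have "x \<notin> C" using assms by simp
  then obtain V where V: "x \<in> V" "open V" "C2_torus_map_on V f" by (metis local_inverse)
  then obtain D :: "'n torus \<Rightarrow> (real ^ 'n) \<Rightarrow>\<^sub>L (real ^ 'n ^ 'n)" where D:
   "\<And>y. y \<in> V \<Longrightarrow> ((\<lambda>v. Df (y + torus_of v)) has_derivative blinfun_apply (D y)) (at 0)" "continuous_on V D"
   unfolding C2_torus_map_on_def by blast
  have "continuous_on V (\<lambda>y. norm (D y))" using D(2) by (intro continuous_intros)
  hence "\<forall>e>0. \<exists>d>0. \<forall>y\<in>V. dist y x < d \<longrightarrow> dist (norm (D y)) (norm (D x)) < e"
   using V(1) unfolding continuous_on_iff by blast
  then obtain d where d: "d > 0" "\<And>y. y \<in> V \<Longrightarrow> dist y x < d \<Longrightarrow> dist (norm (D y)) (norm (D x)) < 1"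
   using zero_less_one by blast
  obtain r0 where r0: "r0 > 0" "ball x r0 \<subseteq> V" using V(1,2) open_contains_ball by blast
  define r where "r = min d r0"
  have "\<forall>\<^sub>F w in nhds y. dist (Df w) (Df y) \<le> (norm (D x) + 2) * dist w y" if y: "dist x y < r" for y
  proof -
   have yV: "y \<in> V" using y r0(2) by (auto simp: r_def)
   have nD: "norm (D y) < norm (D x) + 1" using d(2)[OF yV] y by (auto simp: r_def dist_commute dist_real_def)
   obtain e where e: "e > 0" "\<And>v. norm v < e \<Longrightarrow>
     norm (Df (y + torus_of v) - Df (y + torus_of 0) - D y v) \<le> 1 * norm v"
    using D(1)[OF yV] unfolding has_derivative_at_alt by (metis diff_zero zero_less_one)
   have "dist (Df w) (Df y) \<le> (norm (D x) + 2) * dist w y" if w: "dist w y < e" for w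
   proof -
    obtain v where v: "w = y + torus_of v" "norm v = dist w y" using torus_of_near[of w y] by auto
    have "norm (Df w - Df y) \<le> norm (Df w - Df y - D y v) + norm (D y v)"
     by (metis diff_add_cancel norm_triangle_ineq)
    also have "\<dots> \<le> norm v + norm (D y) * norm v"
     using e(2)[of v] v w norm_blinfun[of "D y" v] by (simp add: torus_of_0)
    also have "\<dots> \<le> norm v + (norm (D x) + 1) * norm v"
     using nD by (intro add_left_mono mult_right_mono) auto
    finally show ?thesis by (simp add: v(2) dist_norm algebra_simps)
   qed
   thus ?thesis unfolding eventually_nhds_metric using e(1) by blast
  qed
  thus ?thesis using d(1) r0(1) unfolding good_def
   by (intro exI[of _ r] exI[of _ "norm (D x) + 2"]) (auto simp: r_def)
 qed
 then obtain r L where rL: "\<And>x. good x (r x) (L x)" by metis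
 have "x \<in> ball x (r x)" for x using rL[of x] unfolding good_def by simp
 then obtain F where F: "finite F" "(\<Union>x\<in>F. ball x (r x)) = UNIV"
  using finite_subcover_torus[of "\<lambda>x. ball x (r x)"] by auto
 define L0 where "L0 = (\<Sum>x\<in>F. L x)"
 have L0: "L0 \<ge> 0" unfolding L0_def by (intro sum_nonneg) (use rL good_def in auto)
 have "dist (Df x) (Df y) \<le> L0 * dist x y" for x y
 proof (rule torus_lipschitzI[OF L0])
  fix y
  obtain x where x: "x \<in> F" "dist x y < r x" using F(2) UNIV_I[of y] by (metis UN_E mem_ball)
  have "L x \<le> L0" unfolding L0_def by (rule member_le_sum) (use x F rL good_def in auto)
  moreover have "\<forall>\<^sub>F w in nhds y. dist (Df w) (Df y) \<le> L x * dist w y"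
   using rL[of x] x(2) by (simp add: good_def)
  ultimately show "\<forall>\<^sub>F w in nhds y. dist (Df w) (Df y) \<le> L0 * dist w y"
   by (elim eventually_mono) (meson mult_right_mono order_trans zero_le_dist)
 qed
 thus thesis using that L0 by (simp add: dist_norm)
qed

text \<open>The inequalities (S1) to (S3) are vacuous without critical points; their analogues come
  from compactness of the torus and the \<open>C2\<close> regularity.\<close>

lemma regular_if_no_critical:
 assumes "C = {}"
 obtains K where "K > 0" "\<And>x. - lnorm x \<le> K"
  "\<And>x y. \<bar>lnorm x - lnorm y\<bar> \<le> K * dist x y"
  "\<And>x y. \<bar>ldet x - ldet y\<bar> \<le> K * dist x y"
proof -
 have nc: "x \<notin> C" for x using assms by simp
 have cU: "- C = UNIV" using assms by simp
 obtain L where L: "L \<ge> 0" "\<And>x y. norm (Df x - Df y) \<le> L * dist x y"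
  using Df_lipschitz_if_no_critical[OF assms] by blast
 have inf: "\<exists>m>0. \<forall>x. m \<le> g x" if "continuous_on UNIV g" "\<And>x. g x > 0" for g :: "'n torus \<Rightarrow> real"
  using continuous_attains_inf[OF compact_torus _ that(1)] that(2) by auto
 have sup: "\<exists>m\<ge>0. \<forall>x. \<bar>g x\<bar> \<le> m" if "continuous_on UNIV g" for g :: "'n torus \<Rightarrow> real"
 proof -
  have "continuous_on UNIV (\<lambda>x. \<bar>g x\<bar>)" using that by (intro continuous_intros)
  from continuous_attains_sup[OF compact_torus _ this] show ?thesis by auto (metis abs_ge_zero)
 qed
 have q: "continuous_on UNIV (\<lambda>x. 1 / inv_norm f x)"
  using continuous_inv_norm inv_norm_pos[OF nc] unfolding cU
  by (intro continuous_intros) (auto simp: less_imp_neq[symmetric])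
 obtain q0 where q0: "q0 > 0" "\<And>x. q0 \<le> 1 / inv_norm f x" using inf[OF q] inv_norm_pos[OF nc] by auto
 obtain q1 where q1: "\<And>x. \<bar>1 / inv_norm f x\<bar> \<le> q1" using sup[OF q] by blast
 have lnq: "ln (1 / inv_norm f x) = - lnorm x" for x using inv_norm_pos[OF nc] by (simp add: ln_div)
 have a: "- lnorm x \<le> ln q1" for x using q1[of x] inv_norm_pos[OF nc, of x] unfolding lnq[symmetric]
  by (intro ln_mono) auto
 have b: "\<bar>lnorm x - lnorm y\<bar> \<le> (L / q0) * dist x y" for x y
 proof -
  have "\<bar>ln (1 / inv_norm f x) - ln (1 / inv_norm f y)\<bar> \<le> \<bar>1 / inv_norm f x - 1 / inv_norm f y\<bar> / q0"
   by (rule abs_ln_diff_le) (use q0 in auto)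
  also have "\<dots> \<le> L * dist x y / q0"
   using expansion_Df[OF nc nc, of x y] L(2)[of x y] q0(1) by (intro divide_right_mono) auto
  finally show ?thesis unfolding lnq by simp
 qed
 have "bdd_lipschitz (\<lambda>x. det (Df x))" unfolding det_def
 proof (intro bdd_lipschitz_sum bdd_lipschitz_mult bdd_lipschitz_const bdd_lipschitz_prod)
  fix p :: "'n \<Rightarrow> 'n" and i :: 'n
  have "continuous_on UNIV (\<lambda>x. Df x $ i $ p i)"
   using continuous_Df unfolding cU by (intro continuous_intros)
  then obtain M where M: "M \<ge> 0" "\<And>x. \<bar>Df x $ i $ p i\<bar> \<le> M" using sup by blast
  have "\<bar>Df x $ i $ p i - Df y $ i $ p i\<bar> \<le> L * dist x y" for x y
   using component_le_norm_cart[of "(Df x - Df y) $ i" "p i"] Finite_Cartesian_Product.norm_nth_le[of "Df x - Df y" i] L(2)[of x y]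
   by simp
  thus "bdd_lipschitz (\<lambda>x. Df x $ i $ p i)" unfolding bdd_lipschitz_def using L(1) M by blast
 qed
 then obtain L' where L': "L' \<ge> 0" "\<And>x y. \<bar>det (Df x) - det (Df y)\<bar> \<le> L' * dist x y"
  unfolding bdd_lipschitz_def by blast
 obtain d0 where d0: "d0 > 0" "\<And>x. d0 \<le> \<bar>det (Df x)\<bar>"
  using inf[OF continuous_det_Df[unfolded cU]] det_nonzero[OF nc] by auto
 have c: "\<bar>ldet x - ldet y\<bar> \<le> (L' / d0) * dist x y" for x y
 proof -
  have "\<bar>ldet x - ldet y\<bar> \<le> \<bar>\<bar>det (Df x)\<bar> - \<bar>det (Df y)\<bar>\<bar> / d0"
   by (rule abs_ln_diff_le) (use d0 in auto)
  also have "\<dots> \<le> L' * dist x y / d0" using L'(2)[of x y] d0(1) by (intro divide_right_mono) auto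
  finally show ?thesis by simp
 qed
 define K where "K = max 1 (max (ln q1) (max (L / q0) (L' / d0)))"
 have K: "K > 0" "ln q1 \<le> K" "L / q0 \<le> K" "L' / d0 \<le> K" by (auto simp: K_def)
 show thesis
 proof (rule that[of K])
  fix x y
  show "- lnorm x \<le> K" using a[of x] K(2) by linarith
  show "\<bar>lnorm x - lnorm y\<bar> \<le> K * dist x y"
   using b[of x y] mult_right_mono[OF K(3), of "dist x y"] by simp
  show "\<bar>ldet x - ldet y\<bar> \<le> K * dist x y"
   using c[of x y] mult_right_mono[OF K(4), of "dist x y"] by simp
 qed (rule K(1))
qed

text \<open>The third claim is a lower bound on the norm of the inverse: it is at least the
  reciprocal of the stretching of any single vector, and (S1) bounds that stretching from
  above.\<close>

lemma regular_if_critical: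
 assumes ne: "C \<noteq> {}"
 shows "B > 1" "\<beta> > 0" "\<And>x. x \<notin> C \<Longrightarrow> - lnorm x \<le> B - \<beta> * ln (crit_dist x)"
  "\<And>x y. x \<notin> C \<Longrightarrow> dist x y < crit_dist x / 2 \<Longrightarrow>
   \<bar>lnorm x - lnorm y\<bar> \<le> B * (dist x y / crit_dist x powr \<beta>)"
  "\<And>x y. x \<notin> C \<Longrightarrow> dist x y < crit_dist x / 2 \<Longrightarrow>
   \<bar>ldet x - ldet y\<bar> \<le> B * (dist x y / crit_dist x powr \<beta>)"
proof -
 have H: "B > 1" "\<beta> > 0" "\<And>x y. x \<notin> C \<Longrightarrow> y \<notin> C \<Longrightarrow> dist x y < infdist x C / 2 \<Longrightarrow>
    (\<forall>v. v \<noteq> 0 \<longrightarrow>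
     1 / B * infdist x C powr \<beta> \<le> norm (Df x *v v) / norm v \<and>
     norm (Df x *v v) / norm v \<le> B * infdist x C powr (-\<beta>)) \<and>
    \<bar>lnorm x - lnorm y\<bar> \<le> B * (dist x y / infdist x C powr \<beta>) \<and>
    \<bar>ln \<bar>det (matrix_inv (Df x))\<bar> - ln \<bar>det (matrix_inv (Df y))\<bar>\<bar> \<le> B * (dist x y / infdist x C powr \<beta>)"
  using local_diffeo unfolding C2_local_diffeo_away_from_critical_def by auto
 have cd: "crit_dist x = infdist x C" for x using ne by (simp add: crit_dist_def)
 have ny: "y \<notin> C" if "x \<notin> C" "dist x y < crit_dist x / 2" for x y
  using crit_dist_near[of x y] that crit_dist_pos[of x] by simp
 show "B > 1" "\<beta> > 0" by (rule H)+
 {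
  fix x assume x: "x \<notin> C"
  have d: "crit_dist x > 0" using crit_dist_pos[OF x] .
  define i :: 'n where "i = undefined"
  have "infdist x C > 0" "axis i (1::real) \<noteq> 0" using d by (auto simp: cd axis_eq_0_iff)
  hence "norm (Df x *v axis i 1) / norm (axis i (1::real)) \<le> B * crit_dist x powr (-\<beta>)"
   using H(3)[OF x x] unfolding cd by (metis dist_self half_gt_zero)
  hence le: "norm (Df x *v axis i 1) \<le> B * crit_dist x powr (-\<beta>)" by simp
  have "1 \<le> inv_norm f x * norm (Df x *v axis i 1)"
   using norm_le_onorm_inv[OF det_nonzero[OF x], of "axis i 1"] by (simp add: inv_norm_def)
  also have "\<dots> \<le> inv_norm f x * (B * crit_dist x powr (-\<beta>))"
   using le inv_norm_pos[OF x] by (intro mult_left_mono) auto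
  finally have "ln 1 \<le> ln (inv_norm f x * (B * crit_dist x powr (-\<beta>)))" by (intro ln_mono) auto
  also have "\<dots> = lnorm x + (ln B - \<beta> * ln (crit_dist x))"
   using inv_norm_pos[OF x] H(1) d by (simp add: ln_mult ln_powr)
  finally have "- lnorm x \<le> ln B - \<beta> * ln (crit_dist x)" by simp
  also have "ln B \<le> B" using H(1) by (meson ln_bound less_trans zero_less_one)
  finally show "- lnorm x \<le> B - \<beta> * ln (crit_dist x)" by simp
 }
 {
  fix x y assume xy: "x \<notin> C" "dist x y < crit_dist x / 2"
  note y = ny[OF xy]
  show "\<bar>lnorm x - lnorm y\<bar> \<le> B * (dist x y / crit_dist x powr \<beta>)"
   using H(3)[OF xy(1) y] xy(2) by (simp add: cd)
  show "\<bar>ldet x - ldet y\<bar> \<le> B * (dist x y / crit_dist x powr \<beta>)"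
   using H(3)[OF xy(1) y] xy(2) det_matrix_inv[OF det_nonzero[OF xy(1)]] det_matrix_inv[OF det_nonzero[OF y]]
   by (simp add: cd abs_minus_commute)
 }
qed

end

subsection \<open>Continuation of inverse branches\<close>

text \<open>The equation is solved in the ball around \<open>h v\<close>. For continuity at
  \<open>v0\<close>, openness of \<open>G\<close> yields a solution close to \<open>g v0\<close>,
  and injectivity on the ball around \<open>h v\<close> identifies it with
  \<open>g v\<close>.\<close>

lemma continuous_local_solution:
 fixes G :: "'a::metric_space \<Rightarrow> 'b::metric_space" and h :: "'c::metric_space \<Rightarrow> 'a"
 assumes inj: "\<And>z. z \<in> T \<Longrightarrow> inj_on G (ball z \<epsilon>1)"
  and opn: "\<And>z U. z \<in> T \<Longrightarrow> open U \<Longrightarrow> U \<subseteq> ball z \<epsilon>1 \<Longrightarrow> open (G ` U)"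
  and sur: "\<And>z. z \<in> T \<Longrightarrow> ball (G z) \<epsilon>0 \<subseteq> G ` ball z \<epsilon>1"
  and h: "continuous_on S h" "h ` S \<subseteq> T" and e: "continuous_on S e"
  and close: "\<And>v. v \<in> S \<Longrightarrow> dist (G (h v)) (e v) < \<epsilon>0"
 obtains g where "continuous_on S g" "\<And>v. v \<in> S \<Longrightarrow> G (g v) = e v" "\<And>v. v \<in> S \<Longrightarrow> dist (h v) (g v) < \<epsilon>1"
proof -
 have "\<exists>z. dist (h v) z < \<epsilon>1 \<and> G z = e v" if "v \<in> S" for v
 proof -
  have "h v \<in> T" using that h(2) by auto
  hence "e v \<in> G ` ball (h v) \<epsilon>1" using sur close[OF that] by (meson mem_ball subsetD)
  thus ?thesis by (metis imageE mem_ball)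
 qed
 then obtain g where g: "\<And>v. v \<in> S \<Longrightarrow> dist (h v) (g v) < \<epsilon>1" "\<And>v. v \<in> S \<Longrightarrow> G (g v) = e v"
  by metis
 have "continuous_on S g" unfolding continuous_on_iff
 proof (intro ballI allI impI)
  fix v0 \<kappa> assume v0: "v0 \<in> S" and "\<kappa> > (0::real)"
  have T0: "h v0 \<in> T" using v0 h(2) by auto
  define \<gamma> where "\<gamma> = \<epsilon>1 - dist (h v0) (g v0)"
  have \<gamma>: "\<gamma> > 0" using g(1)[OF v0] by (simp add: \<gamma>_def)
  define k where "k = min \<kappa> (\<gamma> / 2)"
  have k: "k > 0" "k \<le> \<kappa>" "k \<le> \<gamma> / 2" using \<gamma> \<open>\<kappa> > 0\<close> by (auto simp: k_def)
  have "ball (g v0) k \<subseteq> ball (h v0) \<epsilon>1"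
  proof
   fix z assume "z \<in> ball (g v0) k"
   thus "z \<in> ball (h v0) \<epsilon>1"
    using dist_triangle[of "h v0" z "g v0"] k(3) \<gamma> by (simp add: \<gamma>_def)
  qed
  hence "open (G ` ball (g v0) k)" using opn[OF T0] by blast
  moreover have "e v0 \<in> G ` ball (g v0) k" using g(2)[OF v0] k(1) by (metis centre_in_ball image_eqI)
  ultimately obtain s where s: "s > 0" "ball (e v0) s \<subseteq> G ` ball (g v0) k"
   using open_contains_ball by blast
  obtain d1 where d1: "d1 > 0" "\<And>v. v \<in> S \<Longrightarrow> dist v v0 < d1 \<Longrightarrow> dist (e v) (e v0) < s"
   using e v0 s(1) unfolding continuous_on_iff by metis
  obtain d2 where d2: "d2 > 0" "\<And>v. v \<in> S \<Longrightarrow> dist v v0 < d2 \<Longrightarrow> dist (h v) (h v0) < \<gamma> / 2"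
   using h(1) v0 \<gamma> unfolding continuous_on_iff by (metis half_gt_zero)
  have "dist (g v) (g v0) < \<kappa>" if v: "v \<in> S" "dist v v0 < min d1 d2" for v
  proof -
   have "e v \<in> ball (e v0) s" using d1(2)[of v] v by (simp add: dist_commute)
   then obtain z where z: "dist (g v0) z < k" "G z = e v" using s(2) by (metis imageE mem_ball subsetD)
   have "dist (h v) z \<le> dist (h v) (h v0) + dist (h v0) (g v0) + dist (g v0) z"
    by (meson add_right_mono dist_triangle dist_triangle_le order_trans)
   also have "\<dots> < \<gamma> / 2 + dist (h v0) (g v0) + \<gamma> / 2" using d2(2)[of v] v z(1) k(3) by simp
   finally have "dist (h v) z < \<epsilon>1" by (simp add: \<gamma>_def)
   moreover have "h v \<in> T" using v h(2) by auto
   ultimately have "z = g v" using inj[of "h v"] g[OF v(1)] z(2) unfolding inj_on_def by (metis mem_ball)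
   thus ?thesis using z(1) k(2) by (simp add: dist_commute)
  qed
  thus "\<exists>d>0. \<forall>v\<in>S. dist v v0 < d \<longrightarrow> dist (g v) (g v0) < \<kappa>"
   using d1(1) d2(1) by (intro exI[of _ "min d1 d2"]) auto
 qed
 thus thesis using that g by blast
qed

text \<open>Uniqueness of lifts: the set of agreement is closed, and it is open by local
  injectivity.\<close>

lemma sections_agree:
 fixes G :: "'a::metric_space \<Rightarrow> 'b" and g g' :: "'c::metric_space \<Rightarrow> 'a"
 assumes S: "connected S" and g: "continuous_on S g" and g': "continuous_on S g'"
  and eq: "\<And>v. v \<in> S \<Longrightarrow> G (g v) = G (g' v)"
  and inj: "\<And>v. v \<in> S \<Longrightarrow> \<exists>\<epsilon>>0. inj_on G (ball (g v) \<epsilon>)"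
  and v0: "v0 \<in> S" "g v0 = g' v0" and v: "v \<in> S"
 shows "g v = g' v"
proof -
 let ?E = "{v \<in> S. g v = g' v}"
 have "closedin (top_of_set S) ?E"
 proof -
  have "?E = S \<inter> (\<lambda>v. dist (g v) (g' v)) -` {0}" by auto
  moreover have "continuous_on S (\<lambda>v. dist (g v) (g' v))" using g g' by (intro continuous_intros)
  ultimately show ?thesis by (metis closed_singleton continuous_closedin_preimage)
 qed
 moreover have "openin (top_of_set S) ?E" unfolding openin_contains_ball
 proof (intro conjI ballI)
  fix w assume w: "w \<in> ?E"
  then obtain \<epsilon> where \<epsilon>: "\<epsilon> > 0" "inj_on G (ball (g w) \<epsilon>)" using inj by blast
  obtain d1 where d1: "d1 > 0" "\<And>v. v \<in> S \<Longrightarrow> dist v w < d1 \<Longrightarrow> dist (g v) (g w) < \<epsilon>"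
   using g w \<epsilon>(1) unfolding continuous_on_iff by (metis (mono_tags, lifting) mem_Collect_eq)
  obtain d2 where d2: "d2 > 0" "\<And>v. v \<in> S \<Longrightarrow> dist v w < d2 \<Longrightarrow> dist (g' v) (g' w) < \<epsilon>"
   using g' w \<epsilon>(1) unfolding continuous_on_iff by (metis (mono_tags, lifting) mem_Collect_eq)
  have "ball w (min d1 d2) \<inter> S \<subseteq> ?E"
  proof
   fix v assume v: "v \<in> ball w (min d1 d2) \<inter> S"
   hence "g v \<in> ball (g w) \<epsilon>" "g' v \<in> ball (g w) \<epsilon>"
    using d1(2)[of v] d2(2)[of v] w by (auto simp: dist_commute)
   thus "v \<in> ?E" using \<epsilon>(2) eq[of v] v unfolding inj_on_def by blast
  qed
  thus "\<exists>e>0. ball w e \<inter> S \<subseteq> ?E" using d1(1) d2(1) by (intro exI[of _ "min d1 d2"]) auto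
 qed auto
 ultimately have "?E = {} \<or> ?E = S" using S unfolding connected_clopen by blast
 thus ?thesis using v0 v by blast
qed

subsection \<open>Hyperbolic times\<close>

text \<open>The constants serve two cases: critical points, with \<open>K = B\<close> and
  \<open>b = \<beta>\<close>, and none, with \<open>K\<close> from compactness and
  \<open>b = 1\<close>. Backwards in time, distances in a shadow decay at the rate
  \<open>3 * c / 4\<close> and distances to \<open>C\<close> at most at the rate \<open>a\<close>.
  As \<open>a\<close> and \<open>a * b\<close> are at most \<open>5 * c / 8\<close>, a factor
  \<open>exp (- c / 8)\<close> per step is left for the distortion. The size of
  \<open>\<rho>\<close> keeps the change of \<open>lnorm\<close> at each time below
  \<open>c / 4\<close>.\<close>

locale hyperbolic = torus_map f B \<beta> for f :: "'n::finite torus \<Rightarrow> 'n torus" and B \<beta> +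
 fixes K b a c \<delta> \<rho> :: real
 assumes K: "K > 0" and b: "b > 0"
  and lower: "\<And>x. x \<notin> C \<Longrightarrow> - lnorm x \<le> K - b * ln (crit_dist x)"
  and reg_inv: "\<And>x y. x \<notin> C \<Longrightarrow> dist x y < crit_dist x / 2 \<Longrightarrow>
   \<bar>lnorm x - lnorm y\<bar> \<le> K * (dist x y / crit_dist x powr b)"
  and reg_det: "\<And>x y. x \<notin> C \<Longrightarrow> dist x y < crit_dist x / 2 \<Longrightarrow>
   \<bar>ldet x - ldet y\<bar> \<le> K * (dist x y / crit_dist x powr b)"
  and a: "a > 0" "a \<le> 5 * c / 8" "a * b \<le> 5 * c / 8"
  and c: "c > 0" and \<delta>: "0 < \<delta>"
  and \<rho>: "0 < \<rho>" "\<rho> \<le> 1 / 4" "\<rho> < \<delta> / 2" "K * (\<rho> / \<delta> powr b) \<le> c / 4"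
begin

text \<open>Hyperbolic times in additive form, where \<open>k\<close> counts backwards from
  \<open>m\<close>. The factor \<open>\<delta>\<close> in front of the exponential replaces the
  truncation of the distance.\<close>

definition hyp :: "nat \<Rightarrow> 'n torus \<Rightarrow> bool" where
 "hyp m x \<longleftrightarrow> (\<forall>k\<in>{1..m}. (f ^^ (m - k)) x \<notin> C \<and> \<delta> * exp (- a * k) \<le> crit_dist ((f ^^ (m - k)) x) \<and>
  (\<Sum>j = m - k..<m. lnorm ((f ^^ j) x)) \<le> - c * k)"

text \<open>The rate \<open>3 * c / 4\<close> instead of \<open>c\<close> gives away the
  \<open>c / 4\<close> by which \<open>lnorm\<close> may differ between a point and its
  shadow.\<close>

definition shadow :: "nat \<Rightarrow> 'n torus \<Rightarrow> real \<Rightarrow> 'n torus set" where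
 "shadow m x r = {z. \<forall>k\<in>{1..m}. dist ((f ^^ (m - k)) z) ((f ^^ (m - k)) x) \<le> r * exp (- 3 * c * k / 4)}"

lemma shadow_mono: "r \<le> r' \<Longrightarrow> shadow m x r \<subseteq> shadow m x r'"
 unfolding shadow_def by (auto intro: order_trans mult_right_mono)

lemma compact_shadow: "compact (shadow m x r)"
proof -
 have "closed (shadow m x r)" unfolding shadow_def Ball_def
  by (intro closed_Collect_all closed_Collect_imp closed_Collect_le continuous_intros continuous_iterate) auto
 thus ?thesis by (rule compact_if_closed)
qed

text \<open>The distortion at time \<open>m - k\<close> is controlled by the distance over a power
  of the distance to \<open>C\<close>, hence by a multiple of
  \<open>exp (- 3 * c * k / 4 + a * b * k)\<close>. The third claim keeps the decay in
  \<open>k\<close>, since the sum over \<open>k\<close> has to be bounded independently of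
  \<open>m\<close>.\<close>

lemma shadow_regular:
 assumes x: "hyp m x" and z: "z \<in> shadow m x \<rho>" and k: "k \<in> {1..m}"
 shows "(f ^^ (m - k)) z \<notin> C"
  and "lnorm ((f ^^ (m - k)) z) \<le> lnorm ((f ^^ (m - k)) x) + c / 4"
  and "\<bar>ldet ((f ^^ (m - k)) x) - ldet ((f ^^ (m - k)) z)\<bar> \<le> c / 4 * exp (- c * k / 8)"
  and "lnorm ((f ^^ (m - k)) x) \<le> lnorm ((f ^^ (m - k)) z) + c / 4"
  and "dist ((f ^^ (m - k)) x) ((f ^^ (m - k)) z) < crit_dist ((f ^^ (m - k)) x) / 2"
proof -
 let ?x = "(f ^^ (m - k)) x" and ?z = "(f ^^ (m - k)) z"
 have xC: "?x \<notin> C" and dx: "\<delta> * exp (- a * k) \<le> crit_dist ?x" using x k by (auto simp: hyp_def)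
 have d: "dist ?x ?z \<le> \<rho> * exp (- 3 * c * k / 4)" using z k by (auto simp: shadow_def dist_commute)
 also have "\<dots> < \<delta> / 2 * exp (- a * k)"
 proof (rule mult_less_le_imp_less)
  show "exp (- 3 * c * k / 4) \<le> exp (- a * k)"
  proof -
   have "a * k \<le> 3 * c / 4 * k" using a c by (intro mult_right_mono) auto
   thus ?thesis by simp
  qed
 qed (use \<rho> in auto)
 also have "\<dots> \<le> crit_dist ?x / 2" using dx by simp
 finally have near: "dist ?x ?z < crit_dist ?x / 2" .
 thus "?z \<notin> C" using crit_dist_near[OF xC] crit_dist_pos[OF xC] by auto
 have "dist ?x ?z / crit_dist ?x powr b \<le> \<rho> * exp (- 3 * c * k / 4) / (\<delta> * exp (- a * k)) powr b"
  using d dx \<delta> b \<rho>(1) by (intro frac_le powr_mono2 powr_gt_zero[THEN iffD2]) auto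
 also have "\<dots> = \<rho> / \<delta> powr b * exp (- 3 * c * k / 4 + a * b * k)"
 proof -
  have "(\<delta> * exp (- a * k)) powr b = \<delta> powr b * exp (- a * b * k)"
   using \<delta> by (simp add: powr_mult powr_def[of "exp _"] mult_ac)
  hence "\<rho> * exp (- 3 * c * k / 4) / (\<delta> * exp (- a * k)) powr b = \<rho> / \<delta> powr b * (exp (- 3 * c * k / 4) / exp (- a * b * k))"
   by simp
  thus ?thesis by (simp flip: exp_diff)
 qed
 also have "\<dots> \<le> \<rho> / \<delta> powr b * exp (- c * k / 8)"
 proof (rule mult_left_mono)
  have "a * b * k \<le> 5 * c / 8 * k" using a by (intro mult_right_mono) auto
  thus "exp (- 3 * c * k / 4 + a * b * k) \<le> exp (- c * k / 8)" by simp
 qed (use \<rho> in auto)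
 finally have "K * (dist ?x ?z / crit_dist ?x powr b) \<le> K * (\<rho> / \<delta> powr b * exp (- c * k / 8))"
  using K by (intro mult_left_mono) auto
 also have "\<dots> = K * (\<rho> / \<delta> powr b) * exp (- c * k / 8)" by simp
 also have "\<dots> \<le> c / 4 * exp (- c * k / 8)" using \<rho>(4) by (intro mult_right_mono) auto
 finally have bd: "K * (dist ?x ?z / crit_dist ?x powr b) \<le> c / 4 * exp (- c * k / 8)" .
 thus "\<bar>ldet ?x - ldet ?z\<bar> \<le> c / 4 * exp (- c * k / 8)" using reg_det[OF xC near] by linarith
 have "c / 4 * exp (- c * k / 8) \<le> c / 4 * 1" using c by (intro mult_left_mono) auto
 thus "lnorm ?z \<le> lnorm ?x + c / 4"
  and "lnorm ?x \<le> lnorm ?z + c / 4"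
  using reg_inv[OF xC near] bd by linarith+
 show "dist ?x ?z < crit_dist ?x / 2" by (rule near)
qed

lemma iterate_expand:
 assumes "\<And>j. j < k \<Longrightarrow> (f ^^ j) z \<notin> C" and "exp (\<Sum>j<k. lnorm ((f ^^ j) z)) < L"
 shows "\<forall>\<^sub>F w in nhds z. dist w z \<le> L * dist ((f ^^ k) w) ((f ^^ k) z)"
 using assms
proof (induction k arbitrary: L)
 case 0
 hence "dist w z \<le> L * dist w z" for w by (simp add: mult_le_cancel_right1)
 thus ?case by simp
next
 case (Suc k)
 define E where "E = exp (\<Sum>j<k. lnorm ((f ^^ j) z))"
 define i where "i = inv_norm f ((f ^^ k) z)"
 have i: "i > 0" using inv_norm_pos Suc.prems(1) by (simp add: i_def)
 have E: "E > 0" by (simp add: E_def)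
 have L: "E * i < L" using Suc.prems(2) i by (simp add: E_def i_def exp_add)
 \<comment> \<open>The slack between \<open>E * i\<close> and \<open>L\<close> is split evenly: one
   factor \<open>q\<close> for the first \<open>k\<close> steps, one for the last.\<close>
 define q where "q = sqrt (L / (E * i))"
 have "L > 0" using L E i by (meson less_trans mult_pos_pos)
 hence q: "q > 1" "q * q = L / (E * i)" using L E i by (auto simp: q_def less_divide_eq)
 have "\<forall>\<^sub>F w in nhds z. dist w z \<le> (E * q) * dist ((f ^^ k) w) ((f ^^ k) z)"
  by (rule Suc.IH) (use Suc.prems q E in \<open>auto simp: E_def\<close>)
 moreover have "\<forall>\<^sub>F w in nhds z. dist ((f ^^ k) w) ((f ^^ k) z) \<le> (i * q) * dist (f ((f ^^ k) w)) (f ((f ^^ k) z))"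
 proof -
  have "onorm (\<lambda>v. matrix_inv (Df ((f ^^ k) z)) *v v) < i * q" using q i by (simp add: i_def inv_norm_def)
  hence "\<forall>\<^sub>F y in nhds ((f ^^ k) z). dist y ((f ^^ k) z) \<le> i * q * dist (f y) (f ((f ^^ k) z))"
   using Suc.prems(1) by (intro has_torus_derivative_expand[OF has_derivative_f det_nonzero]) auto
  moreover have "filterlim (f ^^ k) (nhds ((f ^^ k) z)) (nhds z)"
   using continuous_iterate[of UNIV k] by (simp add: continuous_on_eq_continuous_at continuous_at tendsto_nhds_iff)
  ultimately show ?thesis by (rule eventually_compose_filterlim)
 qed
 ultimately show ?case
 proof eventually_elim
  case (elim w)
  have "dist w z \<le> (E * q) * ((i * q) * dist (f ((f ^^ k) w)) (f ((f ^^ k) z)))"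
   using elim E q(1) by (meson less_eq_real_def less_trans mult_left_mono mult_nonneg_nonneg order_trans zero_less_one)
  also have "\<dots> = (E * i * (q * q)) * dist (f ((f ^^ k) w)) (f ((f ^^ k) z))" by (simp add: mult_ac)
  also have "E * i * (q * q) = L" using q(2) E i by simp
  finally show ?case by simp
 qed
qed

lemma iterate_local_homeo:
 assumes "\<And>j. j < k \<Longrightarrow> (f ^^ j) z \<notin> C"
 shows "\<exists>\<epsilon>>0. inj_on (f ^^ k) (ball z \<epsilon>) \<and> (\<forall>U. open U \<longrightarrow> U \<subseteq> ball z \<epsilon> \<longrightarrow> open ((f ^^ k) ` U))"
 using assms
proof (induction k)
 case 0 show ?case by (intro exI[of _ 1]) auto
next
 case (Suc k)
 then obtain e where e: "e > 0" "inj_on (f ^^ k) (ball z e)"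
  "\<And>U. open U \<Longrightarrow> U \<subseteq> ball z e \<Longrightarrow> open ((f ^^ k) ` U)"
  by (metis less_Suc_eq)
 obtain r where r: "r > 0" "inj_on f (ball ((f ^^ k) z) r)"
  "\<And>U. open U \<Longrightarrow> U \<subseteq> ball ((f ^^ k) z) r \<Longrightarrow> open (f ` U)"
  using substitution_local[of "(f ^^ k) z"] Suc.prems[of k] by (metis lessI)
 have "open ((f ^^ k) -` ball ((f ^^ k) z) r)" using continuous_iterate[of UNIV k] by (intro open_vimage) auto
 then obtain e' where e': "e' > 0" "ball z e' \<subseteq> (f ^^ k) -` ball ((f ^^ k) z) r"
  using r(1) by (metis centre_in_ball open_contains_ball vimageI2)
 let ?e = "min e e'"
 have img: "(f ^^ k) ` U \<subseteq> ball ((f ^^ k) z) r" if "U \<subseteq> ball z ?e" for U using that e'(2) by fastforce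
 have "inj_on (f ^^ Suc k) (ball z ?e)"
 proof -
  have "inj_on (f ^^ k) (ball z ?e)" using e(2) by (rule inj_on_subset) auto
  moreover have "inj_on f ((f ^^ k) ` ball z ?e)" using r(2) img[of "ball z ?e"] by (rule inj_on_subset) auto
  ultimately show ?thesis using comp_inj_on[of "f ^^ k" "ball z ?e" f] by (simp add: o_def)
 qed
 moreover have "open ((f ^^ Suc k) ` U)" if U: "open U" "U \<subseteq> ball z ?e" for U
 proof -
  have "open ((f ^^ k) ` U)" by (rule e(3)) (use U in auto)
  hence "open (f ` (f ^^ k) ` U)" using r(3) img[OF U(2)] by blast
  thus ?thesis by (simp add: image_comp o_def)
 qed
 ultimately show ?case using e(1) e'(1) by (intro exI[of _ ?e]) (auto simp: o_def)
qed

text \<open>Each of the \<open>k\<close> terms changes by at most \<open>c / 4\<close>, so the rate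
  \<open>c\<close> at \<open>x\<close> becomes \<open>3 * c / 4\<close>, which is just the rate in
  \<open>shadow\<close>.\<close>

lemma shadow_sum:
 assumes x: "hyp m x" and z: "z \<in> shadow m x \<rho>" and k: "k \<in> {1..m}"
 shows "(\<Sum>j<k. lnorm ((f ^^ j) ((f ^^ (m - k)) z))) \<le> - 3 * c * k / 4"
proof -
 have "(\<Sum>j<k. lnorm ((f ^^ j) ((f ^^ (m - k)) z))) \<le> (\<Sum>j<k. lnorm ((f ^^ j) ((f ^^ (m - k)) x)) + c / 4)"
 proof (rule sum_mono)
  fix j assume j: "j \<in> {..<k}"
  have "(f ^^ j) ((f ^^ (m - k)) y) = (f ^^ (m - (k - j))) y" for y
  proof -
   have "m - (k - j) = j + (m - k)" using j k by auto
   thus ?thesis by (simp add: funpow_add)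
  qed
  moreover have "k - j \<in> {1..m}" using j k by auto
  ultimately show "lnorm ((f ^^ j) ((f ^^ (m - k)) z)) \<le> lnorm ((f ^^ j) ((f ^^ (m - k)) x)) + c / 4"
   using shadow_regular(2)[OF x z] by presburger
 qed
 also have "\<dots> = (\<Sum>j<k. lnorm ((f ^^ j) ((f ^^ (m - k)) x))) + k * (c / 4)" by (simp add: sum.distrib)
 also have "(\<Sum>j<k. lnorm ((f ^^ j) ((f ^^ (m - k)) x))) = (\<Sum>j = m - k..<m. lnorm ((f ^^ j) x))"
  using sum.shift_bounds_nat_ivl[of "\<lambda>j. lnorm ((f ^^ j) x)" 0 "m - k" k] k
  by (simp add: funpow_add lessThan_atLeast0)
 also have "\<dots> \<le> - c * k" using x k by (auto simp: hyp_def)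
 finally show ?thesis by (simp add: algebra_simps)
qed

section \<open>Inverse branches at hyperbolic times\<close>

definition branch :: "nat \<Rightarrow> 'n torus \<Rightarrow> real \<Rightarrow> (real^'n \<Rightarrow> 'n torus) \<Rightarrow> bool" where
 "branch m x r g \<longleftrightarrow> continuous_on (ball 0 r) g \<and> g 0 = x \<and>
  (\<forall>v\<in>ball 0 r. (f ^^ m) (g v) = (f ^^ m) x + torus_of v)"

text \<open>As the lifted curve stays in the shadow of \<open>x\<close>, the last \<open>k\<close>
  iterates expand small distances at least by nearly \<open>exp (3 * c * k / 4)\<close> and end on a
  straight segment of known length. Locally this holds with any larger factor \<open>L\<close> in
  place of the contraction; then \<open>L\<close> decreases to it. The lemma after this one removes
  the condition that the curve stays in the shadow.\<close>

lemma branch_contract_on_segment: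
 assumes x: "hyp m x" and g: "branch m x r g" and v: "v \<in> ball 0 r" and s: "0 \<le> s" "s \<le> 1"
  and sh: "\<And>t. 0 \<le> t \<Longrightarrow> t \<le> s \<Longrightarrow> g (t *\<^sub>R v) \<in> shadow m x \<rho>" and k: "k \<in> {1..m}"
 shows "dist ((f ^^ (m - k)) (g (s *\<^sub>R v))) ((f ^^ (m - k)) x) \<le> exp (- 3 * c * k / 4) * norm v * s"
proof -
 let ?h = "\<lambda>t. (f ^^ (m - k)) (g (t *\<^sub>R v))"
 have tv: "t *\<^sub>R v \<in> ball 0 r" if "0 \<le> t" "t \<le> 1" for t
 proof -
  have "t * norm v \<le> 1 * norm v" using that by (intro mult_right_mono) auto
  thus ?thesis using v that by simp
 qed
 have "dist (?h 0) (?h s) \<le> (L * norm v) * (s - 0)" if L: "L > exp (- 3 * c * k / 4)" for L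
 proof (rule lipschitz_by_local_bound)
  have "L > 0" using L by (meson exp_gt_zero less_trans)
  thus "0 \<le> L * norm v" by simp
  fix t assume t: "0 \<le> t" "t \<le> s"
  hence gt: "g (t *\<^sub>R v) \<in> shadow m x \<rho>" by (rule sh)
  have nC: "(f ^^ j) (?h t) \<notin> C" if "j < k" for j
  proof -
   have kj: "m - (k - j) = j + (m - k)" "k - j \<in> {1..m}" using that k by auto
   hence "(f ^^ j) (?h t) = (f ^^ (m - (k - j))) (g (t *\<^sub>R v))"
    unfolding kj(1) by (simp only: funpow_add o_apply)
   with kj(2) show ?thesis using shadow_regular(1)[OF x gt] by presburger
  qed
  have "exp (\<Sum>j<k. lnorm ((f ^^ j) (?h t))) < L"
   using shadow_sum[OF x gt k] L by (meson exp_le_cancel_iff le_less_trans)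
  from iterate_expand[OF nC this] obtain e where e: "e > 0"
   "\<And>w. dist w (?h t) < e \<Longrightarrow> dist w (?h t) \<le> L * dist ((f ^^ k) w) ((f ^^ k) (?h t))"
   unfolding eventually_nhds_metric by blast
  have "continuous_on {0..1} ?h"
  proof (rule continuous_on_compose2[OF continuous_iterate[of UNIV]])
   show "continuous_on {0..1} (\<lambda>t. g (t *\<^sub>R v))"
    by (rule continuous_on_compose2[of "ball 0 r" g]) (use g tv in \<open>auto simp: branch_def intro!: continuous_intros\<close>)
  qed auto
  hence "\<forall>e>0. \<exists>d>0. \<forall>u\<in>{0..1}. dist u t < d \<longrightarrow> dist (?h u) (?h t) < e"
   using t s by (auto simp: continuous_on_iff)
  then obtain d where d: "d > 0" "\<And>u. u \<in> {0..1} \<Longrightarrow> dist u t < d \<Longrightarrow> dist (?h u) (?h t) < e"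
   using e(1) by blast
  have "dist (?h u) (?h t) \<le> L * norm v * \<bar>u - t\<bar>" if u: "0 \<le> u" "u \<le> s" "\<bar>u - t\<bar> < d" for u
  proof -
   have fk: "(f ^^ k) (?h y) = (f ^^ m) x + torus_of (y *\<^sub>R v)" if "0 \<le> y" "y \<le> 1" for y
   proof -
    have "(f ^^ k) (?h y) = (f ^^ m) (g (y *\<^sub>R v))"
     using k by (simp add: funpow_add[symmetric, THEN fun_cong, unfolded o_def])
    thus ?thesis using g tv[OF that] by (simp add: branch_def)
   qed
   have "dist (?h u) (?h t) \<le> L * dist ((f ^^ k) (?h u)) ((f ^^ k) (?h t))"
    using e(2) d(2) u s by (auto simp: dist_real_def)
   also have "\<dots> \<le> L * dist (u *\<^sub>R v) (t *\<^sub>R v)"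
    using mult_left_mono[OF dist_chart_le[of "(f ^^ m) x" "u *\<^sub>R v" "t *\<^sub>R v"], of L]
     \<open>L > 0\<close> fk[of u] fk[of t] u t s by simp
   also have "dist (u *\<^sub>R v) (t *\<^sub>R v) = norm v * \<bar>u - t\<bar>"
    by (simp add: dist_norm mult.commute flip: scaleR_left_diff_distrib)
   finally show ?thesis by (simp add: mult.assoc)
  qed
  thus "\<exists>d>0. \<forall>u. 0 \<le> u \<longrightarrow> u \<le> s \<longrightarrow> \<bar>u - t\<bar> < d \<longrightarrow> dist (?h u) (?h t) \<le> L * norm v * \<bar>u - t\<bar>"
   using d(1) by blast
 qed (use s in auto)
 hence "dist (?h s) (?h 0) \<le> L * (norm v * s)" if "L > exp (- 3 * c * k / 4)" for L
  using that by (simp add: dist_commute mult.assoc)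
 hence "dist (?h s) (?h 0) \<le> exp (- 3 * c * k / 4) * (norm v * s)"
 proof (cases "norm v * s = 0")
  case True
  thus ?thesis using \<open>\<And>L. L > exp (- 3 * c * k / 4) \<Longrightarrow> dist (?h s) (?h 0) \<le> L * (norm v * s)\<close>[of "exp (- 3 * c * k / 4) + 1"]
   by (simp only: True mult_zero_right)
 next
  case False
  hence pos: "norm v * s > 0" using s by (simp add: less_le)
  have "dist (?h s) (?h 0) / (norm v * s) \<le> L" if "L > exp (- 3 * c * k / 4)" for L
   using \<open>\<And>L. L > exp (- 3 * c * k / 4) \<Longrightarrow> dist (?h s) (?h 0) \<le> L * (norm v * s)\<close>[OF that] pos
   by (simp add: divide_le_eq)
  hence "dist (?h s) (?h 0) / (norm v * s) \<le> exp (- 3 * c * k / 4)" by (rule dense_ge)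
  thus ?thesis using pos by (simp add: divide_le_eq)
 qed
 moreover have "?h 0 = (f ^^ (m - k)) x" using g by (simp add: branch_def)
 ultimately show ?thesis by (simp add: mult.assoc)
qed

text \<open>A continuity argument: up to the first parameter at which some distance reaches its
  bound for the radius \<open>\<rho>\<close>, the estimate on segments applies and gives a strictly
  smaller distance, as \<open>norm v < \<rho>\<close>.\<close>

lemma branch_contract:
 assumes x: "hyp m x" and g: "branch m x r g" and r: "r \<le> \<rho>" and v: "v \<in> ball 0 r"
 shows "g v \<in> shadow m x (norm v)"
proof -
 have tv: "t *\<^sub>R v \<in> ball 0 r" if "0 \<le> t" "t \<le> 1" for t
 proof -
  have "t * norm v \<le> 1 * norm v" using that by (intro mult_right_mono) auto
  thus ?thesis using v that by simp
 qed
 let ?h = "\<lambda>k t. dist ((f ^^ (m - k)) (g (t *\<^sub>R v))) ((f ^^ (m - k)) x)"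
 have cont: "continuous_on {0..1} (?h k)" for k
 proof (intro continuous_intros continuous_on_compose2[OF continuous_iterate[of UNIV]])
  show "continuous_on {0..1} (\<lambda>t. g (t *\<^sub>R v))"
   by (rule continuous_on_compose2[of "ball 0 r" g]) (use g tv in \<open>auto simp: branch_def intro!: continuous_intros\<close>)
 qed auto
 have all: "g (t *\<^sub>R v) \<in> shadow m x \<rho>" if t: "0 \<le> t" "t \<le> 1" for t
 proof (rule ccontr)
  assume not: "g (t *\<^sub>R v) \<notin> shadow m x \<rho>"
  let ?e = "\<lambda>k::nat. exp (- 3 * c * k / 4)"
  \<comment> \<open>Formed with the weak inequality, so that \<open>bad\<close> is closed and has a
    first element.\<close>
  define bad where "bad = (\<Union>k\<in>{1..m}. {0..1} \<inter> ?h k -` {\<rho> * ?e k..})"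
  have "closed ({0..1} \<inter> ?h k -` {\<rho> * ?e k..})" for k by (rule continuous_closed_preimage[OF cont]) auto
  hence "closed bad" unfolding bad_def by (intro closed_UN) auto
  moreover have "bad \<subseteq> {0..1}" by (auto simp: bad_def)
  ultimately have "compact bad" by (metis bounded_closed_interval bounded_subset compact_eq_bounded_closed)
  moreover have "t \<in> bad"
  proof -
   obtain k where "k \<in> {1..m}" "\<not> ?h k t \<le> \<rho> * ?e k" using not unfolding shadow_def by blast
   thus ?thesis using t unfolding bad_def by (intro UN_I[of k]) auto
  qed
  ultimately obtain u where u: "u \<in> bad" "\<And>t. t \<in> bad \<Longrightarrow> u \<le> t"
   using compact_attains_inf[of bad] by blast
  then obtain k where k: "k \<in> {1..m}" "u \<in> {0..1}" "\<rho> * ?e k \<le> ?h k u" by (auto simp: bad_def)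
  have "?h k 0 = 0" using g by (simp add: branch_def)
  hence u0: "u > 0" using k \<rho>(1) by (cases "u = 0") (auto simp: mult_le_0_iff)
  have before: "?h k s \<le> ?e k * norm v * u" if s: "0 \<le> s" "s < u" for s
  proof -
   have "g (t *\<^sub>R v) \<in> shadow m x \<rho>" if "0 \<le> t" "t \<le> s" for t
   proof -
    have "t \<notin> bad" using u(2)[of t] that s by auto
    thus ?thesis using that s k(2) by (auto simp: bad_def shadow_def not_le less_imp_le)
   qed
   hence "?h k s \<le> ?e k * norm v * s" using branch_contract_on_segment[OF x g v s(1) _ _ k(1)] s k(2) by auto
   also have "\<dots> \<le> ?e k * norm v * u" using s by (intro mult_left_mono) auto
   finally show ?thesis .
  qed
  have "?h k u \<le> ?e k * norm v * u"
  proof (rule ccontr)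
   assume less: "\<not> ?thesis"
   have "\<forall>e>0. \<exists>d>0. \<forall>y\<in>{0..1}. dist y u < d \<longrightarrow> dist (?h k y) (?h k u) < e"
    using cont[of k] k(2) unfolding continuous_on_iff by blast
   moreover have "?h k u - ?e k * norm v * u > 0" using less by simp
   ultimately obtain d where d: "d > 0" "\<And>y. y \<in> {0..1} \<Longrightarrow> dist y u < d \<Longrightarrow>
     dist (?h k y) (?h k u) < ?h k u - ?e k * norm v * u" by blast
   define y where "y = max 0 (u - d / 2)"
   have y: "0 \<le> y" "y < u" "y \<in> {0..1}" "dist y u < d"
    using d(1) u0 k(2) by (auto simp: y_def dist_real_def)
   show False using before[OF y(1,2)] d(2)[OF y(3,4)] by (simp add: dist_real_def)
  qed
  also have "\<dots> \<le> ?e k * norm v * 1" using k(2) by (intro mult_left_mono) auto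
  also have "\<dots> < ?e k * \<rho>" using v r by simp
  finally show False using k(3) by (simp add: mult.commute)
 qed
 show ?thesis unfolding shadow_def using branch_contract_on_segment[OF x g v, of 1] all by (auto simp: mult.commute)
qed

lemma shadow_noncritical:
 assumes "hyp m x" "z \<in> shadow m x \<rho>" "j < m" shows "(f ^^ j) z \<notin> C"
 using shadow_regular(1)[OF assms(1,2), of "m - j"] assms(3) by auto

text \<open>A branch over a ball is prolonged by a fixed amount \<open>\<epsilon>0 / 4\<close>: near the boundary, solve locally
 around the value at the radial projection of the point to a slightly smaller ball.\<close>

lemma branch_exists:
 assumes x: "hyp m x"
 obtains g where "branch m x (\<rho> / 2) g"
proof -
 let ?G = "f ^^ m" and ?T = "shadow m x (\<rho> / 2)"
 let ?e = "\<lambda>v. ?G x + torus_of v"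
 have TT: "?T \<subseteq> shadow m x \<rho>" using \<rho> by (intro shadow_mono) auto
 have xT: "x \<in> ?T" using \<rho> by (auto simp: shadow_def)
 define good where "good z \<epsilon> \<longleftrightarrow> \<epsilon> > 0 \<and> inj_on ?G (ball z \<epsilon>) \<and> (\<forall>U. open U \<longrightarrow> U \<subseteq> ball z \<epsilon> \<longrightarrow> open (?G ` U))" for z \<epsilon>
 have "\<exists>\<epsilon>. good z \<epsilon>" if "z \<in> ?T" for z
 proof -
  have "z \<in> shadow m x \<rho>" using that TT by blast
  from iterate_local_homeo[OF shadow_noncritical[OF x this]] show ?thesis unfolding good_def by blast
 qed
 then obtain r where good: "\<And>z. z \<in> ?T \<Longrightarrow> good z (r z)" by metis
 hence r: "\<And>z. z \<in> ?T \<Longrightarrow> r z > 0" "\<And>z. z \<in> ?T \<Longrightarrow> inj_on ?G (ball z (r z))"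
  "\<And>z U. z \<in> ?T \<Longrightarrow> open U \<Longrightarrow> U \<subseteq> ball z (r z) \<Longrightarrow> open (?G ` U)"
  unfolding good_def by auto
 have cov: "?T \<subseteq> \<Union>((\<lambda>z. ball z (r z)) ` ?T)" using r(1) by fastforce
 have opn: "open V" if "V \<in> (\<lambda>z. ball z (r z)) ` ?T" for V using that by auto
 obtain \<epsilon>1 where \<epsilon>1: "\<epsilon>1 > 0" "\<forall>z\<in>?T. \<exists>V\<in>(\<lambda>z. ball z (r z)) ` ?T. ball z \<epsilon>1 \<subseteq> V"
  by (rule Heine_Borel_lemma[OF compact_shadow cov opn]) blast+
 hence \<epsilon>1: "\<epsilon>1 > 0" "\<And>z. z \<in> ?T \<Longrightarrow> \<exists>w\<in>?T. ball z \<epsilon>1 \<subseteq> ball w (r w)"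
  by auto
 have inj: "inj_on ?G (ball z \<epsilon>1)" if "z \<in> ?T" for z
  using \<epsilon>1(2)[OF that] r(2) inj_on_subset by metis
 have opn: "open (?G ` U)" if "z \<in> ?T" "open U" "U \<subseteq> ball z \<epsilon>1" for z U
  using \<epsilon>1(2)[OF that(1)] r(3)[OF _ that(2)] that(3) by (meson order_trans)
 have "\<exists>s. z \<in> ?T \<longrightarrow> s > 0 \<and> ball (?G z) (2 * s) \<subseteq> ?G ` ball z (\<epsilon>1 / 2)" for z
 proof (cases "z \<in> ?T")
  case True
  have "open (?G ` ball z (\<epsilon>1 / 2))" by (rule opn[OF True]) (use \<epsilon>1(1) in \<open>auto intro: subset_ball\<close>)
  moreover have "?G z \<in> ?G ` ball z (\<epsilon>1 / 2)" using \<epsilon>1(1) by auto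
  ultimately obtain s where "s > 0" "ball (?G z) s \<subseteq> ?G ` ball z (\<epsilon>1 / 2)" using open_contains_ball by blast
  thus ?thesis by (intro exI[of _ "s / 2"]) auto
 qed auto
 then obtain s where s: "\<And>z. z \<in> ?T \<Longrightarrow> s z > 0" "\<And>z. z \<in> ?T \<Longrightarrow> ball (?G z) (2 * s z) \<subseteq> ?G ` ball z (\<epsilon>1 / 2)"
  by metis
 define U where "U z = ball z (\<epsilon>1 / 2) \<inter> ?G -` ball (?G z) (s z)" for z
 have "open (U z)" for z unfolding U_def using continuous_iterate[of UNIV m] by (intro open_Int open_vimage) auto
 moreover have "?T \<subseteq> (\<Union>z\<in>?T. U z)" using s(1) \<epsilon>1(1) by (force simp: U_def)
 ultimately obtain F where F: "F \<subseteq> ?T" "finite F" "?T \<subseteq> (\<Union>z\<in>F. U z)"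
  using compactE_image[OF compact_shadow, of ?T U m x "\<rho> / 2"] by metis
 have "F \<noteq> {}" using F(3) xT by auto
 define \<epsilon>0 where "\<epsilon>0 = Min (s ` F)"
 have \<epsilon>0: "\<epsilon>0 > 0" using s(1) F \<open>F \<noteq> {}\<close> by (auto simp: \<epsilon>0_def)
 have sur: "ball (?G z) \<epsilon>0 \<subseteq> ?G ` ball z \<epsilon>1" if "z \<in> ?T" for z
 proof -
  have "z \<in> (\<Union>z\<in>F. U z)" using F(3) that by (rule subsetD)
  then obtain w where w: "w \<in> F" "z \<in> U w" by (rule UN_E)
  have "\<epsilon>0 \<le> s w" using w(1) F(2) by (auto simp: \<epsilon>0_def)
  have "ball (?G z) \<epsilon>0 \<subseteq> ball (?G w) (2 * s w)"
  proof
   fix y assume "y \<in> ball (?G z) \<epsilon>0"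
   thus "y \<in> ball (?G w) (2 * s w)"
    using dist_triangle[of "?G w" y "?G z"] w(2) \<open>\<epsilon>0 \<le> s w\<close> by (simp add: U_def)
  qed
  also have "\<dots> \<subseteq> ?G ` ball w (\<epsilon>1 / 2)" using s(2) w(1) F(1) by blast
  also have "ball w (\<epsilon>1 / 2) \<subseteq> ball z \<epsilon>1"
  proof
   fix y assume "y \<in> ball w (\<epsilon>1 / 2)"
   thus "y \<in> ball z \<epsilon>1" using dist_triangle[of z y w] w(2) by (simp add: U_def dist_commute)
  qed
  finally show ?thesis by blast
 qed
 \<comment> \<open>An approximate section can be corrected to an exact one.
   \<open>\<epsilon>1\<close> is a Lebesgue number for the local injectivity of \<open>?G\<close> on
   the compact shadow, and \<open>\<epsilon>0\<close> a radius that the image of every ball of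
   radius \<open>\<epsilon>1\<close> covers; both are uniform over the shadow.\<close>
 have step: "\<exists>g. branch m x q g"
  if h: "continuous_on (ball 0 q) h" "h ` ball 0 q \<subseteq> ?T" "h 0 = x" "q > 0"
   and cl: "\<And>v. v \<in> ball 0 q \<Longrightarrow> dist (?G (h v)) (?e v) < \<epsilon>0" for q h
 proof -
  obtain g where g: "continuous_on (ball 0 q) g" "\<And>v. v \<in> ball 0 q \<Longrightarrow> ?G (g v) = ?e v"
   "\<And>v. v \<in> ball 0 q \<Longrightarrow> dist (h v) (g v) < \<epsilon>1"
   by (rule continuous_local_solution[OF inj opn sur h(1,2) continuous_chart cl]) blast+
  have "g 0 = x"
  proof (rule inj_onD[OF inj[OF xT]])
   show "?G (g 0) = ?G x" using g(2)[of 0] h(4) by (simp add: torus_of_0)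
   show "g 0 \<in> ball x \<epsilon>1" using g(3)[of 0] h(3,4) by simp
  qed (use \<epsilon>1 in auto)
  thus ?thesis unfolding branch_def using g by blast
 qed
 have base: "\<exists>g. branch m x \<epsilon>0 g"
  by (rule step[of _ "\<lambda>_. x"]) (use xT \<epsilon>0 dist_chart0_le[of "?G x"] in \<open>auto simp: dist_commute intro: le_less_trans\<close>)
 have prolong: "\<exists>g. branch m x (q + \<epsilon>0 / 4) g" if ex: "\<exists>g. branch m x q g" and q: "\<epsilon>0 \<le> q" "q \<le> \<rho> / 2" for q
 proof -
  obtain g where g: "branch m x q g" using ex by blast
  define q' where "q' = q - \<epsilon>0 / 4"
  have q': "q' > 0" using q \<epsilon>0 by (simp add: q'_def)
  define p :: "real^'n \<Rightarrow> real^'n" where "p v = (q' / max q' (norm v)) *\<^sub>R v" for v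
  have pn: "norm (p v) \<le> q'" for v
  proof -
   have "norm v / max q' (norm v) \<le> 1" using q' by (simp add: divide_le_eq)
   hence "q' * (norm v / max q' (norm v)) \<le> q' * 1" using q' by (intro mult_left_mono) auto
   thus ?thesis using q' by (simp add: p_def)
  qed
  have pc: "continuous_on S p" for S
   unfolding p_def by (intro continuous_intros) (use q' in \<open>auto simp: max_def\<close>)
  have pd: "dist (p v) v < \<epsilon>0" if "v \<in> ball 0 (q + \<epsilon>0 / 4)" for v
  proof (cases "norm v \<le> q'")
   case True
   thus ?thesis using q' \<epsilon>0 by (simp add: p_def max_def)
  next
   case False
   have "v - p v = (1 - q' / norm v) *\<^sub>R v" using False q' by (simp add: p_def max_def algebra_simps)
   hence "dist (p v) v = \<bar>1 - q' / norm v\<bar> * norm v" by (metis dist_commute dist_norm norm_scaleR)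
   also have "\<dots> = norm v - q'"
   proof -
    have "norm v > 0" "q' / norm v \<le> 1" using False q' by (auto simp: divide_le_eq)
    thus ?thesis by (simp add: left_diff_distrib)
   qed
   also have "\<dots> < \<epsilon>0" using that \<epsilon>0 by (simp add: q'_def)
   finally show ?thesis .
  qed
  have pq: "p v \<in> ball 0 q" for v using pn[of v] \<epsilon>0 by (simp add: q'_def)
  show ?thesis
  proof (rule step[of _ "g \<circ> p"])
   show "continuous_on (ball 0 (q + \<epsilon>0 / 4)) (g \<circ> p)"
    unfolding o_def by (rule continuous_on_compose2[of "ball 0 q" g]) (use g pc pq in \<open>auto simp: branch_def\<close>)
   show "(g \<circ> p) ` ball 0 (q + \<epsilon>0 / 4) \<subseteq> ?T"
   proof safe
    fix v
    have "g (p v) \<in> shadow m x (norm (p v))" by (rule branch_contract[OF x g _ pq]) (use q \<rho> in auto)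
    moreover have "norm (p v) \<le> \<rho> / 2" using pn[of v] q \<epsilon>0 by (simp add: q'_def)
    ultimately show "(g \<circ> p) v \<in> ?T" using shadow_mono[of "norm (p v)" "\<rho> / 2" m x] by auto
   qed
   show "(g \<circ> p) 0 = x" using g by (simp add: p_def branch_def)
   show "q + \<epsilon>0 / 4 > 0" using q \<epsilon>0 by auto
   fix v :: "real^'n" assume v: "v \<in> ball 0 (q + \<epsilon>0 / 4)"
   have "?G ((g \<circ> p) v) = ?e (p v)" using g pq by (simp add: branch_def)
   thus "dist (?G ((g \<circ> p) v)) (?e v) < \<epsilon>0" using dist_chart_le[of "?G x" "p v" v] pd[OF v] by simp
  qed
 qed
 have grow: "\<exists>q\<ge>min (\<rho> / 2) (\<epsilon>0 + n * (\<epsilon>0 / 4)). q \<ge> \<epsilon>0 \<and> (\<exists>g. branch m x q g)" for n :: nat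
 proof (induction n)
  case 0 show ?case using base by (intro exI[of _ \<epsilon>0]) auto
 next
  case (Suc n)
  then obtain q where q: "q \<ge> min (\<rho> / 2) (\<epsilon>0 + n * (\<epsilon>0 / 4))" "q \<ge> \<epsilon>0" "\<exists>g. branch m x q g" by blast
  show ?case
  proof (cases "q \<le> \<rho> / 2")
   case True
   have "q + \<epsilon>0 / 4 \<ge> min (\<rho> / 2) (\<epsilon>0 + Suc n * (\<epsilon>0 / 4))" 
   proof -
    have "Suc n * (\<epsilon>0 / 4) = n * (\<epsilon>0 / 4) + \<epsilon>0 / 4" by (simp add: field_simps)
    thus ?thesis using q(1) \<epsilon>0 by linarith
   qed
   thus ?thesis using prolong[OF q(3,2) True] q(2) \<epsilon>0 by (intro exI[of _ "q + \<epsilon>0 / 4"]) auto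
  next
   case False
   thus ?thesis using q by (intro exI[of _ q]) auto
  qed
 qed
 obtain n :: nat where n: "\<rho> / 2 \<le> n * (\<epsilon>0 / 4)" using \<epsilon>0 using ex_less_of_nat_mult[of "\<epsilon>0 / 4" "\<rho> / 2"] by (auto intro: less_imp_le)
 have "min (\<rho> / 2) (\<epsilon>0 + n * (\<epsilon>0 / 4)) = \<rho> / 2" using n \<epsilon>0 by linarith
 then obtain q g where q: "q \<ge> \<rho> / 2" "branch m x q g" using grow[of n] by metis
 hence "branch m x (\<rho> / 2) g"
  unfolding branch_def using continuous_on_subset[of "ball 0 q" g "ball 0 (\<rho> / 2)"] subset_ball[OF q(1), of 0] by auto
 thus thesis using that by blast
qed

end

context torus_map begin

lemma prob_leb: "prob_space leb"
 by (rule prob_space_torus_lebesgue)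

text \<open>The test function \<open>u\<close> is there for the induction, which applies the claim
  for \<open>m\<close> to \<open>u (f y) * J y\<close>.\<close>

lemma nn_integral_substitution_iterate:
 assumes "S \<in> sets borel" "\<And>z j. z \<in> S \<Longrightarrow> j < m \<Longrightarrow> (f ^^ j) z \<notin> C" "inj_on (f ^^ m) S"
 shows "(f ^^ m) ` S \<in> sets borel \<and> (\<forall>u\<in>borel_measurable borel. (\<integral>\<^sup>+y\<in>(f ^^ m) ` S. u y \<partial>leb)
  = (\<integral>\<^sup>+y\<in>S. u ((f ^^ m) y) * (\<Prod>j<m. J ((f ^^ j) y)) \<partial>leb))" using assms
proof (induction m)
 case 0 thus ?case by simp
next
 case (Suc m)
 have inj: "inj_on (f ^^ m) S" "inj_on f ((f ^^ m) ` S)" using Suc.prems(3) by (auto simp: inj_on_def)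
 have IH: "(f ^^ m) ` S \<in> sets borel" "\<And>u. u \<in> borel_measurable borel \<Longrightarrow> (\<integral>\<^sup>+y\<in>(f ^^ m) ` S. u y \<partial>leb)
  = (\<integral>\<^sup>+y\<in>S. u ((f ^^ m) y) * (\<Prod>j<m. J ((f ^^ j) y)) \<partial>leb)"
  using Suc.IH[OF Suc.prems(1) _ inj(1)] Suc.prems(2) by auto
 have nC: "(f ^^ m) ` S \<inter> C = {}" using Suc.prems(2)[of _ m] by auto
 have img: "(f ^^ Suc m) ` S = f ` (f ^^ m) ` S" by (simp add: image_comp)
 have "(\<integral>\<^sup>+y\<in>(f ^^ Suc m) ` S. u y \<partial>leb)
  = (\<integral>\<^sup>+y\<in>S. u ((f ^^ Suc m) y) * (\<Prod>j<Suc m. J ((f ^^ j) y)) \<partial>leb)"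
  if u [measurable]: "u \<in> borel_measurable borel" for u
 proof -
  have "(\<integral>\<^sup>+y\<in>(f ^^ Suc m) ` S. u y \<partial>leb) = (\<integral>\<^sup>+y\<in>(f ^^ m) ` S. u (f y) * J y \<partial>leb)"
   unfolding img by (rule nn_integral_substitution[OF IH(1) nC inj(2) u])
  also have "\<dots> = (\<integral>\<^sup>+y\<in>S. u (f ((f ^^ m) y)) * J ((f ^^ m) y) * (\<Prod>j<m. J ((f ^^ j) y)) \<partial>leb)"
   by (rule IH(2)[of "\<lambda>y. u (f y) * J y"]) measurable
  finally show ?thesis by (simp add: mult_ac)
 qed
 moreover have "(f ^^ Suc m) ` S \<in> sets borel" unfolding img by (rule substitution(1)[OF IH(1) nC inj(2)])
 ultimately show ?case by blast
qed

lemma continuous_crit_dist: "continuous_on S crit_dist"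
 unfolding crit_dist_def[abs_def] by (cases "C = {}") (auto intro!: continuous_intros)

lemma measurable_crit_dist [measurable]: "crit_dist \<in> borel_measurable borel"
 by (rule borel_measurable_continuous_onI[OF continuous_crit_dist])

definition log_inv :: "'n torus \<Rightarrow> real" where
 "log_inv x = (if x \<in> - C then lnorm x else 0)"

lemma measurable_log_inv [measurable]: "log_inv \<in> borel_measurable borel"
 unfolding log_inv_def[abs_def] by (rule borel_measurable_off_closed[OF open_noncritical])
  (auto intro!: continuous_intros continuous_inv_norm dest: inv_norm_pos)

end

section \<open>Plaques and bounded distortion\<close>

context hyperbolic begin

definition "H m = {x. hyp m x}"

lemma H_borel [measurable]: "H m \<in> sets borel"
proof -
 have "H m = {x. \<forall>k\<in>{1..m}. (f ^^ (m - k)) x \<notin> C \<and> \<delta> * exp (- a * k) \<le> crit_dist ((f ^^ (m - k)) x) \<and>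
  (\<Sum>j = m - k..<m. log_inv ((f ^^ j) x)) \<le> - c * k}" (is "_ = ?R")
 proof -
  have eq: "(\<Sum>j = m - k..<m. log_inv ((f ^^ j) x)) = (\<Sum>j = m - k..<m. lnorm ((f ^^ j) x))"
   if nC: "\<forall>k\<in>{1..m}. (f ^^ (m - k)) x \<notin> C" for k x
  proof (rule sum.cong[OF refl])
   fix j assume j: "j \<in> {m - k..<m}"
   hence "m - j \<in> {1..m}" "m - (m - j) = j" by auto
   thus "log_inv ((f ^^ j) x) = lnorm ((f ^^ j) x)" using nC by (metis ComplI log_inv_def)
  qed
  show ?thesis unfolding H_def hyp_def by (intro Collect_cong) (metis (no_types, lifting) eq)
 qed
 also have "\<dots> = (\<Inter>k\<in>{1..m}. {x\<in>space borel. (f ^^ (m - k)) x \<notin> C \<and> \<delta> * exp (- a * k) \<le> crit_dist ((f ^^ (m - k)) x) \<and>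
  (\<Sum>j = m - k..<m. log_inv ((f ^^ j) x)) \<le> - c * k}) \<inter> space borel" by auto
 also have "\<dots> \<in> sets borel" by measurable
 finally show ?thesis .
qed

text \<open>Two radii \<open>R\<close> fit into the radius \<open>\<rho> / 2\<close> of the inverse
  branches: if the image of \<open>x\<close> is within \<open>R\<close> of \<open>y\<close>, then
  the branch at \<open>x\<close> is defined over all of \<open>ball y R\<close>.\<close>

definition "R = \<rho> / 4"

lemma R: "0 < R" "R \<le> 1 / 2" "R + R \<le> \<rho> / 2" using \<rho> by (auto simp: R_def)

definition section_over :: "nat \<Rightarrow> 'n torus \<Rightarrow> (real^'n \<Rightarrow> 'n torus) \<Rightarrow> bool" where
 "section_over m y s \<longleftrightarrow> continuous_on (ball 0 R) s \<and> (\<forall>v\<in>ball 0 R. (f ^^ m) (s v) = y + torus_of v) \<and>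
  (\<exists>x. hyp m x \<and> s ` ball 0 R \<subseteq> shadow m x \<rho>)"

text \<open>Plaques are formed over balls with prescribed centres and not around the image of each
  point. Then two of them over the same ball coincide or are disjoint, and estimates on single
  plaques can be summed.\<close>

definition plaques :: "nat \<Rightarrow> 'n torus \<Rightarrow> 'n torus set set" where
 "plaques m y = {s ` ball 0 R | s. section_over m y s}"

lemma plaque_exists:
 assumes x: "hyp m x" and y: "(f ^^ m) x \<in> ball y R"
 shows "\<exists>W\<in>plaques m y. x \<in> W \<and> W \<subseteq> shadow m x \<rho>"
proof -
 obtain g where g: "branch m x (\<rho> / 2) g" using branch_exists[OF x] .
 obtain u where u: "(f ^^ m) x = y + torus_of u" "norm u < R"
  using y torus_of_near[of "(f ^^ m) x" y] by (auto simp: dist_commute)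
 define s where "s v = g (v - u)" for v
 have vu: "v - u \<in> ball 0 (\<rho> / 2)" if "v \<in> ball 0 R" for v
  using norm_triangle_ineq4[of v u] that u(2) R(3) by simp
 have sh: "s ` ball 0 R \<subseteq> shadow m x \<rho>"
 proof safe
  fix v :: "real^'n" assume v: "v \<in> ball 0 R"
  have "s v \<in> shadow m x (norm (v - u))"
   unfolding s_def by (rule branch_contract[OF x g _ vu[OF v]]) (use \<rho> in auto)
  moreover have "norm (v - u) \<le> \<rho>" using vu[OF v] \<rho> by simp
  ultimately show "s v \<in> shadow m x \<rho>" using shadow_mono[of "norm (v - u)" \<rho> m x] by auto
 qed
 have "section_over m y s" unfolding section_over_def
 proof (intro conjI ballI exI[of _ x])
  show "continuous_on (ball 0 R) s" unfolding s_def
   by (rule continuous_on_compose2[of "ball 0 (\<rho> / 2)" g]) (use g vu in \<open>auto simp: branch_def intro!: continuous_intros\<close>)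
  show "(f ^^ m) (s v) = y + torus_of v" if "v \<in> ball 0 R" for v
   using g vu[OF that] u(1) by (simp add: branch_def s_def torus_of_diff)
 qed (rule x, rule sh)
 moreover have "x = s u" using g by (simp add: s_def branch_def)
 moreover have "u \<in> ball 0 R" using u(2) by simp
 ultimately show ?thesis unfolding plaques_def using sh by blast
qed

lemma plaque_noncritical: "section_over m y s \<Longrightarrow> v \<in> ball 0 R \<Longrightarrow> j < m \<Longrightarrow> (f ^^ j) (s v) \<notin> C"
 unfolding section_over_def using shadow_noncritical by blast

text \<open>At a common point both sections have the same parameter, since both follow the chart at
  \<open>y\<close>; uniqueness of lifts extends the agreement to the connected ball.\<close>

lemma plaques_disjoint:
 assumes "W \<in> plaques m y" "W' \<in> plaques m y" "W \<inter> W' \<noteq> {}"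
 shows "W = W'"
proof -
 obtain s s' where s: "W = s ` ball 0 R" "section_over m y s" and s': "W' = s' ` ball 0 R" "section_over m y s'"
  using assms(1,2) unfolding plaques_def by blast
 obtain v v' where v: "v \<in> ball 0 R" "v' \<in> ball 0 R" "s v = s' v'" using assms(3) s(1) s'(1) by blast
 have "y + torus_of v = y + torus_of v'" using s(2) s'(2) v unfolding section_over_def by metis
 hence "v = v'" using v(1,2) R(2) norm_triangle_ineq4[of v v'] by (intro chart_inj) auto
 have "s w = s' w" if w: "w \<in> ball 0 R" for w
 proof (rule sections_agree[where S = "ball 0 R" and G = "f ^^ m" and ?v0.0 = v])
  show "\<exists>\<epsilon>>0. inj_on (f ^^ m) (ball (s v) \<epsilon>)" if "v \<in> ball 0 R" for v
   using iterate_local_homeo[OF plaque_noncritical[OF s(2) that]] by blast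
 qed (use s(2) s'(2) v w \<open>v = v'\<close> in \<open>auto simp: section_over_def\<close>)
 thus ?thesis unfolding s(1) s'(1) by (rule image_cong[OF refl])
qed

lemma plaque_image:
 assumes "W \<in> plaques m y"
 shows "(f ^^ m) ` W = ball y R" and "inj_on (f ^^ m) W"
proof -
 obtain s where s: "W = s ` ball 0 R" "section_over m y s" using assms unfolding plaques_def by blast
 have fs: "(f ^^ m) (s v) = y + torus_of v" if "v \<in> ball 0 R" for v using s(2) that by (simp add: section_over_def)
 show "(f ^^ m) ` W = ball y R"
 proof -
  have "(f ^^ m) ` W = (\<lambda>v. y + torus_of v) ` ball 0 R"
   unfolding s(1) image_image by (rule image_cong) (use fs in auto)
  thus ?thesis by (simp add: chart_image_ball[OF R(2)])
 qed
 show "inj_on (f ^^ m) W"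
 proof (rule inj_onI)
  fix z z' assume "z \<in> W" "z' \<in> W" and eq: "(f ^^ m) z = (f ^^ m) z'"
  then obtain v v' where v: "v \<in> ball 0 R" "v' \<in> ball 0 R" "z = s v" "z' = s v'" using s(1) by blast
  have "v = v'" using v(1,2) R(2) norm_triangle_ineq4[of v v'] eq fs v(3,4) by (intro chart_inj) auto
  thus "z = z'" using v by simp
 qed
qed

lemma plaque_open:
 assumes "W \<in> plaques m y" shows "open W"
proof -
 obtain s where s: "W = s ` ball 0 R" "section_over m y s" using assms unfolding plaques_def by blast
 have fs: "(f ^^ m) (s v) = y + torus_of v" if "v \<in> ball 0 R" for v using s(2) that by (simp add: section_over_def)
 show ?thesis
 proof (subst open_subopen, intro ballI)
  fix z assume "z \<in> W"
  then obtain v where v: "v \<in> ball 0 R" "z = s v" using s(1) by blast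
  obtain \<epsilon> where \<epsilon>: "\<epsilon> > 0" "inj_on (f ^^ m) (ball z \<epsilon>)" "\<And>U. open U \<Longrightarrow> U \<subseteq> ball z \<epsilon> \<Longrightarrow> open ((f ^^ m) ` U)"
   using iterate_local_homeo[OF plaque_noncritical[OF s(2) v(1)]] v(2) by blast
  have "continuous_on (ball 0 R) s" using s(2) by (simp add: section_over_def)
  hence "open (ball 0 R \<inter> s -` ball z \<epsilon>)" by (rule continuous_open_preimage) auto
  hence "open (s -` ball z \<epsilon> \<inter> ball 0 R)" by (simp add: Int_commute)
  moreover have "v \<in> s -` ball z \<epsilon> \<inter> ball 0 R" using v \<epsilon>(1) by simp
  ultimately obtain d where d: "d > 0" "ball v d \<subseteq> s -` ball z \<epsilon> \<inter> ball 0 R"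
   using open_contains_ball by blast
  define T where "T = ball z \<epsilon> \<inter> (f ^^ m) -` ball ((f ^^ m) z) d"
  have "open T" unfolding T_def using continuous_iterate[of UNIV m] by (intro open_Int open_vimage) auto
  moreover have "z \<in> T" using \<epsilon>(1) d(1) by (simp add: T_def)
  moreover have "T \<subseteq> W"
  proof
   fix w assume w: "w \<in> T"
   obtain u where u: "(f ^^ m) w = (f ^^ m) z + torus_of u" "norm u = dist ((f ^^ m) w) ((f ^^ m) z)"
    using torus_of_near by blast
   have "v + u \<in> ball v d" using u(2) w by (simp add: T_def dist_norm dist_commute)
   hence vu: "v + u \<in> ball 0 R" "s (v + u) \<in> ball z \<epsilon>" using d(2) by auto
   have "(f ^^ m) w = (f ^^ m) (s (v + u))"
    using fs[OF vu(1)] fs[OF v(1)] u(1) v(2) by (simp add: torus_of_add add.assoc)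
   hence "w = s (v + u)" using \<epsilon>(2) vu(2) w unfolding inj_on_def T_def by blast
   thus "w \<in> W" using s(1) vu(1) by blast
  qed
  ultimately show "\<exists>T. open T \<and> z \<in> T \<and> T \<subseteq> W" by blast
 qed
qed

lemma countable_plaques: "countable (plaques m y)"
proof -
 obtain D :: "'n torus set" where D: "countable D" "\<And>X. open X \<Longrightarrow> X \<noteq> {} \<Longrightarrow> \<exists>d\<in>D. d \<in> X"
  using countable_dense_exists by metis
 have ne: "W \<noteq> {}" if "W \<in> plaques m y" for W using that R(1) unfolding plaques_def by auto
 have "\<exists>d. d \<in> D \<and> d \<in> W" if "W \<in> plaques m y" for W
  using D(2)[OF plaque_open[OF that] ne[OF that]] by blast
 then obtain p where p: "\<And>W. W \<in> plaques m y \<Longrightarrow> p W \<in> D \<and> p W \<in> W" by metis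
 have "inj_on p (plaques m y)" using plaques_disjoint p by (intro inj_onI) (metis disjoint_iff)
 moreover have "p ` plaques m y \<subseteq> D" using p by blast
 ultimately show ?thesis using D(1) by (metis countable_image_inj_on countable_subset)
qed

lemma plaque_small:
 assumes "W \<in> plaques m y" "m \<ge> 1" "z \<in> W" "w \<in> W"
 shows "dist z w \<le> 2 * \<rho> * exp (- 3 * c * m / 4)"
proof -
 obtain x where x: "hyp m x" "W \<subseteq> shadow m x \<rho>" using assms(1) unfolding plaques_def section_over_def by blast
 have "dist u x \<le> \<rho> * exp (- 3 * c * m / 4)" if "u \<in> W" for u
 proof -
  have "u \<in> shadow m x \<rho>" "m \<in> {1..m}" using that x assms(2) by auto
  hence "dist ((f ^^ (m - m)) u) ((f ^^ (m - m)) x) \<le> \<rho> * exp (- 3 * c * m / 4)"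
   unfolding shadow_def by blast
  thus ?thesis by simp
 qed
 from this[OF assms(3)] this[OF assms(4)] show ?thesis using dist_triangle2[of z w x] by simp
qed

text \<open>The sum of the geometric series of distortions \<open>c / 4 * exp (- c * k / 8)\<close>
  over all \<open>k \<ge> 0\<close>: a bound for the logarithmic distortion of the jacobian that
  does not depend on \<open>m\<close>.\<close>

definition "\<Delta> = c / 4 / (1 - exp (- c / 8))"

lemma distortion_sum: "(\<Sum>k\<in>{1..m}. c / 4 * exp (- c * real k / 8)) \<le> \<Delta>"
proof -
 let ?q = "exp (- c / 8)"
 have q: "0 < ?q" "?q < 1" using c by auto
 have e: "exp (- c * real k / 8) = ?q ^ k" for k by (simp add: exp_of_nat_mult[symmetric] mult.commute)
 have "(\<Sum>k\<in>{1..m}. c / 4 * exp (- c * real k / 8)) = c / 4 * (\<Sum>k\<in>{1..m}. ?q ^ k)"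
  unfolding e sum_distrib_left ..
 also have "(\<Sum>k\<in>{1..m}. ?q ^ k) \<le> (\<Sum>k. ?q ^ k)"
  by (rule sum_le_suminf) (use q in \<open>auto simp: summable_geometric\<close>)
 also have "(\<Sum>k. ?q ^ k) = 1 / (1 - ?q)" using q by (intro suminf_geometric) auto
 finally show ?thesis using c by (simp add: \<Delta>_def mult_left_mono)
qed

lemma plaque_jacobian:
 assumes W: "W \<in> plaques m y"
 obtains A where "A > 0" "\<And>z. z \<in> W \<Longrightarrow> ennreal (A * exp (- \<Delta>)) \<le> (\<Prod>j<m. J ((f ^^ j) z))"
  "\<And>z. z \<in> W \<Longrightarrow> (\<Prod>j<m. J ((f ^^ j) z)) \<le> ennreal (A * exp \<Delta>)"
proof -
 obtain x where x: "hyp m x" "W \<subseteq> shadow m x \<rho>" using W unfolding plaques_def section_over_def by blast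
 define l where "l z = (\<Sum>j<m. ldet ((f ^^ j) z))" for z
 have prod: "(\<Prod>j<m. J ((f ^^ j) z)) = ennreal (exp (l z))" if "z \<in> shadow m x \<rho>" for z
 proof -
  have "J ((f ^^ j) z) = ennreal (exp (ldet ((f ^^ j) z)))" if "j < m" for j
   using shadow_noncritical[OF x(1) \<open>z \<in> _\<close> that] det_nonzero by (simp add: J_def)
  hence "(\<Prod>j<m. J ((f ^^ j) z)) = (\<Prod>j<m. ennreal (exp (ldet ((f ^^ j) z))))" by simp
  also have "\<dots> = ennreal (exp (l z))" by (simp add: prod_ennreal l_def exp_sum)
  finally show ?thesis .
 qed
 have diff: "\<bar>l x - l z\<bar> \<le> \<Delta>" if z: "z \<in> shadow m x \<rho>" for z
 proof -
  have "\<bar>l x - l z\<bar> \<le> (\<Sum>j<m. \<bar>ldet ((f ^^ j) x) - ldet ((f ^^ j) z)\<bar>)"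
   unfolding l_def sum_subtractf[symmetric] by (rule sum_abs)
  also have "\<dots> = (\<Sum>k\<in>{1..m}. \<bar>ldet ((f ^^ (m - k)) x) - ldet ((f ^^ (m - k)) z)\<bar>)"
   by (rule sum.reindex_bij_witness[of _ "\<lambda>k. m - k" "\<lambda>j. m - j"]) auto
  also have "\<dots> \<le> (\<Sum>k\<in>{1..m}. c / 4 * exp (- c * real k / 8))"
   by (intro sum_mono shadow_regular(3)[OF x(1) z])
  finally show ?thesis using distortion_sum by (rule order_trans)
 qed
 show thesis
 proof (rule that[of "exp (l x)"])
  fix z assume "z \<in> W"
  hence z: "z \<in> shadow m x \<rho>" using x(2) by blast
  show "ennreal (exp (l x) * exp (- \<Delta>)) \<le> (\<Prod>j<m. J ((f ^^ j) z))"
   unfolding prod[OF z] using diff[OF z] by (intro ennreal_leI) (simp flip: exp_add)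
  show "(\<Prod>j<m. J ((f ^^ j) z)) \<le> ennreal (exp (l x) * exp \<Delta>)"
   unfolding prod[OF z] using diff[OF z] by (intro ennreal_leI) (simp flip: exp_add)
 qed simp
qed

text \<open>On \<open>W\<close> the jacobian of \<open>f ^^ m\<close> varies at most by the factor
  \<open>exp (2 * \<Delta>)\<close>, so relative volumes in \<open>W\<close> and in
  \<open>ball y R\<close> agree up to this factor. Denominators are multiplied out.\<close>

lemma plaque_distortion:
 assumes W: "W \<in> plaques m y" and S [measurable]: "S \<in> sets borel"
 shows "vol (W \<inter> (f ^^ m) -` S) * vol (ball y R) \<le> exp (2 * \<Delta>) * vol W * vol (S \<inter> ball y R)"
  and "vol (S \<inter> ball y R) * vol W \<le> exp (2 * \<Delta>) * vol (ball y R) * vol (W \<inter> (f ^^ m) -` S)"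
proof -
 interpret prob_space leb by (rule prob_leb)
 obtain A where A: "A > 0" "\<And>z. z \<in> W \<Longrightarrow> ennreal (A * exp (- \<Delta>)) \<le> (\<Prod>j<m. J ((f ^^ j) z))"
  "\<And>z. z \<in> W \<Longrightarrow> (\<Prod>j<m. J ((f ^^ j) z)) \<le> ennreal (A * exp \<Delta>)"
  using plaque_jacobian[OF W] by blast
 have Wb [measurable]: "W \<in> sets borel" using plaque_open[OF W] by simp
 have nC: "(f ^^ j) z \<notin> C" if "z \<in> W" "j < m" for z j
  using W that plaque_noncritical unfolding plaques_def by blast
 have main: "A * exp (- \<Delta>) * vol (W \<inter> (f ^^ m) -` S) \<le> vol (S \<inter> ball y R) \<and>
  vol (S \<inter> ball y R) \<le> A * exp \<Delta> * vol (W \<inter> (f ^^ m) -` S)" if S [measurable]: "S \<in> sets borel" for S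
 proof -
  let ?W = "W \<inter> (f ^^ m) -` S"
  have Wb' [measurable]: "?W \<in> sets borel" using measurable_sets[OF measurable_iterate S, of m] by auto
  have "(f ^^ m) ` ?W = S \<inter> (f ^^ m) ` W" by auto
  hence img: "(f ^^ m) ` ?W = S \<inter> ball y R" using plaque_image(1)[OF W] by simp
  have inj: "inj_on (f ^^ m) ?W" using plaque_image(2)[OF W] by (rule inj_on_subset) auto
  have "\<forall>u\<in>borel_measurable borel. (\<integral>\<^sup>+y\<in>(f ^^ m) ` ?W. u y \<partial>leb)
   = (\<integral>\<^sup>+y. u ((f ^^ m) y) * (\<Prod>j<m. J ((f ^^ j) y)) * indicator ?W y \<partial>leb)"
   using nn_integral_substitution_iterate[OF Wb' _ inj] nC by blast
  from bspec[OF this, of "\<lambda>_. 1"]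
  have eq: "emeasure leb (S \<inter> ball y R) = (\<integral>\<^sup>+y. (\<Prod>j<m. J ((f ^^ j) y)) * indicator ?W y \<partial>leb)"
   by (simp add: img)
  have "ennreal (A * exp (- \<Delta>)) * emeasure leb ?W = (\<integral>\<^sup>+y. ennreal (A * exp (- \<Delta>)) * indicator ?W y \<partial>leb)"
   by (rule nn_integral_cmult_indicator[symmetric]) simp
  also have "\<dots> \<le> emeasure leb (S \<inter> ball y R)"
   unfolding eq by (intro nn_integral_mono) (use A(2) in \<open>auto simp: indicator_def\<close>)
  finally have 1: "ennreal (A * exp (- \<Delta>)) * emeasure leb ?W \<le> emeasure leb (S \<inter> ball y R)" .
  have "emeasure leb (S \<inter> ball y R) \<le> (\<integral>\<^sup>+y. ennreal (A * exp \<Delta>) * indicator ?W y \<partial>leb)"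
   unfolding eq by (intro nn_integral_mono) (use A(3) in \<open>auto simp: indicator_def\<close>)
  also have "\<dots> = ennreal (A * exp \<Delta>) * emeasure leb ?W" by (rule nn_integral_cmult_indicator) simp
  finally show ?thesis using 1 A(1) by (simp add: emeasure_eq_measure ennreal_mult'[symmetric] ennreal_le_iff)
 qed
 note S' = main[OF S] and U = main[of UNIV, simplified]
 let ?w = "vol (W \<inter> (f ^^ m) -` S)" and ?u = "vol (ball y R)" and ?s = "vol (S \<inter> ball y R)"
 have e: "exp (2 * \<Delta>) * (A * exp (- \<Delta>)) = A * exp \<Delta>" by (simp add: mult_exp_exp)
 have "(A * exp (- \<Delta>)) * (?w * ?u) \<le> ?s * (A * exp \<Delta> * vol W)"
  using mult_mono[OF conjunct1[OF S'] conjunct2[OF U]] A(1) by (simp add: mult_ac)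
 also have "\<dots> = (A * exp (- \<Delta>)) * (exp (2 * \<Delta>) * vol W * ?s)"
  unfolding e[symmetric] by (simp add: mult_ac)
 finally show "?w * ?u \<le> exp (2 * \<Delta>) * vol W * ?s" using A(1) by (simp add: mult_le_cancel_left_pos)
 have "(A * exp (- \<Delta>)) * (?s * vol W) \<le> (A * exp \<Delta> * ?w) * ?u"
  using mult_mono[OF conjunct2[OF S'] conjunct1[OF U]] A(1) by (simp add: mult_ac)
 also have "\<dots> = (A * exp (- \<Delta>)) * (exp (2 * \<Delta>) * ?u * ?w)"
  unfolding e[symmetric] by (simp add: mult_ac)
 finally show "?s * vol W \<le> exp (2 * \<Delta>) * ?u * ?w" using A(1) by (simp add: mult_le_cancel_left_pos)
qed

end

subsection \<open>The summability hypothesis forces the critical set to be empty\<close>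

lemma emeasure_lborel_ball_pos:
 assumes "r > 0" shows "emeasure lborel (ball (0::real^'n) r) > 0"
proof -
 have "ball (0::real^'n) r \<notin> null_sets lborel" using open_not_negligible[of "ball (0::real^'n) r"] assms
  by (auto simp: negligible_iff_null_sets dest: null_sets_completionI)
 thus ?thesis by (auto simp: null_sets_def zero_less_iff_neq_zero)
qed

context torus_map begin

text \<open>The summability hypothesis speaks of images. That these are Borel, and null for null
  sets, follows from the local substitution rule on countably many pieces.\<close>

lemma image_borel:
 assumes S: "S \<in> sets borel" "S \<inter> C = {}"
 shows "f ` S \<in> sets borel" and "emeasure leb S = 0 \<Longrightarrow> emeasure leb (f ` S) = 0"
proof -
 obtain P :: "nat \<Rightarrow> 'n torus set" where P: "(\<Union>k. P k) = S" "disjoint_family P" "\<And>k. P k \<in> sets borel" "\<And>k. f ` P k \<in> sets borel"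
  "\<And>k. emeasure leb (f ` P k) = (\<integral>\<^sup>+y\<in>P k. J y \<partial>leb)"
  by (rule substitution_pieces[OF S]) (rule that)
 have fS: "f ` S = (\<Union>k. f ` P k)" unfolding P(1)[symmetric] by (rule image_UN)
 show "f ` S \<in> sets borel" unfolding fS using P(4) by auto
 assume 0: "emeasure leb S = 0"
 have "f ` P k \<in> null_sets leb" for k
 proof -
  have "AE y in leb. y \<notin> S" by (rule AE_not_in) (use 0 S(1) in \<open>simp add: null_sets_def\<close>)
  hence "AE y in leb. J y * indicator (P k) y = 0" by eventually_elim (use P(1) in \<open>auto simp: indicator_def\<close>)
  thus ?thesis using P(4,5) by (simp add: null_sets_def nn_integral_cong_AE[of _ "\<lambda>_. 0"])
 qed
 hence "(\<Union>k. f ` P k) \<in> null_sets leb" by (intro null_sets_UN') auto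
 thus "emeasure leb (f ` S) = 0" unfolding fS by (simp add: null_sets_def)
qed

lemma iterate_image_borel:
 assumes "S \<in> sets borel" "\<And>z j. z \<in> S \<Longrightarrow> j < k \<Longrightarrow> (f ^^ j) z \<notin> C"
 shows "(f ^^ k) ` S \<in> sets borel \<and> (emeasure leb S = 0 \<longrightarrow> emeasure leb ((f ^^ k) ` S) = 0)"
 using assms(2)
proof (induction k)
 case 0 thus ?case using assms(1) by simp
next
 case (Suc k)
 have IH: "(f ^^ k) ` S \<in> sets borel" "emeasure leb S = 0 \<longrightarrow> emeasure leb ((f ^^ k) ` S) = 0"
  using Suc by auto
 have "(f ^^ k) ` S \<inter> C = {}" using Suc.prems[of _ k] by auto
 note img = image_borel[OF IH(1) this]
 have "(f ^^ Suc k) ` S = f ` (f ^^ k) ` S" by (simp add: image_comp)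
 thus ?case using img IH(2) by (simp del: funpow.simps)
qed

context
 fixes \<sigma> \<delta> :: real
 assumes \<sigma>: "0 < \<sigma>" "\<sigma> < 1" and \<delta>: "0 < \<delta>" "\<delta> < 1" and ne: "C \<noteq> {}"
begin

abbreviation "ht \<equiv> hyperbolic_time f \<beta> \<sigma> \<delta>"
abbreviation "rec_rate \<equiv> min (1 / 2) (1 / (2 * \<beta>))"

lemma hyperbolic_time_noncritical:
 assumes "ht x m" "j < m"
 shows "(f ^^ j) x \<notin> C" and "\<delta> * \<sigma> powr (rec_rate * real (m - j)) \<le> crit_dist ((f ^^ j) x)"
proof -
 have k: "1 \<le> m - j" "m - j \<le> m" "m - (m - j) = j" using assms(2) by auto
 have t: "\<sigma> powr (rec_rate * real (m - j)) \<le> truncated_dist \<delta> ((f ^^ j) x) C"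
  using assms(1) k unfolding hyperbolic_time_def by metis
 have pos: "0 < \<sigma> powr (rec_rate * real (m - j))" using \<sigma> by simp
 have "\<sigma> powr (rec_rate * real (m - j)) \<le> 1"
 proof -
  have "rec_rate \<ge> 0" using regular_if_critical(2)[OF ne] by simp
  hence "\<sigma> powr (rec_rate * real (m - j)) \<le> \<sigma> powr 0" using \<sigma> by (intro powr_mono') auto
  thus ?thesis using \<sigma> by simp
 qed
 hence b: "\<delta> * \<sigma> powr (rec_rate * real (m - j)) \<le> \<delta>" "\<delta> * \<sigma> powr (rec_rate * real (m - j)) \<le> \<sigma> powr (rec_rate * real (m - j))"
  using \<delta> pos by (auto simp: mult_left_le mult_le_cancel_right2)
 show "\<delta> * \<sigma> powr (rec_rate * real (m - j)) \<le> crit_dist ((f ^^ j) x)"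
  using b t ne by (auto simp: truncated_dist_def crit_dist_def split: if_splits)
 show "(f ^^ j) x \<notin> C"
 proof
  assume "(f ^^ j) x \<in> C"
  hence "infdist ((f ^^ j) x) C = 0" by simp
  thus False using t pos \<delta> ne by (simp add: truncated_dist_def)
 qed
qed

lemma hyperbolic_time_sum:
 assumes "ht x m" "k \<in> {1..m}"
 shows "(\<Sum>j = m - k..<m. lnorm ((f ^^ j) x)) \<le> k * ln \<sigma>"
proof -
 have pos: "0 < inv_norm f ((f ^^ j) x)" if "j \<in> {m - k..<m}" for j
  using hyperbolic_time_noncritical(1)[OF assms(1)] that by (intro inv_norm_pos) auto
 have "(\<Prod>j = m - k..<m. inv_norm f ((f ^^ j) x)) \<le> \<sigma> ^ k"
  using assms unfolding hyperbolic_time_def by auto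
 hence "ln (\<Prod>j = m - k..<m. inv_norm f ((f ^^ j) x)) \<le> ln (\<sigma> ^ k)"
  using pos by (intro ln_mono prod_pos) auto
 moreover have "ln (\<Prod>j = m - k..<m. inv_norm f ((f ^^ j) x)) = (\<Sum>j = m - k..<m. lnorm ((f ^^ j) x))"
  using pos by (intro ln_prod) (simp_all add: less_imp_neq[symmetric])
 ultimately show ?thesis using \<sigma> by (simp add: ln_realpow)
qed

definition "first n = first_hyperbolic_time f \<beta> \<sigma> \<delta> -` {enat n}"

lemma first_iff:
 "x \<in> first n \<longleftrightarrow> ht x n \<and> (\<forall>t<n. \<not> ht x t)"
proof -
 let ?A = "{m. ht x m}"
 show ?thesis
 proof (cases "?A = {}")
  case True
  thus ?thesis by (simp add: first_def first_hyperbolic_time_def Inf_enat_def)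
 next
  case False
  define l where "l = (LEAST m. m \<in> ?A)"
  have l: "l \<in> ?A" "\<And>m. m \<in> ?A \<Longrightarrow> l \<le> m"
   using False unfolding l_def by (metis LeastI ex_in_conv, metis Least_le)
  have "Inf (enat ` ?A) = enat l" by (rule antisym) (use l in \<open>auto intro!: Inf_lower Inf_greatest\<close>)
  hence "x \<in> first n \<longleftrightarrow> l = n" by (simp add: first_def first_hyperbolic_time_def)
  also have "\<dots> \<longleftrightarrow> n \<in> ?A \<and> (\<forall>t<n. t \<notin> ?A)"
   using l by (metis antisym not_le)
  finally show ?thesis by simp
 qed
qed

lemma hyperbolic_time_borel: "{x. ht x n} \<in> sets borel"
proof -
 define i where "i x = (if x \<in> - C then inv_norm f x else 1)" for x
 have [measurable]: "i \<in> borel_measurable borel"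
  unfolding i_def[abs_def] by (rule borel_measurable_off_closed[OF open_noncritical continuous_inv_norm])
 have [measurable]: "(\<lambda>x. truncated_dist \<delta> x C) \<in> borel_measurable borel"
 proof -
  have "truncated_dist \<delta> x C = (if crit_dist x < \<delta> then crit_dist x else 1)" for x
   using ne by (simp add: truncated_dist_def crit_dist_def)
  thus ?thesis by simp
 qed
 let ?ok = "\<lambda>x. 1 \<le> n \<and> (\<forall>k\<in>{1..n}. (f ^^ (n - k)) x \<notin> C \<and>
  (\<Prod>j=n-k..<n. i ((f ^^ j) x)) \<le> \<sigma> ^ k \<and> truncated_dist \<delta> ((f ^^ (n - k)) x) C \<ge> \<sigma> powr (rec_rate * real k))"
 have eq: "ht x n \<longleftrightarrow> ?ok x" for x
 proof -
  have p: "(\<Prod>j=n-k..<n. i ((f ^^ j) x)) = (\<Prod>j=n-k..<n. inv_norm f ((f ^^ j) x))" if "\<forall>j<n. (f ^^ j) x \<notin> C" for k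
   using that by (intro prod.cong) (auto simp: i_def)
  show ?thesis
  proof
   assume h: "ht x n"
   hence "\<forall>j<n. (f ^^ j) x \<notin> C" using hyperbolic_time_noncritical(1) by blast
   with h p show "?ok x" unfolding hyperbolic_time_def by auto
  next
   assume r: "?ok x"
   have "\<forall>j<n. (f ^^ j) x \<notin> C"
   proof (intro allI impI)
    fix j assume "j < n"
    hence "n - j \<in> {1..n}" "n - (n - j) = j" by auto
    thus "(f ^^ j) x \<notin> C" using r by metis
   qed
   with r p show "ht x n" unfolding hyperbolic_time_def by auto
  qed
 qed
 have "{x. ht x n} = {x\<in>space borel. ?ok x}" unfolding eq by simp
 also have "\<dots> \<in> sets borel" by measurable
 finally show ?thesis .
qed

lemma first_borel: "first n \<in> sets borel"
proof -
 have "first n = {x. ht x n} - (\<Union>t<n. {x. ht x t})" by (auto simp: first_iff)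
 also have "\<dots> \<in> sets borel" using hyperbolic_time_borel by auto
 finally show ?thesis .
qed

lemma hyperbolic_time_bounded:
 assumes ae: "AE x in leb. first_hyperbolic_time f \<beta> \<sigma> \<delta> x < \<infinity>"
  and sum: "(\<Sum>n. \<Sum>j<Suc n. emeasure leb ((f ^^ j) ` first (Suc n))) < \<infinity>"
 obtains \<kappa> where "\<kappa> > 0" "\<And>x. first_hyperbolic_time f \<beta> \<sigma> \<delta> x < \<infinity> \<Longrightarrow> \<kappa> \<le> crit_dist x"
proof -
 interpret prob_space leb by (rule prob_leb)
 \<comment> \<open>Origin of the constants: passing from a point of a plaque to its centre costs
   \<open>c / 4\<close> per step, and \<open>s - c / 4 = c\<close> for \<open>c = 4 * s / 5\<close>.
   As \<open>rec_rate\<close> and \<open>rec_rate * \<beta>\<close> are at most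
   \<open>1 / 2\<close>, both \<open>a\<close> and \<open>a * \<beta>\<close> are at most
   \<open>s / 2 = 5 * c / 8\<close>. The factor \<open>2 / 3\<close> in \<open>d\<close> makes up
   for the factor \<open>3 / 2\<close> by which the distance to \<open>C\<close> may change.\<close>
 define s where "s = - ln \<sigma>"
 define c where "c = 4 * s / 5"
 define a where "a = rec_rate * s"
 define d where "d = 2 * \<delta> / 3"
 define \<rho> where "\<rho> = Min {1 / 4, d / 4, c / 4 * d powr \<beta> / B}"
 have s: "s > 0" using \<sigma> by (simp add: s_def)
 have c: "c > 0" using s by (simp add: c_def)
 have d: "d > 0" using \<delta> by (simp add: d_def)
 have Bb: "B > 1" "\<beta> > 0" using regular_if_critical(1,2)[OF ne] .
 have rr: "rec_rate > 0" "rec_rate \<le> 1 / 2" "rec_rate * \<beta> \<le> 1 / 2"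
 proof -
  have "rec_rate * \<beta> \<le> 1 / (2 * \<beta>) * \<beta>" using Bb by (intro mult_right_mono) auto
  thus "rec_rate * \<beta> \<le> 1 / 2" using Bb by simp
 qed (use Bb in auto)
 have \<rho>: "0 < \<rho>" "\<rho> \<le> 1 / 4" "\<rho> \<le> d / 4" "\<rho> \<le> c / 4 * d powr \<beta> / B"
  using d c Bb by (auto simp: \<rho>_def)
 interpret hyperbolic f B \<beta> B \<beta> a c d \<rho>
 proof
  show "a \<le> 5 * c / 8" using mult_right_mono[OF rr(2), of s] s by (simp add: a_def c_def)
  show "a * \<beta> \<le> 5 * c / 8" using mult_right_mono[OF rr(3), of s] s by (simp add: a_def c_def mult_ac)
  show "B * (\<rho> / d powr \<beta>) \<le> c / 4" using \<rho>(4) Bb d by (simp add: field_simps)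
  show "a > 0" using rr s by (simp add: a_def)
  show "\<rho> < d / 2" using \<rho>(3) d by simp
 qed (use regular_if_critical[OF ne] Bb c d \<rho> in auto)
 have exp_a: "\<sigma> powr (rec_rate * real k) = exp (- a * k)" for k :: nat
  using \<sigma> by (simp add: powr_def a_def s_def mult_ac)
 \<comment> \<open>The transfer goes from the given constants at \<open>z\<close> to the weaker ones
   at \<open>x\<close>. So if \<open>m\<close> is the first time of \<open>x\<close> for the weaker
   constants, no point of its plaque has an earlier time for the given ones.\<close>
 have hyp_exact: "hyp t x" if h: "ht z t" and x: "hyp m x" and z: "z \<in> shadow m x \<rho>" and t: "t \<le> m" for t z m x
  unfolding hyp_def
 proof (intro ballI conjI)
  fix k assume k: "k \<in> {1..t}"
  have kk: "m - (m - (t - k)) = t - k" "m - (t - k) \<in> {1..m}" using k t by auto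
  note reg = shadow_regular[OF x z kk(2), unfolded kk(1)]
  show "(f ^^ (t - k)) x \<notin> C" using x kk unfolding hyp_def by metis
  have tk: "t - k < t" "t - (t - k) = k" using k by auto
  have "\<delta> * exp (- a * k) \<le> crit_dist ((f ^^ (t - k)) z)"
   using hyperbolic_time_noncritical(2)[OF h tk(1)] unfolding tk(2) exp_a .
  also have "\<dots> \<le> crit_dist ((f ^^ (t - k)) x) + dist ((f ^^ (t - k)) x) ((f ^^ (t - k)) z)"
   using ne infdist_triangle[of "(f ^^ (t - k)) z" C "(f ^^ (t - k)) x"] by (simp add: crit_dist_def dist_commute)
  also have "\<dots> \<le> 3 / 2 * crit_dist ((f ^^ (t - k)) x)" using reg(5) by simp
  finally show "d * exp (- a * k) \<le> crit_dist ((f ^^ (t - k)) x)" by (simp add: d_def)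
  have "(\<Sum>j = t - k..<t. lnorm ((f ^^ j) x)) \<le> (\<Sum>j = t - k..<t. lnorm ((f ^^ j) z) + c / 4)"
  proof (rule sum_mono)
   fix j assume j: "j \<in> {t - k..<t}"
   have "m - (m - j) = j" "m - j \<in> {1..m}" using j t by auto
   thus "lnorm ((f ^^ j) x) \<le> lnorm ((f ^^ j) z) + c / 4" using shadow_regular(4)[OF x z] by metis
  qed
  also have "\<dots> = (\<Sum>j = t - k..<t. lnorm ((f ^^ j) z)) + k * (c / 4)" using k by (simp add: sum.distrib)
  also have "\<dots> \<le> k * ln \<sigma> + k * (c / 4)" using hyperbolic_time_sum[OF h k] by simp
  also have "\<dots> = - c * k" by (simp add: c_def s_def algebra_simps)
  finally show "(\<Sum>j = t - k..<t. lnorm ((f ^^ j) x)) \<le> - c * k" .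
 qed
 have hyp_exact': "hyp t z" if h: "ht z t" for t z unfolding hyp_def
 proof (intro ballI conjI)
  fix k assume k: "k \<in> {1..t}"
  have tk: "t - k < t" "t - (t - k) = k" using k by auto
  show "(f ^^ (t - k)) z \<notin> C" by (rule hyperbolic_time_noncritical(1)[OF h tk(1)])
  have "d * exp (- a * k) \<le> \<delta> * exp (- a * k)" using \<delta> by (intro mult_right_mono) (auto simp: d_def)
  also have "\<dots> \<le> crit_dist ((f ^^ (t - k)) z)"
   using hyperbolic_time_noncritical(2)[OF h tk(1)] unfolding tk(2) exp_a .
  finally show "d * exp (- a * k) \<le> crit_dist ((f ^^ (t - k)) z)" .
  have "(\<Sum>j = t - k..<t. lnorm ((f ^^ j) z)) \<le> k * ln \<sigma>" by (rule hyperbolic_time_sum[OF h k])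
  also have "\<dots> \<le> - c * k"
  proof -
   have "k * (- s) \<le> k * (- c)" using s by (intro mult_left_mono) (auto simp: c_def)
   thus ?thesis by (simp add: s_def mult.commute)
  qed
  finally show "(\<Sum>j = t - k..<t. lnorm ((f ^^ j) z)) \<le> - c * k" .
 qed
 define u where "u = emeasure lborel (ball (0::real^'n) R)"
 have uball: "emeasure leb (ball y R) = u" for y unfolding u_def by (rule emeasure_torus_ball[OF R(2)])
 have u: "u > 0" using R(1) unfolding u_def by (simp add: emeasure_lborel_ball_pos)
 \<comment> \<open>A compact set that will contain \<open>S\<close> below: at time
   \<open>m - 1\<close> the centre of the plaque has distance at least \<open>d * exp (- a)\<close>
   to \<open>C\<close>, and its shadow at least half of that. It bounds the jacobian of the last
   step.\<close>
 define Kset where "Kset = {w. d / 2 * exp (- a) \<le> crit_dist w}"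
 have Kset: "compact Kset" "Kset \<subseteq> - C"
 proof -
  have "closed Kset" unfolding Kset_def by (intro closed_Collect_le continuous_intros continuous_crit_dist)
  thus "compact Kset" by (rule compact_if_closed)
  show "Kset \<subseteq> - C"
  proof
   fix w assume w: "w \<in> Kset"
   have "d / 2 * exp (- a) > 0" using d by simp
   hence "infdist w C \<noteq> 0" using w ne by (auto simp: Kset_def crit_dist_def)
   thus "w \<in> - C" by auto
  qed
 qed
 obtain Jm where Jm: "Jm > 0" "\<And>w. w \<in> Kset \<Longrightarrow> J w \<le> ennreal Jm"
 proof -
  have "compact ((\<lambda>x. \<bar>det (Df x)\<bar>) ` Kset)"
   using Kset continuous_on_subset[OF continuous_det_Df] by (intro compact_continuous_image) auto
  then obtain M where M: "\<And>w. w \<in> Kset \<Longrightarrow> \<bar>det (Df w)\<bar> \<le> M"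
   using compact_imp_bounded[THEN bounded_imp_bdd_above] unfolding bdd_above_def by (meson imageI)
  hence "J w \<le> ennreal (max M 1)" if "w \<in> Kset" for w
   using M[OF that] that Kset(2) by (auto simp: J_def le_max_iff_disj intro!: ennreal_leI)
  thus thesis by (intro that[of "max M 1"]) auto
 qed
 define g where "g n = (\<Sum>j<Suc n. emeasure leb ((f ^^ j) ` first (Suc n)))" for n
 have tail: "\<exists>N. \<forall>n\<ge>N. ennreal Jm * (\<Sum>i. g (i + n)) < u"
 proof -
  have fin: "g n < \<infinity>" for n unfolding g_def using emeasure_finite by (auto simp: less_top[symmetric])
  define g' where "g' n = enn2real (g n)" for n
  have gg: "g n = ennreal (g' n)" for n using fin[of n] by (simp add: g'_def less_top)
  have "(\<Sum>n. ennreal (g' n)) \<noteq> \<top>" using sum by (simp add: gg[symmetric] g_def less_top)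
  hence sm: "summable g'" by (rule summable_suminf_not_top[rotated]) (simp add: g'_def)
  define e where "e = measure lborel (ball (0::real^'n) R) / (2 * Jm)"
  have u': "u = ennreal (measure lborel (ball (0::real^'n) R))"
   unfolding u_def using emeasure_lborel_ball_finite by (intro emeasure_eq_ennreal_measure) (auto simp: less_top)
  have e: "0 < e" "Jm * e < measure lborel (ball (0::real^'n) R)" using u Jm(1) unfolding u' by (auto simp: e_def)
  obtain N where N: "\<And>n. n \<ge> N \<Longrightarrow> norm (\<Sum>i. g' (i + n)) < e"
   using suminf_exist_split[OF e(1) sm] by blast
  have "ennreal Jm * (\<Sum>i. g (i + n)) < u" if "n \<ge> N" for n
  proof -
   have "summable (\<lambda>i. g' (i + n))" using sm by (simp add: summable_iff_shift)
   hence "(\<Sum>i. g (i + n)) = ennreal (\<Sum>i. g' (i + n))"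
    unfolding gg by (intro suminf_ennreal2) (auto simp: g'_def)
   also have "\<dots> \<le> ennreal e" using N[OF that] by (intro ennreal_leI) auto
   finally have "ennreal Jm * (\<Sum>i. g (i + n)) \<le> ennreal Jm * ennreal e" by (rule mult_left_mono) simp
   also have "\<dots> < u" using e Jm(1) unfolding u' by (simp add: ennreal_mult[symmetric] ennreal_less_iff)
   finally show ?thesis .
  qed
  thus ?thesis by blast
 qed
 then obtain N where N: "\<And>n. n \<ge> N \<Longrightarrow> ennreal Jm * (\<Sum>i. g (i + n)) < u" by blast
 have bounded: "\<exists>t\<le>N. t \<ge> 1 \<and> hyp t z" if "first_hyperbolic_time f \<beta> \<sigma> \<delta> z < \<infinity>" for z
 proof (rule ccontr)
  assume no: "\<not> (\<exists>t\<le>N. t \<ge> 1 \<and> hyp t z)"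
  have "{m. ht z m} \<noteq> {}"
  proof
   assume "{m. ht z m} = {}"
   hence "first_hyperbolic_time f \<beta> \<sigma> \<delta> z = \<infinity>"
    unfolding first_hyperbolic_time_def by (simp only: image_empty) (simp add: Inf_enat_def)
   thus False using that by simp
  qed
  then obtain n0 where "ht z n0" by blast
  hence "n0 \<ge> 1 \<and> hyp n0 z" using hyp_exact' by (simp add: hyperbolic_time_def)
  define m where "m = (LEAST t. t \<ge> 1 \<and> hyp t z)"
  have m: "m \<ge> 1 \<and> hyp m z" unfolding m_def by (rule LeastI) fact
  have mmin: "m \<le> t" if "t \<ge> 1" "hyp t z" for t unfolding m_def by (rule Least_le) (use that in simp)
  have mN: "m > N" using no m by (meson not_le)
  define y where "y = (f ^^ m) z"
  obtain W where W: "W \<in> plaques m y" "z \<in> W" "W \<subseteq> shadow m z \<rho>"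
   using plaque_exists[of m z y] m R(1) by (auto simp: y_def)
  have late: "\<not> ht w t" if "w \<in> W" "t < m" for w t
  proof
   assume h: "ht w t"
   have "hyp t z" by (rule hyp_exact[OF h conjunct2[OF m]]) (use W(3) that in auto)
   thus False using mmin[of t] h that(2) by (auto simp: hyperbolic_time_def)
  qed
  have nC: "(f ^^ j) w \<notin> C" if "w \<in> W" "j < m" for w j
   using shadow_noncritical[OF conjunct2[OF m]] W(3) that by blast
  have Wb: "W \<in> sets borel" using plaque_open[OF W(1)] by simp
  \<comment> \<open>The iterate \<open>m - 1\<close> and not \<open>m\<close>: the series contains
    the images of the level set of \<open>n\<close> only under \<open>f ^^ j\<close> with
    \<open>j < n\<close>, and \<open>n = m\<close> has to be included. The missing step costs the
    factor \<open>Jm\<close>.\<close>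
  let ?F = "f ^^ (m - 1)" and ?E = "\<lambda>i. first (Suc (i + (m - 1)))"
  define S where "S = ?F ` W"
  have Sb: "S \<in> sets borel" unfolding S_def using iterate_image_borel[OF Wb, of "m - 1"] nC by simp
  have fm: "f (?F w) = (f ^^ m) w" for w using m by (cases m) auto
  have fS: "f ` S = ball y R" unfolding S_def image_image fm using plaque_image(1)[OF W(1)] by simp
  have injS: "inj_on f S"
   unfolding S_def by (rule inj_on_imageI) (use plaque_image(2)[OF W(1)] fm in \<open>simp add: inj_on_def\<close>)
  have SC: "S \<inter> C = {}" using nC[of _ "m - 1"] m unfolding S_def by auto
  have SK: "S \<subseteq> Kset"
  proof
   fix w assume "w \<in> S"
   then obtain z' where z': "z' \<in> W" "w = ?F z'" unfolding S_def by blast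
   have 1: "1 \<in> {1..m}" using m by auto
   have "d * exp (- a) \<le> crit_dist (?F z)" using m 1 unfolding hyp_def by force
   moreover have "dist (?F z) w < crit_dist (?F z) / 2"
    using shadow_regular(5)[OF conjunct2[OF m] _ 1] W(3) z' by blast
   moreover have "crit_dist (?F z) \<le> crit_dist w + dist (?F z) w"
    using ne infdist_triangle[of "?F z" C w] by (simp add: crit_dist_def)
   ultimately show "w \<in> Kset" by (simp add: Kset_def)
  qed
  have "u = (\<integral>\<^sup>+w\<in>S. J w \<partial>leb)"
   using substitution(2)[OF Sb SC injS] by (simp add: fS uball)
  also have "\<dots> \<le> (\<integral>\<^sup>+w\<in>S. ennreal Jm \<partial>leb)"
   by (intro nn_integral_mono) (use SK Jm(2) in \<open>auto simp: indicator_def\<close>)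
  also have "\<dots> = ennreal Jm * emeasure leb S" by (rule nn_integral_cmult_indicator) (use Sb in simp)
  finally have uS: "u \<le> ennreal Jm * emeasure leb S" .
  define Z where "Z = W - (\<Union>n. first n)"
  have Zb: "Z \<in> sets borel" using Wb first_borel by (auto simp: Z_def)
  have Z0: "emeasure leb Z = 0"
  proof -
   have "AE x in leb. x \<notin> Z" using ae by eventually_elim (auto simp: Z_def first_def)
   hence "Z \<in> null_sets leb" using Zb by (subst AE_iff_null_sets) simp_all
   thus ?thesis by (simp add: null_sets_def)
  qed
  have fZ: "?F ` Z \<in> null_sets leb"
   using iterate_image_borel[OF Zb, of "m - 1"] Z0 nC unfolding null_sets_def by (auto simp: Z_def)
  have ib: "?F ` ?E i \<in> sets borel" for i
  proof -
   have "(f ^^ j) w \<notin> C" if "w \<in> first (Suc (i + (m - 1)))" "j < m - 1" for w j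
    using that hyperbolic_time_noncritical(1)[of w "Suc (i + (m - 1))" j] by (auto simp: first_iff)
   thus ?thesis using iterate_image_borel[OF first_borel] by blast
  qed
  have "S \<subseteq> ?F ` Z \<union> (\<Union>i. ?F ` ?E i)"
  proof
   fix w assume "w \<in> S"
   then obtain z' where z': "z' \<in> W" "w = ?F z'" unfolding S_def by blast
   show "w \<in> ?F ` Z \<union> (\<Union>i. ?F ` ?E i)"
   proof (cases "z' \<in> Z")
    case False
    then obtain n where n: "z' \<in> first n" using z' by (auto simp: Z_def)
    hence "n \<ge> m" using late[OF z'(1)] by (auto simp: first_iff not_less[symmetric])
    hence "n = Suc ((n - m) + (m - 1))" using m by auto
    hence "z' \<in> first (Suc ((n - m) + (m - 1)))" using n by simp
    thus ?thesis using z'(2) by blast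
   qed (use z' in auto)
  qed
  hence "emeasure leb S \<le> emeasure leb (?F ` Z \<union> (\<Union>i. ?F ` ?E i))"
   by (rule emeasure_mono) (use fZ ib in \<open>auto simp: null_sets_def\<close>)
  also have "\<dots> = emeasure leb (\<Union>i. ?F ` ?E i)"
   using fZ ib by (subst Un_commute, intro emeasure_Un_null_set) auto
  also have "\<dots> \<le> (\<Sum>i. emeasure leb (?F ` ?E i))"
   by (rule emeasure_subadditive_countably) (use ib in auto)
  \<comment> \<open>Of each inner sum in the series only the term \<open>j = m - 1\<close> is
    used.\<close>
  also have "\<dots> \<le> (\<Sum>i. g (i + (m - 1)))"
   unfolding g_def by (intro suminf_le summableI member_le_sum) auto
  finally have "u \<le> ennreal Jm * (\<Sum>i. g (i + (m - 1)))"
   using uS by (meson mult_left_mono order_trans zero_le)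
  moreover have "m - 1 \<ge> N" using mN by simp
  ultimately show False using N[of "m - 1"] by (meson leD)
 qed
 show thesis
 proof (rule that[of "d * exp (- a * N)"])
  show "0 < d * exp (- a * N)" using d by simp
  fix x assume "first_hyperbolic_time f \<beta> \<sigma> \<delta> x < \<infinity>"
  then obtain t where t: "t \<le> N" "t \<ge> 1" "hyp t x" using bounded by blast
  have "a * t \<le> a * N" using t(1) rr s by (intro mult_left_mono) (auto simp: a_def)
  hence "d * exp (- a * N) \<le> d * exp (- a * t)" using d by simp
  also have "\<dots> \<le> crit_dist ((f ^^ (t - t)) x)" using t(2,3) unfolding hyp_def by (meson atLeastAtMost_iff order_refl)
  finally show "d * exp (- a * N) \<le> crit_dist x" by simp
 qed
qed

end

text \<open>Points with a hyperbolic time keep a fixed distance from \<open>C\<close>, so around a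
  critical point there would be a ball of positive volume without any of them.\<close>

theorem no_critical_points:
 assumes \<sigma>: "0 < \<sigma>" "\<sigma> < 1" and \<delta>: "0 < \<delta>" "\<delta> < 1"
  and ae: "AE x in leb. first_hyperbolic_time f \<beta> \<sigma> \<delta> x < \<infinity>"
  and sum: "(\<Sum>n. \<Sum>j<Suc n. emeasure leb ((f ^^ j) ` (first_hyperbolic_time f \<beta> \<sigma> \<delta> -` {enat (Suc n)}))) < \<infinity>"
 shows "C = {}"
proof (rule ccontr)
 assume ne: "C \<noteq> {}"
 obtain \<kappa> where \<kappa>: "\<kappa> > 0" "\<And>x. first_hyperbolic_time f \<beta> \<sigma> \<delta> x < \<infinity> \<Longrightarrow> \<kappa> \<le> crit_dist x"
  using hyperbolic_time_bounded[OF \<sigma> \<delta> ne ae] sum unfolding first_def[OF \<sigma> \<delta> ne] by blast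
 obtain p where p: "p \<in> C" using ne by blast
 have "AE x in leb. x \<notin> ball p (min \<kappa> (1 / 2))" using ae
 proof eventually_elim
  case (elim x)
  hence "\<kappa> \<le> infdist x C" using \<kappa>(2) ne by (simp add: crit_dist_def)
  also have "\<dots> \<le> dist x p" using p by (rule infdist_le)
  finally show ?case by (simp add: dist_commute)
 qed
 hence "ball p (min \<kappa> (1 / 2)) \<in> null_sets leb" by (subst (asm) AE_iff_null_sets[symmetric]) simp_all
 hence "emeasure leb (ball p (min \<kappa> (1 / 2))) = 0" by (simp add: null_sets_def)
 hence "emeasure lborel (ball (0::real^'n) (min \<kappa> (1 / 2))) = 0" by (subst (asm) emeasure_torus_ball) auto
 thus False using \<kappa>(1) emeasure_lborel_ball_pos[of "min \<kappa> (1 / 2)", where 'n = 'n] by simp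
qed

end

subsection \<open>Regularity of finite Borel measures\<close>

lemma vimage_funpow_eq: "f -` A = A \<Longrightarrow> (f ^^ m) -` A = A"
 by (induction m) (simp_all add: vimage_comp[symmetric])

lemma compact_in_open:
 fixes K :: "'a::heine_borel set"
 assumes "compact K" "open U" "K \<subseteq> U"
 obtains t where "t > 0" "\<And>x y. x \<in> K \<Longrightarrow> dist x y < t \<Longrightarrow> y \<in> U"
proof -
 have "closed (- U)" "K \<inter> - U = {}" using assms(2,3) by auto
 then obtain t where "t > 0" "\<forall>x\<in>K. \<forall>y\<in>- U. t \<le> dist x y" using separate_compact_closed[OF assms(1)] by blast
 thus thesis by (intro that[of t]) (auto simp: not_less[symmetric])
qed

lemma inner_approximation:
 fixes M :: "'a::{second_countable_topology, complete_space} measure"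
 assumes M: "finite_measure M" "sets M = sets borel" and A: "A \<in> sets borel" and e: "e > 0"
 obtains K where "compact K" "K \<subseteq> A" "measure M A < measure M K + e"
proof -
 interpret finite_measure M by fact
 show thesis
 proof (cases "measure M A < e")
  case True thus ?thesis by (intro that[of "{}"]) auto
 next
  case False
  hence pos: "measure M A > 0" using e by linarith
  have "ennreal (measure M A - e) < emeasure M A" using e pos by (simp add: emeasure_eq_measure ennreal_lessI)
  also have "\<dots> = (SUP K \<in> {K. K \<subseteq> A \<and> compact K}. emeasure M K)"
   by (rule inner_regular) (use M A in simp_all)
  finally obtain K where K: "K \<subseteq> A" "compact K" "ennreal (measure M A - e) < emeasure M K"
   by (auto simp: less_SUP_iff)
  thus ?thesis using False by (intro that[of K]) (auto simp: emeasure_eq_measure ennreal_less_iff)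
 qed
qed

lemma outer_approximation:
 fixes M :: "'a::{second_countable_topology, complete_space} measure"
 assumes M: "finite_measure M" "sets M = sets borel" and A: "A \<in> sets borel" and e: "e > 0"
 obtains U where "open U" "A \<subseteq> U" "measure M U < measure M A + e"
proof -
 interpret finite_measure M by fact
 have "(INF U \<in> {U. A \<subseteq> U \<and> open U}. emeasure M U) = emeasure M A"
  by (rule outer_regular[symmetric]) (use M A in simp_all)
 also have "\<dots> < ennreal (measure M A + e)" using e by (simp add: emeasure_eq_measure ennreal_less_iff)
 finally obtain U where "A \<subseteq> U" "open U" "emeasure M U < ennreal (measure M A + e)"
  by (auto simp: INF_less_iff)
 thus ?thesis by (intro that[of U]) (auto simp: emeasure_eq_measure ennreal_less_iff)
qed

lemma emeasure_UN_le:
 assumes "countable I" "\<And>i. i \<in> I \<Longrightarrow> X i \<in> sets M" "\<And>i. i \<in> I \<Longrightarrow> Y i \<in> sets M"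
  and "disjoint_family_on X I" "disjoint_family_on Y I"
  and le: "\<And>i. i \<in> I \<Longrightarrow> emeasure M (X i) \<le> c * emeasure M (Y i)"
 shows "emeasure M (\<Union>i\<in>I. X i) \<le> c * emeasure M (\<Union>i\<in>I. Y i)"
proof -
 have "emeasure M (\<Union>i\<in>I. X i) = (\<integral>\<^sup>+i. emeasure M (X i) \<partial>count_space I)"
  by (rule emeasure_UN_countable) (use assms in auto)
 also have "\<dots> \<le> (\<integral>\<^sup>+i. c * emeasure M (Y i) \<partial>count_space I)"
  by (intro nn_integral_mono) (use le in simp)
 also have "\<dots> = c * (\<integral>\<^sup>+i. emeasure M (Y i) \<partial>count_space I)"
  by (rule nn_integral_cmult) simp
 also have "(\<integral>\<^sup>+i. emeasure M (Y i) \<partial>count_space I) = emeasure M (\<Union>i\<in>I. Y i)"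
  by (rule emeasure_UN_countable[symmetric]) (use assms in auto)
 finally show ?thesis .
qed

subsection \<open>Hyperbolic times of bounded sequences\<close>

text \<open>A time at which the partial sums of \<open>a - c\<close> reach a new maximum is hyperbolic, and each such
 record increases the maximum by at most \<open>K\<close>.\<close>

lemma pliss:
 fixes a :: "nat \<Rightarrow> real"
 assumes K: "\<And>j. a j \<le> K" and c: "0 \<le> c" and K0: "0 \<le> K"
 shows "(\<Sum>j<n. a j - c) \<le> K * real (card {m\<in>{1..n}. \<forall>k\<in>{1..m}. c * k \<le> (\<Sum>j = m - k..<m. a j)})"
proof -
 define S where "S n = (\<Sum>j<n. a j - c)" for n
 define P where "P m \<longleftrightarrow> (\<forall>k\<in>{1..m}. c * k \<le> (\<Sum>j = m - k..<m. a j))" for m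
 have rec: "P m" if "\<And>i. i < m \<Longrightarrow> S i \<le> S m" for m unfolding P_def
 proof
  fix k assume k: "k \<in> {1..m}"
  have "S m = S (m - k) + (\<Sum>j = m - k..<m. a j - c)"
   unfolding S_def lessThan_atLeast0 by (rule sum.atLeastLessThan_concat[symmetric]) auto
  moreover have "S (m - k) \<le> S m" using that[of "m - k"] k by auto
  ultimately show "c * k \<le> (\<Sum>j = m - k..<m. a j)" using k by (simp add: sum_subtractf mult.commute)
 qed
 have "\<forall>i\<le>n. S i \<le> K * real (card {m\<in>{1..n}. P m})"
 proof (induction n)
  case 0 thus ?case using K0 by (simp add: S_def)
 next
  case (Suc n)
  let ?N = "\<lambda>n. card {m\<in>{1..n}. P m}"
  have mono: "?N n \<le> ?N (Suc n)" by (intro card_mono) auto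
  have old: "S i \<le> K * real (?N (Suc n))" if "i \<le> n" for i
   using Suc that mult_left_mono[OF of_nat_mono[OF mono] K0] by (meson order_trans)
  have "S (Suc n) \<le> K * real (?N (Suc n))"
  proof (cases "P (Suc n)")
   case True
   have "{m\<in>{1..Suc n}. P m} = insert (Suc n) {m\<in>{1..n}. P m}" using True by (auto simp: le_Suc_eq)
   hence N: "?N (Suc n) = Suc (?N n)" by simp
   have "S (Suc n) \<le> S n + K" using K[of n] c by (simp add: S_def)
   also have "\<dots> \<le> K * real (?N (Suc n))" using Suc N by (simp add: algebra_simps)
   finally show ?thesis .
  next
   case False
   then obtain i where "i < Suc n" "S (Suc n) < S i" using rec[of "Suc n"] by (meson not_le)
   thus ?thesis using old[of i] by simp
  qed
  thus ?case using old by (simp add: le_Suc_eq)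
 qed
 thus ?thesis unfolding S_def P_def by blast
qed

section \<open>Volume estimates from plaques\<close>

context hyperbolic begin

lemma plaque_cover:
 obtains Y where "finite Y" "Y \<noteq> {}" "(\<Union>y\<in>Y. ball y R) = (UNIV :: 'n torus set)"
  "\<And>m. H m \<subseteq> (\<Union>y\<in>Y. \<Union>W\<in>plaques m y. W)"
proof -
 obtain Y where Y: "finite Y" "(\<Union>y\<in>Y. ball y R) = (UNIV :: 'n torus set)"
  using finite_subcover_torus[of "\<lambda>x. ball x R"] R(1) by auto
 have "H m \<subseteq> (\<Union>y\<in>Y. \<Union>W\<in>plaques m y. W)" for m
 proof
  fix x assume "x \<in> H m"
  hence x: "hyp m x" by (simp add: H_def)
  obtain y where y: "y \<in> Y" "(f ^^ m) x \<in> ball y R" using Y(2) UNIV_I by blast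
  then obtain W where "W \<in> plaques m y" "x \<in> W" using plaque_exists[OF x] by blast
  thus "x \<in> (\<Union>y\<in>Y. \<Union>W\<in>plaques m y. W)" using y(1) by blast
 qed
 thus thesis using Y by (intro that[of Y]) auto
qed

definition "u = vol (ball (0::'n torus) R)"

lemma u: "u > 0" "vol (ball y R) = u"
proof -
 show "vol (ball y R) = u" for y unfolding u_def measure_def emeasure_torus_ball[OF R(2)] ..
 show "u > 0" unfolding u_def measure_def emeasure_torus_ball[OF R(2)]
  using emeasure_lborel_ball_pos[OF R(1), where 'n = 'n] emeasure_lborel_ball_finite[of "0::real^'n" R]
  by (simp add: enn2real_positive_iff)
qed

lemma disjoint_plaques:
 assumes "F \<subseteq> plaques m y" "\<And>W. X W \<subseteq> W" shows "disjoint_family_on X F"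
 unfolding disjoint_family_on_def
proof (intro ballI impI)
 fix W W' assume W: "W \<in> F" "W' \<in> F" "W \<noteq> W'"
 hence "W \<inter> W' = {}" using plaques_disjoint assms(1) by (meson subsetD)
 thus "X W \<inter> X W' = {}" using assms(2) by blast
qed

text \<open>In each plaque the proportion of points sent into \<open>S\<close> is at most
  \<open>exp (2 * \<Delta>)\<close> times the proportion of \<open>S\<close> in the ball below.
  Plaques over one ball are disjoint and finitely many balls suffice, so the constant is independent
  of \<open>m\<close>.\<close>

lemma hyperbolic_pushforward_le:
 obtains C0 where "C0 > 0" "\<And>m S. S \<in> sets borel \<Longrightarrow> vol (H m \<inter> (f ^^ m) -` S) \<le> C0 * vol S"
proof -
 interpret prob_space leb by (rule prob_leb)
 obtain Y where Y: "finite Y" "Y \<noteq> {}" "\<And>m. H m \<subseteq> (\<Union>y\<in>Y. \<Union>W\<in>plaques m y. W)"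
  using plaque_cover by metis
 let ?c = "exp (2 * \<Delta>) / u"
 have "vol (H m \<inter> (f ^^ m) -` S) \<le> card Y * ?c * vol S" if S [measurable]: "S \<in> sets borel" for m S
 proof -
  let ?T = "(f ^^ m) -` S"
  have T: "?T \<in> sets borel" using measurable_sets[OF measurable_iterate S, of m] by auto
  have Wb: "W \<in> sets borel" if "W \<in> plaques m y" for W y using plaque_open[OF that] by simp
  have UW: "(\<Union>W\<in>plaques m y. W \<inter> ?T) \<in> sets borel" for y
   using Wb T countable_plaques by (intro sets.countable_UN'') auto
  have "emeasure leb (\<Union>W\<in>plaques m y. W \<inter> ?T) \<le> ennreal (?c * vol S)" for y
  proof -
   have "emeasure leb (\<Union>W\<in>plaques m y. W \<inter> ?T) \<le> ennreal (?c * vol S) * emeasure leb (\<Union>W\<in>plaques m y. W)"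
   proof (rule emeasure_UN_le)
    fix W assume W: "W \<in> plaques m y"
    have "vol (W \<inter> ?T) * u \<le> exp (2 * \<Delta>) * vol W * vol (S \<inter> ball y R)"
     using plaque_distortion(1)[OF W S] unfolding u(2) .
    also have "\<dots> \<le> exp (2 * \<Delta>) * vol W * vol S"
     by (intro mult_left_mono finite_measure_mono) auto
    finally have "vol (W \<inter> ?T) \<le> ?c * vol S * vol W" using u(1) by (simp add: field_simps)
    thus "emeasure leb (W \<inter> ?T) \<le> ennreal (?c * vol S) * emeasure leb W"
     using u(1) by (simp add: emeasure_eq_measure ennreal_mult[symmetric] ennreal_leI)
   qed (use Wb T countable_plaques in \<open>auto intro!: disjoint_plaques\<close>)
   also have "\<dots> \<le> ennreal (?c * vol S) * 1" by (intro mult_left_mono emeasure_le_1) auto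
   finally show ?thesis by simp
  qed
  hence le: "vol (\<Union>W\<in>plaques m y. W \<inter> ?T) \<le> ?c * vol S" for y
   using u(1) by (simp add: emeasure_eq_measure)
  have "H m \<inter> ?T \<subseteq> (\<Union>y\<in>Y. \<Union>W\<in>plaques m y. W \<inter> ?T)" using Y(3) by fastforce
  hence "vol (H m \<inter> ?T) \<le> vol (\<Union>y\<in>Y. \<Union>W\<in>plaques m y. W \<inter> ?T)"
   using sets.finite_UN[OF Y(1) UW] by (intro finite_measure_mono) (simp_all del: UN_simps)
  also have "\<dots> \<le> (\<Sum>y\<in>Y. vol (\<Union>W\<in>plaques m y. W \<inter> ?T))"
   using UW Y(1) by (intro finite_measure_subadditive_finite) auto
  also have "\<dots> \<le> (\<Sum>y\<in>Y. ?c * vol S)" by (intro sum_mono le)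
  finally show ?thesis by simp
 qed
 moreover have "card Y * ?c > 0" using Y(1,2) u(1) by (simp add: card_gt_0_iff)
 ultimately show thesis by (intro that) auto
qed

text \<open>The argument of density points, with plaques in place of balls. For late
  \<open>m\<close> the plaques that meet a compact part of \<open>A\<close> lie in a thin
  neighbourhood of \<open>A\<close>, so one of them is almost filled by \<open>A\<close>. As
  \<open>A\<close> is invariant, bounded distortion shows that \<open>A\<close> fills more than half
  of the image ball; \<open>\<eta>\<close> is chosen to give this half.\<close>

lemma invariant_measure_ge:
 assumes A [measurable]: "A \<in> sets borel" and inv: "f -` A = A"
  and often: "\<And>A'. A' \<in> sets borel \<Longrightarrow> A' \<subseteq> A \<Longrightarrow> vol A' > 0 \<Longrightarrow> \<exists>\<tau>>0. \<forall>n. \<exists>m\<ge>n. \<tau> \<le> vol (A' \<inter> H m)"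
  and pos: "vol A > 0"
 shows "vol A \<ge> u / 2"
proof -
 interpret prob_space leb by (rule prob_leb)
 obtain Y where Y: "finite Y" "Y \<noteq> {}" "(\<Union>y\<in>Y. ball y R) = (UNIV :: 'n torus set)"
  using plaque_cover by metis
 have invm: "(f ^^ m) -` (- A) = - A" for m using inv by (intro vimage_funpow_eq) auto
 have "vol A / 2 > 0" using pos by simp
 then obtain A' where A': "compact A'" "A' \<subseteq> A" "vol A < vol A' + vol A / 2"
  by (rule inner_approximation[OF finite_measure_axioms sets_torus_lebesgue A]) auto
 have A'b [measurable]: "A' \<in> sets borel" using A'(1) by (simp add: compact_imp_closed)
 have "vol A' > 0" using A'(3) pos by simp
 from often[OF A'b A'(2) this]
 obtain \<tau> where \<tau>: "\<tau> > 0" "\<And>n. \<exists>m\<ge>n. \<tau> \<le> vol (A' \<inter> H m)" by blast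
 define \<tau>' where "\<tau>' = \<tau> / card Y"
 define \<eta> where "\<eta> = \<tau>' * exp (- 2 * \<Delta>) / 2"
 have cY: "card Y > 0" using Y by (simp add: card_gt_0_iff)
 have \<tau>': "\<tau>' > 0" using \<tau>(1) cY by (simp add: \<tau>'_def)
 have \<eta>: "\<eta> > 0" using \<tau>' by (simp add: \<eta>_def)
 obtain O' where O': "open O'" "A \<subseteq> O'" "vol O' < vol A + \<eta>"
  by (rule outer_approximation[OF finite_measure_axioms sets_torus_lebesgue A \<eta>])
 have "vol (O' - A) = vol O' - vol A" using O' by (intro finite_measure_Diff) auto
 hence OA: "vol (O' - A) < \<eta>" using O'(3) by simp
 obtain r where r: "r > 0" "\<And>x y. x \<in> A' \<Longrightarrow> dist x y < r \<Longrightarrow> y \<in> O'"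
  using compact_in_open[OF A'(1) O'(1)] A'(2) O'(2) by blast
 obtain m where m: "m \<ge> 1" "2 * \<rho> * exp (- 3 * c * m / 4) < r" "\<tau> \<le> vol (A' \<inter> H m)"
 proof -
  have "(\<lambda>m. 2 * \<rho> * exp (- 3 * c * real m / 4)) \<longlonglongrightarrow> 0" using c by real_asymp
  hence "\<forall>\<^sub>F m in sequentially. 2 * \<rho> * exp (- 3 * c * real m / 4) < r"
   using r(1) by (simp add: order_tendsto_iff)
  then obtain n where n: "\<And>m. m \<ge> n \<Longrightarrow> 2 * \<rho> * exp (- 3 * c * real m / 4) < r"
   unfolding eventually_sequentially by blast
  obtain m where "m \<ge> max n 1" "\<tau> \<le> vol (A' \<inter> H m)" using \<tau>(2) by blast
  thus thesis using n by (intro that[of m]) auto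
 qed
 have pb [measurable]: "(f ^^ m) -` ball y R \<in> sets borel" for y
  using measurable_sets[OF measurable_iterate, of "ball y R" m] by auto
 obtain y where y: "y \<in> Y" "\<tau>' \<le> vol (A' \<inter> H m \<inter> (f ^^ m) -` ball y R)"
 proof (rule ccontr)
  assume no: "\<not> thesis"
  have "A' \<inter> H m = (\<Union>y\<in>Y. A' \<inter> H m \<inter> (f ^^ m) -` ball y R)"
  proof -
   have "(\<Union>y\<in>Y. (f ^^ m) -` ball y R) = UNIV" unfolding vimage_UN[symmetric] Y(3) by simp
   thus ?thesis unfolding Int_UN_distrib[symmetric] by simp
  qed
  hence "\<tau> \<le> vol (\<Union>y\<in>Y. A' \<inter> H m \<inter> (f ^^ m) -` ball y R)" using m(3) by simp
  also have "\<dots> \<le> (\<Sum>y\<in>Y. vol (A' \<inter> H m \<inter> (f ^^ m) -` ball y R))"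
   using Y(1) by (intro finite_measure_subadditive_finite) auto
  also have "\<dots> < (\<Sum>y\<in>Y. \<tau>')" using no that Y by (intro sum_strict_mono) (auto simp: not_le[symmetric])
  also have "\<dots> = \<tau>" using cY by (simp add: \<tau>'_def)
  finally show False by simp
 qed
 define F where "F = {W\<in>plaques m y. W \<inter> A' \<noteq> {}}"
 have Fp: "W \<in> plaques m y" if "W \<in> F" for W using that by (simp add: F_def)
 have Fc: "countable F" unfolding F_def using countable_plaques by (rule countable_subset[rotated]) auto
 have Fb [measurable]: "W \<in> sets borel" if "W \<in> F" for W using plaque_open[OF Fp[OF that]] by simp
 have FU [measurable]: "(\<Union>W\<in>F. W) \<in> sets borel" by (intro sets.countable_UN'' Fc Fb)
 have "A' \<inter> H m \<inter> (f ^^ m) -` ball y R \<subseteq> (\<Union>W\<in>F. W)"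
 proof
  fix x assume x: "x \<in> A' \<inter> H m \<inter> (f ^^ m) -` ball y R"
  then obtain W where "W \<in> plaques m y" "x \<in> W" using plaque_exists[of m x y] by (auto simp: H_def)
  thus "x \<in> (\<Union>W\<in>F. W)" using x by (auto simp: F_def)
 qed
 hence "vol (A' \<inter> H m \<inter> (f ^^ m) -` ball y R) \<le> vol (\<Union>W\<in>F. W)"
  using FU by (intro finite_measure_mono) auto
 with y(2) have big: "\<tau>' \<le> vol (\<Union>W\<in>F. W)" by simp
 have FO: "W \<subseteq> O'" if WF: "W \<in> F" for W
 proof
  fix z assume z: "z \<in> W"
  obtain x where x: "x \<in> W" "x \<in> A'" using WF unfolding F_def by blast
  have "dist x z < r" using plaque_small[OF Fp[OF WF] m(1) x(1) z] m(2) by simp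
  thus "z \<in> O'" using r(2) x(2) by blast
 qed
 have "\<exists>W\<in>F. vol (W - A) * \<tau>' < \<eta> * vol W"
 proof (rule ccontr)
  assume no: "\<not> (\<exists>W\<in>F. vol (W - A) * \<tau>' < \<eta> * vol W)"
  have "emeasure leb (\<Union>W\<in>F. W) \<le> ennreal (\<tau>' / \<eta>) * emeasure leb (\<Union>W\<in>F. W - A)"
  proof (rule emeasure_UN_le)
   fix W assume W: "W \<in> F"
   hence "\<eta> * vol W \<le> vol (W - A) * \<tau>'" using no by (auto simp: not_less)
   hence "vol W \<le> \<tau>' / \<eta> * vol (W - A)" using \<eta> by (simp add: field_simps)
   thus "emeasure leb W \<le> ennreal (\<tau>' / \<eta>) * emeasure leb (W - A)"
    using \<eta> \<tau>' by (simp add: emeasure_eq_measure ennreal_mult[symmetric] ennreal_leI)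
  qed (use Fc Fb in \<open>auto simp: F_def intro!: disjoint_plaques\<close>)
  hence "vol (\<Union>W\<in>F. W) \<le> \<tau>' / \<eta> * vol (\<Union>W\<in>F. W - A)"
   using \<eta> \<tau>' by (simp add: emeasure_eq_measure ennreal_mult[symmetric])
  also have "(\<Union>W\<in>F. W - A) \<subseteq> O' - A" using FO by auto
  hence "\<tau>' / \<eta> * vol (\<Union>W\<in>F. W - A) \<le> \<tau>' / \<eta> * vol (O' - A)"
   using \<eta> \<tau>' O'(1) by (intro mult_left_mono finite_measure_mono) auto
  also have "\<dots> < \<tau>' / \<eta> * \<eta>" using OA \<eta> \<tau>' by (intro mult_strict_left_mono) auto
  finally show False using big \<eta> by simp
 qed
 then obtain W where W: "W \<in> F" "vol (W - A) * \<tau>' < \<eta> * vol W" by blast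
 have Wp: "vol W > 0"
  using W(2) \<tau>' \<eta> by (metis measure_nonneg mult_nonneg_nonneg mult_zero_right less_le not_less)
 have "vol (- A \<inter> ball y R) * vol W \<le> exp (2 * \<Delta>) * u * vol (W - A)"
  using plaque_distortion(2)[OF Fp[OF W(1)], of "- A"] unfolding invm u(2) by (simp add: Diff_eq)
 also have "\<dots> < exp (2 * \<Delta>) * u * (\<eta> / \<tau>' * vol W)"
  using W(2) \<tau>' u(1) by (intro mult_strict_left_mono) (auto simp: field_simps)
 also have "\<dots> = u / 2 * vol W" using \<tau>' by (simp add: \<eta>_def exp_minus field_simps)
 finally have "vol (- A \<inter> ball y R) < u / 2" using Wp by simp
 moreover have "u = vol (A \<inter> ball y R) + vol (- A \<inter> ball y R)" unfolding u(2)[of y, symmetric]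
  by (subst finite_measure_Union[symmetric]) (auto intro!: arg_cong[of _ _ "vol"])
 moreover have "vol (A \<inter> ball y R) \<le> vol A" by (intro finite_measure_mono) auto
 ultimately show ?thesis by simp
qed

end

context torus_map begin

text \<open>After this, the geometry of \<open>f\<close> enters through the sets \<open>H m\<close>
  of points with hyperbolic time \<open>m\<close>. The lemma of Pliss bounds the frequency of these
  times from below by \<open>\<theta>\<close> at almost every point, and integration over
  \<open>A\<close> gives the claim on volumes.\<close>

lemma hyperbolic_sets:
 assumes empty: "C = {}" and nue: "nonuniformly_expanding f"
 obtains H :: "nat \<Rightarrow> 'n torus set" and \<theta> C0 c0 :: real
 where "\<And>m. H m \<in> sets borel" "\<theta> > 0" "C0 > 0" "c0 > 0"
  "\<And>A \<kappa>. A \<in> sets borel \<Longrightarrow> \<kappa> < vol A \<Longrightarrow>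
   \<forall>\<^sub>F n in sequentially. \<theta> * \<kappa> * n \<le> (\<Sum>m\<in>{1..n}. vol (A \<inter> H m))"
  "\<And>m S. S \<in> sets borel \<Longrightarrow> vol (H m \<inter> (f ^^ m) -` S) \<le> C0 * vol S"
  "\<And>A. A \<in> sets borel \<Longrightarrow> f -` A = A \<Longrightarrow> vol A > 0 \<Longrightarrow> vol A \<ge> c0"
proof -
 interpret prob_space leb by (rule prob_leb)
 have cd: "crit_dist x = 1" for x using empty by (simp add: crit_dist_def)
 obtain K where Kp: "K > 0" "\<And>x. - lnorm x \<le> K"
  "\<And>x y. \<bar>lnorm x - lnorm y\<bar> \<le> K * dist x y"
  "\<And>x y. \<bar>ldet x - ldet y\<bar> \<le> K * dist x y"
  using regular_if_no_critical[OF empty] by blast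
 obtain c1 where c1: "c1 > 0" "AE x in leb. limsup (\<lambda>m. (\<Sum>j<m. log_inv_norm f ((f ^^ j) x)) / ereal (real m)) \<le> ereal (- c1)"
  using nue unfolding nonuniformly_expanding_def by blast
 \<comment> \<open>Half of the rate \<open>c1\<close>. The averages are eventually above
   \<open>3 * c1 / 4\<close>, so an excess of \<open>c1 / 4\<close> per step remains, and each
   hyperbolic time accounts for at most \<open>K\<close> of it. This is the origin of
   \<open>\<theta>\<close>.\<close>
 define c where "c = c1 / 2"
 define \<rho> where "\<rho> = min (1 / 4) (c / (4 * K))"
 have c: "c > 0" using c1 by (simp add: c_def)
 have \<rho>: "0 < \<rho>" "\<rho> \<le> 1 / 4" "K * \<rho> \<le> c / 4"
 proof -
  show "0 < \<rho>" "\<rho> \<le> 1 / 4" using c Kp(1) by (auto simp: \<rho>_def)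
  have "\<rho> \<le> c / (4 * K)" by (simp add: \<rho>_def)
  thus "K * \<rho> \<le> c / 4" using Kp(1) by (simp add: field_simps)
 qed
 interpret hyperbolic f B \<beta> K 1 "5 * c / 8" c 1 \<rho>
  by unfold_locales (use Kp c \<rho> in \<open>auto simp: cd\<close>)
 define \<theta> where "\<theta> = c1 / (4 * K)"
 have \<theta>: "\<theta> > 0" using c1 Kp(1) by (simp add: \<theta>_def)
 define cnt where "cnt n x = (\<Sum>m\<in>{1..n}. indicator (H m) x :: real)" for n x
 have cnt_meas [measurable]: "cnt n \<in> borel_measurable borel" for n unfolding cnt_def[abs_def] by measurable
 have freq: "AE x in leb. \<forall>\<^sub>F n in sequentially. \<theta> * n \<le> cnt n x" using c1(2)
 proof eventually_elim
  case (elim x)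
  have s: "(\<Sum>j<m. log_inv_norm f ((f ^^ j) x)) = ereal (\<Sum>j<m. lnorm ((f ^^ j) x))" for m
   using empty by (simp add: log_inv_norm_def)
  have "limsup (\<lambda>m. (\<Sum>j<m. log_inv_norm f ((f ^^ j) x)) / ereal (real m)) < ereal (- (3 * c1 / 4))"
   by (rule le_less_trans[OF elim]) (use c1 in simp)
  from Limsup_lessD[OF this] eventually_gt_at_top[of 0] show ?case
  proof eventually_elim
   case (elim n)
   have "(\<Sum>j<n. lnorm ((f ^^ j) x)) < - (3 * c1 / 4) * n" using elim unfolding s by (simp add: field_simps)
   hence sum: "3 * c1 / 4 * n \<le> (\<Sum>j<n. - lnorm ((f ^^ j) x))" by (simp add: sum_negf)
   have "c1 / 4 * n \<le> (\<Sum>j<n. - lnorm ((f ^^ j) x) - c)"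
    using sum by (simp add: sum_subtractf) (simp add: c_def field_simps)
   also have "\<dots> \<le> K * real (card {m\<in>{1..n}. \<forall>k\<in>{1..m}. c * k \<le> (\<Sum>j = m - k..<m. - lnorm ((f ^^ j) x))})"
    by (rule pliss) (use Kp(1) c in \<open>auto intro: Kp(2)\<close>)
   also have "{m\<in>{1..n}. \<forall>k\<in>{1..m}. c * k \<le> (\<Sum>j = m - k..<m. - lnorm ((f ^^ j) x))} = {1..n} \<inter> {m. x \<in> H m}"
    using empty c unfolding H_def hyp_def cd by (auto simp: sum_negf)
   also have "real (card \<dots>) = cnt n x" unfolding cnt_def by (simp add: indicator_def sum.If_cases)
   finally show ?case using Kp(1) by (simp add: \<theta>_def field_simps)
  qed
 qed
 have HS1: "\<forall>\<^sub>F n in sequentially. \<theta> * \<kappa> * n \<le> (\<Sum>m\<in>{1..n}. vol (A \<inter> H m))"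
  if A [measurable]: "A \<in> sets borel" and \<kappa>: "\<kappa> < vol A" for A \<kappa>
 proof -
  \<comment> \<open>The time from which the frequency bound holds depends on the point. The sets
    \<open>X N\<close> where it holds from \<open>N\<close> on exhaust \<open>A\<close> up to a null
    set, so one of them has volume above \<open>\<kappa>\<close>.\<close>
  define X where "X N = {x\<in>A. \<forall>n\<ge>N. \<theta> * n \<le> cnt n x}" for N
  have Xm [measurable]: "X N \<in> sets borel" for N
  proof -
   have "X N = {x\<in>space borel. x \<in> A \<and> (\<forall>n\<ge>N. \<theta> * n \<le> cnt n x)}" by (simp add: X_def)
   also have "\<dots> \<in> sets borel" by measurable
   finally show ?thesis .
  qed
  have "incseq X" unfolding incseq_def X_def by auto
  hence "(\<lambda>N. vol (X N)) \<longlonglongrightarrow> vol (\<Union>N. X N)"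
   by (intro finite_Lim_measure_incseq) auto
  also have "vol (\<Union>N. X N) = vol A"
   by (rule finite_measure_eq_AE) (use freq in \<open>auto simp: X_def eventually_sequentially elim!: eventually_mono\<close>)
  finally have "\<forall>\<^sub>F N in sequentially. \<kappa> < vol (X N)" by (rule order_tendstoD(1)[OF _ \<kappa>])
  then obtain N where N: "\<kappa> < vol (X N)" by (auto dest!: eventually_happens)
  show ?thesis unfolding eventually_sequentially
  proof (intro exI allI impI)
   fix n assume n: "n \<ge> N"
   have "\<theta> * \<kappa> * n \<le> (\<theta> * n) * vol (X N)"
    using mult_left_mono[of \<kappa> "vol (X N)" "\<theta> * n"] N \<theta> by (simp add: mult_ac)
   also have "\<dots> = (\<integral>x. \<theta> * n * indicator (X N) x \<partial>leb)" by simp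
   also have "\<dots> \<le> (\<integral>x. (\<Sum>m\<in>{1..n}. indicator (A \<inter> H m) x) \<partial>leb)"
   proof (rule integral_mono)
    fix x
    have "\<theta> * n \<le> (\<Sum>m\<in>{1..n}. indicator (A \<inter> H m) x)" if "x \<in> X N"
     using that n by (auto simp: X_def cnt_def indicator_inter_arith)
    thus "\<theta> * n * indicator (X N) x \<le> (\<Sum>m\<in>{1..n}. indicator (A \<inter> H m) x)"
     by (auto simp: indicator_def intro!: sum_nonneg)
   qed (auto intro!: integrable_real_indicator simp: less_top[symmetric])
   also have "\<dots> = (\<Sum>m\<in>{1..n}. vol (A \<inter> H m))"
    by (subst Bochner_Integration.integral_sum) (auto intro!: integrable_real_indicator simp: less_top[symmetric])
   finally show "\<theta> * \<kappa> * n \<le> (\<Sum>m\<in>{1..n}. vol (A \<inter> H m))" .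
  qed
 qed
 have often: "\<exists>\<tau>>0. \<forall>n. \<exists>m\<ge>n. \<tau> \<le> vol (A \<inter> H m)"
  if A: "A \<in> sets borel" "vol A > 0" for A
 proof (intro exI[of _ "\<theta> * vol A / 4"] conjI allI)
  define \<tau> where "\<tau> = \<theta> * vol A / 4"
  show "\<theta> * vol A / 4 > 0" using \<theta> A by simp
  fix n show "\<exists>m\<ge>n. \<theta> * vol A / 4 \<le> vol (A \<inter> H m)"
  proof (rule ccontr)
   assume no: "\<not> ?thesis"
   have "vol A / 2 < vol A" using A(2) by simp
   note HS1[OF A(1) this]
   moreover have "\<forall>\<^sub>F N in sequentially. n / \<tau> < real N"
    using filterlim_real_sequentially unfolding filterlim_at_top_dense by blast
   ultimately have "\<forall>\<^sub>F N in sequentially. \<theta> * (vol A / 2) * N \<le> (\<Sum>m\<in>{1..N}. vol (A \<inter> H m)) \<and> n / \<tau> < real N"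
    by (rule eventually_conj)
   then obtain N where "\<theta> * (vol A / 2) * N \<le> (\<Sum>m\<in>{1..N}. vol (A \<inter> H m)) \<and> n / \<tau> < real N"
    using eventually_happens'[OF sequentially_bot] by blast
   hence N: "2 * \<tau> * N \<le> (\<Sum>m\<in>{1..N}. vol (A \<inter> H m))" "real N > n / \<tau>"
    by (auto simp: \<tau>_def)
   have "\<tau> > 0" using \<theta> A by (simp add: \<tau>_def)
   have "(\<Sum>m\<in>{1..N}. vol (A \<inter> H m)) \<le> (\<Sum>m\<in>{1..N}. (if m < n then 1 else 0) + \<tau>)"
   proof (rule sum_mono)
    fix m show "vol (A \<inter> H m) \<le> (if m < n then 1 else 0) + \<tau>"
    proof (cases "m < n")
     case True thus ?thesis using \<open>\<tau> > 0\<close> by (simp add: add_increasing2)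
    next
     case False
     hence "vol (A \<inter> H m) < \<tau>" using no unfolding \<tau>_def by (meson not_le)
     thus ?thesis using False by simp
    qed
   qed
   also have "\<dots> = card {m\<in>{1..N}. m < n} + \<tau> * N" by (simp add: sum.distrib sum.If_cases Int_def conj_commute)
   also have "card {m\<in>{1..N}. m < n} \<le> card {..<n}" by (intro card_mono) auto
   finally have "2 * \<tau> * N \<le> n + \<tau> * N" using N(1) by simp
   thus False using N(2) \<open>\<tau> > 0\<close> by (simp add: field_simps)
  qed
 qed
 obtain C0 where C0: "C0 > 0" "\<And>m S. S \<in> sets borel \<Longrightarrow> vol (H m \<inter> (f ^^ m) -` S) \<le> C0 * vol S"
  using hyperbolic_pushforward_le by blast
 show thesis
 proof (rule that[of H \<theta> C0 "u / 2"])
  show "u / 2 \<le> vol A" if "A \<in> sets borel" "f -` A = A" "vol A > 0" for A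
   by (rule invariant_measure_ge[OF that(1,2) _ that(3)]) (use often in blast)
 qed (use \<theta> C0 u HS1 in auto)
qed

end

subsection \<open>Limits of set functions and invariant measures\<close>

text \<open>Tychonoff's theorem. In the application the indices are all sets of points, which are
  uncountably many, so a convergent subsequence need not exist and a filter takes its place.\<close>

lemma pointwise_cluster:
 fixes X :: "nat \<Rightarrow> 'i \<Rightarrow> real"
 assumes "\<And>n i. X n i \<in> {0..1}"
 obtains G x where "G \<le> sequentially" "G \<noteq> bot" "\<And>i. ((\<lambda>n. X n i) \<longlongrightarrow> x i) G"
proof -
 have "compactin (product_topology (\<lambda>_. euclidean) UNIV) (PiE UNIV (\<lambda>_::'i. {0..1::real}))"
  by (simp add: compactin_PiE)
 hence K: "compact (PiE UNIV (\<lambda>_::'i. {0..1::real}))"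
  by (metis compactin_euclidean_iff euclidean_product_topology)
 let ?F = "filtermap X sequentially"
 have "?F \<noteq> bot" by (simp add: filtermap_bot_iff)
 moreover have "eventually (\<lambda>x. x \<in> PiE UNIV (\<lambda>_::'i. {0..1::real})) ?F"
  using assms by (auto simp: eventually_filtermap PiE_def)
 ultimately obtain x where x: "inf (nhds x) ?F \<noteq> bot" using K unfolding compact_filter by blast
 define G where "G = inf sequentially (filtercomap X (nhds x))"
 show thesis
 proof
  show "G \<le> sequentially" by (simp add: G_def)
  show "G \<noteq> bot"
  proof
   assume "G = bot"
   hence "eventually (\<lambda>_. False) G" by simp
   then obtain P Q where PQ: "eventually P sequentially" "eventually Q (filtercomap X (nhds x))" "\<And>n. P n \<Longrightarrow> Q n \<Longrightarrow> False"
    unfolding G_def eventually_inf by blast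
   obtain U where U: "eventually U (nhds x)" "\<And>n. U (X n) \<Longrightarrow> Q n"
    using PQ(2) unfolding eventually_filtercomap by blast
   have "eventually (\<lambda>y. \<not> U y) ?F"
    unfolding eventually_filtermap using PQ(1) by (rule eventually_mono) (use PQ(3) U(2) in blast)
   hence "eventually (\<lambda>_. False) (inf (nhds x) ?F)" unfolding eventually_inf using U(1) by blast
   thus False using x by (simp add: eventually_False)
  qed
  fix i
  have "filterlim X (nhds x) G" unfolding G_def filterlim_def
   by (rule order_trans[OF filtermap_mono[OF inf_le2] filtermap_filtercomap])
  thus "((\<lambda>n. X n i) \<longlongrightarrow> x i) G"
   using continuous_on_tendsto_compose[OF continuous_on_product_coordinates[of i]] by simp
 qed
qed

text \<open>Caratheodory's construction. The infimum over countable measurable covers is the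
  countably additive part of \<open>m\<close>, that is the largest measure below
  \<open>m\<close>.\<close>

lemma outer_measure_of_additive:
 fixes m :: "'a set \<Rightarrow> real"
 assumes nn: "\<And>S. S \<in> sets N \<Longrightarrow> 0 \<le> m S"
  and add: "\<And>S T. S \<in> sets N \<Longrightarrow> T \<in> sets N \<Longrightarrow> S \<inter> T = {} \<Longrightarrow> m (S \<union> T) = m S + m T"
 obtains \<mu> where "sets \<mu> = sets N" "\<And>S. S \<in> sets N \<Longrightarrow> emeasure \<mu> S = outer_measure (sets N) (\<lambda>S. ennreal (m S)) S"
proof -
 let ?f = "\<lambda>S. ennreal (m S)" and ?O = "outer_measure (sets N) (\<lambda>S. ennreal (m S))"
 have pos: "positive (sets N) ?f" using add[of "{}" "{}"] by (simp add: positive_def)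
 have addf: "additive (sets N) ?f" unfolding additive_def using add nn by simp
 have inc: "increasing (sets N) ?f"
  by (rule ring_of_sets.additive_increasing[OF _ pos addf]) (rule sets.ring_of_sets_axioms)
 have "measure_space (space N) (lambda_system (space N) (Pow (space N)) ?O) ?O"
  by (rule sigma_algebra.caratheodory_lemma[OF sigma_algebra_Pow])
   (rule sets.outer_measure_space_outer_measure[OF pos inc])
 moreover have "sets N \<subseteq> lambda_system (space N) (Pow (space N)) ?O"
  by (rule sets.algebra_subset_lambda_system[OF pos inc addf])
 ultimately have ms: "measure_space (space N) (sets N) ?O" by (rule measure_down[OF _ sets.sigma_algebra_axioms])
 show thesis
 proof
  show "sets (measure_of (space N) (sets N) ?O) = sets N" by simp
  show "emeasure (measure_of (space N) (sets N) ?O) S = ?O S" if "S \<in> sets N" for S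
   using ms that by (intro emeasure_measure_of_sigma) (auto simp: measure_space_def)
 qed
qed

text \<open>If \<open>Y\<close> is a Hahn set of the difference \<open>w\<close> of the measures, then the preimages of \<open>Y\<close> differ
 from \<open>Y\<close> by \<open>w\<close>-null sets only, and the points which are eventually in \<open>Y\<close> form an invariant set.\<close>

lemma invariant_measures_eq:
 fixes f :: "'a::topological_space \<Rightarrow> 'a"
 assumes MN: "finite_measure M" "finite_measure N" "sets M = sets borel" "sets N = sets borel"
  and f [measurable]: "f \<in> borel_measurable borel"
  and invM: "\<And>A. A \<in> sets borel \<Longrightarrow> measure M (f -` A) = measure M A"
  and invN: "\<And>A. A \<in> sets borel \<Longrightarrow> measure N (f -` A) = measure N A"
  and eq: "\<And>A. A \<in> sets borel \<Longrightarrow> f -` A = A \<Longrightarrow> measure M A = measure N A"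
 shows "M = N"
proof -
 interpret M: finite_measure M by fact
 interpret N: finite_measure N by fact
 note [simp, measurable_cong] = MN(3,4)
 define w where "w A = measure M A - measure N A" for A
 have split: "w A = w (A \<inter> B) + w (A - B)" if "A \<in> sets borel" "B \<in> sets borel" for A B
 proof -
  have "measure M A = measure M (A \<inter> B) + measure M (A - B)" "measure N A = measure N (A \<inter> B) + measure N (A - B)"
   using that by (auto simp: M.finite_measure_Diff' N.finite_measure_Diff')
  thus ?thesis by (simp add: w_def)
 qed
 obtain Y where Y: "Y \<in> sets borel" "\<And>X. X \<in> sets borel \<Longrightarrow> X \<subseteq> Y \<Longrightarrow> 0 \<le> w X" "\<And>X. X \<in> sets borel \<Longrightarrow> X \<inter> Y = {} \<Longrightarrow> w X \<le> 0"
  using finite_unsigned_Hahn_decomposition[OF MN(1,2)]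
  unfolding w_def by (auto simp: M.emeasure_eq_measure N.emeasure_eq_measure)
 define Yj where "Yj j = (f ^^ j) -` Y" for j
 have fj [measurable]: "f ^^ j \<in> borel_measurable borel" for j by (induction j) auto
 have Yjb [measurable]: "Yj j \<in> sets borel" for j using measurable_sets[OF fj Y(1), of j] by (simp add: Yj_def)
 have wj: "w (Yj j) = w Y" for j
 proof (induction j)
  case (Suc j)
  have "Yj (Suc j) = f -` Yj j" by (auto simp: Yj_def funpow_swap1)
  thus ?case using Suc invM[OF Yjb] invN[OF Yjb] by (simp add: w_def)
 qed (simp add: Yj_def)
 have wd: "w (Yj j - Y) = 0 \<and> w (Y - Yj j) = 0" for j
 proof -
  have "w (Yj j - Y) \<le> 0" "0 \<le> w (Y - Yj j)" using Y(1) by (auto intro!: Y(2,3))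
  thus ?thesis using split[of "Yj j" Y] split[of Y "Yj j"] wj[of j] Y(1) by (simp add: Int_commute)
 qed
 have null: "w X = 0" if X: "X \<in> sets borel" "X \<subseteq> Yj j - Y \<or> X \<subseteq> Y - Yj j" for X j
  using X(2)
 proof
  assume X2: "X \<subseteq> Yj j - Y"
  have "w X \<le> 0" "w (Yj j - Y - X) \<le> 0" using X(1) X2 Y(1) by (auto intro!: Y(3))
  moreover have "w (Yj j - Y) = w X + w (Yj j - Y - X)"
   using split[of "Yj j - Y" X] X X2 Y(1) by (simp add: Int_absorb1)
  ultimately show ?thesis using wd[of j] by simp
 next
  assume X2: "X \<subseteq> Y - Yj j"
  have "0 \<le> w X" "0 \<le> w (Y - Yj j - X)" using X(1) X2 Y(1) by (auto intro!: Y(2))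
  moreover have "w (Y - Yj j) = w X + w (Y - Yj j - X)"
   using split[of "Y - Yj j" X] X X2 Y(1) by (simp add: Int_absorb1)
  ultimately show ?thesis using wd[of j] by simp
 qed
 have null_UN: "w X = 0" if X: "X \<in> sets borel" "X \<subseteq> (\<Union>j. Z j)" "\<And>j. Z j \<in> sets borel" "\<And>j X. X \<in> sets borel \<Longrightarrow> X \<subseteq> Z j \<Longrightarrow> w X = 0" for X and Z :: "nat \<Rightarrow> 'a set"
 proof -
  define D where "D j = X \<inter> disjointed Z j" for j
  have Db: "D j \<in> sets borel" for j
   unfolding D_def using X(1) sets.range_disjointed_sets[of Z borel] X(3) by auto
  have "disjoint_family D" using disjoint_family_disjointed[of Z] unfolding D_def disjoint_family_on_def by blast
  moreover have "(\<Union>j. D j) = X" using X(2) unfolding D_def by (simp add: UN_disjointed_eq flip: Int_UN_distrib) blast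
  ultimately have "(\<lambda>j. measure M (D j)) sums measure M X" "(\<lambda>j. measure N (D j)) sums measure N X"
   using M.finite_measure_UNION[of D] N.finite_measure_UNION[of D] Db by auto
  moreover have "measure M (D j) = measure N (D j)" for j
   using X(4)[OF Db, of j j] disjointed_subset[of Z j] by (auto simp: w_def D_def)
  ultimately show ?thesis unfolding w_def using sums_unique2 by fastforce
 qed
 define Y' where "Y' = (\<Union>n. \<Inter>j\<in>{n..}. Yj j)"
 have Y'b: "Y' \<in> sets borel" unfolding Y'_def by measurable
 have "f -` Y' = Y'"
 proof (rule set_eqI)
  fix x
  have "(f ^^ j) (f x) = (f ^^ Suc j) x" for j by (simp add: funpow_swap1)
  hence "x \<in> f -` Y' \<longleftrightarrow> (\<exists>n. \<forall>j\<ge>n. (f ^^ Suc j) x \<in> Y)" by (auto simp: Y'_def Yj_def)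
  also have "\<dots> \<longleftrightarrow> (\<exists>n. \<forall>j\<ge>n. (f ^^ j) x \<in> Y)"
   using eventually_sequentially_Suc[of "\<lambda>j. (f ^^ j) x \<in> Y"] by (simp only: eventually_sequentially)
  also have "\<dots> \<longleftrightarrow> x \<in> Y'" by (auto simp: Y'_def Yj_def)
  finally show "x \<in> f -` Y' \<longleftrightarrow> x \<in> Y'" .
 qed
 hence "w Y' = 0" using eq[OF Y'b] by (simp add: w_def)
 moreover have "w (Y' - Y) = 0"
  by (rule null_UN[of _ "\<lambda>j. Yj j - Y"]) (use Y'b Y(1) null in \<open>auto simp: Y'_def\<close>)
 moreover have "w (Y - Y') = 0"
  by (rule null_UN[of _ "\<lambda>j. Y - Yj j"]) (use Y'b Y(1) null in \<open>auto simp: Y'_def\<close>)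
 ultimately have wY: "w Y = 0" using split[OF Y'b Y(1)] split[OF Y(1) Y'b] by (simp add: Int_commute)
 have wU: "w UNIV = 0" using eq[of UNIV] by (simp add: w_def)
 have "w X = 0" if X: "X \<in> sets borel" for X
 proof -
  have "w (X \<inter> Y) = 0"
  proof -
   have "0 \<le> w (Y \<inter> X)" "0 \<le> w (Y - X)" using X Y(1) by (auto intro!: Y(2))
   thus ?thesis using split[OF Y(1) X] wY by (simp add: Int_commute)
  qed
  moreover have "w (X - Y) = 0"
  proof -
   have "w (- Y \<inter> X) \<le> 0" "w (- Y - X) \<le> 0" using X Y(1) by (auto intro!: Y(3))
   moreover have "w (- Y) = 0" using split[of UNIV Y] wU wY Y(1) by (simp add: Compl_eq_Diff_UNIV)
   ultimately show ?thesis using split[of "- Y" X] X Y(1) by (simp add: Int_commute Diff_eq)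
  qed
  ultimately show ?thesis using split[OF X Y(1)] by simp
 qed
 thus ?thesis by (intro measure_eqI) (auto simp: M.emeasure_eq_measure N.emeasure_eq_measure w_def)
qed

text \<open>Otherwise there are sets of \<open>M\<close>-measure below \<open>(1 / 2) ^ n\<close>
  that keep a fixed \<open>N\<close>-measure, and their upper limit is null for \<open>M\<close> but
  not for \<open>N\<close>.\<close>

lemma absolutely_continuous_uniform:
 assumes MN: "finite_measure M" "finite_measure N" "sets M = sets N"
  and ac: "\<And>A. A \<in> sets M \<Longrightarrow> measure M A = 0 \<Longrightarrow> measure N A = 0" and e: "e > 0"
 obtains d where "d > 0" "\<And>A. A \<in> sets M \<Longrightarrow> measure M A < d \<Longrightarrow> measure N A < e"
proof (rule ccontr)
 interpret M: finite_measure M by fact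
 interpret N: finite_measure N by fact
 note [simp, measurable_cong] = MN(3)
 assume no: "\<not> thesis"
 have "\<exists>A\<in>sets M. measure M A < (1 / 2) ^ n \<and> e \<le> measure N A" for n
 proof (rule ccontr)
  assume "\<not> (\<exists>A\<in>sets M. measure M A < (1 / 2) ^ n \<and> e \<le> measure N A)"
  hence "measure N A < e" if "A \<in> sets M" "measure M A < (1 / 2) ^ n" for A using that by (meson not_le)
  thus False using no that[of "(1 / 2) ^ n"] by simp
 qed
 then obtain A where A: "\<And>n. A n \<in> sets M" "\<And>n. measure M (A n) < (1 / 2) ^ n" "\<And>n. e \<le> measure N (A n)"
  by metis
 define U where "U n = (\<Union>k. A (k + n))" for n
 have Ub: "U n \<in> sets M" for n unfolding U_def using A(1) by auto
 have dec: "decseq U"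
 proof (rule decseq_SucI)
  fix n show "U (Suc n) \<subseteq> U n" unfolding U_def
  proof (rule UN_least)
   fix k show "A (k + Suc n) \<subseteq> (\<Union>k. A (k + n))" using UN_upper[of "Suc k" UNIV "\<lambda>k. A (k + n)"] by simp
  qed
 qed
 have sm: "summable (\<lambda>k. measure M (A (k + n)))" for n
  by (rule summable_comparison_test[OF _ summable_ignore_initial_segment[OF summable_geometric[of "1 / 2 :: real"], of n]])
   (use A(2) in \<open>auto intro!: exI[of _ 0] less_imp_le\<close>)
 have le: "measure M (U n) \<le> 2 * (1 / 2) ^ n" for n
 proof -
  have "measure M (U n) \<le> (\<Sum>k. measure M (A (k + n)))"
   unfolding U_def using A(1) sm by (intro M.finite_measure_subadditive_countably) auto
  also have "\<dots> \<le> (\<Sum>k. (1 / 2) ^ (k + n))"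
   by (intro suminf_le sm summable_ignore_initial_segment[OF summable_geometric[of "1 / 2 :: real"]] less_imp_le A(2)) simp
  also have "\<dots> = 2 * (1 / 2) ^ n" by (simp add: power_add suminf_mult2[symmetric] summable_geometric suminf_geometric)
  finally show ?thesis .
 qed
 have "(\<lambda>n. measure M (U n)) \<longlonglongrightarrow> 0"
  by (rule tendsto_sandwich[of "\<lambda>_. 0" _ _ "\<lambda>n. 2 * (1 / 2) ^ n"]) (use le in \<open>auto intro!: tendsto_mult_right_zero LIMSEQ_power_zero\<close>)
 moreover have "(\<lambda>n. measure M (U n)) \<longlonglongrightarrow> measure M (\<Inter>n. U n)"
  using Ub dec by (intro M.finite_Lim_measure_decseq) auto
 ultimately have "measure M (\<Inter>n. U n) = 0" using LIMSEQ_unique by blast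
 hence "measure N (\<Inter>n. U n) = 0" using Ub by (intro ac) auto
 moreover have lim: "(\<lambda>n. measure N (U n)) \<longlonglongrightarrow> measure N (\<Inter>n. U n)"
  using Ub dec by (intro N.finite_Lim_measure_decseq) auto
 moreover have "e \<le> measure N (U n)" for n
 proof -
  have "A n \<subseteq> U n" unfolding U_def using UN_upper[of 0 UNIV "\<lambda>k. A (k + n)"] by simp
  hence "measure N (A n) \<le> measure N (U n)" using Ub by (intro N.finite_measure_mono) auto
  thus ?thesis using A(3)[of n] by simp
 qed
 ultimately have "e \<le> 0" using LIMSEQ_le_const[OF lim, of e] by auto
 thus False using e by simp
qed

subsection \<open>Absolutely continuous invariant measures\<close>

text \<open>Absolutely continuous invariant probability measures, ergodic or not.\<close>

definition acip :: "('n::finite torus \<Rightarrow> 'n torus) \<Rightarrow> 'n torus measure \<Rightarrow> bool" where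
 "acip f \<nu> \<longleftrightarrow> sets \<nu> = sets borel \<and> prob_space \<nu> \<and> (\<forall>S\<in>sets borel. measure \<nu> (f -` S) = measure \<nu> S) \<and>
  (\<forall>S\<in>sets borel. measure torus_lebesgue S = 0 \<longrightarrow> measure \<nu> S = 0)"

lemma acipD:
 assumes "acip f \<nu>"
 shows "sets \<nu> = sets borel" "prob_space \<nu>" "S \<in> sets borel \<Longrightarrow> measure \<nu> (f -` S) = measure \<nu> S"
  "S \<in> sets borel \<Longrightarrow> measure torus_lebesgue S = 0 \<Longrightarrow> measure \<nu> S = 0"
  "space \<nu> = UNIV" "finite_measure \<nu>"
 using assms sets_eq_imp_space_eq[of \<nu> borel] by (auto simp: acip_def prob_space_def)

lemma measure_vimage_iterate:
 assumes f: "f \<in> borel_measurable borel" and inv: "\<And>S. S \<in> sets borel \<Longrightarrow> measure \<nu> (f -` S) = measure \<nu> S"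
 shows "S \<in> sets borel \<Longrightarrow> measure \<nu> ((f ^^ j) -` S) = measure \<nu> S"
proof (induction j arbitrary: S)
 case (Suc j)
 have "(f ^^ Suc j) -` S = (f ^^ j) -` (f -` S)" by (simp add: vimage_comp funpow_swap1 comp_def)
 thus ?case using Suc.IH[of "f -` S"] measurable_sets[OF f Suc.prems] inv[OF Suc.prems] by (simp del: funpow.simps)
qed simp

text \<open>What the construction of the noise uses of \<open>f\<close>. No derivative occurs: there
  are finitely many invariant measures \<open>Q\<close> that see almost every orbit, an invariant
  measure \<open>\<mu>\<close> above them, and the uniform smallness \<open>UA\<close> of preimages
  under all iterates, a substitute for bounded densities.\<close>

locale regular_dynamics =
 fixes f :: "'n::finite torus \<Rightarrow> 'n torus" and Q :: "'n torus measure set" and \<mu> :: "'n torus measure"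
 assumes cont: "continuous_on UNIV f" and finQ: "finite Q" "Q \<noteq> {}" and Q: "\<And>\<nu>. \<nu> \<in> Q \<Longrightarrow> acip f \<nu>"
  and cover: "\<And>D. D \<in> sets borel \<Longrightarrow> f -` D = D \<Longrightarrow> (\<And>\<nu>. \<nu> \<in> Q \<Longrightarrow> measure \<nu> D \<noteq> 0) \<Longrightarrow> measure torus_lebesgue D = 1"
  and mu: "finite_measure \<mu>" "sets \<mu> = sets borel"
  and inv: "\<And>S. S \<in> sets borel \<Longrightarrow> measure \<mu> (f -` S) = measure \<mu> S"
  and ac: "\<And>S. S \<in> sets borel \<Longrightarrow> measure torus_lebesgue S = 0 \<Longrightarrow> measure \<mu> S = 0"
  and le: "\<And>\<nu> S. \<nu> \<in> Q \<Longrightarrow> S \<in> sets borel \<Longrightarrow> measure \<nu> S \<le> measure \<mu> S"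
  and UA: "\<And>\<eta>. \<eta> > 0 \<Longrightarrow> \<exists>\<delta>>0. \<forall>D\<in>sets borel. \<forall>j. measure torus_lebesgue D < \<delta> \<longrightarrow> measure torus_lebesgue ((f ^^ j) -` D) < \<eta>"

locale expanding = torus_map f B \<beta> for f :: "'n::finite torus \<Rightarrow> 'n torus" and B \<beta> +
 fixes H :: "nat \<Rightarrow> 'n torus set" and \<theta> C0 c0 :: real
 assumes no_crit: "critical_set f = {}" and H_borel [measurable]: "\<And>m. H m \<in> sets borel"
  and cpos: "\<theta> > 0" "C0 > 0" "c0 > 0"
  and frequency: "\<And>A \<kappa>. A \<in> sets borel \<Longrightarrow> \<kappa> < vol A \<Longrightarrow>
   \<forall>\<^sub>F n in sequentially. \<theta> * \<kappa> * n \<le> (\<Sum>m\<in>{1..n}. vol (A \<inter> H m))"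
  and pushforward: "\<And>m S. S \<in> sets borel \<Longrightarrow> vol (H m \<inter> (f ^^ m) -` S) \<le> C0 * vol S"
  and invariant_ge: "\<And>A. A \<in> sets borel \<Longrightarrow> f -` A = A \<Longrightarrow> vol A > 0 \<Longrightarrow> vol A \<ge> c0"
begin

sublocale leb: prob_space leb by (rule prob_leb)

lemma vimage_borel [measurable]: "S \<in> sets borel \<Longrightarrow> (f ^^ j) -` S \<in> sets borel"
 using measurable_sets[OF measurable_iterate, of S j] by simp

lemma vimage_borel1 [measurable]: "S \<in> sets borel \<Longrightarrow> f -` S \<in> sets borel"
 using measurable_sets[OF measurable_f, of S] by simp

text \<open>The jacobian vanishes nowhere, so on each of finitely many balls a set with null image
  is null.\<close>

lemma null_vimage:
 assumes S: "S \<in> sets borel" "vol S = 0" shows "vol (f -` S) = 0"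
proof -
 have "\<exists>r>0. \<forall>T. T \<in> sets borel \<longrightarrow> T \<subseteq> ball x r \<longrightarrow> f ` T \<in> sets borel \<and>
   emeasure leb (f ` T) = (\<integral>\<^sup>+y\<in>T. J y \<partial>leb)" for x
  using substitution_local[of x] no_crit by (metis empty_iff)
 then obtain r where r: "\<And>x. r x > 0" "\<And>x T. T \<in> sets borel \<Longrightarrow> T \<subseteq> ball x (r x) \<Longrightarrow> f ` T \<in> sets borel \<and>
   emeasure leb (f ` T) = (\<integral>\<^sup>+y\<in>T. J y \<partial>leb)" by metis
 obtain Y where Y: "finite Y" "(\<Union>y\<in>Y. ball y (r y)) = UNIV"
  using finite_subcover_torus[of "\<lambda>x. ball x (r x)"] r(1) by auto
 define T where "T y = ball y (r y) \<inter> f -` S" for y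
 have Tb [measurable]: "T y \<in> sets borel" for y using S(1) by (simp add: T_def vimage_borel1)
 have "vol (T y) = 0" for y
 proof -
  have Tr: "T y \<subseteq> ball y (r y)" by (simp add: T_def)
  have "emeasure leb (f ` T y) \<le> emeasure leb S" using S(1) by (intro emeasure_mono) (auto simp: T_def)
  hence "(\<integral>\<^sup>+x\<in>T y. J x \<partial>leb) = 0"
   using r(2)[OF Tb Tr] S(2) by (simp add: leb.emeasure_eq_measure)
  hence "AE x in leb. J x * indicator (T y) x = 0" by (subst (asm) nn_integral_0_iff_AE) auto
  hence "AE x in leb. x \<notin> T y"
  proof eventually_elim
   case (elim x)
   have "J x \<noteq> 0" using det_nonzero[of x] no_crit by (simp add: J_def)
   thus ?case using elim by auto
  qed
  hence "T y \<in> null_sets leb" by (subst AE_iff_null_sets) simp_all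
  thus ?thesis by (simp add: measure_def null_sets_def)
 qed
 moreover have "f -` S = (\<Union>y\<in>Y. T y)"
 proof -
  have "(\<Union>y\<in>Y. T y) = (\<Union>y\<in>Y. ball y (r y)) \<inter> f -` S" unfolding T_def by simp
  thus ?thesis unfolding Y(2) by simp
 qed
 moreover have "vol (\<Union>y\<in>Y. T y) \<le> (\<Sum>y\<in>Y. vol (T y))"
  using Y(1) Tb by (intro leb.finite_measure_subadditive_finite) auto
 ultimately show ?thesis by (simp add: measure_le_0_iff)
qed

lemma null_vimage_iterate:
 assumes S: "S \<in> sets borel" "vol S = 0" shows "vol ((f ^^ j) -` S) = 0"
proof (induction j)
 case (Suc j)
 have "(f ^^ Suc j) -` S = f -` (f ^^ j) -` S" by (auto simp: funpow_swap1)
 thus ?case using null_vimage[OF vimage_borel[OF S(1)] Suc] by (simp del: funpow.simps)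
qed (simp add: S)

text \<open>The limit \<open>m\<close> of the averages is only finitely additive, but its countably additive part is
 invariant as well; it does not vanish because of the hyperbolic times.\<close>

lemma acip_exists:
 assumes A [measurable]: "A \<in> sets borel" and inv: "f -` A = A" and pos: "vol A > 0"
 obtains \<nu> where "acip f \<nu>" "measure \<nu> A = 1"
proof -
 let ?a = "\<lambda>j S. vol (A \<inter> (f ^^ j) -` S)"
 define X where "X n S = (if S \<in> sets borel then (\<Sum>j\<in>{1..n}. ?a j S) / n else 0)" for n :: nat and S
 have X01: "X n S \<in> {0..1}" for n S
 proof -
  have "(\<Sum>j\<in>{1..n}. ?a j S) \<le> (\<Sum>j\<in>{1..n}. 1)" by (intro sum_mono leb.prob_le_1)
  thus ?thesis by (auto simp: X_def divide_le_eq_1 intro!: divide_nonneg_nonneg sum_nonneg)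
 qed
 obtain G m where G: "G \<le> sequentially" "G \<noteq> bot" "\<And>S. ((\<lambda>n. X n S) \<longlongrightarrow> m S) G"
  using pointwise_cluster[of X, OF X01] by blast
 have m_ge: "l \<le> m S" if "\<forall>\<^sub>F n in sequentially. l \<le> X n S" for l S
  using G(3) filter_leD[OF G(1) that] G(2) by (rule tendsto_lowerbound)
 have m_le: "m S \<le> l" if "\<forall>\<^sub>F n in sequentially. X n S \<le> l" for l S
  using G(3) filter_leD[OF G(1) that] G(2) by (rule tendsto_upperbound)
 have m0: "0 \<le> m S" for S using X01 by (intro m_ge) auto
 have add: "m (S \<union> T) = m S + m T" if [measurable]: "S \<in> sets borel" "T \<in> sets borel" and d: "S \<inter> T = {}" for S T
 proof -
  have "?a j (S \<union> T) = ?a j S + ?a j T" for j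
   by (subst leb.finite_measure_Union[symmetric]) (use d in \<open>auto intro!: arg_cong[of _ _ "vol"]\<close>)
  hence "X n (S \<union> T) = X n S + X n T" for n by (simp add: X_def sum.distrib add_divide_distrib)
  hence "((\<lambda>n. X n (S \<union> T)) \<longlongrightarrow> m S + m T) G" using tendsto_add[OF G(3)[of S] G(3)[of T]] by simp
  thus ?thesis using G(3) G(2) tendsto_unique by blast
 qed
 have minv: "m (f -` S) = m S" if S [measurable]: "S \<in> sets borel" for S
 proof -
  have eq: "X n (f -` S) = X n S + (?a (Suc n) S - vol (A \<inter> f -` S)) / n" for n
  proof -
   have "(\<Sum>j\<in>{1..n}. ?a j (f -` S)) = (\<Sum>j\<in>{1..n}. ?a (Suc j) S)"
    by (intro sum.cong) (auto simp: vimage_def funpow_swap1)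
   also have "\<dots> = (\<Sum>j\<in>{1..n}. ?a j S) + (?a (Suc n) S - vol (A \<inter> f -` S))"
    by (induction n) (auto simp del: funpow.simps(2) simp: funpow.simps(2)[of 0])
   finally show ?thesis by (simp add: X_def vimage_borel1 add_divide_distrib diff_divide_distrib)
  qed
  have "(\<lambda>n. (?a (Suc n) S - vol (A \<inter> f -` S)) / n) \<longlonglongrightarrow> 0"
  proof (rule Lim_null_comparison)
   have "\<bar>?a (Suc n) S - vol (A \<inter> f -` S)\<bar> \<le> 1" for n
    using leb.prob_le_1[of "A \<inter> (f ^^ Suc n) -` S"] leb.prob_le_1[of "A \<inter> f -` S"]
     measure_nonneg[of leb "A \<inter> (f ^^ Suc n) -` S"] measure_nonneg[of leb "A \<inter> f -` S"] by linarith
   thus "\<forall>\<^sub>F n in sequentially. norm ((?a (Suc n) S - vol (A \<inter> f -` S)) / n) \<le> 1 / real n"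
    by (intro always_eventually) (auto intro: divide_right_mono)
  qed (rule lim_1_over_n)
  hence lim: "((\<lambda>n. (?a (Suc n) S - vol (A \<inter> f -` S)) / n) \<longlongrightarrow> 0) G"
   using G(1) by (rule tendsto_mono[rotated])
  have "((\<lambda>n. X n (f -` S)) \<longlongrightarrow> m S + 0) G" unfolding eq by (rule tendsto_add[OF G(3) lim])
  thus ?thesis using tendsto_unique[OF G(2) _ G(3)] by fastforce
 qed
 have mac: "m S = 0" if "S \<in> sets borel" "vol S = 0" for S
 proof -
  have "?a j S = 0" for j
   using leb.finite_measure_mono[of "A \<inter> (f ^^ j) -` S" "(f ^^ j) -` S"] null_vimage_iterate[OF that, of j] that(1)
   by (auto simp: measure_le_0_iff)
  hence "X n S = 0" for n by (simp add: X_def)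
  thus ?thesis using m_le[of S 0] m0[of S] by simp
 qed
 have "(f ^^ j) -` (- A) = - A" for j using inv by (intro vimage_funpow_eq) auto
 hence "X n (- A) = 0" for n by (simp add: X_def)
 hence mA: "m (- A) = 0" using m_le[of "- A" 0] m0[of "- A"] by simp
 define q where "q = \<theta> * (vol A / 2)"
 have q: "q > 0" using cpos pos by (simp add: q_def)
 \<comment> \<open>The part of the averages due to hyperbolic times has mass about \<open>q\<close>
   and density at most \<open>C0\<close>, so a set with small complement keeps most of it.\<close>
 have big: "q - C0 * vol (- S) \<le> m S" if S [measurable]: "S \<in> sets borel" for S
 proof (rule m_ge)
  have "vol A / 2 < vol A" using pos by simp
  from frequency[OF A this] eventually_gt_at_top[of 0]
  show "\<forall>\<^sub>F n in sequentially. q - C0 * vol (- S) \<le> X n S"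
  proof eventually_elim
   case (elim n)
   have "q * n - n * (C0 * vol (- S)) \<le> (\<Sum>j\<in>{1..n}. vol (A \<inter> H j) - C0 * vol (- S))"
    using elim by (simp add: q_def sum_subtractf)
   also have "\<dots> \<le> (\<Sum>j\<in>{1..n}. ?a j S)"
   proof (rule sum_mono)
    fix j
    have "vol (A \<inter> H j) \<le> vol ((A \<inter> (f ^^ j) -` S) \<union> (H j \<inter> (f ^^ j) -` (- S)))"
     by (intro leb.finite_measure_mono) auto
    also have "\<dots> \<le> ?a j S + vol (H j \<inter> (f ^^ j) -` (- S))" by (rule measure_Un_le) auto
    also have "vol (H j \<inter> (f ^^ j) -` (- S)) \<le> C0 * vol (- S)" by (rule pushforward) simp
    finally show "vol (A \<inter> H j) - C0 * vol (- S) \<le> ?a j S" by simp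
   qed
   finally have "q * n - n * (C0 * vol (- S)) \<le> (\<Sum>j\<in>{1..n}. ?a j S)" .
   hence "(q - C0 * vol (- S)) * n \<le> (\<Sum>j\<in>{1..n}. ?a j S)" by (simp add: algebra_simps)
   thus ?case unfolding X_def using elim(2) S by (simp only: if_True pos_le_divide_eq of_nat_0_less_iff)
  qed
 qed
 let ?O = "outer_measure (sets borel) (\<lambda>S. ennreal (m S))"
 obtain \<mu> where \<mu>: "sets \<mu> = sets borel" "\<And>S. S \<in> sets borel \<Longrightarrow> emeasure \<mu> S = ?O S"
  using outer_measure_of_additive[of borel m] m0 add by blast
 have \<mu>le: "emeasure \<mu> S \<le> ennreal (m S)" if S: "S \<in> sets borel" for S
 proof -
  have m_empty: "m {} = 0" using add[of "{}" "{}"] by simp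
  let ?B = "\<lambda>i::nat. if i = 0 then S else {}"
  have "(\<Sum>i. ennreal (m (?B i))) = (\<Sum>i\<in>{0}. ennreal (m (?B i)))"
   by (rule suminf_finite) (auto simp: m_empty)
  moreover have "?O S \<le> (\<Sum>i. ennreal (m (?B i)))"
   unfolding outer_measure_def by (rule INF_lower) (use S in \<open>auto simp: disjoint_family_on_def\<close>)
  ultimately show ?thesis using \<mu>(2)[OF S] by simp
 qed
 interpret \<mu>: finite_measure \<mu>
  using \<mu>le[of UNIV] sets_eq_imp_space_eq[OF \<mu>(1)] by (intro finite_measureI) (auto simp: top_unique)
 have \<mu>0: "measure \<mu> S = 0" if "S \<in> sets borel" "m S = 0" for S
  using \<mu>le[OF that(1)] that(2) by (simp add: \<mu>.emeasure_eq_measure)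
 have sp: "space \<mu> = UNIV" using sets_eq_imp_space_eq[OF \<mu>(1)] by simp
 \<comment> \<open>Preimages turn a cover into a cover with the same sum, which gives one
   inequality; the other follows by passing to complements.\<close>
 have mono_inv: "measure \<mu> (f -` S) \<le> measure \<mu> S" if S: "S \<in> sets borel" for S
 proof -
  have "?O (f -` S) \<le> ?O S" unfolding outer_measure_def[of _ _ S]
  proof (rule INF_greatest, clarify)
   fix D :: "nat \<Rightarrow> 'n torus set" assume D: "range D \<subseteq> sets borel" "disjoint_family D" "S \<subseteq> (\<Union>i. D i)"
   have "(\<lambda>i. f -` D i) \<in> {A. range A \<subseteq> sets borel \<and> disjoint_family A \<and> f -` S \<subseteq> (\<Union>i. A i)}"
   proof (intro CollectI conjI)
    show "range (\<lambda>i. f -` D i) \<subseteq> sets borel" using D(1) vimage_borel1 by (simp add: image_subset_iff)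
    show "disjoint_family (\<lambda>i. f -` D i)"
     using D(2) unfolding disjoint_family_on_def by (metis vimage_Int vimage_empty)
    show "f -` S \<subseteq> (\<Union>i. f -` D i)" unfolding vimage_UN[symmetric] using D(3) by (rule vimage_mono)
   qed
   hence "?O (f -` S) \<le> (\<Sum>i. ennreal (m (f -` D i)))"
    unfolding outer_measure_def by (rule INF_lower2) simp
   also have "\<dots> = (\<Sum>i. ennreal (m (D i)))" using D(1) minv by (simp add: image_subset_iff)
   finally show "?O (f -` S) \<le> (\<Sum>i. ennreal (m (D i)))" .
  qed
  hence "emeasure \<mu> (f -` S) \<le> emeasure \<mu> S" using \<mu>(2)[OF S] \<mu>(2)[OF vimage_borel1[OF S]] by simp
  thus ?thesis by (simp add: \<mu>.emeasure_eq_measure)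
 qed
 have \<mu>inv: "measure \<mu> (f -` S) = measure \<mu> S" if S: "S \<in> sets borel" for S
 proof -
  have "measure \<mu> (f -` (- S)) \<le> measure \<mu> (- S)" using S by (intro mono_inv) simp
  moreover have "measure \<mu> (f -` (- S)) = measure \<mu> UNIV - measure \<mu> (f -` S)"
   using \<mu>.finite_measure_compl[of "f -` S"] vimage_borel1[OF S] by (simp add: sp \<mu>(1) vimage_Diff Compl_eq_Diff_UNIV)
  moreover have "measure \<mu> (- S) = measure \<mu> UNIV - measure \<mu> S"
   using \<mu>.finite_measure_compl[of S] S by (simp add: sp \<mu>(1) Compl_eq_Diff_UNIV)
  ultimately show ?thesis using mono_inv[OF S] by simp
 qed
 \<comment> \<open>The partial unions of a countable cover fill up the volume, so by
   \<open>big\<close> its sum is at least \<open>q\<close>. This excludes a limit that is purely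
   finitely additive.\<close>
 have "ennreal q \<le> ?O UNIV" unfolding outer_measure_def
 proof (rule INF_greatest, clarify)
  fix D :: "nat \<Rightarrow> 'n torus set" assume D: "range D \<subseteq> sets borel" "disjoint_family D" "UNIV \<subseteq> (\<Union>i. D i)"
  define U where "U k = (\<Union>i<k. D i)" for k
  have Db: "D i \<in> sets borel" for i using D(1) by auto
  have Ub: "U k \<in> sets borel" for k unfolding U_def using Db by auto
  have mU: "m (U k) = (\<Sum>i<k. m (D i))" for k
  proof (induction k)
   case 0 thus ?case using add[of "{}" "{}"] by (simp add: U_def)
  next
   case (Suc k)
   have "U (Suc k) = U k \<union> D k" by (auto simp: U_def lessThan_Suc)
   moreover have "U k \<inter> D k = {}"
   proof (rule equals0I)
    fix x assume "x \<in> U k \<inter> D k"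
    then obtain i where i: "i < k" "x \<in> D i \<inter> D k" by (auto simp: U_def)
    hence "D i \<inter> D k = {}" using disjoint_family_onD[OF D(2), of i k] by simp
    thus False using i(2) by simp
   qed
   ultimately show ?case using add[OF Ub Db, of k k] Suc by simp
  qed
  have "(\<lambda>k. vol (U k)) \<longlonglongrightarrow> vol (\<Union>k. U k)"
  proof (rule leb.finite_Lim_measure_incseq)
   show "incseq U" unfolding U_def by (intro incseq_SucI UN_mono) auto
  qed (use Ub in auto)
  moreover have "(\<Union>k. U k) = UNIV"
  proof -
   have "x \<in> (\<Union>k. U k)" for x
   proof -
    obtain i where "x \<in> D i" using D(3) by blast
    hence "x \<in> U (Suc i)" by (auto simp: U_def)
    thus ?thesis by blast
   qed
   thus ?thesis by blast
  qed
  moreover have "vol (- U k) = 1 - vol (U k)" for k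
   using leb.prob_compl[of "U k"] Ub by (simp add: Compl_eq_Diff_UNIV)
  moreover have "measure leb UNIV = 1" using leb.prob_space by simp
  ultimately have "(\<lambda>k. q - C0 * (1 - vol (U k))) \<longlonglongrightarrow> q - C0 * (1 - 1)"
   by (intro tendsto_intros) simp
  hence "(\<lambda>k. ennreal (q - C0 * (1 - vol (U k)))) \<longlonglongrightarrow> ennreal q"
   by (intro tendsto_ennrealI) simp
  thus "ennreal q \<le> (\<Sum>i. ennreal (m (D i)))"
  proof (rule LIMSEQ_le_const2, intro exI allI impI)
   fix k
   have "q - C0 * (1 - vol (U k)) \<le> m (U k)"
    using big[OF Ub, of k] leb.prob_compl[of "U k"] Ub by (simp add: Compl_eq_Diff_UNIV)
   hence "ennreal (q - C0 * (1 - vol (U k))) \<le> (\<Sum>i<k. ennreal (m (D i)))"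
    unfolding mU using m0 by (simp add: ennreal_leI sum_ennreal)
   also have "\<dots> \<le> (\<Sum>i. ennreal (m (D i)))" by (intro sum_le_suminf) auto
   finally show "ennreal (q - C0 * (1 - vol (U k))) \<le> (\<Sum>i. ennreal (m (D i)))" .
  qed
 qed
 hence "ennreal q \<le> emeasure \<mu> UNIV" using \<mu>(2)[of UNIV] by simp
 hence "q \<le> measure \<mu> UNIV" using q by (simp add: \<mu>.emeasure_eq_measure)
 hence mass: "measure \<mu> UNIV > 0" using q by simp
 define \<nu> where "\<nu> = scale_measure (ennreal (1 / measure \<mu> UNIV)) \<mu>"
 have \<nu>: "measure \<nu> S = measure \<mu> S / measure \<mu> UNIV" for S by (simp add: \<nu>_def)
 show thesis
 proof (rule that, unfold acip_def, intro conjI ballI impI)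
  show "sets \<nu> = sets borel" by (simp add: \<nu>_def \<mu>(1))
  show "prob_space \<nu>"
   by (rule prob_spaceI) (use mass in \<open>simp add: \<nu>_def space_scale_measure sp \<mu>.emeasure_eq_measure ennreal_mult[symmetric]\<close>)
  show "measure \<nu> (f -` S) = measure \<nu> S" if "S \<in> sets borel" for S using \<mu>inv[OF that] by (simp add: \<nu>)
  show "measure \<nu> S = 0" if "S \<in> sets borel" "vol S = 0" for S using \<mu>0[OF that(1) mac[OF that]] by (simp add: \<nu>)
  have "measure \<mu> UNIV - measure \<mu> A = 0"
   using \<mu>0[of "- A"] mA \<mu>.finite_measure_compl[of A] by (simp add: sp \<mu>(1) Compl_eq_Diff_UNIV)
  thus "measure \<nu> A = 1" using mass by (simp add: \<nu>)
 qed
qed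

end

section \<open>Ergodic components and physical measures\<close>

context expanding begin

definition invariant :: "'n torus set \<Rightarrow> bool" where
 "invariant A \<longleftrightarrow> A \<in> sets borel \<and> f -` A = A"

text \<open>Atoms of the algebra of invariant sets modulo null sets: the ergodic components of
  Lebesgue measure.\<close>

definition atom :: "'n torus set \<Rightarrow> bool" where
 "atom A \<longleftrightarrow> invariant A \<and> vol A > 0 \<and>
  (\<forall>B. invariant B \<longrightarrow> B \<subseteq> A \<longrightarrow> vol B = 0 \<or> vol (A - B) = 0)"

lemma invariant_borel: "invariant A \<Longrightarrow> A \<in> sets borel"
 by (simp add: invariant_def)

lemma invariant_Int: "invariant A \<Longrightarrow> invariant D \<Longrightarrow> invariant (A \<inter> D)"
 by (auto simp: invariant_def)

lemma invariant_Diff: "invariant A \<Longrightarrow> invariant D \<Longrightarrow> invariant (A - D)"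
 by (auto simp: invariant_def vimage_Diff)

text \<open>An invariant subset with volume less than the infimum plus \<open>c0\<close> cannot be
  split: one part would have at least the infimum, the other at least \<open>c0\<close>.\<close>

lemma atom_subset:
 assumes A: "invariant A" "vol A > 0"
 obtains E where "E \<subseteq> A" "atom E"
proof -
 let ?V = "{vol D | D. invariant D \<and> D \<subseteq> A \<and> vol D > 0}"
 have ne: "?V \<noteq> {}" using A by blast
 have bdd: "bdd_below ?V" by (rule bdd_belowI[of _ 0]) auto
 have "Inf ?V < Inf ?V + c0" using cpos by simp
 then obtain v where v: "v \<in> ?V" "v < Inf ?V + c0" using cInf_lessD[OF ne] by blast
 then obtain E where E: "v = vol E" "invariant E" "E \<subseteq> A" "vol E > 0" by blast
 have "atom E" unfolding atom_def
 proof (intro conjI allI impI)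
  fix D assume D: "invariant D" "D \<subseteq> E"
  note [measurable] = invariant_borel[OF E(2)] invariant_borel[OF D(1)]
  show "vol D = 0 \<or> vol (E - D) = 0"
  proof (rule ccontr)
   assume "\<not> ?thesis"
   hence p: "vol D > 0" "vol (E - D) > 0" by (simp_all add: less_le)
   have "invariant (E - D)" by (rule invariant_Diff[OF E(2) D(1)])
   hence "c0 \<le> vol (E - D)" using invariant_ge p(2) by (simp add: invariant_def)
   moreover have "vol (E - D) = vol E - vol D" using D(2) by (intro leb.finite_measure_Diff) auto
   moreover have "Inf ?V \<le> vol D"
   proof (rule cInf_lower[OF _ bdd])
    have "D \<subseteq> A" using D(2) E(3) by blast
    thus "vol D \<in> ?V" using D(1) p(1) by blast
   qed
   ultimately show False using v(2) E(1) by simp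
  qed
 qed (use E in auto)
 thus thesis using E(3) that by blast
qed

text \<open>A disjoint family of atoms has at most \<open>1 / c0\<close> members. One of maximal
  cardinality has a null complement, which would otherwise contain a further atom.\<close>

lemma atoms_exist:
 obtains F where "finite F" "F \<noteq> {}" "\<And>E. E \<in> F \<Longrightarrow> atom E" "disjoint F" "vol (- \<Union>F) = 0" "\<Union>F \<in> sets borel"
proof -
 let ?P = "\<lambda>F. finite F \<and> (\<forall>E\<in>F. atom E) \<and> disjoint F"
 have Ub: "\<Union>F \<in> sets borel" "invariant (- \<Union>F)" if "?P F" for F
 proof -
  show U: "\<Union>F \<in> sets borel" using that by (intro sets.finite_Union) (auto simp: atom_def invariant_def)
  have "f -` (\<Union>F) = (\<Union>E\<in>F. f -` E)" by (rule vimage_Union)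
  also have "\<dots> = (\<Union>E\<in>F. E)" using that by (intro SUP_cong) (auto simp: atom_def invariant_def)
  finally show "invariant (- \<Union>F)" using U by (simp add: invariant_def vimage_Compl)
 qed
 have card: "card F \<le> nat \<lfloor>1 / c0\<rfloor>" if F: "?P F" for F
 proof -
  have "real (card F) * c0 = (\<Sum>E\<in>F. c0)" by simp
  also have "\<dots> \<le> (\<Sum>E\<in>F. vol E)"
   by (intro sum_mono invariant_ge) (use F in \<open>auto simp: atom_def invariant_def\<close>)
  also have "\<dots> = vol (\<Union>E\<in>F. E)" by (rule leb.finite_measure_finite_Union[symmetric])
    (use F in \<open>auto simp: atom_def invariant_def disjoint_def disjoint_family_on_def\<close>)
  also have "\<dots> \<le> 1" by (rule leb.prob_le_1)
  finally have "real (card F) \<le> 1 / c0" using cpos by (simp add: field_simps)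
  hence "int (card F) \<le> \<lfloor>1 / c0\<rfloor>" by (simp add: le_floor_iff)
  thus ?thesis by linarith
 qed
 have "\<exists>F. ?P F \<and> (\<forall>F'. ?P F' \<longrightarrow> card F' \<le> card F)"
 proof (rule ex_has_greatest_nat)
  show "?P {}" by (simp add: disjoint_def)
  show "\<forall>F. ?P F \<longrightarrow> card F < Suc (nat \<lfloor>1 / c0\<rfloor>)" by (intro allI impI le_imp_less_Suc card)
 qed
 then obtain F where FF: "?P F \<and> (\<forall>F'. ?P F' \<longrightarrow> card F' \<le> card F)" by (rule exE)
 note F = conjunct1[OF FF] and max = conjunct2[OF FF, THEN spec, THEN mp]
 have 0: "vol (- \<Union>F) = 0"
 proof (rule ccontr)
  assume "vol (- \<Union>F) \<noteq> 0"
  hence "vol (- \<Union>F) > 0" by (simp add: less_le)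
  then obtain E where E: "E \<subseteq> - \<Union>F" "atom E" using atom_subset[OF Ub(2)[OF F]] by blast
  have "E \<noteq> {}" using E(2) by (auto simp: atom_def)
  hence "E \<notin> F" using E(1) by blast
  moreover have "?P (insert E F)" using F E by (auto simp: disjoint_def)
  ultimately show False using max[of "insert E F"] F by simp
 qed
 moreover have "F \<noteq> {}" using 0 leb.prob_space by auto
 ultimately show thesis using F Ub(1)[OF F] by (intro that[of F]) auto
qed

lemma atom_zero_one:
 assumes E: "atom E" and D: "invariant D"
  and "acip f \<nu>"
 shows "vol (E \<inter> D) = 0 \<and> measure \<nu> (E \<inter> D) = 0 \<or> vol (E - D) = 0 \<and> measure \<nu> (E \<inter> D) = measure \<nu> E"
proof -
 note \<nu> = acipD[OF \<open>acip f \<nu>\<close>]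
 interpret \<nu>: finite_measure \<nu> by (rule \<nu>(6))
 have Ei: "invariant E" using E by (simp add: atom_def)
 have b: "E \<in> sets borel" "D \<in> sets borel" using Ei D by (auto simp: invariant_def)
 have "vol (E \<inter> D) = 0 \<or> vol (E - E \<inter> D) = 0"
  using E invariant_Int[OF Ei D] unfolding atom_def by blast
 moreover have "E - E \<inter> D = E - D" by blast
 moreover have "measure \<nu> E = measure \<nu> (E \<inter> D) + measure \<nu> (E - D)"
  using \<nu>.finite_measure_Diff'[of E D] b \<nu>(1) by simp
 ultimately show ?thesis using \<nu>(4)[of "E \<inter> D"] \<nu>(4)[of "E - D"] b by auto
qed

text \<open>Each atom carries a single such measure: invariant measures are determined by their
  values on invariant sets, and inside an atom these sets are trivial. So every \<open>\<mu>\<close>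
  splits over the atoms into multiples of the chosen measures.\<close>

lemma finite_physical_measures:
 obtains Q where "finite Q" "Q \<noteq> {}" "Q \<subseteq> physical_measures f" "\<And>\<mu>. acip f \<mu> \<Longrightarrow> convex_combination_of Q \<mu>"
  "\<And>D. D \<in> sets borel \<Longrightarrow> f -` D = D \<Longrightarrow> (\<And>\<nu>. \<nu> \<in> Q \<Longrightarrow> measure \<nu> D \<noteq> 0) \<Longrightarrow> vol D = 1"
proof -
 obtain F where F: "finite F" "F \<noteq> {}" "\<And>E. E \<in> F \<Longrightarrow> atom E" "disjoint F" "vol (- \<Union>F) = 0" "\<Union>F \<in> sets borel"
  using atoms_exist by blast
 have Fi: "E \<in> sets borel" "f -` E = E" "vol E > 0" if "E \<in> F" for E
  using F(3)[OF that] by (auto simp: atom_def invariant_def)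
 have "\<exists>\<nu>. acip f \<nu> \<and> measure \<nu> E = 1" if "E \<in> F" for E
  by (rule acip_exists[OF Fi(1,2,3)[OF that]]) blast
 then obtain \<nu> where \<nu>': "\<And>E. E \<in> F \<Longrightarrow> acip f (\<nu> E)" "\<And>E. E \<in> F \<Longrightarrow> measure (\<nu> E) E = 1" by metis
 note \<nu> = acipD(1-3)[OF \<nu>'(1)] \<nu>'(2) acipD(4)[OF \<nu>'(1)] and \<nu>sp = acipD(5)[OF \<nu>'(1)]
 have \<nu>Int: "measure (\<nu> E) (E \<inter> D) = measure (\<nu> E) D" if E: "E \<in> F" and D: "D \<in> sets borel" for E D
 proof -
  interpret prob_space "\<nu> E" by (rule \<nu>(2)[OF E])
  have "prob (D - E) \<le> prob (space (\<nu> E) - E)" using D Fi(1)[OF E] \<nu>(1)[OF E] \<nu>sp[OF E] by (intro finite_measure_mono) auto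
  also have "\<dots> = 0" using prob_compl[of E] \<nu>(4)[OF E] Fi(1)[OF E] \<nu>(1)[OF E] by simp
  finally have "prob (D - E) = 0" by (simp add: measure_le_0_iff)
  thus ?thesis using finite_measure_Diff'[of D E] D Fi(1)[OF E] \<nu>(1)[OF E] by (simp add: Int_commute)
 qed
 have disj: "E \<inter> E' = {}" if "E \<in> F" "E' \<in> F" "E \<noteq> E'" for E E' using F(4) that by (simp add: disjoint_def)
 have inj: "inj_on \<nu> F"
 proof (rule inj_onI, rule ccontr)
  fix E E' assume E: "E \<in> F" "E' \<in> F" "\<nu> E = \<nu> E'" "E \<noteq> E'"
  have "measure (\<nu> E) (E \<inter> E') = measure (\<nu> E) E'" by (rule \<nu>Int[OF E(1) Fi(1)[OF E(2)]])
  thus False using disj[OF E(1,2,4)] E(3) \<nu>(4)[OF E(2)] by simp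
 qed
 show thesis
 proof (rule that[of "\<nu> ` F"])
  show "finite (\<nu> ` F)" "\<nu> ` F \<noteq> {}" using F(1,2) by auto
  show "\<nu> ` F \<subseteq> physical_measures f"
  proof (rule image_subsetI)
   fix E assume E: "E \<in> F"
   interpret prob_space "\<nu> E" by (rule \<nu>(2)[OF E])
   note [simp, measurable_cong] = \<nu>(1)[OF E]
   have "distr (\<nu> E) borel f = \<nu> E"
    by (rule measure_eqI) (use \<nu>(3)[OF E] in \<open>auto simp: emeasure_distr \<nu>sp[OF E] emeasure_eq_measure\<close>)
   moreover have "ergodic_measure f (\<nu> E)" unfolding ergodic_measure_def
   proof (intro ballI impI)
    fix D assume D: "D \<in> sets borel" "f -` D = D"
    hence "invariant D" by (simp add: invariant_def)
    from atom_zero_one[OF F(3)[OF E] this \<nu>'(1)[OF E]]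
    show "measure (\<nu> E) D = 0 \<or> measure (\<nu> E) D = 1" using \<nu>Int[OF E D(1)] \<nu>(4)[OF E] by auto
   qed
   moreover have "absolutely_continuous leb (\<nu> E)" unfolding absolutely_continuous_def
    using \<nu>(5)[OF E] by (auto simp: null_sets_def emeasure_eq_measure leb.emeasure_eq_measure)
   ultimately show "\<nu> E \<in> physical_measures f" using \<nu>(1,2)[OF E] by (simp add: physical_measures_def)
  qed
  show "vol D = 1" if D: "D \<in> sets borel" "f -` D = D" "\<And>\<nu>'. \<nu>' \<in> \<nu> ` F \<Longrightarrow> measure \<nu>' D \<noteq> 0" for D
  proof -
   have Di: "invariant D" using D by (simp add: invariant_def)
   have "vol (E - D) = 0" if E: "E \<in> F" for E
    using atom_zero_one[OF F(3)[OF E] Di \<nu>'(1)[OF E]] \<nu>Int[OF E D(1)] D(3)[of "\<nu> E"] E by auto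
   hence "(\<Sum>E\<in>F. vol (E - D)) = 0" by simp
   moreover have "vol (\<Union>E\<in>F. E - D) \<le> (\<Sum>E\<in>F. vol (E - D))"
    using F(1) Fi(1) D(1) by (intro leb.finite_measure_subadditive_finite) auto
   ultimately have 0: "vol (\<Union>E\<in>F. E - D) \<le> 0" by simp
   have eqU: "(\<Union>E\<in>F. E - D) = \<Union>F - D" by simp
   have "vol (- D) \<le> vol (- \<Union>F \<union> (\<Union>F - D))"
    using F(6) D(1) by (intro leb.finite_measure_mono) auto
   also have "\<dots> \<le> vol (- \<Union>F) + vol (\<Union>F - D)" using F(6) D(1) by (intro measure_Un_le) auto
   also have "\<dots> \<le> 0" using 0 F(5) unfolding eqU by simp
   finally show ?thesis using leb.prob_compl[of D] D(1) by (simp add: Compl_eq_Diff_UNIV measure_le_0_iff)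
  qed
  fix \<mu> assume "acip f \<mu>"
  note \<mu> = acipD(1-4)[OF this] and \<mu>sp = acipD(5)[OF this]
  interpret \<mu>: prob_space \<mu> by (rule \<mu>(2))
  note [simp, measurable_cong] = \<mu>(1)
  have cond: "measure \<mu> (E \<inter> S) = measure \<mu> E * measure (\<nu> E) S" if E: "E \<in> F" and S: "S \<in> sets borel" for E S
  proof -
   note [measurable] = Fi(1)[OF E]
   interpret \<nu>E: prob_space "\<nu> E" by (rule \<nu>(2)[OF E])
   let ?M = "density \<mu> (indicator E)" and ?N = "scale_measure (ennreal (measure \<mu> E)) (\<nu> E)"
   have M: "emeasure ?M S = ennreal (measure \<mu> (E \<inter> S))" if "S \<in> sets borel" for S
    using that by (subst emeasure_density) (simp_all add: indicator_inter_arith[symmetric] \<mu>.emeasure_eq_measure)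
   have mM: "measure ?M S = measure \<mu> (E \<inter> S)" if "S \<in> sets borel" for S
    using M[OF that] by (simp add: measure_def)
   have "?M = ?N"
   proof (rule invariant_measures_eq[where f = f])
    show "finite_measure ?M" by (rule finite_measureI) (simp add: M \<mu>sp)
    show "finite_measure ?N" by (rule finite_measureI) (simp add: space_scale_measure \<nu>E.emeasure_eq_measure ennreal_mult[symmetric])
    show "sets ?M = sets borel" "sets ?N = sets borel" "f \<in> borel_measurable borel" by (auto simp: \<nu>(1)[OF E])
    show "measure ?M (f -` A) = measure ?M A" if A: "A \<in> sets borel" for A
    proof -
     have "E \<inter> f -` A = f -` (E \<inter> A)" using Fi(2)[OF E] by auto
     thus ?thesis using A \<mu>(3)[of "E \<inter> A"] by (simp add: mM vimage_borel1)
    qed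
    show "measure ?N (f -` A) = measure ?N A" if "A \<in> sets borel" for A using \<nu>(3)[OF E that] by simp
    show "measure ?M A = measure ?N A" if A: "A \<in> sets borel" "f -` A = A" for A
    proof -
     have Ai: "invariant A" using A by (simp add: invariant_def)
     from atom_zero_one[OF F(3)[OF E] Ai \<open>acip f \<mu>\<close>]
      atom_zero_one[OF F(3)[OF E] Ai \<nu>'(1)[OF E]]
     have "measure \<mu> (E \<inter> A) = 0 \<and> measure (\<nu> E) A = 0 \<or> measure \<mu> (E \<inter> A) = measure \<mu> E \<and> measure (\<nu> E) A = 1"
     proof -
      have "vol E = vol (E \<inter> A) + vol (E - A)" using leb.finite_measure_Diff'[of E A] A(1) by simp
      hence "\<not> (vol (E \<inter> A) = 0 \<and> vol (E - A) = 0)" using Fi(3)[OF E] by auto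
      thus ?thesis using atom_zero_one[OF F(3)[OF E] Ai \<open>acip f \<mu>\<close>]
        atom_zero_one[OF F(3)[OF E] Ai \<nu>'(1)[OF E]] \<nu>Int[OF E A(1)] \<nu>(4)[OF E] by auto
     qed
     thus ?thesis using mM[OF A(1)] by auto
    qed
   qed
   thus ?thesis using mM[OF S] by simp
  qed
  define \<alpha> where "\<alpha> \<nu>' = measure \<mu> (inv_into F \<nu> \<nu>')" for \<nu>'
  have \<alpha>: "\<alpha> (\<nu> E) = measure \<mu> E" if "E \<in> F" for E using that inj by (simp add: \<alpha>_def)
  have tot: "measure \<mu> S = (\<Sum>\<nu>'\<in>\<nu> ` F. \<alpha> \<nu>' * measure \<nu>' S)" if S: "S \<in> sets borel" for S
  proof -
   have "measure \<mu> (S - \<Union>F) \<le> measure \<mu> (- \<Union>F)" using F(6) by (intro \<mu>.finite_measure_mono) auto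
   also have "\<dots> = 0" using \<mu>(4)[of "- \<Union>F"] F(5,6) by simp
   finally have "measure \<mu> (S - \<Union>F) = 0" by (simp add: measure_le_0_iff)
   hence "measure \<mu> S = measure \<mu> (S \<inter> \<Union>F)"
    using \<mu>.finite_measure_Diff'[of S "\<Union>F"] S F(6) by simp
   also have "S \<inter> \<Union>F = (\<Union>E\<in>F. E \<inter> S)" by blast
   also have "measure \<mu> \<dots> = (\<Sum>E\<in>F. measure \<mu> (E \<inter> S))"
    by (rule \<mu>.finite_measure_finite_Union)
     (use F(1) Fi(1) S disj in \<open>auto simp: disjoint_family_on_def\<close>)
   also have "\<dots> = (\<Sum>E\<in>F. \<alpha> (\<nu> E) * measure (\<nu> E) S)" by (intro sum.cong) (simp_all add: cond[OF _ S] \<alpha>)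
   also have "\<dots> = (\<Sum>\<nu>'\<in>\<nu> ` F. \<alpha> \<nu>' * measure \<nu>' S)" by (simp add: sum.reindex[OF inj])
   finally show ?thesis .
  qed
  have "(\<Sum>\<nu>'\<in>\<nu> ` F. \<alpha> \<nu>') = (\<Sum>\<nu>'\<in>\<nu> ` F. \<alpha> \<nu>' * measure \<nu>' UNIV)"
  proof (intro sum.cong refl)
   fix \<nu>' assume "\<nu>' \<in> \<nu> ` F"
   then obtain E where E: "E \<in> F" "\<nu>' = \<nu> E" by blast
   show "\<alpha> \<nu>' = \<alpha> \<nu>' * measure \<nu>' UNIV"
    using prob_space.prob_space[OF \<nu>(2)[OF E(1)]] unfolding E(2) \<nu>sp[OF E(1)] by simp
  qed
  also have "\<dots> = 1" using tot[of UNIV] \<mu>.prob_space by (simp add: \<mu>sp)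
  finally show "convex_combination_of (\<nu> ` F) \<mu>" unfolding convex_combination_of_def
   by (intro exI[of _ "\<nu> ` F"] exI[of _ \<alpha>]) (use F(1) tot in \<open>auto simp: \<alpha>_def\<close>)
 qed
qed

text \<open>\<open>\<mu>\<close> is the sum of the physical measures. Almost every orbit ends up in a set on which \<open>leb\<close> is
 absolutely continuous with respect to \<open>\<mu>\<close>.\<close>

lemma physical_structure:
 obtains Q \<mu> where "Q \<subseteq> physical_measures f" "\<And>\<nu>. acip f \<nu> \<Longrightarrow> convex_combination_of Q \<nu>" "regular_dynamics f Q \<mu>"
proof -
 obtain Q where Q: "finite Q" "Q \<noteq> {}" "Q \<subseteq> physical_measures f" "\<And>\<nu>. acip f \<nu> \<Longrightarrow> convex_combination_of Q \<nu>"
  and cover: "\<And>D. D \<in> sets borel \<Longrightarrow> f -` D = D \<Longrightarrow> (\<And>\<nu>. \<nu> \<in> Q \<Longrightarrow> measure \<nu> D \<noteq> 0) \<Longrightarrow> vol D = 1"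
 proof (rule finite_physical_measures, goal_cases)
  case (1 Q) show ?case by (rule 1(1)[OF 1(2-6)])
 qed
 have acip: "acip f \<nu>" if "\<nu> \<in> Q" for \<nu>
 proof -
  have \<nu>: "sets \<nu> = sets borel" "prob_space \<nu>" "distr \<nu> borel f = \<nu>" "absolutely_continuous leb \<nu>"
   using Q(3) that by (auto simp: physical_measures_def)
  have fm: "f \<in> measurable \<nu> borel" unfolding measurable_cong_sets[OF \<nu>(1) refl] by (rule measurable_f)
  have "measure \<nu> (f -` S) = measure \<nu> S" if "S \<in> sets borel" for S
   using measure_distr[OF fm that] sets_eq_imp_space_eq[OF \<nu>(1)] \<nu>(3) by simp
  moreover have "measure \<nu> S = 0" if S: "S \<in> sets borel" "vol S = 0" for S
  proof -
   have "S \<in> null_sets leb" using S by (simp add: null_sets_def leb.emeasure_eq_measure)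
   hence "S \<in> null_sets \<nu>" using \<nu>(4) unfolding absolutely_continuous_def by (rule subsetD[rotated])
   thus ?thesis by (simp add: null_sets_def measure_def)
  qed
  ultimately show ?thesis using \<nu>(1,2) by (simp add: acip_def)
 qed
 note Qs = acipD[OF acip]
 define \<mu> where "\<mu> = measure_of UNIV (sets borel) (\<lambda>S. \<Sum>\<nu>\<in>Q. emeasure \<nu> S)"
 have \<mu>s [simp, measurable_cong]: "sets \<mu> = sets borel" using sets.sigma_sets_eq[of borel] by (simp add: \<mu>_def)
 have e\<mu>: "emeasure \<mu> S = (\<Sum>\<nu>\<in>Q. emeasure \<nu> S)" if S: "S \<in> sets borel" for S
  unfolding \<mu>_def
 proof (rule emeasure_measure_of_sigma[OF _ _ _ S])
  show "sigma_algebra UNIV (sets (borel :: 'n torus measure))" using sets.sigma_algebra_axioms[of borel] by simp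
  show "positive (sets borel) (\<lambda>S. \<Sum>\<nu>\<in>Q. emeasure \<nu> S)" by (simp add: positive_def)
  show "countably_additive (sets borel) (\<lambda>S. \<Sum>\<nu>\<in>Q. emeasure \<nu> S)"
  proof (rule countably_additiveI)
   fix D :: "nat \<Rightarrow> 'n torus set" assume D: "range D \<subseteq> sets borel" "disjoint_family D"
   have "(\<Sum>i. \<Sum>\<nu>\<in>Q. emeasure \<nu> (D i)) = (\<Sum>\<nu>\<in>Q. \<Sum>i. emeasure \<nu> (D i))" by (rule suminf_sum) simp
   also have "\<dots> = (\<Sum>\<nu>\<in>Q. emeasure \<nu> (\<Union>i. D i))"
    by (intro sum.cong refl suminf_emeasure) (use D Qs(1) in auto)
   finally show "(\<Sum>i. \<Sum>\<nu>\<in>Q. emeasure \<nu> (D i)) = (\<Sum>\<nu>\<in>Q. emeasure \<nu> (\<Union>i. D i))" .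
  qed
 qed
 have m\<mu>: "measure \<mu> S = (\<Sum>\<nu>\<in>Q. measure \<nu> S)" if S: "S \<in> sets borel" for S
 proof -
  have "emeasure \<mu> S = (\<Sum>\<nu>\<in>Q. ennreal (measure \<nu> S))"
   unfolding e\<mu>[OF S] using Qs(6) by (intro sum.cong refl finite_measure.emeasure_eq_measure)
  also have "\<dots> = ennreal (\<Sum>\<nu>\<in>Q. measure \<nu> S)" by (simp add: sum_ennreal)
  finally show ?thesis by (simp add: measure_def sum_nonneg)
 qed
 have sp\<mu>: "space \<mu> = UNIV" using sets_eq_imp_space_eq[OF \<mu>s] by simp
 interpret \<mu>: finite_measure \<mu>
 proof (rule finite_measureI)
  have "emeasure \<nu> UNIV = 1" if "\<nu> \<in> Q" for \<nu> using prob_space.emeasure_space_1[OF Qs(2)[OF that]] Qs(5)[OF that] by simp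
  thus "emeasure \<mu> (space \<mu>) \<noteq> \<infinity>" by (simp add: sp\<mu> e\<mu> ennreal_of_nat_eq_real_of_nat)
 qed
 have \<mu>inv: "measure \<mu> (f -` S) = measure \<mu> S" if "S \<in> sets borel" for S
  using that Qs(3) by (simp add: m\<mu> vimage_borel1)
 have \<mu>ac: "measure \<mu> S = 0" if "S \<in> sets borel" "vol S = 0" for S using that Qs(4) by (simp add: m\<mu>)
 have \<mu>le: "measure \<nu> S \<le> measure \<mu> S" if "\<nu> \<in> Q" "S \<in> sets borel" for \<nu> S
  unfolding m\<mu>[OF that(2)] using Q(1) that(1) by (intro member_le_sum) auto
 have "absolutely_continuous leb \<mu>" unfolding absolutely_continuous_def using \<mu>ac
  by (auto simp: null_sets_def \<mu>.emeasure_eq_measure leb.emeasure_eq_measure)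
 then obtain g where g: "g \<in> borel_measurable leb" "density leb g = \<mu>"
  using leb.Radon_Nikodym[of \<mu>] by auto
 note [measurable] = g(1)
 \<comment> \<open>Where the density of \<open>\<mu>\<close> is positive, Lebesgue measure is
   conversely absolutely continuous with respect to \<open>\<mu>\<close>; this is
   \<open>Pac\<close>.\<close>
 define P where "P = {x. g x \<noteq> 0}"
 have P [measurable]: "P \<in> sets borel"
 proof -
  have "P = {x\<in>space leb. g x \<noteq> 0}" by (simp add: P_def)
  also have "\<dots> \<in> sets leb" by measurable
  finally show ?thesis by simp
 qed
 have \<mu>P: "measure \<mu> (- P) = 0"
 proof -
  have "emeasure \<mu> (- P) = (\<integral>\<^sup>+x\<in>- P. g x \<partial>leb)"
   unfolding g(2)[symmetric] by (rule emeasure_density) auto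
  also have "\<dots> = (\<integral>\<^sup>+x. 0 \<partial>leb)" by (intro nn_integral_cong) (auto simp: P_def indicator_def)
  finally show ?thesis by (simp add: measure_def)
 qed
 have Pac: "vol (P \<inter> Z) = 0" if [measurable]: "Z \<in> sets borel" and Z0: "measure \<mu> Z = 0" for Z
 proof -
  have "(\<integral>\<^sup>+x\<in>Z. g x \<partial>leb) = emeasure \<mu> Z"
   unfolding g(2)[symmetric] by (rule emeasure_density[symmetric]) auto
  hence "(\<integral>\<^sup>+x\<in>Z. g x \<partial>leb) = 0" using Z0 by (simp add: \<mu>.emeasure_eq_measure)
  hence "AE x in leb. g x * indicator Z x = 0" by (subst (asm) nn_integral_0_iff_AE) auto
  hence "AE x in leb. x \<notin> P \<inter> Z" by eventually_elim (auto simp: P_def indicator_def split: if_splits)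
  hence "P \<inter> Z \<in> null_sets leb" by (subst AE_iff_null_sets) simp_all
  thus ?thesis by (simp add: measure_def null_sets_def)
 qed
 \<comment> \<open>The points whose orbit never leaves \<open>P\<close>. By invariance
   \<open>\<mu>\<close> does not charge the complement, so the invariant set of points that ever
   enter \<open>S\<close> has full volume by \<open>cover\<close>.\<close>
 define S where "S = (\<Inter>j. (f ^^ j) -` P)"
 have Sb [measurable]: "S \<in> sets borel" unfolding S_def by measurable
 have \<mu>iter: "measure \<mu> ((f ^^ j) -` Z) = measure \<mu> Z" if "Z \<in> sets borel" for Z j
  by (rule measure_vimage_iterate[OF measurable_f \<mu>inv that])
 have \<mu>S: "measure \<mu> (- S) = 0"
 proof -
  have "(f ^^ j) -` (- P) \<in> null_sets \<mu>" for j
   using \<mu>iter[of "- P" j] \<mu>P by (simp add: null_sets_def \<mu>.emeasure_eq_measure vimage_borel)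
  hence "(\<Union>j. (f ^^ j) -` (- P)) \<in> null_sets \<mu>" by (intro null_sets_UN') auto
  moreover have "(\<Union>j. (f ^^ j) -` (- P)) = - S" by (auto simp: S_def)
  ultimately show ?thesis by (simp add: null_sets_def measure_def)
 qed
 define T where "T n = (f ^^ n) -` S" for n
 have Tb [measurable]: "T n \<in> sets borel" for n by (simp add: T_def)
 have SS: "f x \<in> S" if "x \<in> S" for x
 proof -
  have "(f ^^ j) (f x) \<in> P" for j using that unfolding S_def by (metis INT_D UNIV_I comp_apply funpow_Suc_right vimageD)
  thus ?thesis by (simp add: S_def)
 qed
 have incT: "incseq T" unfolding T_def by (intro incseq_SucI) (use SS in auto)
 have "f -` (\<Union>n. T n) = (\<Union>n. T (Suc n))"
  unfolding vimage_UN T_def by (intro SUP_cong refl) (auto simp: funpow_swap1)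
 also have "\<dots> = (\<Union>n. T n)"
 proof (rule antisym)
  show "(\<Union>n. T (Suc n)) \<subseteq> (\<Union>n. T n)" by (rule UN_least, rule UN_upper) simp
  show "(\<Union>n. T n) \<subseteq> (\<Union>n. T (Suc n))" using incT by (intro UN_mono) (auto simp: incseq_Suc_iff)
 qed
 finally have Tinv: "f -` (\<Union>n. T n) = (\<Union>n. T n)" .
 have "vol (\<Union>n. T n) = 1"
 proof (rule cover[OF _ Tinv])
  fix \<nu> assume \<nu>: "\<nu> \<in> Q"
  interpret \<nu>: prob_space \<nu> by (rule Qs(2)[OF \<nu>])
  have b: "S \<in> sets \<nu>" "(\<Union>n. T n) \<in> sets \<nu>" using Qs(1)[OF \<nu>] by auto
  have "measure \<nu> (- S) \<le> 0" using \<mu>le[OF \<nu>, of "- S"] \<mu>S by simp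
  hence "measure \<nu> S = 1" using \<nu>.prob_compl[OF b(1)] Qs(5)[OF \<nu>] by (simp add: Compl_eq_Diff_UNIV measure_le_0_iff)
  moreover have "measure \<nu> S \<le> measure \<nu> (\<Union>n. T n)"
   using b UN_upper[of 0 UNIV T] by (intro \<nu>.finite_measure_mono) (auto simp: T_def)
  ultimately show "measure \<nu> (\<Union>n. T n) \<noteq> 0" by simp
 qed auto
 hence Tlim: "(\<lambda>n. vol (T n)) \<longlonglongrightarrow> 1"
  using leb.finite_Lim_measure_incseq[OF _ incT] Tb by (simp add: image_subset_iff)
 \<comment> \<open>The iterates with \<open>j < n0\<close> are finitely many. For
   \<open>j \<ge> n0\<close> most points are in \<open>P\<close> at time \<open>n0\<close>, and from
   then on volume is controlled by \<open>\<mu>\<close>, which does not change under preimages. So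
   one \<open>d\<close> serves all \<open>j\<close>.\<close>
 have UA: "\<exists>\<delta>>0. \<forall>D\<in>sets borel. \<forall>j. vol D < \<delta> \<longrightarrow> vol ((f ^^ j) -` D) < \<eta>" if \<eta>: "\<eta> > 0" for \<eta>
 proof -
  have iter: "\<exists>d>0. \<forall>Z\<in>sets borel. vol Z < d \<longrightarrow> vol ((f ^^ j) -` Z) < e" if e: "e > 0" for j e
  proof -
   let ?N = "distr leb borel (f ^^ j)"
   have N: "measure ?N Z = vol ((f ^^ j) -` Z)" if "Z \<in> sets borel" for Z
    using that by (subst measure_distr) auto
   have fin: "finite_measure ?N" by (intro leb.finite_measure_distr) simp
   obtain d where "d > 0" "\<And>A. A \<in> sets leb \<Longrightarrow> vol A < d \<Longrightarrow> measure ?N A < e"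
    by (rule absolutely_continuous_uniform[OF leb.finite_measure_axioms fin _ _ e])
     (use N null_vimage_iterate in auto)
   thus ?thesis using N by (intro exI[of _ d]) auto
  qed
  have "\<forall>\<^sub>F n in sequentially. 1 - \<eta> / 2 < vol (T n)"
   using Tlim by (rule order_tendstoD(1)) (use \<eta> in simp)
  then obtain n0 where "1 - \<eta> / 2 < vol (T n0)" using eventually_happens'[OF sequentially_bot] by blast
  hence n0: "vol (- T n0) < \<eta> / 2" using leb.prob_compl[of "T n0"] by (simp add: Compl_eq_Diff_UNIV)
  obtain d1 where d1: "d1 > 0" "\<And>Z. Z \<in> sets borel \<Longrightarrow> vol Z < d1 \<Longrightarrow> vol ((f ^^ n0) -` Z) < \<eta> / 2"
   using iter[of "\<eta> / 2" n0] \<eta> by auto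
  obtain d2 where d2: "d2 > 0" "\<And>Z. Z \<in> sets borel \<Longrightarrow> measure \<mu> Z < d2 \<Longrightarrow> vol (P \<inter> Z) < d1"
  proof -
   let ?N = "density leb (indicator P)"
   have eN: "emeasure ?N Z = ennreal (vol (P \<inter> Z))" if "Z \<in> sets borel" for Z
    using that by (subst emeasure_density) (simp_all add: indicator_inter_arith[symmetric] leb.emeasure_eq_measure)
   hence N: "measure ?N Z = vol (P \<inter> Z)" if "Z \<in> sets borel" for Z using that by (simp add: measure_def)
   have fin: "finite_measure ?N" by (rule finite_measureI) (simp add: eN)
   obtain d where "d > 0" "\<And>A. A \<in> sets \<mu> \<Longrightarrow> measure \<mu> A < d \<Longrightarrow> measure ?N A < d1"
    by (rule absolutely_continuous_uniform[OF \<mu>.finite_measure_axioms fin _ _ d1(1)]) (use N Pac in auto)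
   thus thesis using N by (intro that[of d]) auto
  qed
  obtain d3 where d3: "d3 > 0" "\<And>A. A \<in> sets leb \<Longrightarrow> vol A < d3 \<Longrightarrow> measure \<mu> A < d2"
   by (rule absolutely_continuous_uniform[OF leb.finite_measure_axioms \<mu>.finite_measure_axioms _ _ d2(1)]) (use \<mu>ac in auto)
  have "\<exists>e. \<forall>j. e j > 0 \<and> (\<forall>Z\<in>sets borel. vol Z < e j \<longrightarrow> vol ((f ^^ j) -` Z) < \<eta>)"
   using iter[OF \<eta>] by metis
  then obtain e where e: "\<And>j. e j > 0" "\<And>j Z. Z \<in> sets borel \<Longrightarrow> vol Z < e j \<Longrightarrow> vol ((f ^^ j) -` Z) < \<eta>"
   by blast
  define d where "d = Min (insert d3 (e ` {..<n0}))"
  have d: "d > 0" "d \<le> d3" "\<And>j. j < n0 \<Longrightarrow> d \<le> e j" using d3(1) e(1) by (auto simp: d_def)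
  have "vol ((f ^^ j) -` D) < \<eta>" if D [measurable]: "D \<in> sets borel" and Dd: "vol D < d" for D j
  proof (cases "j < n0")
   case True
   thus ?thesis using e(2)[OF D] d(3)[OF True] Dd by simp
  next
   case False
   define i where "i = j - n0"
   have fj: "f ^^ j = f ^^ i \<circ> f ^^ n0" using False by (simp add: i_def funpow_add[symmetric])
   let ?Z = "(f ^^ i) -` D"
   have "measure \<mu> ?Z < d2" using \<mu>iter[OF D] d3(2)[of D] Dd d(2) by simp
   hence "vol (P \<inter> ?Z) < d1" by (intro d2(2)) auto
   hence 1: "vol ((f ^^ n0) -` (P \<inter> ?Z)) < \<eta> / 2" by (intro d1(2)) auto
   have "(f ^^ j) -` D \<subseteq> - T n0 \<union> (f ^^ n0) -` (P \<inter> ?Z)"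
   proof
    fix x assume x: "x \<in> (f ^^ j) -` D"
    show "x \<in> - T n0 \<union> (f ^^ n0) -` (P \<inter> ?Z)"
    proof (cases "x \<in> T n0")
     case True
     hence "(f ^^ n0) x \<in> S" by (simp add: T_def)
     hence "(f ^^ 0) ((f ^^ n0) x) \<in> P" unfolding S_def by blast
     thus ?thesis using x by (simp add: fj)
    qed simp
   qed
   hence "vol ((f ^^ j) -` D) \<le> vol (- T n0 \<union> (f ^^ n0) -` (P \<inter> ?Z))"
    by (intro leb.finite_measure_mono) auto
   also have "\<dots> \<le> vol (- T n0) + vol ((f ^^ n0) -` (P \<inter> ?Z))" by (rule measure_Un_le) auto
   finally show ?thesis using n0 1 by simp
  qed
  thus ?thesis using d(1) by blast
 qed
 show thesis
  by (rule that[OF Q(3,4) regular_dynamics.intro[OF continuous_f Q(1,2) acip cover \<mu>.finite_measure_axioms \<mu>s \<mu>inv \<mu>ac \<mu>le UA]])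
qed

end

subsection \<open>The noise\<close>

lemma nn_integral_torus_shift:
 fixes y :: "'n::finite torus"
 assumes [measurable]: "\<phi> \<in> borel_measurable borel"
 shows "(\<integral>\<^sup>+w. \<phi> (y + torus_of w) \<partial>uniform_measure lborel (cbox 0 1)) = (\<integral>\<^sup>+x. \<phi> x \<partial>torus_lebesgue)"
proof -
 have [measurable]: "torus_of \<in> borel_measurable (borel :: (real^'n) measure)" by (rule measurable_torus_of)
 have "torus_lebesgue = distr torus_lebesgue borel (\<lambda>x. y + x)"
  by (rule measure_eqI) (auto simp: emeasure_distr torus_lebesgue_translate space_torus_lebesgue)
 hence "(\<integral>\<^sup>+x. \<phi> x \<partial>torus_lebesgue) = (\<integral>\<^sup>+x. \<phi> x \<partial>distr torus_lebesgue borel (\<lambda>x. y + x))" by simp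
 also have "\<dots> = (\<integral>\<^sup>+x. \<phi> (y + x) \<partial>torus_lebesgue)" by (rule nn_integral_distr) measurable
 also have "\<dots> = (\<integral>\<^sup>+w. \<phi> (y + torus_of w) \<partial>uniform_measure lborel (cbox 0 1))"
  unfolding torus_lebesgue_def by (rule nn_integral_distr) measurable
 finally show ?thesis ..
qed

lemma prob_uniform_cbox: "prob_space (uniform_measure lborel (cbox 0 1 :: (real ^ 'n::finite) set))"
 by (intro prob_space_uniform_measure) (simp_all add: emeasure_cbox01)

lemma ball_borel [measurable]: "ball (x::'a::metric_space) r \<in> sets borel"
 by simp

context
 fixes y :: "'n::finite torus" and \<phi> :: "'n torus \<Rightarrow> ennreal" and z :: real
 assumes \<phi> [measurable]: "\<phi> \<in> borel_measurable borel" and z: "z > 0"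
begin

private abbreviation "U \<equiv> uniform_measure lborel (cbox 0 1 :: (real ^ 'n) set)"
private abbreviation "g v \<equiv> \<phi> (y + torus_of v)"
private abbreviation "I \<equiv> (\<integral>\<^sup>+x. \<phi> x \<partial>torus_lebesgue)"

text \<open>The bounds on the law of the noise come from averaging over a shift \<open>w\<close>
  that is uniform in the unit cube: with it the law is exactly Lebesgue measure, for each
  \<open>t\<close>. In \<open>translated\<close> the shift moves the ball by
  \<open>w /\<^sub>R z\<close>, of norm at most \<open>CARD('n) / z\<close>, so undoing the average
  only costs a change of radius.\<close>

private lemma average:
 "(\<integral>\<^sup>+w. \<integral>\<^sup>+t. g (z *\<^sub>R t + w) * indicator (ball 0 r) t \<partial>lborel \<partial>U) =
  emeasure lborel (ball (0::real^'n) r) * I"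
proof -
 interpret U: prob_space U by (rule prob_uniform_cbox)
 interpret pair_sigma_finite U lborel ..
 have [measurable]: "torus_of \<in> borel_measurable (borel :: (real^'n) measure)" by (rule measurable_torus_of)
 have "(\<integral>\<^sup>+w. \<integral>\<^sup>+t. g (z *\<^sub>R t + w) * indicator (ball 0 r) t \<partial>lborel \<partial>U) =
  (\<integral>\<^sup>+t. \<integral>\<^sup>+w. g (z *\<^sub>R t + w) * indicator (ball 0 r) t \<partial>U \<partial>lborel)"
  by (rule Fubini'[symmetric]) measurable
 also have "\<dots> = (\<integral>\<^sup>+t\<in>ball (0::real^'n) r. I \<partial>lborel)"
 proof (rule nn_integral_cong)
  fix t
  have "(\<integral>\<^sup>+w. g (z *\<^sub>R t + w) * indicator (ball 0 r) t \<partial>U) =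
   (\<integral>\<^sup>+w. \<phi> ((y + torus_of (z *\<^sub>R t)) + torus_of w) \<partial>U) * indicator (ball 0 r) t"
   by (subst nn_integral_multc) (simp_all add: torus_of_add add.assoc)
  thus "(\<integral>\<^sup>+w. g (z *\<^sub>R t + w) * indicator (ball 0 r) t \<partial>U) =
   I * indicator (ball 0 r) t" by (simp add: nn_integral_torus_shift)
 qed
 also have "\<dots> = emeasure lborel (ball (0::real^'n) r) * I"
  by (subst nn_integral_cmult_indicator) (auto simp: mult.commute)
 finally show ?thesis .
qed

private lemma translated:
 "(\<integral>\<^sup>+t\<in>ball 0 r. g (z *\<^sub>R t) \<partial>lborel) =
 (\<integral>\<^sup>+t. g (z *\<^sub>R t + w) * indicator (ball (0::real^'n) r) (w /\<^sub>R z + t) \<partial>lborel)"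
proof -
 have [measurable]: "torus_of \<in> borel_measurable (borel :: (real^'n) measure)" by (rule measurable_torus_of)
 have "(\<integral>\<^sup>+t\<in>ball 0 r. g (z *\<^sub>R t) \<partial>lborel) =
  (\<integral>\<^sup>+t\<in>ball 0 r. g (z *\<^sub>R t) \<partial>distr lborel borel ((+) (w /\<^sub>R z)))"
  unfolding lborel_distr_plus ..
 also have "\<dots> = (\<integral>\<^sup>+t. g (z *\<^sub>R (w /\<^sub>R z + t)) * indicator (ball (0::real^'n) r) (w /\<^sub>R z + t) \<partial>lborel)"
  by (rule nn_integral_distr) measurable
 finally show ?thesis using z by (simp add: scaleR_add_right add.commute)
qed

private lemma norm_cbox: "w \<in> cbox 0 1 \<Longrightarrow> norm (w /\<^sub>R z) \<le> CARD('n) / z" for w :: "real^'n"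
proof -
 assume w: "w \<in> cbox 0 1"
 have "norm w \<le> (\<Sum>i\<in>UNIV. \<bar>w $ i\<bar>)" by (rule norm_le_l1_cart)
 also have "\<dots> \<le> (\<Sum>i\<in>(UNIV::'n set). 1)" using w by (intro sum_mono) (auto simp: mem_box_cart)
 finally show ?thesis using z by (simp add: divide_simps)
qed

private lemma AE_U: "AE w in U. w \<in> cbox 0 1" by (rule AE_uniform_measureI) auto

private lemma lborel_upper:
 "(\<integral>\<^sup>+t\<in>ball 0 r. g (z *\<^sub>R t) \<partial>lborel) \<le>
 emeasure lborel (ball (0::real^'n) (r + CARD('n) / z)) * I" (is "?L \<le> _")
proof -
 interpret U: prob_space U by (rule prob_uniform_cbox)
 have "?L = (\<integral>\<^sup>+w. ?L \<partial>U)" using U.emeasure_space_1 by simp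
 also have "\<dots> \<le> (\<integral>\<^sup>+w. \<integral>\<^sup>+t. g (z *\<^sub>R t + w) * indicator (ball 0 (r + CARD('n) / z)) t \<partial>lborel \<partial>U)"
 proof (rule nn_integral_mono_AE, use AE_U in eventually_elim)
  fix w :: "real^'n" assume w: "w \<in> cbox 0 1"
  show "?L \<le> (\<integral>\<^sup>+t. g (z *\<^sub>R t + w) * indicator (ball 0 (r + CARD('n) / z)) t \<partial>lborel)"
   unfolding translated[of r w]
  proof (intro nn_integral_mono mult_left_mono)
   fix t
   have "norm t \<le> norm (w /\<^sub>R z + t) + norm (w /\<^sub>R z)" using norm_triangle_ineq4[of "w /\<^sub>R z + t" "w /\<^sub>R z"] by simp
   thus "indicator (ball 0 r) (w /\<^sub>R z + t) \<le> (indicator (ball 0 (r + CARD('n) / z)) t :: ennreal)"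
    using norm_cbox[OF w] by (auto simp: indicator_def)
  qed simp
 qed
 finally show ?thesis unfolding average .
qed

private lemma lborel_lower:
 "emeasure lborel (ball (0::real^'n) (r - CARD('n) / z)) * I \<le>
 (\<integral>\<^sup>+t\<in>ball 0 r. g (z *\<^sub>R t) \<partial>lborel)" (is "_ \<le> ?L")
proof -
 interpret U: prob_space U by (rule prob_uniform_cbox)
 have "(\<integral>\<^sup>+w. \<integral>\<^sup>+t. g (z *\<^sub>R t + w) * indicator (ball 0 (r - CARD('n) / z)) t \<partial>lborel \<partial>U) \<le> (\<integral>\<^sup>+w. ?L \<partial>U)"
 proof (rule nn_integral_mono_AE, use AE_U in eventually_elim)
  fix w :: "real^'n" assume w: "w \<in> cbox 0 1"
  show "(\<integral>\<^sup>+t. g (z *\<^sub>R t + w) * indicator (ball 0 (r - CARD('n) / z)) t \<partial>lborel) \<le> ?L"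
   unfolding translated[of r w]
  proof (intro nn_integral_mono mult_left_mono)
   fix t
   have "norm (w /\<^sub>R z + t) \<le> norm (w /\<^sub>R z) + norm t" by (rule norm_triangle_ineq)
   thus "indicator (ball 0 (r - CARD('n) / z)) t \<le> (indicator (ball 0 r) (w /\<^sub>R z + t) :: ennreal)"
    using norm_cbox[OF w] by (auto simp: indicator_def)
  qed simp
 qed
 also have "(\<integral>\<^sup>+w. ?L \<partial>U) = ?L" using U.emeasure_space_1 by simp
 finally show ?thesis unfolding average .
qed

private lemma noise_integral:
 assumes \<epsilon>: "\<epsilon> > 0"
 shows "(\<integral>\<^sup>+t. g (z *\<^sub>R t) \<partial>noise \<epsilon>) * emeasure lborel (ball (0::real^'n) \<epsilon>) =
  (\<integral>\<^sup>+t\<in>ball 0 \<epsilon>. g (z *\<^sub>R t) \<partial>lborel)"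
proof -
 have [measurable]: "torus_of \<in> borel_measurable (borel :: (real^'n) measure)" by (rule measurable_torus_of)
 have "emeasure lborel (ball (0::real^'n) \<epsilon>) \<noteq> 0" using emeasure_lborel_ball_pos[OF \<epsilon>, where 'n = 'n] by simp
 moreover have "emeasure lborel (ball (0::real^'n) \<epsilon>) \<noteq> \<top>" using emeasure_lborel_ball_finite[of "0::real^'n" \<epsilon>] by simp
 ultimately show ?thesis
  unfolding noise_def by (subst nn_integral_uniform_measure) (auto simp: ennreal_divide_times less_top)
qed

text \<open>The constant is the ratio of the volumes of the balls of radius
  \<open>\<epsilon> + CARD('n) / z\<close> and \<open>\<epsilon>\<close>.\<close>

lemma noise_law_upper:
 assumes \<epsilon>: "\<epsilon> > 0"
 shows "(\<integral>\<^sup>+t. g (z *\<^sub>R t) \<partial>noise \<epsilon>) \<le> ennreal ((1 + CARD('n) / (z * \<epsilon>)) ^ CARD('n)) * I"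
proof -
 have "emeasure lborel (ball (0::real^'n) (\<epsilon> + CARD('n) / z)) = ennreal ((1 + CARD('n) / (z * \<epsilon>)) ^ CARD('n)) * emeasure lborel (ball (0::real^'n) \<epsilon>)"
 proof -
  have "\<epsilon> + CARD('n) / z = (1 + CARD('n) / (z * \<epsilon>)) * \<epsilon>" using z \<epsilon> by (simp add: field_simps)
  hence "(\<epsilon> + CARD('n) / z) ^ CARD('n) = (1 + CARD('n) / (z * \<epsilon>)) ^ CARD('n) * \<epsilon> ^ CARD('n)"
   by (metis power_mult_distrib)
  thus ?thesis using z \<epsilon> by (simp add: emeasure_ball ennreal_mult[symmetric] mult_ac)
 qed
 with lborel_upper[of \<epsilon>] noise_integral[OF \<epsilon>]
 have "(\<integral>\<^sup>+t. g (z *\<^sub>R t) \<partial>noise \<epsilon>) * emeasure lborel (ball (0::real^'n) \<epsilon>) \<le>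
  (ennreal ((1 + CARD('n) / (z * \<epsilon>)) ^ CARD('n)) * I) * emeasure lborel (ball (0::real^'n) \<epsilon>)"
  by (simp add: mult_ac)
 thus ?thesis
  using emeasure_lborel_ball_pos[OF \<epsilon>, where 'n = 'n] emeasure_lborel_ball_finite[of "0::real^'n" \<epsilon>]
  by (simp add: ennreal_mult_le_mult_iff mult.commute)
qed

text \<open>By \<open>big\<close> the shift is at most half the radius, and the ball of radius
  \<open>\<epsilon> / 2\<close> has the fraction \<open>(1 / 2) ^ CARD('n)\<close> of the
  volume.\<close>

lemma noise_law_lower:
 assumes \<epsilon>: "\<epsilon> > 0" and big: "z * \<epsilon> \<ge> 2 * CARD('n)"
 shows "ennreal ((1 / 2) ^ CARD('n)) * I \<le> (\<integral>\<^sup>+t. g (z *\<^sub>R t) \<partial>noise \<epsilon>)"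
proof -
 have "\<epsilon> / 2 \<le> \<epsilon> - CARD('n) / z" using z big by (simp add: field_simps)
 hence "ball (0::real^'n) (\<epsilon> / 2) \<subseteq> ball 0 (\<epsilon> - CARD('n) / z)" by (rule subset_ball)
 hence "emeasure lborel (ball (0::real^'n) (\<epsilon> / 2)) \<le> emeasure lborel (ball (0::real^'n) (\<epsilon> - CARD('n) / z))"
  by (rule emeasure_mono) simp
 moreover have "emeasure lborel (ball (0::real^'n) (\<epsilon> / 2)) = ennreal ((1 / 2) ^ CARD('n)) * emeasure lborel (ball (0::real^'n) \<epsilon>)"
  using \<epsilon> by (simp add: emeasure_ball ennreal_mult[symmetric] power_divide)
 ultimately have "(ennreal ((1 / 2) ^ CARD('n)) * emeasure lborel (ball (0::real^'n) \<epsilon>)) * I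
  \<le> emeasure lborel (ball (0::real^'n) (\<epsilon> - CARD('n) / z)) * I" by (intro mult_right_mono) auto
 also note lborel_lower[of \<epsilon>]
 also note noise_integral[OF \<epsilon>, symmetric]
 finally have "(ennreal ((1 / 2) ^ CARD('n)) * I) * emeasure lborel (ball (0::real^'n) \<epsilon>)
  \<le> (\<integral>\<^sup>+t. g (z *\<^sub>R t) \<partial>noise \<epsilon>) * emeasure lborel (ball (0::real^'n) \<epsilon>)"
  by (simp add: mult_ac)
 thus ?thesis
  using emeasure_lborel_ball_pos[OF \<epsilon>, where 'n = 'n] emeasure_lborel_ball_finite[of "0::real^'n" \<epsilon>]
  by (simp add: ennreal_mult_le_mult_iff mult.commute)
qed

end

lemma prob_noise: "\<epsilon> > 0 \<Longrightarrow> prob_space (noise \<epsilon> :: (real^'n::finite) measure)"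
 unfolding noise_def using emeasure_lborel_ball_pos[of \<epsilon>, where 'n = 'n] emeasure_lborel_ball_finite[of "0::real^'n" \<epsilon>]
 by (intro prob_space_uniform_measure) (simp_all add: less_le)

lemma AE_noise: "AE t in (noise \<epsilon> :: (real^'n::finite) measure). norm t < \<epsilon>"
proof -
 have b: "ball (0::real^'n) \<epsilon> \<in> sets lborel" by simp
 have a: "AE t in lborel. (t::real^'n) \<in> ball 0 \<epsilon> \<longrightarrow> norm t < \<epsilon>" by (rule AE_I2) simp
 have "AE t in uniform_measure lborel (ball (0::real^'n) \<epsilon>). norm t < \<epsilon>"
  by (rule AE_uniform_measureI[OF b a])
 thus ?thesis by (simp only: noise_def)
qed

subsection \<open>Stationary measures\<close>

lemma borel_measure_eqI_continuous:
 fixes M N :: "'a::metric_space measure"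
 assumes MN: "finite_measure M" "finite_measure N" "sets M = sets borel" "sets N = sets borel"
  and eq: "\<And>\<phi>::'a \<Rightarrow> real. continuous_on UNIV \<phi> \<Longrightarrow> (\<integral>x. \<phi> x \<partial>M) = (\<integral>x. \<phi> x \<partial>N)"
 shows "M = N"
proof (rule measure_eqI_generator_eq[where E = "Collect closed" and \<Omega> = UNIV and A = "\<lambda>_. UNIV"])
 interpret M: finite_measure M by fact
 interpret N: finite_measure N by fact
 show "Int_stable (Collect closed :: 'a set set)" by (auto simp: Int_stable_def)
 show "sets M = sigma_sets UNIV (Collect closed)" "sets N = sigma_sets UNIV (Collect closed)"
  using MN(3,4) by (simp_all add: borel_eq_closed)
 show "emeasure M UNIV \<noteq> \<infinity>" by simp
 fix X :: "'a set" assume "X \<in> Collect closed"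
 hence X: "closed X" by simp
 show "emeasure M X = emeasure N X"
 proof (cases "X = {}")
  case False
  define g where "g n x = max 0 (1 - real n * infdist x X)" for n x
  have cg: "continuous_on UNIV (g n)" for n unfolding g_def by (intro continuous_intros)
  have lim: "(\<lambda>n. \<integral>x. g n x \<partial>P) \<longlonglongrightarrow> measure P X" if P: "finite_measure P" "sets P = sets borel" for P
  proof -
   interpret P: finite_measure P by fact
   have "(\<lambda>n. \<integral>x. g n x \<partial>P) \<longlonglongrightarrow> (\<integral>x. indicator X x \<partial>P)"
   proof (rule integral_dominated_convergence[where w = "\<lambda>_. 1"])
    show "(\<lambda>x. indicator X x :: real) \<in> borel_measurable P" using X P(2) by (intro borel_measurable_indicator) auto
    show "g n \<in> borel_measurable P" for n
     using borel_measurable_continuous_onI[OF cg[of n]] P(2) by (simp cong: measurable_cong_sets)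
    show "AE x in P. (\<lambda>n. g n x) \<longlonglongrightarrow> indicator X x"
    proof (rule AE_I2)
     fix x
     show "(\<lambda>n. g n x) \<longlonglongrightarrow> indicator X x"
     proof (cases "x \<in> X")
      case True thus ?thesis by (simp add: g_def)
     next
      case F: False
      hence d: "infdist x X > 0"
       using in_closed_iff_infdist_zero[OF X False, of x] infdist_nonneg[of x X] by linarith
      obtain n0 where n0: "real n0 * infdist x X > 1" using reals_Archimedean3[OF d] by blast
      have "g n x = 0" if "n \<ge> n0" for n
      proof -
       have "real n0 * infdist x X \<le> real n * infdist x X" using that d by (intro mult_right_mono) auto
       thus ?thesis using n0 by (simp add: g_def)
      qed
      hence "\<forall>\<^sub>F n in sequentially. g n x = 0" unfolding eventually_sequentially by blast
      thus ?thesis using F by (simp add: tendsto_eventually)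
     qed
    qed
    show "AE x in P. norm (g n x) \<le> 1" for n
     by (rule AE_I2) (auto simp: g_def infdist_nonneg intro: order_trans)
   qed auto
   thus ?thesis using X P(2) by simp
  qed
  have "measure M X = measure N X" using LIMSEQ_unique[OF lim[OF MN(1,3)]] lim[OF MN(2,4)] by (simp add: eq[OF cg])
  thus ?thesis by (simp add: M.emeasure_eq_measure N.emeasure_eq_measure)
 qed simp
qed auto

lemma measurable_torus_add:
 "(\<lambda>p::'n::finite torus \<times> 'n torus. fst p + snd p) \<in> borel_measurable (borel \<Otimes>\<^sub>M borel)"
 unfolding borel_prod
proof (rule borel_measurable_continuous_onI, unfold continuous_on_iff, intro ballI allI impI)
 fix p :: "'n torus \<times> 'n torus" and e :: real assume e: "e > 0"
 have "dist (fst q + snd q) (fst p + snd p) < e" if q: "dist q p < e / 2" for q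
 proof -
  have "dist (fst q + snd q) (fst p + snd p) \<le> dist (snd q) (snd p) + dist (fst q) (fst p)"
   using dist_triangle[of "fst q + snd q" "fst p + snd p" "fst q + snd p"]
    dist_torus_translate[of "fst q" "snd q" "snd p"] dist_torus_translate[of "snd p" "fst q" "fst p"]
   by (simp add: add.commute)
  moreover have "dist (snd q) (snd p) \<le> dist q p" "dist (fst q) (fst p) \<le> dist q p"
   by (auto simp: dist_snd_le dist_fst_le)
  ultimately show ?thesis using q by simp
 qed
 thus "\<exists>d>0. \<forall>q\<in>UNIV. dist q p < d \<longrightarrow> dist (fst q + snd q) (fst p + snd p) < e"
  using e by (intro exI[of _ "e / 2"]) auto
qed

lemma measurable_perturbed:
 fixes f :: "'n::finite torus \<Rightarrow> 'n torus" and \<zeta> :: "'n torus \<Rightarrow> real"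
 assumes "f \<in> borel_measurable borel" "\<zeta> \<in> borel_measurable borel"
 shows "(\<lambda>p. f (fst p) + torus_of (\<zeta> (fst p) *\<^sub>R snd p)) \<in> borel_measurable (borel \<Otimes>\<^sub>M borel)"
proof -
 have "(\<lambda>p. (f (fst p), torus_of (\<zeta> (fst p) *\<^sub>R snd p))) \<in> measurable (borel \<Otimes>\<^sub>M (borel :: (real^'n) measure)) (borel \<Otimes>\<^sub>M borel)"
 proof (rule measurable_Pair)
  show "(\<lambda>p. f (fst p)) \<in> borel_measurable (borel \<Otimes>\<^sub>M (borel :: (real^'n) measure))"
   by (rule measurable_compose[OF measurable_fst assms(1)])
  show "(\<lambda>p. torus_of (\<zeta> (fst p) *\<^sub>R snd p)) \<in> borel_measurable (borel \<Otimes>\<^sub>M (borel :: (real^'n) measure))"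
   by (intro measurable_compose[OF _ measurable_torus_of] borel_measurable_scaleR measurable_compose[OF measurable_fst assms(2)] measurable_snd)
 qed
 from measurable_compose[OF this measurable_torus_add] show ?thesis by simp
qed

text \<open>Stationarity is tested on continuous functions only, and these are not preserved by the
  transition operator when \<open>\<zeta>\<close> jumps. But a finite Borel measure is determined by
  its integrals of continuous functions, so the law of one perturbed step started from
  \<open>\<nu>\<close> is \<open>\<nu>\<close> itself, and Borel functions may be tested.\<close>

lemma stationary_nn_integral:
 fixes f :: "'n::finite torus \<Rightarrow> 'n torus"
 assumes st: "stationary_measure (adapted_perturbation f \<zeta>) (noise \<epsilon>) \<nu>" and \<epsilon>: "\<epsilon> > 0"
  and fm [measurable]: "f \<in> borel_measurable borel" and \<zeta>m [measurable]: "\<zeta> \<in> borel_measurable borel"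
  and [measurable]: "\<phi> \<in> borel_measurable borel"
 shows "(\<integral>\<^sup>+x. \<phi> x \<partial>\<nu>) = (\<integral>\<^sup>+x. \<integral>\<^sup>+t. \<phi> (f x + torus_of (\<zeta> x *\<^sub>R t)) \<partial>noise \<epsilon> \<partial>\<nu>)"
proof -
 have \<nu>: "sets \<nu> = sets borel" "prob_space \<nu>"
  "\<And>\<phi>::'n torus \<Rightarrow> real. continuous_on UNIV \<phi> \<Longrightarrow> (\<integral>x. \<phi> x \<partial>\<nu>) = (\<integral>t. (\<integral>x. \<phi> (adapted_perturbation f \<zeta> t x) \<partial>\<nu>) \<partial>noise \<epsilon>)"
  using st unfolding stationary_measure_def by blast+
 interpret \<nu>: prob_space \<nu> by fact
 interpret \<theta>: prob_space "noise \<epsilon> :: (real^'n) measure" by (rule prob_noise[OF \<epsilon>])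
 interpret pair_prob_space "noise \<epsilon> :: (real^'n) measure" \<nu> ..
 have [measurable]: "torus_of \<in> borel_measurable (borel :: (real^'n) measure)" by (rule measurable_torus_of)
 note [measurable_cong] = \<nu>(1)
 have sN [measurable_cong]: "sets (noise \<epsilon> :: (real^'n) measure) = sets borel" by (simp add: noise_def)
 have F [measurable]: "(\<lambda>(t, x). adapted_perturbation f \<zeta> t x) \<in> measurable (noise \<epsilon> \<Otimes>\<^sub>M \<nu>) borel"
 proof -
  have "fst \<in> borel_measurable ((noise \<epsilon> :: (real^'n) measure) \<Otimes>\<^sub>M \<nu>)" "snd \<in> borel_measurable ((noise \<epsilon> :: (real^'n) measure) \<Otimes>\<^sub>M \<nu>)"
   using measurable_fst[of "noise \<epsilon> :: (real^'n) measure" \<nu>] measurable_snd[of "noise \<epsilon> :: (real^'n) measure" \<nu>]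
   unfolding measurable_cong_sets[OF refl sN] measurable_cong_sets[OF refl \<nu>(1)] .
  from measurable_compose[OF measurable_Pair[OF this(2,1)] measurable_perturbed[OF fm \<zeta>m]]
  show ?thesis by (simp add: adapted_perturbation_def case_prod_beta)
 qed
 let ?D = "distr (noise \<epsilon> \<Otimes>\<^sub>M \<nu>) borel (\<lambda>(t, x). adapted_perturbation f \<zeta> t x)"
 have "?D = \<nu>"
 proof (rule borel_measure_eqI_continuous)
  show "finite_measure ?D" by (rule finite_measure_distr[OF F])
  show "finite_measure \<nu>" by (rule \<nu>.finite_measure_axioms)
  fix \<phi> :: "'n torus \<Rightarrow> real" assume c: "continuous_on UNIV \<phi>"
  have [measurable]: "\<phi> \<in> borel_measurable borel" by (rule borel_measurable_continuous_onI[OF c])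
  have "bounded (range \<phi>)" by (rule compact_imp_bounded[OF compact_continuous_image[OF c compact_torus]])
  then obtain b where b: "\<And>x. norm (\<phi> x) \<le> b" unfolding bounded_iff by blast
  have "(\<integral>x. \<phi> x \<partial>?D) = (\<integral>p. \<phi> ((\<lambda>(t, x). adapted_perturbation f \<zeta> t x) p) \<partial>(noise \<epsilon> \<Otimes>\<^sub>M \<nu>))"
   by (rule integral_distr) measurable
  also have "\<dots> = (\<integral>t. (\<integral>x. \<phi> (adapted_perturbation f \<zeta> t x) \<partial>\<nu>) \<partial>noise \<epsilon>)"
   by (subst integral_fst'[symmetric]) (auto intro!: integrable_const_bound[of _ b] b simp: case_prod_beta)
  finally show "(\<integral>x. \<phi> x \<partial>?D) = (\<integral>x. \<phi> x \<partial>\<nu>)" using \<nu>(3)[OF c] by simp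
 qed (use \<nu>(1) in auto)
 hence "(\<integral>\<^sup>+x. \<phi> x \<partial>\<nu>) = (\<integral>\<^sup>+x. \<phi> x \<partial>?D)" by simp
 also have "\<dots> = (\<integral>\<^sup>+p. \<phi> (case p of (t, x) \<Rightarrow> adapted_perturbation f \<zeta> t x) \<partial>(noise \<epsilon> \<Otimes>\<^sub>M \<nu>))"
  by (rule nn_integral_distr) measurable
 also have "\<dots> = (\<integral>\<^sup>+x. \<integral>\<^sup>+t. \<phi> (case (t, x) of (t, x) \<Rightarrow> adapted_perturbation f \<zeta> t x) \<partial>noise \<epsilon> \<partial>\<nu>)"
  by (rule nn_integral_snd[symmetric]) measurable
 finally show ?thesis by (simp add: adapted_perturbation_def)
qed

subsection \<open>Sweeping sets\<close>

text \<open>For each of the finitely many functions only countably many levels carry mass, and an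
  interval is uncountable.\<close>

lemma null_level:
 fixes g :: "'i \<Rightarrow> 'a::topological_space \<Rightarrow> real"
 assumes M: "finite_measure M" "sets M = sets borel" and I: "finite I" and g: "\<And>i. i \<in> I \<Longrightarrow> continuous_on UNIV (g i)"
  and ab: "a < b"
 obtains r where "a < r" "r < b" "\<And>i. i \<in> I \<Longrightarrow> measure M {x. g i x = r} = 0"
proof -
 interpret finite_measure M by fact
 note [measurable_cong] = M(2)
 have sp: "space M = UNIV" using sets_eq_imp_space_eq[OF M(2)] by simp
 let ?D = "\<lambda>i. distr M borel (g i)"
 have gm: "g i \<in> borel_measurable M" if "i \<in> I" for i
  using borel_measurable_continuous_onI[OF g[OF that]] M(2) by (simp cong: measurable_cong_sets)
 have "countable {r. measure (?D i) {r} \<noteq> 0}" if "i \<in> I" for i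
  by (rule finite_measure.countable_support[OF finite_measure_distr[OF gm[OF that]]])
 hence c: "countable (\<Union>i\<in>I. {r. measure (?D i) {r} \<noteq> 0})" using I by (intro countable_UN) (auto intro: countable_finite)
 have "uncountable {a<..<b}" using ab by (simp add: uncountable_open_interval)
 hence "\<not> {a<..<b} \<subseteq> (\<Union>i\<in>I. {r. measure (?D i) {r} \<noteq> 0})" using c countable_subset by blast
 then obtain r where "r \<in> {a<..<b}" "r \<notin> (\<Union>i\<in>I. {r. measure (?D i) {r} \<noteq> 0})" unfolding subset_iff by blast
 hence r: "a < r" "r < b" "\<And>i. i \<in> I \<Longrightarrow> measure (?D i) {r} = 0" by auto
 have "measure M {x. g i x = r} = 0" if "i \<in> I" for i
 proof -
  have "measure (?D i) {r} = measure M (g i -` {r} \<inter> space M)" by (rule measure_distr[OF gm[OF that]]) simp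
  moreover have "g i -` {r} \<inter> space M = {x. g i x = r}" by (auto simp: sp)
  ultimately show ?thesis using r(3)[OF that] by simp
 qed
 thus thesis using r that by blast
qed

lemma frontier_superlevel:
 fixes g :: "'a::topological_space \<Rightarrow> real"
 assumes "continuous_on UNIV g" shows "frontier {x. g x > r} \<subseteq> {x. g x = r}"
proof -
 have op: "open {x. g x > r}" and cl: "closed {x. g x \<ge> r}"
  using assms by (auto intro: open_Collect_less closed_Collect_le continuous_on_const)
 have "closure {x. g x > r} \<subseteq> {x. g x \<ge> r}" by (rule closure_minimal[OF _ cl]) auto
 moreover have "interior {x. g x > r} = {x. g x > r}" by (rule interior_open[OF op])
 ultimately show ?thesis unfolding frontier_def by force
qed

context regular_dynamics begin

abbreviation "leb \<equiv> torus_lebesgue :: 'n torus measure"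
abbreviation "vol \<equiv> measure leb"

sublocale leb: prob_space leb by (rule prob_space_torus_lebesgue)
sublocale mu: finite_measure \<mu> by (rule mu(1))

declare mu(2) [simp, measurable_cong]

lemma continuous_iter: "continuous_on S (f ^^ k)"
proof (induction k)
 case (Suc k)
 thus ?case using continuous_on_compose[OF Suc, of f] continuous_on_subset[OF cont] by (simp add: comp_def)
qed (simp add: id_def)

lemma measurable_iter [measurable]: "f ^^ k \<in> borel_measurable borel"
 by (rule borel_measurable_continuous_onI[OF continuous_iter])

lemma vimage_iter [measurable]: "S \<in> sets borel \<Longrightarrow> (f ^^ k) -` S \<in> sets borel"
 using measurable_sets[OF measurable_iter, of S k] by simp

lemma inv_iter: "S \<in> sets borel \<Longrightarrow> measure \<mu> ((f ^^ k) -` S) = measure \<mu> S"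
 using measurable_iter[of 1] by (intro measure_vimage_iterate inv) simp_all

lemma Q_iter: "\<nu> \<in> Q \<Longrightarrow> S \<in> sets borel \<Longrightarrow> measure \<nu> ((f ^^ k) -` S) = measure \<nu> S"
 using measurable_iter[of 1] by (intro measure_vimage_iterate acipD(3)[OF Q]) simp_all

lemma mass: "measure \<mu> UNIV \<ge> 1"
proof -
 obtain \<nu> where \<nu>: "\<nu> \<in> Q" using finQ(2) by blast
 thus ?thesis using le[OF \<nu>, of UNIV] prob_space.prob_space[of \<nu>] acipD(2,5)[OF Q[OF \<nu>]] by simp
qed

text \<open>Both measures of a sweeping set have to be small: \<open>vol\<close>, so that the cells
  fill the torus up to a null set, and \<open>\<mu>\<close>, so that many points need a long time to
  enter it.\<close>

definition m :: "'n torus set \<Rightarrow> real" where "m S = vol S + measure \<mu> S"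

lemma m_mono: "S \<subseteq> T \<Longrightarrow> T \<in> sets borel \<Longrightarrow> m S \<le> m T"
 unfolding m_def by (intro add_mono leb.finite_measure_mono mu.finite_measure_mono) auto

lemma m_Un_le: "S \<in> sets borel \<Longrightarrow> T \<in> sets borel \<Longrightarrow> m (S \<union> T) \<le> m S + m T"
 unfolding m_def using measure_Un_le[of S leb T] measure_Un_le[of S \<mu> T] by simp

lemma m_Un: "S \<in> sets borel \<Longrightarrow> T \<in> sets borel \<Longrightarrow> S \<inter> T = {} \<Longrightarrow> m (S \<union> T) = m S + m T"
 unfolding m_def by (simp add: leb.finite_measure_Union mu.finite_measure_Union)

text \<open>A condition on every orbit, without an exceptional null set, so that it passes to
  pseudo-orbits with arbitrary starting points.\<close>

definition sweeping :: "nat \<Rightarrow> 'n torus set \<Rightarrow> bool" where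
 "sweeping N A \<longleftrightarrow> (\<forall>x. \<exists>j<N. (f ^^ j) x \<in> A)"

text \<open>The depth of \<open>x\<close> in \<open>A\<close>. The whole torus needs a value of its
  own, as \<open>infdist\<close> to the empty set is \<open>0\<close>.\<close>

definition height :: "'n torus set \<Rightarrow> 'n torus \<Rightarrow> real" where
 "height A x = (if A = UNIV then 1 else infdist x (- A))"

lemma height:
 shows "continuous_on S (height A)" "0 \<le> height A x" "open A \<Longrightarrow> 0 < height A x \<longleftrightarrow> x \<in> A"
  and "\<rho> \<le> 1 \<Longrightarrow> \<rho> \<le> height A x \<Longrightarrow> ball x \<rho> \<subseteq> A"
proof -
 show "continuous_on S (height A)" unfolding height_def[abs_def] by (cases "A = UNIV") (auto intro!: continuous_intros)
 show "0 \<le> height A x" by (simp add: height_def infdist_nonneg)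
 show "0 < height A x \<longleftrightarrow> x \<in> A" if "open A"
 proof (cases "A = UNIV")
  case False
  hence "closed (- A)" "- A \<noteq> {}" using that by auto
  hence "x \<in> - A \<longleftrightarrow> infdist x (- A) = 0" by (rule in_closed_iff_infdist_zero)
  thus ?thesis using False infdist_nonneg[of x "- A"] by (auto simp: height_def less_le)
 qed (simp add: height_def)
 show "ball x \<rho> \<subseteq> A" if "\<rho> \<le> 1" "\<rho> \<le> height A x"
 proof
  fix y assume y: "y \<in> ball x \<rho>"
  show "y \<in> A"
  proof (rule ccontr)
   assume "y \<notin> A"
   hence "infdist x (- A) \<le> dist x y" "A \<noteq> UNIV" by (auto intro: infdist_le)
   thus False using y that by (simp add: height_def)
  qed
 qed
qed

text \<open>The sum of the depths along \<open>N\<close> steps is continuous and positive, hence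
  bounded below on the compact torus.\<close>

lemma sweeping_height:
 assumes "open A" "sweeping N A"
 obtains c where "c > 0" "\<And>x. \<exists>j<N. c \<le> height A ((f ^^ j) x)"
proof -
 have N: "N > 0" using assms(2) by (auto simp: sweeping_def)
 define \<psi> where "\<psi> x = (\<Sum>j<N. height A ((f ^^ j) x))" for x
 have "continuous_on UNIV \<psi>"
  unfolding \<psi>_def by (intro continuous_intros continuous_on_compose2[OF height(1)] continuous_iter) auto
 then obtain x0 where x0: "\<And>x. \<psi> x0 \<le> \<psi> x"
  using continuous_attains_inf[OF compact_torus] by (metis UNIV_I UNIV_not_empty)
 obtain j where "j < N" "(f ^^ j) x0 \<in> A" using assms(2) by (auto simp: sweeping_def)
 hence pos: "\<psi> x0 > 0" unfolding \<psi>_def using height(2,3) assms(1) by (intro sum_pos2[of _ j]) auto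
 have "\<exists>j<N. \<psi> x0 / N \<le> height A ((f ^^ j) x)" for x
 proof (rule ccontr)
  assume "\<not> ?thesis"
  hence "\<psi> x < (\<Sum>j<N. \<psi> x0 / N)" unfolding \<psi>_def using N by (intro sum_strict_mono) (auto simp: not_le)
  thus False using x0[of x] N by simp
 qed
 thus thesis using pos N by (intro that[of "\<psi> x0 / N"]) auto
qed

text \<open>The points of depth greater than \<open>r\<close> still form a sweeping set for small
  \<open>r\<close>, and its boundary is null for all but countably many \<open>r\<close>.\<close>

lemma sweeping_shrink:
 assumes A: "open A" "sweeping N A"
 obtains A' where "A' \<subseteq> A" "open A'" "vol (frontier A') = 0" "sweeping N A'"
proof -
 obtain c where c: "c > 0" "\<And>x. \<exists>j<N. c \<le> height A ((f ^^ j) x)" using sweeping_height[OF A] by blast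
 obtain r where r: "0 < r" "r < c" "\<And>i::unit. i \<in> UNIV \<Longrightarrow> vol {x. height A x = r} = 0"
  by (rule null_level[of leb "UNIV::unit set" "\<lambda>_. height A" 0 c]) (use c height(1) leb.finite_measure_axioms in auto)
 let ?A = "{x. height A x > r}"
 have "open ?A" using height(1)[of UNIV A] by (intro open_Collect_less continuous_on_const)
 moreover have "?A \<subseteq> A"
 proof
  fix x assume "x \<in> ?A"
  hence "0 < height A x" using r(1) by simp
  thus "x \<in> A" using height(3)[OF A(1)] by blast
 qed
 moreover have "vol (frontier ?A) = 0"
 proof -
  have "closed {x. height A x = r}" using height(1)[of UNIV A] by (intro closed_Collect_eq continuous_on_const)
  hence "vol (frontier ?A) \<le> vol {x. height A x = r}"
   by (intro leb.finite_measure_mono frontier_superlevel height(1)) auto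
  thus ?thesis using r(3)[of "()"] by (simp add: measure_le_0_iff)
 qed
 moreover have "sweeping N ?A" using c(2) r(2) unfolding sweeping_def by (metis less_le_trans mem_Collect_eq)
 ultimately show thesis by (intro that[of ?A])
qed

lemma small_balls:
 assumes "e > 0"
 obtains r where "r > 0" "\<And>x s. s \<le> r \<Longrightarrow> vol (ball x s) < e"
proof -
 let ?v = "\<lambda>r. measure lborel (ball (0::real^'n) r)"
 have v: "?v r = unit_ball_vol CARD('n) * r ^ CARD('n)" if "r \<ge> 0" for r
  using that by (simp add: measure_def emeasure_ball)
 have "((\<lambda>r. unit_ball_vol CARD('n) * r ^ CARD('n)) \<longlongrightarrow> unit_ball_vol CARD('n) * 0 ^ CARD('n)) (at_right 0)"
  by (intro tendsto_intros)
 moreover have "unit_ball_vol CARD('n) * 0 ^ CARD('n) = (0::real)" by simp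
 ultimately have "((\<lambda>r. unit_ball_vol CARD('n) * r ^ CARD('n)) \<longlongrightarrow> 0) (at_right 0)" by (simp only:)
 hence "\<forall>\<^sub>F r in at_right 0. unit_ball_vol CARD('n) * r ^ CARD('n) < e"
  using assms by (intro order_tendstoD(2)) auto
 moreover have "\<forall>\<^sub>F r in at_right (0::real). r < 1 / 2" using eventually_at_right_real[of 0 "1/2"] by (auto elim: eventually_mono)
 moreover have "\<forall>\<^sub>F r in at_right (0::real). r > 0" by (rule eventually_at_right_less)
 ultimately have "\<forall>\<^sub>F r in at_right 0. unit_ball_vol CARD('n) * r ^ CARD('n) < e \<and> r < 1 / 2 \<and> r > 0"
  by eventually_elim simp
 then obtain r where r: "unit_ball_vol CARD('n) * r ^ CARD('n) < e" "r < 1 / 2" "r > 0"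
  by (metis (mono_tags, lifting) eventually_happens trivial_limit_at_right_real)
 show thesis
 proof (rule that[OF r(3)])
  fix x s assume s: "s \<le> r"
  have "vol (ball x s) \<le> vol (ball x r)" using s by (intro leb.finite_measure_mono subset_ball) auto
  also have "\<dots> = ?v r" unfolding measure_def by (subst emeasure_torus_ball) (use r in auto)
  finally show "vol (ball x s) < e" using v r by simp
 qed
qed

text \<open>\<open>G\<close> takes from \<open>A\<close> one small piece for each measure in
  \<open>Q\<close>, charged by that measure; there is one because finitely many preimages of
  \<open>A\<close> cover the torus. The points that visit \<open>G\<close> infinitely often form an
  invariant set charged by all of \<open>Q\<close>, hence of full volume.\<close>

lemma small_sweeping:
 assumes A: "open A" "sweeping N A" and e: "e > 0"
 obtains G where "G \<subseteq> A" "open G" "m G \<le> e" "vol {x. \<forall>j. (f ^^ j) x \<notin> G} = 0"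
proof -
 define e' where "e' = e / (2 * (card Q + 1))"
 have e': "e' > 0" using e by (simp add: e'_def)
 obtain d where d: "d > 0" "\<And>A. A \<in> sets leb \<Longrightarrow> vol A < d \<Longrightarrow> measure \<mu> A < e'"
  by (rule absolutely_continuous_uniform[OF leb.finite_measure_axioms mu(1) _ _ e']) (use ac in auto)
 obtain r where r: "r > 0" "\<And>x s. s \<le> r \<Longrightarrow> vol (ball x s) < min d e'"
  using small_balls[of "min d e'"] d(1) e' by auto
 have mb: "m (ball x r) \<le> 2 * e'" for x using r(2)[of r x] d(2)[of "ball x r"] by (simp add: m_def)
 obtain F where F: "finite F" "(\<Union>x\<in>F. ball x r) = (UNIV :: 'n torus set)"
  using finite_subcover_torus[of "\<lambda>x. ball x r"] r(1) by auto
 have Ab [measurable]: "A \<in> sets borel" using A(1) by simp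
 have "\<exists>x. measure \<nu> (A \<inter> ball x r) > 0" if \<nu>: "\<nu> \<in> Q" for \<nu>
 proof (rule ccontr)
  assume no: "\<not> ?thesis"
  interpret \<nu>: prob_space \<nu> by (rule acipD(2)[OF Q[OF \<nu>]])
  note s = acipD(1)[OF Q[OF \<nu>]]
  have eA: "(\<Union>x\<in>F. A \<inter> ball x r) = A" unfolding Int_UN_distrib[symmetric] F(2) by simp
  have "measure \<nu> (\<Union>x\<in>F. A \<inter> ball x r) \<le> (\<Sum>x\<in>F. measure \<nu> (A \<inter> ball x r))"
   by (rule \<nu>.finite_measure_subadditive_finite[OF F(1)]) (use s in \<open>simp add: image_subset_iff\<close>)
  hence "measure \<nu> A \<le> (\<Sum>x\<in>F. measure \<nu> (A \<inter> ball x r))" unfolding eA .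
  also have "\<dots> \<le> 0" using no by (intro sum_nonpos) (auto simp: not_less)
  finally have A0: "measure \<nu> A = 0" by (simp add: measure_le_0_iff)
  have eU: "(\<Union>j<N. (f ^^ j) -` A) = UNIV" using A(2) by (simp add: sweeping_def set_eq_iff Bex_def)
  have "measure \<nu> (\<Union>j<N. (f ^^ j) -` A) \<le> (\<Sum>j<N. measure \<nu> ((f ^^ j) -` A))"
   by (rule \<nu>.finite_measure_subadditive_finite) (use s in \<open>simp_all add: image_subset_iff\<close>)
  hence "measure \<nu> UNIV \<le> (\<Sum>j<N. measure \<nu> ((f ^^ j) -` A))" unfolding eU .
  also have "\<dots> = 0" using Q_iter[OF \<nu> Ab] A0 by simp
  finally show False using \<nu>.prob_space acipD(5)[OF Q[OF \<nu>]] by simp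
 qed
 then obtain p where p: "\<And>\<nu>. \<nu> \<in> Q \<Longrightarrow> measure \<nu> (A \<inter> ball (p \<nu>) r) > 0" by metis
 define G where "G = (\<Union>\<nu>\<in>Q. A \<inter> ball (p \<nu>) r)"
 have Go: "open G" unfolding G_def using A(1) by auto
 hence Gb [measurable]: "G \<in> sets borel" by simp
 have "m G \<le> (\<Sum>\<nu>\<in>Q. m (A \<inter> ball (p \<nu>) r))"
 proof -
  have "vol G \<le> (\<Sum>\<nu>\<in>Q. vol (A \<inter> ball (p \<nu>) r))"
   unfolding G_def using finQ(1) by (intro leb.finite_measure_subadditive_finite) auto
  moreover have "measure \<mu> G \<le> (\<Sum>\<nu>\<in>Q. measure \<mu> (A \<inter> ball (p \<nu>) r))"
   unfolding G_def using finQ(1) by (intro mu.finite_measure_subadditive_finite) auto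
  ultimately show ?thesis by (simp add: m_def sum.distrib)
 qed
 also have "\<dots> \<le> (\<Sum>\<nu>\<in>Q. 2 * e')" by (intro sum_mono order_trans[OF m_mono mb]) auto
 also have "\<dots> \<le> e" using e by (simp add: e'_def field_simps)
 finally have mG: "m G \<le> e" .
 define V where "V n = (\<Union>k. (f ^^ (k + n)) -` G)" for n
 have Vb [measurable]: "V n \<in> sets borel" for n unfolding V_def by measurable
 have Vmem: "x \<in> V n \<longleftrightarrow> (\<exists>j\<ge>n. (f ^^ j) x \<in> G)" for x n
  unfolding V_def by (auto simp: le_iff_add add.commute)
 define D where "D = (\<Inter>n. V n)"
 have Db: "D \<in> sets borel" unfolding D_def by measurable
 have "f -` D = D"
 proof (rule set_eqI)
  fix x
  have "(f ^^ j) (f x) = (f ^^ Suc j) x" for j by (simp add: funpow_swap1)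
  hence "x \<in> f -` D \<longleftrightarrow> (\<forall>n. \<exists>j\<ge>n. (f ^^ Suc j) x \<in> G)" by (simp add: D_def Vmem del: funpow.simps)
  also have "\<dots> \<longleftrightarrow> (\<forall>n. \<exists>j\<ge>n. (f ^^ j) x \<in> G)"
   using eventually_sequentially_Suc[of "\<lambda>j. (f ^^ j) x \<notin> G"] by (simp only: eventually_sequentially) blast
  finally show "x \<in> f -` D \<longleftrightarrow> x \<in> D" by (simp add: D_def Vmem)
 qed
 hence "vol D = 1"
 proof (rule cover[OF Db])
  fix \<nu> assume \<nu>: "\<nu> \<in> Q"
  interpret \<nu>: prob_space \<nu> by (rule acipD(2)[OF Q[OF \<nu>]])
  note s = acipD(1)[OF Q[OF \<nu>]]
  have g: "measure \<nu> G > 0"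
  proof -
   have "measure \<nu> (A \<inter> ball (p \<nu>) r) \<le> measure \<nu> G"
    using s Gb \<nu> by (intro \<nu>.finite_measure_mono) (auto simp: G_def)
   thus ?thesis using p[OF \<nu>] by simp
  qed
  have "(\<lambda>n. measure \<nu> (V n)) \<longlonglongrightarrow> measure \<nu> D" unfolding D_def
  proof (rule \<nu>.finite_Lim_measure_decseq)
   show "decseq V" unfolding decseq_def by (meson Vmem order_trans subsetI)
  qed (use s Vb in \<open>simp add: image_subset_iff\<close>)
  moreover have "measure \<nu> G \<le> measure \<nu> (V n)" for n
  proof -
   have "(f ^^ n) -` G \<subseteq> V n" unfolding subset_iff Vmem by auto
   hence "measure \<nu> ((f ^^ n) -` G) \<le> measure \<nu> (V n)" using s by (intro \<nu>.finite_measure_mono) auto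
   thus ?thesis using Q_iter[OF \<nu> Gb] by simp
  qed
  ultimately have "measure \<nu> G \<le> measure \<nu> D" by (intro LIMSEQ_le_const[of _ _ "measure \<nu> G"]) auto
  thus "measure \<nu> D \<noteq> 0" using g by simp
 qed
 hence "vol (- D) = 0" using leb.prob_compl[of D] Db by (simp add: Compl_eq_Diff_UNIV)
 moreover have "vol {x. \<forall>j. (f ^^ j) x \<notin> G} \<le> vol (- D)"
  using Db by (intro leb.finite_measure_mono) (auto simp: D_def Vmem)
 ultimately have "vol {x. \<forall>j. (f ^^ j) x \<notin> G} = 0" by (simp add: measure_le_0_iff)
 moreover have "G \<subseteq> A" by (auto simp: G_def)
 ultimately show thesis using Go mG that by blast
qed

text \<open>\<open>V k\<close> consists of the points of \<open>A\<close> which visit \<open>A\<close> exactly \<open>k\<close> times before they reach \<open>G\<close>.\<close>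

lemma halving:
 assumes A: "open A" "sweeping N A" and e: "e > 0"
 obtains A' where "A' \<subseteq> A" "open A'" "vol (frontier A') = 0" "sweeping (2 * N) A'" "m A' \<le> m A / 2 + e"
proof -
 have "e / 4 > 0" using e by simp
 then obtain G where G: "G \<subseteq> A" "open G" "m G \<le> e / 4" "vol {x. \<forall>j. (f ^^ j) x \<notin> G} = 0"
  using small_sweeping[OF A] by blast
 have Ab [measurable]: "A \<in> sets borel" "G \<in> sets borel" using A(1) G(2) by auto
 define nxt where "nxt i y \<longleftrightarrow> 0 < i \<and> (f ^^ i) y \<in> A \<and> (\<forall>l. 0 < l \<longrightarrow> l < i \<longrightarrow> (f ^^ l) y \<notin> A)" for i y
 define V where "V = rec_nat G (\<lambda>_ E. {y \<in> A - G. \<exists>i. nxt i y \<and> (f ^^ i) y \<in> E})"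
 have V0: "V 0 = G" and VS: "V (Suc k) = {y \<in> A - G. \<exists>i. nxt i y \<and> (f ^^ i) y \<in> V k}" for k
  by (simp_all add: V_def)
 have Vb [measurable]: "V k \<in> sets borel" for k
 proof (induction k)
  case (Suc k)
  note [measurable] = Suc
  have "V (Suc k) = {y \<in> space borel. y \<in> A - G \<and> (\<exists>i. (0 < i \<and> (f ^^ i) y \<in> A \<and> (\<forall>l. 0 < l \<longrightarrow> l < i \<longrightarrow> (f ^^ l) y \<notin> A)) \<and> (f ^^ i) y \<in> V k)}"
   by (simp add: VS nxt_def)
  also have "\<dots> \<in> sets borel" by measurable
  finally show ?case .
 qed (simp add: V0 Ab)
 have nxt_unique: "i = i'" if "nxt i y" "nxt i' y" for i i' y
  using that unfolding nxt_def by (metis linorder_neqE_nat)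
 have VA: "V k \<subseteq> A" for k by (cases k) (use G(1) in \<open>auto simp: V0 VS\<close>)
 have disj: "V k \<inter> V (k + Suc l) = {}" for k l
 proof (induction k)
  case 0 show ?case by (auto simp: V0 VS)
 next
  case (Suc k)
  show ?case
  proof (rule equals0I)
   fix y assume "y \<in> V (Suc k) \<inter> V (Suc k + Suc l)"
   then obtain i i' where "nxt i y" "(f ^^ i) y \<in> V k" "nxt i' y" "(f ^^ i') y \<in> V (k + Suc l)"
    by (auto simp: VS)
   thus False using nxt_unique Suc by blast
  qed
 qed
 have nxt_ex: "\<exists>i\<le>N. nxt i y" for y
 proof -
  obtain j where j: "j < N" "(f ^^ j) (f y) \<in> A" using A(2) by (auto simp: sweeping_def)
  define P where "P i \<longleftrightarrow> 0 < i \<and> (f ^^ i) y \<in> A" for i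
  have "P (Suc j)" using j(2) by (simp add: P_def funpow_swap1)
  hence "P (LEAST i. P i)" "(LEAST i. P i) \<le> Suc j" "\<And>l. l < (LEAST i. P i) \<Longrightarrow> \<not> P l"
   by (auto intro: LeastI Least_le dest: not_less_Least)
  thus ?thesis using j(1) unfolding nxt_def P_def by (intro exI[of _ "LEAST i. P i"]) (auto simp: P_def)
 qed
 have reach: "y \<in> A \<Longrightarrow> (f ^^ j) y \<in> G \<Longrightarrow> \<exists>k. y \<in> V k" for j y
 proof (induction j arbitrary: y rule: less_induct)
  case (less j)
  show ?case
  proof (cases "y \<in> G")
   case True thus ?thesis by (metis V0)
  next
   case False
   obtain i where i: "nxt i y" using nxt_ex by blast
   have "j \<noteq> 0" using less.prems False by (cases j) auto
   hence "i \<le> j" using i less.prems(2) G(1) unfolding nxt_def by (meson not_less subsetD neq0_conv)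
   hence "(f ^^ (j - i)) ((f ^^ i) y) \<in> G" using less.prems(2) by (simp add: funpow_add[symmetric, THEN fun_cong, unfolded comp_def])
   moreover have "j - i < j" "(f ^^ i) y \<in> A" using i \<open>j \<noteq> 0\<close> by (auto simp: nxt_def)
   ultimately obtain k where "(f ^^ i) y \<in> V k" using less.IH by blast
   hence "y \<in> V (Suc k)" using i less.prems(1) False by (auto simp: VS)
   thus ?thesis by blast
  qed
 qed
 define E where "E = (\<Union>k. V (2 * k))"
 define O' where "O' = (\<Union>k. V (2 * k + 1))"
 define I where "I = A - (\<Union>k. V k)"
 have b [measurable]: "E \<in> sets borel" "O' \<in> sets borel" "I \<in> sets borel" unfolding E_def O'_def I_def by measurable
 have EO: "E \<inter> O' = {}"
 proof (rule equals0I)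
  fix y assume "y \<in> E \<inter> O'"
  then obtain k l where kl: "y \<in> V (2 * k)" "y \<in> V (2 * l + 1)" by (auto simp: E_def O'_def)
  show False
  proof (cases "2 * k < 2 * l + 1")
   case True
   then obtain i where "2 * l + 1 = 2 * k + Suc i" using less_imp_Suc_add by auto
   thus False using disj[of "2 * k" i] kl by auto
  next
   case False
   hence "2 * l + 1 < 2 * k" by presburger
   then obtain i where "2 * k = (2 * l + 1) + Suc i" using less_imp_Suc_add by (metis add_Suc_right add_Suc)
   thus False using disj[of "2 * l + 1" i] kl by auto
  qed
 qed
 have par: "(\<Union>k. V k) \<subseteq> E \<union> O'"
 proof
  fix y assume "y \<in> (\<Union>k. V k)"
  then obtain k where k: "y \<in> V k" by blast
  show "y \<in> E \<union> O'"
  proof (cases "even k")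
   case True thus ?thesis using k by (auto simp: E_def elim!: evenE)
  next
   case False thus ?thesis using k by (auto simp: O'_def elim!: oddE)
  qed
 qed
 have I0: "m I = 0"
 proof -
  have "I \<subseteq> {x. \<forall>j. (f ^^ j) x \<notin> G}" using reach unfolding I_def by blast
  moreover have "{x. \<forall>j. (f ^^ j) x \<notin> G} \<in> sets borel"
  proof -
   have "{x. \<forall>j. (f ^^ j) x \<notin> G} = {x \<in> space borel. \<forall>j. (f ^^ j) x \<notin> G}" by simp
   also have "\<dots> \<in> sets borel" by measurable
   finally show ?thesis .
  qed
  ultimately have "vol I \<le> vol {x. \<forall>j. (f ^^ j) x \<notin> G}" by (intro leb.finite_measure_mono) auto
  hence "vol I = 0" using G(4) by (simp add: measure_le_0_iff)
  thus ?thesis using ac[OF b(3)] by (simp add: m_def)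
 qed
 have mEO: "m E + m O' \<le> m A"
  unfolding m_Un[OF b(1,2) EO, symmetric] by (rule m_mono) (use VA in \<open>auto simp: E_def O'_def\<close>)
 \<comment> \<open>The smaller of the two parity classes is kept, with the null set
   \<open>I\<close>. A discarded point has its next visit to \<open>A\<close> in the class that is
   kept, so the sweeping time at most doubles. With the odd class also \<open>G\<close> is kept,
   because points of \<open>V 0 = G\<close> need not visit that class next.\<close>
 obtain S where S: "S \<in> sets borel" "S \<subseteq> A" "m S \<le> m A / 2 + e / 4" "\<And>y. y \<in> A - S \<Longrightarrow> \<exists>i. nxt i y \<and> (f ^^ i) y \<in> S"
 proof (cases "m E \<le> m O'")
  case True
  show thesis
  proof (rule that[of "E \<union> I"])
   show "m (E \<union> I) \<le> m A / 2 + e / 4" using m_Un_le[OF b(1,3)] I0 mEO True e by simp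
   show "E \<union> I \<subseteq> A" using VA by (auto simp: E_def I_def)
   fix y assume "y \<in> A - (E \<union> I)"
   hence "y \<in> O'" using par by (auto simp: I_def)
   then obtain k where "y \<in> V (Suc (2 * k))" by (auto simp: O'_def)
   then obtain i where "nxt i y" "(f ^^ i) y \<in> V (2 * k)" by (auto simp: VS)
   thus "\<exists>i. nxt i y \<and> (f ^^ i) y \<in> E \<union> I" by (auto simp: E_def)
  qed measurable
 next
  case False
  show thesis
  proof (rule that[of "(O' \<union> G) \<union> I"])
   show "m ((O' \<union> G) \<union> I) \<le> m A / 2 + e / 4"
    using m_Un_le[of "O' \<union> G" I] m_Un_le[of O' G] b Ab I0 mEO False G(3) by simp
   show "(O' \<union> G) \<union> I \<subseteq> A" using VA G(1) by (auto simp: O'_def I_def)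
   fix y assume y: "y \<in> A - ((O' \<union> G) \<union> I)"
   hence "y \<in> E" using par by (auto simp: I_def)
   then obtain k where k: "y \<in> V (2 * k)" by (auto simp: E_def)
   have "k \<noteq> 0" using k y by (cases k) (auto simp: V0)
   then obtain l where "2 * k = Suc (2 * l + 1)" by (cases k) auto
   then obtain i where "nxt i y" "(f ^^ i) y \<in> V (2 * l + 1)" using k by (auto simp: VS)
   thus "\<exists>i. nxt i y \<and> (f ^^ i) y \<in> (O' \<union> G) \<union> I" by (auto simp: O'_def)
  qed measurable
 qed
 have "e / 4 > 0" using e by simp
 obtain U1 where U1: "open U1" "S \<subseteq> U1" "vol U1 < vol S + e / 4"
  by (rule outer_approximation[OF leb.finite_measure_axioms _ S(1) \<open>e / 4 > 0\<close>]) auto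
 obtain U2 where U2: "open U2" "S \<subseteq> U2" "measure \<mu> U2 < measure \<mu> S + e / 4"
  by (rule outer_approximation[OF mu(1,2) S(1) \<open>e / 4 > 0\<close>]) auto
 define U where "U = A \<inter> U1 \<inter> U2"
 have U: "open U" "S \<subseteq> U" "U \<subseteq> A" using U1 U2 A(1) S(2) by (auto simp: U_def)
 have mU: "m U \<le> m A / 2 + e"
 proof -
  have "vol U \<le> vol U1" "measure \<mu> U \<le> measure \<mu> U2"
   using U1(1) U2(1) by (auto simp: U_def intro!: leb.finite_measure_mono mu.finite_measure_mono)
  thus ?thesis using U1(3) U2(3) S(3) e by (simp add: m_def)
 qed
 have "sweeping (2 * N) U" unfolding sweeping_def
 proof
  fix x
  obtain j where j: "j < N" "(f ^^ j) x \<in> A" using A(2) by (auto simp: sweeping_def)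
  show "\<exists>j<2 * N. (f ^^ j) x \<in> U"
  proof (cases "(f ^^ j) x \<in> S")
   case True thus ?thesis using j U(2) by (intro exI[of _ j]) auto
  next
   case False
   then obtain i where i: "nxt i ((f ^^ j) x)" "(f ^^ i) ((f ^^ j) x) \<in> S" using S(4) j(2) by blast
   obtain i' where "i' \<le> N" "nxt i' ((f ^^ j) x)" using nxt_ex by blast
   hence "i \<le> N" using nxt_unique i(1) by blast
   moreover have "(f ^^ (i + j)) x \<in> U" using i(2) U(2) by (auto simp: funpow_add)
   ultimately show ?thesis using j(1) by (intro exI[of _ "i + j"]) auto
  qed
 qed
 then obtain A' where A': "A' \<subseteq> U" "open A'" "vol (frontier A') = 0" "sweeping (2 * N) A'"
  using sweeping_shrink[OF U(1)] by blast
 have "m A' \<le> m A / 2 + e" using m_mono[OF A'(1)] U(1) mU by simp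
 thus thesis using A' U(3) that by blast
qed

lemma sweeping_sequence:
 obtains A where "A 0 = UNIV" "\<And>s. A (Suc s) \<subseteq> A s" "\<And>s. open (A s)" "\<And>s. vol (frontier (A s)) = 0"
  "\<And>s. sweeping (2 ^ s) (A s)" "\<And>s. m (A s) \<le> (m UNIV + 1) / 2 ^ s"
proof -
 \<comment> \<open>The numerator grows from \<open>m UNIV\<close> towards \<open>m UNIV + 1\<close>;
   its increments pay exactly for the errors \<open>1 / (2 ^ Suc s * 2 ^ Suc s)\<close> of the
   halvings.\<close>
 define P where "P s A \<longleftrightarrow> open A \<and> vol (frontier A) = 0 \<and> sweeping (2 ^ s) A \<and>
  m A \<le> (m UNIV + 1 - 1 / 2 ^ s) / 2 ^ s \<and> (s = 0 \<longrightarrow> A = UNIV)" for s A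
 have "\<exists>A. \<forall>s. P s (A s) \<and> A (Suc s) \<subseteq> A s"
 proof (rule dependent_nat_choice)
  show "\<exists>A. P 0 A" by (rule exI[of _ UNIV]) (auto simp: P_def sweeping_def)
  fix A s assume "P s A"
  hence A: "open A" "sweeping (2 ^ s) A" "m A \<le> (m UNIV + 1 - 1 / 2 ^ s) / 2 ^ s" by (auto simp: P_def)
  have e: "1 / (2 ^ Suc s * 2 ^ Suc s) > (0::real)" by simp
  obtain A' where A': "A' \<subseteq> A" "open A'" "vol (frontier A') = 0" "sweeping (2 * 2 ^ s) A'"
   "m A' \<le> m A / 2 + 1 / (2 ^ Suc s * 2 ^ Suc s)" using halving[OF A(1,2) e] by blast
  have "m A' \<le> (m UNIV + 1 - 1 / 2 ^ s) / 2 ^ s / 2 + 1 / (2 ^ Suc s * 2 ^ Suc s)"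
   by (rule order_trans[OF A'(5) add_right_mono[OF divide_right_mono[OF A(3)]]]) simp
  also have "\<dots> = (m UNIV + 1 - 1 / 2 ^ Suc s) / 2 ^ Suc s" by (simp add: field_simps)
  finally show "\<exists>A'. P (Suc s) A' \<and> A' \<subseteq> A" using A' by (intro exI[of _ A']) (auto simp: P_def)
 qed
 then obtain A where A: "\<And>s. P s (A s)" "\<And>s. A (Suc s) \<subseteq> A s" by blast
 show thesis
 proof
  show "A 0 = UNIV" using A(1)[of 0] by (simp add: P_def)
  show "m (A s) \<le> (m UNIV + 1) / 2 ^ s" for s
  proof -
   have "m (A s) \<le> (m UNIV + 1 - 1 / 2 ^ s) / 2 ^ s" using A(1)[of s] by (simp add: P_def)
   also have "\<dots> \<le> (m UNIV + 1) / 2 ^ s" by (intro divide_right_mono) auto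
   finally show ?thesis .
  qed
 qed (use A in \<open>auto simp: P_def\<close>)
qed

end

subsection \<open>The size of the noise\<close>

text \<open>The factor in \<open>noise_law_upper\<close> in dimension \<open>n\<close>: a bound for
  the density of the wrapped noise when its radius is at least \<open>r\<close>.\<close>

abbreviation law_const :: "nat \<Rightarrow> real \<Rightarrow> real" where
 "law_const n r \<equiv> (1 + n / r) ^ n"

text \<open>The finite blocks of cells of successive shells are listed one after the other, so that
  a later cell never lies in an earlier shell.\<close>

lemma lexicographic_enumeration:
 fixes c :: "nat \<Rightarrow> nat"
 assumes c: "\<And>s. c s \<ge> 1"
 obtains st ix :: "nat \<Rightarrow> nat" where "\<And>k. ix k < c (st k)"
  "\<And>i k. i < k \<Longrightarrow> st i < st k \<or> st i = st k \<and> ix i < ix k" "\<And>s l. l < c s \<Longrightarrow> \<exists>k. st k = s \<and> ix k = l"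
proof -
 define p where "p = rec_nat (0, 0) (\<lambda>_ (s, l). if Suc l < c s then (s, Suc l) else (Suc s, 0))"
 define st ix where "st k = fst (p k)" and "ix k = snd (p k)" for k
 have s0: "st 0 = 0" "ix 0 = 0" by (simp_all add: st_def ix_def p_def)
 have step: "(if Suc (ix k) < c (st k) then st (Suc k) = st k \<and> ix (Suc k) = Suc (ix k) else st (Suc k) = Suc (st k) \<and> ix (Suc k) = 0)" for k
  by (simp add: st_def ix_def p_def split: prod.split)
 have bound: "ix k < c (st k)" for k
 proof (induction k)
  case 0 show ?case using c[of 0] by (simp add: s0)
 next
  case (Suc k) show ?case using step[of k] c[of "Suc (st k)"] by (auto split: if_splits)
 qed
 have ord: "i < k \<Longrightarrow> st i < st k \<or> st i = st k \<and> ix i < ix k" for i k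
 proof (induction k)
  case (Suc k)
  have "st k < st (Suc k) \<or> st k = st (Suc k) \<and> ix k < ix (Suc k)" using step[of k] by (auto split: if_splits)
  thus ?case using Suc by (cases "i = k") auto
 qed simp
 have within: "st k = s \<Longrightarrow> ix k = 0 \<Longrightarrow> l < c s \<Longrightarrow> st (k + l) = s \<and> ix (k + l) = l" for k s l
 proof (induction l)
  case (Suc l) thus ?case using step[of "k + l"] by simp
 qed simp
 have start: "\<exists>k. st k = s \<and> ix k = 0" for s
 proof (induction s)
  case 0 show ?case using s0 by blast
 next
  case (Suc s)
  then obtain k where k: "st k = s" "ix k = 0" by blast
  have "st (k + (c s - 1)) = s" "ix (k + (c s - 1)) = c s - 1" using within[OF k, of "c s - 1"] c[of s] by auto
  thus ?case using step[of "k + (c s - 1)"] c[of s] by auto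
 qed
 have "\<exists>k. st k = s \<and> ix k = l" if "l < c s" for s l using start[of s] within that by blast
 thus thesis using that bound ord by blast
qed

context regular_dynamics begin

text \<open>Uniform continuity of \<open>f\<close> is applied once per step, and the number of steps
  is fixed.\<close>

lemma tracking:
 assumes "\<rho> > 0"
 shows "\<exists>\<eta>>0. \<forall>X. \<forall>j\<le>N. (\<forall>i<j. dist (X (Suc i)) (f (X i)) < \<eta>) \<longrightarrow> dist (X j) ((f ^^ j) (X 0)) < \<rho>"
 using assms
proof (induction N arbitrary: \<rho>)
 case 0 thus ?case by (intro exI[of _ 1]) auto
next
 case (Suc N)
 have "uniformly_continuous_on UNIV f" by (rule compact_uniformly_continuous[OF cont compact_torus])
 then obtain d where d: "d > 0" "\<And>x y. dist y x < d \<Longrightarrow> dist (f y) (f x) < \<rho> / 2"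
  unfolding uniformly_continuous_on_def using Suc.prems by (metis UNIV_I half_gt_zero)
 have "min d \<rho> > 0" using d(1) Suc.prems by simp
 then obtain \<eta> where \<eta>: "\<eta> > 0" "\<And>X j. j \<le> N \<Longrightarrow> (\<forall>i<j. dist (X (Suc i)) (f (X i)) < \<eta>) \<Longrightarrow> dist (X j) ((f ^^ j) (X 0)) < min d \<rho>"
  using Suc.IH[of "min d \<rho>"] by blast
 show ?case
 proof (intro exI[of _ "min \<eta> (\<rho> / 2)"] conjI allI impI)
  show "0 < min \<eta> (\<rho> / 2)" using \<eta>(1) Suc.prems by simp
  fix X j assume j: "j \<le> Suc N" and X: "\<forall>i<j. dist (X (Suc i)) (f (X i)) < min \<eta> (\<rho> / 2)"
  hence le: "dist (X i) ((f ^^ i) (X 0)) < min d \<rho>" if "i \<le> N" "i \<le> j" for i using \<eta>(2)[of i X] that by auto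
  show "dist (X j) ((f ^^ j) (X 0)) < \<rho>"
  proof (cases "j = Suc N")
   case True
   have "dist (f (X N)) (f ((f ^^ N) (X 0))) < \<rho> / 2" using le[of N] True by (intro d(2)) simp
   moreover have "dist (X (Suc N)) (f (X N)) < \<rho> / 2" using X True by auto
   ultimately show ?thesis using True dist_triangle[of "X (Suc N)" "f ((f ^^ N) (X 0))" "f (X N)"] by simp
  qed (use le[of j] j in auto)
 qed
qed

text \<open>The orbit of \<open>f x\<close> cannot meet \<open>x\<close> before it enters \<open>A\<close>, as it would be periodic.\<close>

lemma no_return:
 assumes A: "open A" "sweeping N A"
 obtains \<kappa> r where "\<kappa> > 0" "r > 0" "\<And>x y. x \<notin> A \<Longrightarrow> dist y (f x) < r \<Longrightarrow>
  \<exists>j<N. \<kappa> \<le> height A ((f ^^ j) y) \<and> (\<forall>l<j. \<kappa> \<le> dist ((f ^^ l) y) x)"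
proof (cases "A = UNIV")
 case True thus ?thesis by (intro that[of 1 1]) auto
next
 case False
 have N: "N > 0" using A(2) by (auto simp: sweeping_def)
 \<comment> \<open>Positive exactly if the orbit of \<open>y\<close> is in \<open>A\<close> at time
   \<open>j\<close> and has not met \<open>x\<close> before. The sum over \<open>j\<close> is
   continuous in both points, so compactness turns positivity at \<open>y = f x\<close> into a
   uniform bound for nearby \<open>y\<close>.\<close>
 define t where "t j x y = height A ((f ^^ j) y) * (\<Prod>l<j. dist ((f ^^ l) y) x)" for j x y
 define \<psi> where "\<psi> = (\<lambda>(x, y). \<Sum>j<N. t j x y)"
 have t0: "0 \<le> t j x y" for j x y unfolding t_def by (intro mult_nonneg_nonneg height(2) prod_nonneg) auto
 have c\<psi>: "continuous_on UNIV \<psi>" unfolding \<psi>_def t_def case_prod_beta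
  by (intro continuous_intros continuous_on_compose2[OF height(1)[of UNIV]] continuous_on_compose2[OF continuous_iter[of UNIV]]) auto
 have pos: "\<psi> (x, f x) > 0" if x: "x \<notin> A" for x
 proof -
  define P where "P j \<longleftrightarrow> (f ^^ j) (f x) \<in> A" for j
  obtain j0 where j0: "j0 < N" "P j0" using A(2) by (auto simp: sweeping_def P_def)
  define j where "j = (LEAST j. P j)"
  have j: "P j" "j < N" "\<And>l. l < j \<Longrightarrow> \<not> P l"
   using j0 Least_le[of P j0] unfolding j_def by (auto intro: LeastI dest: not_less_Least)
  have "(f ^^ l) (f x) \<noteq> x" if l: "l < j" for l
  proof
   assume eq: "(f ^^ l) (f x) = x"
   have "(f ^^ ((j - Suc l) + Suc l)) (f x) = (f ^^ (j - Suc l)) (f ((f ^^ l) (f x)))"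
    by (simp only: funpow_add comp_apply funpow.simps(2))
   hence "(f ^^ j) (f x) = (f ^^ (j - Suc l)) (f ((f ^^ l) (f x)))"
    unfolding le_add_diff_inverse2[OF Suc_leI[OF l]] .
   hence "P (j - Suc l)" using j(1) eq by (simp add: P_def)
   thus False using j(3)[of "j - Suc l"] l by simp
  qed
  hence "t j x (f x) > 0" using j(1) height(3)[OF A(1)] unfolding t_def P_def by (intro mult_pos_pos prod_pos) auto
  thus ?thesis unfolding \<psi>_def using j(2) t0 by (auto intro!: sum_pos2[of _ j])
 qed
 obtain c where c: "c > 0" "\<And>x. x \<notin> A \<Longrightarrow> c \<le> \<psi> (x, f x)"
 proof -
  have "compact (- A)" using A(1) by (intro compact_if_closed) auto
  moreover have "- A \<noteq> {}" using False by auto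
  moreover have "continuous_on (- A) (\<lambda>x. \<psi> (x, f x))"
   by (intro continuous_on_compose2[OF c\<psi>] continuous_intros continuous_on_subset[OF cont]) auto
  ultimately obtain x0 where "x0 \<in> - A" "\<forall>x\<in>- A. \<psi> (x0, f x0) \<le> \<psi> (x, f x)"
   using continuous_attains_inf by blast
  thus thesis using pos[of x0] by (intro that[of "\<psi> (x0, f x0)"]) auto
 qed
 have "compact (UNIV :: ('n torus \<times> 'n torus) set)"
  using compact_Times[OF compact_torus compact_torus] by (simp add: UNIV_Times_UNIV[symmetric] del: UNIV_Times_UNIV)
 from compact_uniformly_continuous[OF c\<psi> this]
 obtain r where r: "r > 0" "\<And>p q. dist q p < r \<Longrightarrow> dist (\<psi> q) (\<psi> p) < c / 2"
  unfolding uniformly_continuous_on_def using c(1) by (metis UNIV_I half_gt_zero)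
 obtain D where D: "D \<ge> 1" "\<And>x y :: 'n torus. dist x y \<le> D"
 proof -
  have "bounded (UNIV :: 'n torus set)" by (rule compact_imp_bounded[OF compact_torus])
  then obtain e where "\<And>x y :: 'n torus. dist x y \<le> e" unfolding bounded_two_points by blast
  thus thesis by (intro that[of "max 1 e"]) (auto simp: le_max_iff_disj)
 qed
 have hD: "height A x \<le> D" for x
 proof -
  obtain p where "p \<in> - A" using False by auto
  hence "infdist x (- A) \<le> dist x p" by (rule infdist_le)
  thus ?thesis using D(2)[of x p] False by (simp add: height_def)
 qed
 define q where "q = c / (2 * N)"
 have q: "q > 0" using c(1) N by (simp add: q_def)
 \<comment> \<open>All factors of \<open>t\<close> are at most \<open>D\<close>, so the lower bound
   \<open>q\<close> on the product bounds each single factor below by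
   \<open>q / D ^ N\<close>.\<close>
 define \<kappa> where "\<kappa> = q / D ^ N"
 have DN: "D ^ N > 0" using D(1) by simp
 have "\<exists>j<N. \<kappa> \<le> height A ((f ^^ j) y) \<and> (\<forall>l<j. \<kappa> \<le> dist ((f ^^ l) y) x)" if x: "x \<notin> A" and y: "dist y (f x) < r" for x y
 proof -
  have "dist (x, y) (x, f x) < r" using y by (simp add: dist_Pair_Pair)
  hence "dist (\<psi> (x, y)) (\<psi> (x, f x)) < c / 2" by (rule r(2))
  hence "\<psi> (x, y) > c / 2" using c(2)[OF x] unfolding dist_real_def by arith
  have "\<exists>j<N. q \<le> t j x y"
  proof (rule ccontr)
   assume "\<not> ?thesis"
   hence "(\<Sum>j<N. t j x y) \<le> (\<Sum>j<N. q)" by (intro sum_mono) (auto simp: not_le intro: less_imp_le)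
   hence "\<psi> (x, y) \<le> (\<Sum>j<N. q)" by (simp add: \<psi>_def)
   thus False using \<open>\<psi> (x, y) > c / 2\<close> N by (simp add: q_def)
  qed
  then obtain j where j: "j < N" "q \<le> t j x y" by blast
  have pj: "D ^ i \<le> D ^ N" if "i \<le> N" for i using D(1) that by (rule power_increasing[rotated])
  have "q \<le> height A ((f ^^ j) y) * D ^ N"
  proof -
   have "(\<Prod>l<j. dist ((f ^^ l) y) x) \<le> (\<Prod>l<j. D)" by (intro prod_mono) (use D in auto)
   also have "\<dots> \<le> D ^ N" using pj[of j] j(1) by simp
   finally show ?thesis using j(2) height(2) unfolding t_def by (meson mult_left_mono order_trans)
  qed
  moreover have "q \<le> dist ((f ^^ l) y) x * D ^ N" if l: "l < j" for l
  proof -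
   have "(\<Prod>l<j. dist ((f ^^ l) y) x) = dist ((f ^^ l) y) x * (\<Prod>l\<in>{..<j} - {l}. dist ((f ^^ l) y) x)"
    using l by (intro prod.remove) auto
   also have "(\<Prod>l\<in>{..<j} - {l}. dist ((f ^^ l) y) x) \<le> (\<Prod>l\<in>{..<j} - {l}. D)" by (intro prod_mono) (use D in auto)
   hence "dist ((f ^^ l) y) x * (\<Prod>l\<in>{..<j} - {l}. dist ((f ^^ l) y) x) \<le> dist ((f ^^ l) y) x * D ^ (j - 1)"
    using l by (intro mult_left_mono) auto
   finally have "t j x y \<le> D * (dist ((f ^^ l) y) x * D ^ (j - 1))"
    unfolding t_def using D(1) hD height(2) by (intro mult_mono prod_nonneg) auto
   also have "\<dots> = dist ((f ^^ l) y) x * D ^ j" using l by (cases j) auto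
   also have "\<dots> \<le> dist ((f ^^ l) y) x * D ^ N" using pj[of j] j(1) by (intro mult_left_mono) auto
   finally show ?thesis using j(2) by simp
  qed
  ultimately show ?thesis using j(1) DN by (auto simp: \<kappa>_def pos_divide_le_eq)
 qed
 thus ?thesis using q DN r(1) by (intro that[of \<kappa> r]) (auto simp: \<kappa>_def)
qed

text \<open>The requirements on one shell. \<open>\<eta>\<close> is the error per step that keeps
  pseudo-orbits \<open>\<rho>\<close>-close for \<open>N\<close> steps, and \<open>\<rho>\<close>
  also bounds the size of the cells. \<open>r\<close> separates weak from strong noise on a cell:
  below \<open>r\<close> an orbit enters \<open>A'\<close> before it can return; above
  \<open>r\<close> the density is at most \<open>law_const CARD('n) r\<close>, and the last line
  makes cells small against it. The bound \<open>1 / N\<close> makes a cell negligible even when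
  multiplied by the length of an excursion.\<close>

definition stage :: "'n torus set \<Rightarrow> 'n torus set \<Rightarrow> nat \<Rightarrow> real \<Rightarrow> real \<Rightarrow> real \<Rightarrow> real \<Rightarrow> bool" where
 "stage A A' N e \<rho> \<eta> r \<longleftrightarrow> 0 < \<rho> \<and> \<rho> \<le> e \<and> 0 < \<eta> \<and> \<eta> \<le> e \<and> 0 < r \<and>
  (\<forall>X. \<forall>j\<le>N. (\<forall>i<j. dist (X (Suc i)) (f (X i)) < \<eta>) \<longrightarrow> dist (X j) ((f ^^ j) (X 0)) < \<rho>) \<and>
  (\<forall>x. \<exists>j<N. ball ((f ^^ j) x) \<rho> \<subseteq> A') \<and>
  measure \<mu> {x. \<exists>y\<in>A. dist x y < \<rho>} \<le> measure \<mu> A + e \<and>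
  (\<forall>x y. x \<notin> A' \<longrightarrow> dist y (f x) < r \<longrightarrow> (\<exists>j<N. ball ((f ^^ j) y) \<rho> \<subseteq> A' \<and> (\<forall>l<j. 3 * \<rho> \<le> dist ((f ^^ l) y) x))) \<and>
  (\<forall>x. (\<Sum>j<N. vol ((f ^^ j) -` ball x (3 * \<rho>))) \<le> min (1 / (2 * law_const CARD('n) r)) (1 / N))"

text \<open>The order of the choices matters: \<open>r\<close> and the gap \<open>\<kappa>\<close>
  come first, \<open>\<rho>\<close> depends on them, and \<open>\<eta>\<close> on
  \<open>\<rho>\<close>. The boundary of \<open>A\<close> is null also for \<open>\<mu>\<close>,
  hence thin neighbourhoods of \<open>A\<close> have nearly the measure of \<open>A\<close>.\<close>

lemma stage_exists:
 assumes A: "open A" "vol (frontier A) = 0" "A' \<subseteq> A" and A': "open A'" "sweeping N A'" and e: "e > 0"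
 obtains \<rho> \<eta> r where "stage A A' N e \<rho> \<eta> r"
proof -
 have N: "N > 0" using A'(2) by (auto simp: sweeping_def)
 obtain c where c: "c > 0" "\<And>x. \<exists>j<N. c \<le> height A' ((f ^^ j) x)" using sweeping_height[OF A'] by blast
 obtain \<kappa> r where \<kappa>: "\<kappa> > 0" "r > 0" "\<And>x y. x \<notin> A' \<Longrightarrow> dist y (f x) < r \<Longrightarrow>
  \<exists>j<N. \<kappa> \<le> height A' ((f ^^ j) y) \<and> (\<forall>l<j. \<kappa> \<le> dist ((f ^^ l) y) x)" using no_return[OF A'] by blast
 have L: "law_const CARD('n) r > 0" using \<kappa>(2) by (intro zero_less_power) (simp add: add_pos_nonneg)
 define q where "q = min (1 / (2 * law_const CARD('n) r)) (1 / N) / N"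
 have q: "q > 0" using L N by (simp add: q_def)
 obtain d where d: "d > 0" "\<And>D j. D \<in> sets borel \<Longrightarrow> vol D < d \<Longrightarrow> vol ((f ^^ j) -` D) < q"
  using UA[OF q] by blast
 obtain s where s: "s > 0" "\<And>x t. t \<le> s \<Longrightarrow> vol (ball x t) < d" using small_balls[OF d(1)] by blast
 have "measure \<mu> (closure A) \<le> measure \<mu> A + measure \<mu> (frontier A)"
  unfolding closure_Un_frontier using A(1) by (intro measure_Un_le) auto
 also have "measure \<mu> (frontier A) = 0" using A(2) by (intro ac) auto
 finally have clA: "measure \<mu> (closure A) \<le> measure \<mu> A" by simp
 obtain U where U: "open U" "closure A \<subseteq> U" "measure \<mu> U < measure \<mu> (closure A) + e"
  by (rule outer_approximation[OF mu(1,2) _ e, of "closure A"]) auto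
 obtain w where w: "w > 0" "\<And>x y. x \<in> closure A \<Longrightarrow> dist x y < w \<Longrightarrow> y \<in> U"
  using compact_in_open[OF compact_if_closed[OF closed_closure] U(1,2)] by blast
 define \<rho> where "\<rho> = Min {c, 1, \<kappa> / 3, s / 3, w, e}"
 have \<rho>: "\<rho> > 0" "\<rho> \<le> c" "\<rho> \<le> 1" "3 * \<rho> \<le> \<kappa>" "3 * \<rho> \<le> s" "\<rho> \<le> w" "\<rho> \<le> e"
 proof -
  show "\<rho> > 0" using c(1) \<kappa>(1) s(1) w(1) e by (simp add: \<rho>_def)
  have "\<rho> \<le> \<kappa> / 3" "\<rho> \<le> s / 3" unfolding \<rho>_def by (intro Min_le; simp)+
  thus "3 * \<rho> \<le> \<kappa>" "3 * \<rho> \<le> s" by auto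
  show "\<rho> \<le> c" "\<rho> \<le> 1" "\<rho> \<le> w" "\<rho> \<le> e" unfolding \<rho>_def by (intro Min_le; simp)+
 qed
 obtain \<eta> where \<eta>: "\<eta> > 0" "\<And>X j. j \<le> N \<Longrightarrow> (\<forall>i<j. dist (X (Suc i)) (f (X i)) < \<eta>) \<Longrightarrow> dist (X j) ((f ^^ j) (X 0)) < \<rho>"
  using tracking[OF \<rho>(1), of N] by blast
 have "stage A A' N e \<rho> (min \<eta> e) r" unfolding stage_def
 proof (intro conjI allI impI)
  show "\<exists>j<N. ball ((f ^^ j) x) \<rho> \<subseteq> A'" for x
   using c(2)[of x] height(4)[OF \<rho>(3)] \<rho>(2) by (meson order_trans)
  show "measure \<mu> {x. \<exists>y\<in>A. dist x y < \<rho>} \<le> measure \<mu> A + e"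
  proof -
   have "{x. \<exists>y\<in>A. dist x y < \<rho>} \<subseteq> U"
   proof clarify
    fix x y assume "y \<in> A" "dist x y < \<rho>"
    thus "x \<in> U" using w(2)[of y x] \<rho>(6) closure_subset[of A] by (auto simp: dist_commute)
   qed
   hence "measure \<mu> {x. \<exists>y\<in>A. dist x y < \<rho>} \<le> measure \<mu> U" using U(1) by (intro mu.finite_measure_mono) auto
   thus ?thesis using U(3) clA by simp
  qed
  show "\<exists>j<N. ball ((f ^^ j) y) \<rho> \<subseteq> A' \<and> (\<forall>l<j. 3 * \<rho> \<le> dist ((f ^^ l) y) x)" if xy: "x \<notin> A'" "dist y (f x) < r" for x y
  proof -
   obtain j where j: "j < N" "\<kappa> \<le> height A' ((f ^^ j) y)" "\<forall>l<j. \<kappa> \<le> dist ((f ^^ l) y) x" using \<kappa>(3)[OF xy] by blast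
   have "\<rho> \<le> height A' ((f ^^ j) y)" using j(2) \<rho>(1,4) by linarith
   thus ?thesis using j(1,3) height(4)[OF \<rho>(3)] \<rho>(4) by (intro exI[of _ j]) (auto intro: order_trans)
  qed
  show "(\<Sum>j<N. vol ((f ^^ j) -` ball x (3 * \<rho>))) \<le> min (1 / (2 * law_const CARD('n) r)) (1 / N)" for x
  proof -
   have "(\<Sum>j<N. vol ((f ^^ j) -` ball x (3 * \<rho>))) \<le> (\<Sum>j<N. q)"
    by (intro sum_mono less_imp_le d(2) s(2) \<rho>(5)) auto
   also have "\<dots> = min (1 / (2 * law_const CARD('n) r)) (1 / N)" using N by (simp add: q_def)
   finally show ?thesis .
  qed
  show "dist (X j) ((f ^^ j) (X 0)) < \<rho>" if "j \<le> N" "\<forall>i<j. dist (X (Suc i)) (f (X i)) < min \<eta> e" for X j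
   using \<eta>(2)[of j X] that by simp
 qed (use \<rho>(1,7) \<eta>(1) \<kappa>(2) e in auto)
 thus thesis by (rule that)
qed

text \<open>Sets with null boundary are closed under the operations that form the cells, and off
  these boundaries \<open>\<zeta>\<close> is locally constant.\<close>

definition nullf :: "'n torus set \<Rightarrow> bool" where
 "nullf S \<longleftrightarrow> vol (frontier S) = 0"

lemma nullf_subset:
 assumes "frontier S \<subseteq> frontier T \<union> frontier U" "nullf T" "nullf U" shows "nullf S"
proof -
 have "vol (frontier S) \<le> vol (frontier T \<union> frontier U)"
  using assms(1) by (intro leb.finite_measure_mono) auto
 also have "\<dots> \<le> vol (frontier T) + vol (frontier U)" by (intro measure_Un_le) auto
 finally show ?thesis using assms(2,3) by (simp add: nullf_def measure_le_0_iff)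
qed

lemma nullf_Un: "nullf S \<Longrightarrow> nullf T \<Longrightarrow> nullf (S \<union> T)"
 by (rule nullf_subset[OF frontier_Un_subset])

lemma nullf_Diff: "nullf S \<Longrightarrow> nullf T \<Longrightarrow> nullf (S - T)"
 unfolding Diff_eq by (rule nullf_subset[OF frontier_Int_subset]) (simp_all add: nullf_def frontier_complement)

lemma nullf_UN: "finite I \<Longrightarrow> (\<And>i. i \<in> I \<Longrightarrow> nullf (S i)) \<Longrightarrow> nullf (\<Union>i\<in>I. S i)"
proof (induction I rule: finite_induct)
 case (insert i I) thus ?case by (simp add: nullf_Un)
qed (simp add: nullf_def)

text \<open>The common radius is above \<open>\<rho> / 2\<close>, so that the balls cover, below
  \<open>\<rho>\<close>, and such that all their spheres are null.\<close>

lemma cells_exist: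
 assumes S: "S \<in> sets borel" "nullf S" and \<rho>: "\<rho> > 0"
 obtains c :: nat and cell and p where "c \<ge> 1" "\<And>l. cell l \<in> sets borel" "\<And>l. nullf (cell l)" "(\<Union>l<c. cell l) = S"
  "\<And>l l'. l < l' \<Longrightarrow> cell l \<inter> cell l' = {}" "\<And>l. cell l \<subseteq> ball (p l) \<rho>"
proof -
 obtain F where F: "finite F" "(\<Union>x\<in>F. ball x (\<rho> / 2)) = (UNIV :: 'n torus set)"
  using finite_subcover_torus[of "\<lambda>x. ball x (\<rho> / 2)"] \<rho> by auto
 have Fne: "F \<noteq> {}" using F(2) by auto
 obtain r where r: "\<rho> / 2 < r" "r < \<rho>" "\<And>x. x \<in> F \<Longrightarrow> vol {y. dist x y = r} = 0"
  by (rule null_level[OF leb.finite_measure_axioms sets_torus_lebesgue F(1), of dist "\<rho> / 2" \<rho>])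
   (use \<rho> in \<open>auto intro!: continuous_intros\<close>)
 have nb: "nullf (ball x r)" if "x \<in> F" for x
 proof -
  have "continuous_on UNIV (\<lambda>y. - dist x y)" by (intro continuous_intros)
  from frontier_superlevel[OF this, of "- r"]
  have "frontier (ball x r) \<subseteq> {y. dist x y = r}" by (simp add: ball_def)
  moreover have "{y. dist x y = r} \<in> sets borel"
   using closed_Collect_eq[of "dist x" "\<lambda>_. r"] by (auto intro!: continuous_intros borel_closed)
  ultimately have "vol (frontier (ball x r)) \<le> vol {y. dist x y = r}" by (intro leb.finite_measure_mono) auto
  thus ?thesis using r(3)[OF that] by (simp add: nullf_def measure_le_0_iff)
 qed
 obtain xs where xs: "set xs = F" using finite_list[OF F(1)] by blast
 define c where "c = length xs"
 define p where "p l = (if l < c then xs ! l else xs ! 0)" for l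
 have c: "c \<ge> 1" using Fne xs by (cases xs) (auto simp: c_def)
 have "0 < length xs" using c unfolding c_def by linarith
 hence pF: "p l \<in> F" for l using xs nth_mem[of l xs] nth_mem[of 0 xs] by (auto simp: p_def c_def)
 have Fp: "\<exists>l<c. x = p l" if xF: "x \<in> F" for x
 proof -
  obtain l where "l < length xs" "xs ! l = x" using xF unfolding xs[symmetric] in_set_conv_nth by blast
  thus ?thesis by (intro exI[of _ l]) (simp add: p_def c_def)
 qed
 define cell where "cell l = S - (- ball (p l) r) - (\<Union>l'<l. ball (p l') r)" for l
 have cu: "(\<Union>l<c. cell l) = S"
 proof
  show "(\<Union>l<c. cell l) \<subseteq> S" by (rule UN_least) (auto simp: cell_def)
  show "S \<subseteq> (\<Union>l<c. cell l)"
  proof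
   fix x assume x: "x \<in> S"
   obtain y where y: "y \<in> F" "x \<in> ball y (\<rho> / 2)" using F(2) UNIV_I by blast
   then obtain l0 where l0: "l0 < c" "x \<in> ball (p l0) r" using Fp[OF y(1)] r(1) by auto
   define l where "l = (LEAST l. x \<in> ball (p l) r)"
   have l: "x \<in> ball (p l) r" "l \<le> l0" "\<And>l'. l' < l \<Longrightarrow> x \<notin> ball (p l') r"
    using l0(2) unfolding l_def by (auto intro: LeastI Least_le dest: not_less_Least)
   hence "x \<in> cell l" using x unfolding cell_def by blast
   moreover have "l < c" using l(2) l0(1) by simp
   ultimately show "x \<in> (\<Union>l<c. cell l)" by blast
  qed
 qed
 show thesis
 proof (rule that[OF c _ _ cu])
  show "cell l \<in> sets borel" for l unfolding cell_def using S(1) by measurable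
  show "nullf (cell l)" for l
   unfolding cell_def using nb[OF pF] S(2) by (intro nullf_Diff nullf_UN) (auto simp: nullf_def)
  show "cell l \<inter> cell l' = {}" if "l < l'" for l l' using that unfolding cell_def by blast
  show "cell l \<subseteq> ball (p l) \<rho>" for l using r(2) unfolding cell_def by auto
 qed
qed

end

subsection \<open>Excursions between regenerations\<close>

text \<open>The last condition on \<open>z\<close> is the dichotomy for the noise: if
  \<open>z (Suc k) * \<epsilon>\<close> is below the wrapping threshold \<open>2 * CARD('n)\<close>,
  then \<open>z k * \<epsilon>\<close> is below the tracking error of the stage of cell
  \<open>Suc k\<close>. By the doubling, every \<open>\<epsilon> > 0\<close> passes the threshold at
  some cell.\<close>

locale perturbation = regular_dynamics f Q \<mu> for f :: "'n::finite torus \<Rightarrow> 'n torus" and Q \<mu> +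
 fixes A :: "nat \<Rightarrow> 'n torus set" and \<rho> \<eta> r :: "nat \<Rightarrow> real" and st :: "nat \<Rightarrow> nat"
  and cell :: "nat \<Rightarrow> 'n torus set" and p :: "nat \<Rightarrow> 'n torus" and z :: "nat \<Rightarrow> real" and \<zeta> :: "'n torus \<Rightarrow> real"
 assumes A: "\<And>s t. s \<le> t \<Longrightarrow> A t \<subseteq> A s" "\<And>s. open (A s)" "\<And>s. m (A s) \<le> (m UNIV + 1) / 2 ^ s"
  and stage: "\<And>s. stage (A s) (A (Suc s)) (2 ^ Suc s) (1 / 2 ^ s) (\<rho> s) (\<eta> s) (r s)"
  and cell: "\<And>k. cell k \<in> sets borel" "\<And>i k. i < k \<Longrightarrow> cell i \<inter> cell k = {}"
   "\<And>k. cell k \<subseteq> A (st k) - A (Suc (st k))" "\<And>k. cell k \<subseteq> ball (p k) (\<rho> (st k))"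
  and cells: "\<And>s. - A s \<subseteq> (\<Union>i\<in>{i. st i < s}. cell i)" "measure torus_lebesgue (- (\<Union>k. cell k)) = 0"
  and st: "\<And>i k. i \<le> k \<Longrightarrow> st i \<le> st k" "\<And>s. \<exists>k. s \<le> st k"
  and z: "z 0 = 1" "\<And>k. 2 * z k \<le> z (Suc k)" "\<And>k. z k * (2 * CARD('n)) \<le> \<eta> (st (Suc k)) * z (Suc k)"
  and \<zeta>: "\<zeta> \<in> borel_measurable borel" "\<And>x. 0 < \<zeta> x" "\<And>k x. x \<in> cell k \<Longrightarrow> \<zeta> x = z k"
begin

declare cell(1) [measurable] \<zeta>(1) [measurable]

lemma f_measurable [measurable]: "f \<in> borel_measurable borel"
 by (rule borel_measurable_continuous_onI[OF cont])

lemma stageD: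
 shows "0 < \<rho> s" "\<rho> s \<le> 1 / 2 ^ s" "0 < \<eta> s" "\<eta> s \<le> 1 / 2 ^ s" "0 < r s"
  and "\<And>X j. j \<le> 2 ^ Suc s \<Longrightarrow> (\<And>i. i < j \<Longrightarrow> dist (X (Suc i)) (f (X i)) < \<eta> s) \<Longrightarrow> dist (X j) ((f ^^ j) (X 0)) < \<rho> s"
  and "\<And>x. \<exists>j<2 ^ Suc s. ball ((f ^^ j) x) (\<rho> s) \<subseteq> A (Suc s)"
  and "measure \<mu> {x. \<exists>y\<in>A s. dist x y < \<rho> s} \<le> measure \<mu> (A s) + 1 / 2 ^ s"
  and "\<And>x y. x \<notin> A (Suc s) \<Longrightarrow> dist y (f x) < r s \<Longrightarrow>
   \<exists>j<2 ^ Suc s. ball ((f ^^ j) y) (\<rho> s) \<subseteq> A (Suc s) \<and> (\<forall>l<j. 3 * \<rho> s \<le> dist ((f ^^ l) y) x)"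
  and "\<And>x. (\<Sum>j<2 ^ Suc s. vol ((f ^^ j) -` ball x (3 * \<rho> s))) \<le> min (1 / (2 * law_const CARD('n) (r s))) (1 / 2 ^ Suc s)"
 using stage[of s] unfolding stage_def by (blast | simp)+

definition nbhd :: "'n torus set \<Rightarrow> real \<Rightarrow> 'n torus set" where
 "nbhd D t = {x. \<exists>y\<in>D. dist x y < t}"

lemma nbhd_borel [measurable]: "nbhd D t \<in> sets borel"
proof -
 have "nbhd D t = (\<Union>y\<in>D. ball y t)" by (auto simp: nbhd_def dist_commute)
 hence "open (nbhd D t)" by auto
 thus ?thesis by simp
qed

lemma z_mono: "i \<le> k \<Longrightarrow> z i \<le> z k" and z_ge: "2 ^ k \<le> z k"
proof -
 show ge: "2 ^ k \<le> z k" for k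
 proof (induction k)
  case (Suc k) thus ?case using z(2)[of k] by simp
 qed (simp add: z(1))
 have "z k \<le> z (Suc k)" for k using z(2)[of k] ge[of k] zero_le_power[of "2::real" k] by linarith
 thus "i \<le> k \<Longrightarrow> z i \<le> z k" by (rule lift_Suc_mono_le)
qed

text \<open>In each of \<open>J = 2 ^ (s - Suc P)\<close> steps the neighbourhood is hit with
  \<open>\<mu>\<close>-measure at most \<open>2 ^ P / 2 ^ s\<close>, so the points that avoid it
  have \<open>\<mu>\<close>-measure at least \<open>1 / 2\<close>, as the total mass is at least
  \<open>1\<close>. Absolute continuity turns this into a volume \<open>d\<close> independent of
  \<open>s\<close>.\<close>

lemma good_points:
 obtains d P where "d > 0" "\<And>s. P < s \<Longrightarrow> d \<le> vol {x. \<forall>i<2 ^ (s - Suc P). (f ^^ i) x \<notin> nbhd (A s) (\<rho> s)}"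
proof -
 have "(1 / 2 :: real) > 0" by simp
 obtain d where d: "d > 0" "\<And>S. S \<in> sets leb \<Longrightarrow> vol S < d \<Longrightarrow> measure \<mu> S < 1 / 2"
  by (rule absolutely_continuous_uniform[OF leb.finite_measure_axioms mu(1) _ _ \<open>1 / 2 > 0\<close>]) (use ac in auto)
 obtain P where P: "m UNIV + 2 \<le> 2 ^ P" using real_arch_pow[of 2 "m UNIV + 2"] by (auto intro: less_imp_le)
 have "d \<le> vol {x. \<forall>i<2 ^ (s - Suc P). (f ^^ i) x \<notin> nbhd (A s) (\<rho> s)}" if s: "P < s" for s
 proof -
  define J :: nat where "J = 2 ^ (s - Suc P)"
  have J: "real J * 2 * 2 ^ P = 2 ^ s"
  proof -
   have "(s - Suc P) + Suc P = s" using s by simp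
   hence "(2::real) ^ s = 2 ^ (s - Suc P) * 2 ^ Suc P" by (metis power_add)
   thus ?thesis by (simp add: J_def)
  qed
  define Y where "Y = (\<Union>i<J. (f ^^ i) -` nbhd (A s) (\<rho> s))"
  have Yb [measurable]: "Y \<in> sets borel" unfolding Y_def by measurable
  have "measure \<mu> (A s) \<le> m (A s)" by (simp add: m_def)
  hence "measure \<mu> (A s) \<le> (m UNIV + 1) / 2 ^ s" using A(3) by (rule order_trans)
  hence "measure \<mu> (nbhd (A s) (\<rho> s)) \<le> (m UNIV + 2) / 2 ^ s"
   using stageD(8)[of s] by (simp add: nbhd_def add_divide_distrib)
  also have "\<dots> \<le> 2 ^ P / 2 ^ s" using P by (intro divide_right_mono) auto
  finally have n: "measure \<mu> (nbhd (A s) (\<rho> s)) \<le> 2 ^ P / 2 ^ s" .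
  have "measure \<mu> Y \<le> (\<Sum>i<J. measure \<mu> ((f ^^ i) -` nbhd (A s) (\<rho> s)))"
   unfolding Y_def by (rule mu.finite_measure_subadditive_finite) (auto simp: image_subset_iff)
  also have "\<dots> = J * measure \<mu> (nbhd (A s) (\<rho> s))" by (simp add: inv_iter)
  also have "\<dots> \<le> J * (2 ^ P / 2 ^ s)" using n by (rule mult_left_mono) simp
  also have "\<dots> = 1 / 2" using J by (simp add: field_simps)
  finally have "measure \<mu> Y \<le> 1 / 2" .
  hence "\<not> measure \<mu> (- Y) < 1 / 2"
   using mass mu.finite_measure_compl[of Y] sets_eq_imp_space_eq[OF mu(2)] by (simp add: Compl_eq_Diff_UNIV)
  hence "d \<le> vol (- Y)" using d(2)[of "- Y"] by (auto simp: not_less[symmetric])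
  also have "- Y = {x. \<forall>i<2 ^ (s - Suc P). (f ^^ i) x \<notin> nbhd (A s) (\<rho> s)}" by (auto simp: Y_def J_def)
  finally show ?thesis .
 qed
 thus thesis using d(1) that by blast
qed

context
 fixes \<epsilon> :: real and \<nu> :: "'n torus measure" and k :: nat
 assumes \<epsilon>: "\<epsilon> > 0" and stationary: "stationary_measure (adapted_perturbation f \<zeta>) (noise \<epsilon>) \<nu>"
  and large: "2 * CARD('n) \<le> z (Suc k) * \<epsilon>" and small: "\<And>i. i < k \<Longrightarrow> z i * \<epsilon> \<le> \<eta> (st k)"
begin

abbreviation "s \<equiv> st k"
abbreviation "N \<equiv> (2::nat) ^ Suc s"
text \<open>The cells before and after \<open>k\<close>, split according to \<open>small\<close> and
  \<open>large\<close>: on \<open>Lo\<close> the noise stays within the tracking error of the stage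
  of \<open>k\<close>, and on \<open>Hi\<close> it wraps around the torus. With the cell
  \<open>k\<close> they make up everything up to a null set of \<open>\<nu>\<close>.\<close>

definition "Lo = (\<Union>i<k. cell i)"
definition "Hi = (\<Union>i\<in>{k<..}. cell i)"

lemma LH_borel [measurable]: "Lo \<in> sets borel" "Hi \<in> sets borel"
 unfolding Lo_def Hi_def by measurable

lemma nu: "sets \<nu> = sets borel" "prob_space \<nu>"
 using stationary by (auto simp: stationary_measure_def)

interpretation nu: prob_space \<nu> by (rule nu(2))
declare nu(1) [simp, measurable_cong]

interpretation noise: prob_space "noise \<epsilon> :: (real^'n) measure" by (rule prob_noise[OF \<epsilon>])

definition Pt :: "('n torus \<Rightarrow> ennreal) \<Rightarrow> 'n torus \<Rightarrow> ennreal" where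
 "Pt \<phi> x = (\<integral>\<^sup>+t. \<phi> (f x + torus_of (\<zeta> x *\<^sub>R t)) \<partial>noise \<epsilon>)"

lemma Pt_measurable [measurable]:
 assumes [measurable]: "\<phi> \<in> borel_measurable borel" shows "Pt \<phi> \<in> borel_measurable borel"
proof -
 have "sets (noise \<epsilon> :: (real^'n) measure) = sets borel" by (simp add: noise_def)
 hence "(\<lambda>q. f (fst q) + torus_of (\<zeta> (fst q) *\<^sub>R snd q)) \<in> borel_measurable (borel \<Otimes>\<^sub>M (noise \<epsilon> :: (real^'n) measure))"
  using measurable_perturbed[OF f_measurable \<zeta>(1)] by (simp cong: measurable_cong_sets sets_pair_measure_cong)
 from measurable_compose[OF this assms]
 have "(\<lambda>(x, t). \<phi> (f x + torus_of (\<zeta> x *\<^sub>R t))) \<in> borel_measurable (borel \<Otimes>\<^sub>M (noise \<epsilon> :: (real^'n) measure))"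
  by (simp add: case_prod_beta)
 thus ?thesis unfolding Pt_def[abs_def] by (rule noise.borel_measurable_nn_integral)
qed

lemma Pt_stationary: "\<phi> \<in> borel_measurable borel \<Longrightarrow> (\<integral>\<^sup>+x. \<phi> x \<partial>\<nu>) = (\<integral>\<^sup>+x. Pt \<phi> x \<partial>\<nu>)"
 unfolding Pt_def by (rule stationary_nn_integral[OF stationary \<epsilon> f_measurable \<zeta>(1)])

lemma Pt_AE: "AE t in noise \<epsilon>. dist (f x + torus_of (\<zeta> x *\<^sub>R t)) (f x) < \<zeta> x * \<epsilon>"
 using AE_noise
proof eventually_elim
 case (elim t)
 have "dist (f x + torus_of (\<zeta> x *\<^sub>R t)) (f x + torus_of 0) \<le> norm (\<zeta> x *\<^sub>R t)"
  using dist_torus_of_le[of "\<zeta> x *\<^sub>R t" 0] by (simp add: dist_torus_translate)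
 also have "\<dots> < \<zeta> x * \<epsilon>" using elim \<zeta>(2)[of x] by simp
 finally show ?case by (simp add: torus_of_0)
qed

lemma Pt_zero: "(\<And>y. dist y (f x) < \<zeta> x * \<epsilon> \<Longrightarrow> \<phi> y = 0) \<Longrightarrow> Pt \<phi> x = 0"
 unfolding Pt_def by (subst nn_integral_cong_AE[where v = "\<lambda>_. 0"]) (use Pt_AE[of x] in \<open>auto elim!: eventually_mono\<close>)

lemma Pt_one: "(\<And>y. dist y (f x) < \<zeta> x * \<epsilon> \<Longrightarrow> \<phi> y = 1) \<Longrightarrow> Pt \<phi> x = 1"
 unfolding Pt_def by (subst nn_integral_cong_AE[where v = "\<lambda>_. 1"])
  (use Pt_AE[of x] noise.emeasure_space_1 in \<open>auto elim!: eventually_mono\<close>)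

lemma Pt_le_1: "(\<And>y. \<phi> y \<le> 1) \<Longrightarrow> Pt \<phi> x \<le> 1"
 unfolding Pt_def using nn_integral_mono[of "noise \<epsilon>" "\<lambda>t. \<phi> (f x + torus_of (\<zeta> x *\<^sub>R t))" "\<lambda>_. 1"] noise.emeasure_space_1 by simp

lemma Pt_upper:
 assumes "\<phi> \<in> borel_measurable borel" "0 < t" "t \<le> \<zeta> x * \<epsilon>"
 shows "Pt \<phi> x \<le> ennreal (law_const CARD('n) t) * (\<integral>\<^sup>+y. \<phi> y \<partial>leb)"
proof -
 have "Pt \<phi> x \<le> ennreal (law_const CARD('n) (\<zeta> x * \<epsilon>)) * (\<integral>\<^sup>+y. \<phi> y \<partial>leb)"
  unfolding Pt_def using noise_law_upper[OF assms(1) \<zeta>(2) \<epsilon>, of "f x" x] by simp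
 also have "law_const CARD('n) (\<zeta> x * \<epsilon>) \<le> law_const CARD('n) t"
  using assms by (intro power_mono add_left_mono divide_left_mono) auto
 hence "ennreal (law_const CARD('n) (\<zeta> x * \<epsilon>)) * (\<integral>\<^sup>+y. \<phi> y \<partial>leb) \<le> ennreal (law_const CARD('n) t) * (\<integral>\<^sup>+y. \<phi> y \<partial>leb)"
  by (intro mult_right_mono ennreal_leI) auto
 finally show ?thesis .
qed

text \<open>The noise is positive everywhere, so each point has a next position with bounded
  density; the bound may depend on the point.\<close>

lemma nu_ac: assumes S: "S \<in> sets borel" "vol S = 0" shows "measure \<nu> S = 0"
proof -
 have "emeasure \<nu> S = (\<integral>\<^sup>+x. Pt (indicator S) x \<partial>\<nu>)" using Pt_stationary[of "indicator S"] S(1) by simp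
 also have "\<dots> = (\<integral>\<^sup>+x. 0 \<partial>\<nu>)"
 proof (rule nn_integral_cong)
  fix x
  have "Pt (indicator S) x \<le> ennreal (law_const CARD('n) (\<zeta> x * \<epsilon>)) * (\<integral>\<^sup>+y. indicator S y \<partial>leb)"
   by (rule Pt_upper) (use S(1) \<zeta>(2) \<epsilon> in auto)
  thus "Pt (indicator S) x = 0" using S by (simp add: leb.emeasure_eq_measure)
 qed
 finally show ?thesis by (simp add: measure_def)
qed

lemma outside: "AE x in \<nu>. x \<in> Lo \<or> x \<in> cell k \<or> x \<in> Hi"
proof -
 have b: "- (\<Union>i. cell i) \<in> sets borel" by measurable
 have "- (\<Union>i. cell i) \<in> null_sets \<nu>" using nu_ac[OF b cells(2)] b by (simp add: null_sets_def nu.emeasure_eq_measure)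
 hence "AE x in \<nu>. x \<notin> - (\<Union>i. cell i)" by (rule AE_not_in)
 thus ?thesis
 proof eventually_elim
  case (elim x)
  then obtain i where i: "x \<in> cell i" by blast
  consider "i < k" | "i = k" | "k < i" by linarith
  thus ?case by cases (use i in \<open>auto simp: Lo_def Hi_def\<close>)
 qed
qed

lemma Lo_small: "x \<in> Lo \<Longrightarrow> \<zeta> x * \<epsilon> \<le> \<eta> s"
 using \<zeta>(3) small by (auto simp: Lo_def)

text \<open>With \<open>not_A_Lo\<close> this places \<open>Lo\<close> between the complements of
  \<open>A s\<close> and of \<open>A (Suc s)\<close>: an excursion is over at the latest on entering
  \<open>A (Suc s)\<close>, and goes on at least as long as it avoids \<open>A s\<close>.\<close>

lemma Lo_A: "x \<in> Lo \<Longrightarrow> x \<notin> A (Suc s)"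
proof -
 assume "x \<in> Lo"
 then obtain i where i: "i < k" "x \<in> cell i" by (auto simp: Lo_def)
 hence "A (Suc s) \<subseteq> A (Suc (st i))" using st(1)[of i k] by (intro A(1)) auto
 thus ?thesis using cell(3) i(2) by blast
qed

lemma not_A_Lo: "x \<notin> A s \<Longrightarrow> x \<in> Lo"
proof -
 assume "x \<notin> A s"
 then obtain i where i: "st i < s" "x \<in> cell i" using cells(1)[of s] by blast
 hence "i < k" using st(1)[of k i] by (meson not_le)
 thus ?thesis using i(2) by (auto simp: Lo_def)
qed

lemma Hi_large: "x \<in> Hi \<Longrightarrow> 2 * CARD('n) \<le> \<zeta> x * \<epsilon>"
proof -
 assume "x \<in> Hi"
 then obtain i where i: "k < i" "x \<in> cell i" by (auto simp: Hi_def)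
 hence "z (Suc k) * \<epsilon> \<le> \<zeta> x * \<epsilon>" using \<epsilon> z_mono[of "Suc k" i] \<zeta>(3)[OF i(2)] by (intro mult_right_mono) auto
 thus ?thesis using large by simp
qed

lemma Hi_not_Lo: "x \<in> Hi \<Longrightarrow> x \<notin> Lo"
proof
 assume "x \<in> Hi" "x \<in> Lo"
 then obtain i j where "k < j" "x \<in> cell j" "i < k" "x \<in> cell i" by (auto simp: Lo_def Hi_def)
 thus False using cell(2)[of i j] by auto
qed

text \<open>\<open>v D j x\<close> is the probability that the perturbed orbit of \<open>x\<close> is in \<open>Lo\<close> at the times less than
 \<open>j\<close>, and in \<open>D\<close> at time \<open>j\<close>.\<close>

definition v :: "'n torus set \<Rightarrow> nat \<Rightarrow> 'n torus \<Rightarrow> ennreal" where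
 "v D = rec_nat (indicator D) (\<lambda>_ \<phi> x. indicator Lo x * Pt \<phi> x)"

lemma v_0: "v D 0 = indicator D" and v_Suc: "v D (Suc j) x = indicator Lo x * Pt (v D j) x"
 by (simp_all add: v_def)

lemma v_measurable [measurable]: "D \<in> sets borel \<Longrightarrow> v D j \<in> borel_measurable borel"
proof (induction j)
 case (Suc j)
 hence [measurable]: "v D j \<in> borel_measurable borel" by simp
 have "v D (Suc j) = (\<lambda>x. indicator Lo x * Pt (v D j) x)" by (rule ext) (rule v_Suc)
 thus ?case by simp
qed (simp add: v_0)

lemma v_le_1: "v D j x \<le> 1"
proof (induction j arbitrary: x)
 case 0 show ?case by (auto simp: v_0 indicator_def)
next
 case (Suc j)
 show ?case using Pt_le_1[of "v D j" x, OF Suc] by (auto simp: v_Suc indicator_def)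
qed

text \<open>Positive probability requires an actual path. This reduces questions about
  \<open>v\<close> to deterministic pseudo-orbits and avoids a measure on the space of
  paths.\<close>

lemma chain:
 assumes "v D j x \<noteq> 0"
 obtains X where "X 0 = x" "X j \<in> D" "\<And>i. i < j \<Longrightarrow> X i \<in> Lo" "\<And>i. i < j \<Longrightarrow> dist (X (Suc i)) (f (X i)) < \<eta> s"
proof -
 have "\<exists>X. X 0 = x \<and> X j \<in> D \<and> (\<forall>i<j. X i \<in> Lo \<and> dist (X (Suc i)) (f (X i)) < \<eta> s)"
  using assms
 proof (induction j arbitrary: x)
  case 0 thus ?case by (intro exI[of _ "\<lambda>_. x"]) (auto simp: v_0 indicator_def split: if_splits)
 next
  case (Suc j)
  hence x: "x \<in> Lo" "Pt (v D j) x \<noteq> 0" by (auto simp: v_Suc indicator_def split: if_splits)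
  obtain y where y: "dist y (f x) < \<zeta> x * \<epsilon>" "v D j y \<noteq> 0" using Pt_zero[of x "v D j"] x(2) by blast
  obtain X where X: "X 0 = y" "X j \<in> D" "\<forall>i<j. X i \<in> Lo \<and> dist (X (Suc i)) (f (X i)) < \<eta> s" using Suc.IH[OF y(2)] by blast
  show ?case
  proof (intro exI[of _ "case_nat x X"] conjI allI impI)
   fix i assume "i < Suc j"
   thus "case_nat x X i \<in> Lo" "dist (case_nat x X (Suc i)) (f (case_nat x X i)) < \<eta> s"
    using X x(1) y(1) Lo_small[OF x(1)] by (cases i; simp)+
  qed (use X in auto)
 qed
 thus thesis using that by blast
qed

text \<open>The sweeping property holds with the margin \<open>\<rho> s\<close>, so the pseudo-orbit
  enters \<open>A (Suc s)\<close> as well, and there it is outside \<open>Lo\<close>.\<close>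

lemma v_N: "v D N x = 0"
proof (rule ccontr)
 assume "v D N x \<noteq> 0"
 then obtain X where X: "X 0 = x" "\<And>i. i < N \<Longrightarrow> X i \<in> Lo" "\<And>i. i < N \<Longrightarrow> dist (X (Suc i)) (f (X i)) < \<eta> s"
  by (rule chain) blast
 obtain j where j: "j < N" "ball ((f ^^ j) x) (\<rho> s) \<subseteq> A (Suc s)" using stageD(7) by blast
 have "dist (X j) ((f ^^ j) (X 0)) < \<rho> s" by (rule stageD(6)) (use j X in auto)
 hence "X j \<in> A (Suc s)" using j(2) X(1) by (auto simp: dist_commute)
 thus False using Lo_A[OF X(2)[OF j(1)]] by blast
qed

lemma v_integral:
 assumes D [measurable]: "D \<in> sets borel" and j: "j \<le> N"
 shows "(\<integral>\<^sup>+x. v D j x \<partial>leb) \<le> ennreal (vol ((f ^^ j) -` nbhd D (\<rho> s)))"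
proof -
 have "v D j x \<le> indicator ((f ^^ j) -` nbhd D (\<rho> s)) x" for x
 proof (cases "v D j x = 0")
  case False
  then obtain X where X: "X 0 = x" "X j \<in> D" "\<And>i. i < j \<Longrightarrow> dist (X (Suc i)) (f (X i)) < \<eta> s" by (rule chain) blast
  have "dist (X j) ((f ^^ j) (X 0)) < \<rho> s" by (rule stageD(6)[where X = X and j = j and s = s, OF j X(3)])
  hence "x \<in> (f ^^ j) -` nbhd D (\<rho> s)" using X(1,2) by (auto simp: nbhd_def dist_commute)
  thus ?thesis using v_le_1 by simp
 qed simp
 hence "(\<integral>\<^sup>+x. v D j x \<partial>leb) \<le> (\<integral>\<^sup>+x. indicator ((f ^^ j) -` nbhd D (\<rho> s)) x \<partial>leb)" by (rule nn_integral_mono)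
 thus ?thesis by (simp add: leb.emeasure_eq_measure)
qed

text \<open>Stationarity is used repeatedly to split by the last visit outside \<open>Lo\<close>
  before the present. The remaining term, in which there is no such visit during \<open>N\<close>
  steps, vanishes by \<open>v_N\<close>.\<close>

lemma decomposition:
 assumes D [measurable]: "D \<in> sets borel"
 shows "emeasure \<nu> D = (\<integral>\<^sup>+x. indicator (- Lo) x * (\<Sum>j<N. Pt (v D j) x) \<partial>\<nu>)"
proof -
 have "emeasure \<nu> D = (\<Sum>j<J. \<integral>\<^sup>+x. indicator (- Lo) x * Pt (v D j) x \<partial>\<nu>) + (\<integral>\<^sup>+x. v D J x \<partial>\<nu>)" for J
 proof (induction J)
  case (Suc J)
  have "(\<integral>\<^sup>+x. v D J x \<partial>\<nu>) = (\<integral>\<^sup>+x. indicator (- Lo) x * Pt (v D J) x + indicator Lo x * Pt (v D J) x \<partial>\<nu>)"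
   unfolding Pt_stationary[OF v_measurable[OF D]] by (intro nn_integral_cong) (auto simp: indicator_def)
  also have "\<dots> = (\<integral>\<^sup>+x. indicator (- Lo) x * Pt (v D J) x \<partial>\<nu>) + (\<integral>\<^sup>+x. v D (Suc J) x \<partial>\<nu>)"
   unfolding v_Suc by (rule nn_integral_add) measurable
  finally show ?case using Suc by (simp add: add.assoc)
 qed (simp add: v_0)
 from this[of N] have "emeasure \<nu> D = (\<Sum>j<N. \<integral>\<^sup>+x. indicator (- Lo) x * Pt (v D j) x \<partial>\<nu>)"
  by (simp only: v_N nn_integral_0_iff_AE nn_integral_const mult_zero_left add_0_right)
 also have "\<dots> = (\<integral>\<^sup>+x. (\<Sum>j<N. indicator (- Lo) x * Pt (v D j) x) \<partial>\<nu>)" by (rule nn_integral_sum[symmetric]) measurable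
 finally show ?thesis by (simp only: sum_distrib_left)
qed

lemma measure_le:
 assumes D: "D \<in> sets borel" and b: "0 \<le> bR" "0 \<le> bV"
  "\<And>x. x \<in> cell k \<Longrightarrow> (\<Sum>j<N. Pt (v D j) x) \<le> ennreal bR" "\<And>x. x \<in> Hi \<Longrightarrow> (\<Sum>j<N. Pt (v D j) x) \<le> ennreal bV"
 shows "measure \<nu> D \<le> bR * measure \<nu> (cell k) + bV * measure \<nu> Hi"
proof -
 have "emeasure \<nu> D \<le> (\<integral>\<^sup>+x. ennreal bR * indicator (cell k) x + ennreal bV * indicator Hi x \<partial>\<nu>)"
  unfolding decomposition[OF D]
 proof (rule nn_integral_mono_AE, use outside in eventually_elim)
  fix x assume "x \<in> Lo \<or> x \<in> cell k \<or> x \<in> Hi"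
  thus "indicator (- Lo) x * (\<Sum>j<N. Pt (v D j) x) \<le> ennreal bR * indicator (cell k) x + ennreal bV * indicator Hi x"
   using b(3,4)[of x] by (auto simp: indicator_def intro: add_increasing add_increasing2)
 qed
 also have "\<dots> = ennreal bR * emeasure \<nu> (cell k) + ennreal bV * emeasure \<nu> Hi"
  by (subst nn_integral_add) (auto simp: nn_integral_cmult_indicator)
 also have "\<dots> = ennreal (bR * measure \<nu> (cell k) + bV * measure \<nu> Hi)"
  using b(1,2) by (simp add: nu.emeasure_eq_measure ennreal_mult)
 finally show ?thesis unfolding nu.emeasure_eq_measure using b(1,2) by (subst (asm) ennreal_le_iff) auto
qed

lemma sum_Pt_upper:
 assumes D: "D \<in> sets borel" and t: "0 < t" "t \<le> \<zeta> x * \<epsilon>"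
 shows "(\<Sum>j<N. Pt (v D j) x) \<le> ennreal (law_const CARD('n) t * (\<Sum>j<N. vol ((f ^^ j) -` nbhd D (\<rho> s))))"
proof -
 have "(\<Sum>j<N. Pt (v D j) x) \<le> (\<Sum>j<N. ennreal (law_const CARD('n) t * vol ((f ^^ j) -` nbhd D (\<rho> s))))"
 proof (rule sum_mono)
  fix j assume j: "j \<in> {..<N}"
  have "Pt (v D j) x \<le> ennreal (law_const CARD('n) t) * (\<integral>\<^sup>+y. v D j y \<partial>leb)" by (rule Pt_upper[OF v_measurable[OF D] t])
  also have "\<dots> \<le> ennreal (law_const CARD('n) t) * ennreal (vol ((f ^^ j) -` nbhd D (\<rho> s)))"
   by (rule mult_left_mono[OF v_integral[OF D]]) (use j in auto)
  finally show "Pt (v D j) x \<le> ennreal (law_const CARD('n) t * vol ((f ^^ j) -` nbhd D (\<rho> s)))"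
   using t(1) by (simp add: ennreal_mult)
 qed
 also have "\<dots> = ennreal (\<Sum>j<N. law_const CARD('n) t * vol ((f ^^ j) -` nbhd D (\<rho> s)))"
  using t(1) by (intro sum_ennreal) auto
 finally show ?thesis by (simp add: sum_distrib_left)
qed

text \<open>The density bound for the noise on \<open>Hi\<close>; it depends on the dimension
  only.\<close>

definition c2 :: real where "c2 = law_const CARD('n) (2 * CARD('n))"

lemma c2_nonneg: "0 \<le> c2" by (simp add: c2_def)

lemma sum_Pt_Hi:
 assumes D: "D \<in> sets borel" and x: "x \<in> Hi"
 shows "(\<Sum>j<N. Pt (v D j) x) \<le> ennreal (c2 * (\<Sum>j<N. vol ((f ^^ j) -` nbhd D (\<rho> s))))"
 unfolding c2_def using sum_Pt_upper[OF D _ Hi_large[OF x]] by simp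

lemma nbhd_cell: "nbhd (cell k) (\<rho> s) \<subseteq> ball (p k) (3 * \<rho> s)"
proof
 fix y assume "y \<in> nbhd (cell k) (\<rho> s)"
 then obtain w where w: "w \<in> cell k" "dist y w < \<rho> s" by (auto simp: nbhd_def)
 hence "dist (p k) w < \<rho> s" using cell(4)[of k] by auto
 thus "y \<in> ball (p k) (3 * \<rho> s)" using w(2) dist_triangle[of "p k" y w] stageD(1)[of s] by (simp add: dist_commute)
qed

lemma sum_cell: "(\<Sum>j<N. vol ((f ^^ j) -` nbhd (cell k) (\<rho> s))) \<le> min (1 / (2 * law_const CARD('n) (r s))) (1 / 2 ^ Suc s)"
proof -
 have "(\<Sum>j<N. vol ((f ^^ j) -` nbhd (cell k) (\<rho> s))) \<le> (\<Sum>j<N. vol ((f ^^ j) -` ball (p k) (3 * \<rho> s)))"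
  by (intro sum_mono leb.finite_measure_mono vimage_mono nbhd_cell) (simp add: vimage_iter)
 thus ?thesis using stageD(10)[where s = s and x = "p k"] by linarith
qed

text \<open>If the noise on the cell is weak, then the orbit visits \<open>A (Suc s)\<close> before it can return to the
 cell; otherwise its law is spread out, and the cell is small.\<close>

lemma cell_return:
 assumes x: "x \<in> cell k" shows "(\<Sum>j<N. Pt (v (cell k) j) x) \<le> ennreal (1 / 2)"
proof (cases "\<zeta> x * \<epsilon> < r s")
 case True
 have "Pt (v (cell k) j) x = 0" if j: "j < N" for j
 proof (rule Pt_zero, rule ccontr)
  fix y assume y: "dist y (f x) < \<zeta> x * \<epsilon>" and "v (cell k) j y \<noteq> 0"
  then obtain X where X: "X 0 = y" "X j \<in> cell k" "\<And>i. i < j \<Longrightarrow> X i \<in> Lo" "\<And>i. i < j \<Longrightarrow> dist (X (Suc i)) (f (X i)) < \<eta> s"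
   using chain by metis
  have xA: "x \<notin> A (Suc s)" using x cell(3) by blast
  obtain j' where j': "ball ((f ^^ j') y) (\<rho> s) \<subseteq> A (Suc s)" "\<forall>l<j'. 3 * \<rho> s \<le> dist ((f ^^ l) y) x"
   using stageD(9)[OF xA, of y] y True by auto
  have tr: "dist (X i) ((f ^^ i) y) < \<rho> s" if "i \<le> j" for i
   unfolding X(1)[symmetric] by (rule stageD(6)) (use that j X(4) in auto)
  show False
  proof (cases "j < j'")
   case True
   have "dist (p k) (X j) < \<rho> s" "dist (p k) x < \<rho> s" using cell(4)[of k] X(2) x by auto
   hence "dist (X j) x < 2 * \<rho> s" using dist_triangle[of "X j" x "p k"] by (simp add: dist_commute)
   hence "dist ((f ^^ j) y) x < 3 * \<rho> s"
    using tr[of j] dist_triangle[of "(f ^^ j) y" x "X j"] by (simp add: dist_commute)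
   thus False using j'(2) True by (meson not_le)
  next
   case False
   hence "X j' \<in> A (Suc s)" using tr[of j'] j'(1) by (auto simp: dist_commute)
   moreover have "X j' \<notin> A (Suc s)" using False X(2,3) Lo_A cell(3)[of k] by (cases "j' = j") auto
   ultimately show False by blast
  qed
 qed
 thus ?thesis by simp
next
 case False
 have L: "law_const CARD('n) (r s) > 0" using stageD(5)[of s] by (intro zero_less_power) (simp add: add_pos_nonneg)
 have "(\<Sum>j<N. Pt (v (cell k) j) x) \<le> ennreal (law_const CARD('n) (r s) * (\<Sum>j<N. vol ((f ^^ j) -` nbhd (cell k) (\<rho> s))))"
  using False stageD(5) by (intro sum_Pt_upper) auto
 also have "\<dots> \<le> ennreal (law_const CARD('n) (r s) * (1 / (2 * law_const CARD('n) (r s))))"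
  using sum_cell L by (intro ennreal_leI mult_left_mono) auto
 also have "q * (1 / (2 * q)) = 1 / 2" if "q > 0" for q :: real using that by simp
 from this[OF L] have "ennreal (law_const CARD('n) (r s) * (1 / (2 * law_const CARD('n) (r s)))) = ennreal (1 / 2)"
  by (rule arg_cong)
 finally show ?thesis .
qed

text \<open>Excursions from the cell back to itself contribute at most half of its mass, which is
  absorbed on the left; the rest comes from \<open>Hi\<close>.\<close>

lemma cell_measure: "measure \<nu> (cell k) \<le> 2 * c2 / N * measure \<nu> Hi"
proof -
 have "measure \<nu> (cell k) \<le> 1 / 2 * measure \<nu> (cell k) + c2 * (1 / N) * measure \<nu> Hi"
 proof (rule measure_le)
  fix x assume "x \<in> Hi"
  hence "(\<Sum>j<N. Pt (v (cell k) j) x) \<le> ennreal (c2 * (\<Sum>j<N. vol ((f ^^ j) -` nbhd (cell k) (\<rho> s))))"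
   by (intro sum_Pt_Hi) auto
  also have "\<dots> \<le> ennreal (c2 * (1 / N))"
   using sum_cell c2_nonneg by (intro ennreal_leI mult_left_mono) auto
  finally show "(\<Sum>j<N. Pt (v (cell k) j) x) \<le> ennreal (c2 * (1 / N))" .
 qed (use cell_return c2_nonneg in auto)
 thus ?thesis by simp
qed

text \<open>Excursions from the exceptional cell may have a concentrated law, so only their length
  \<open>N\<close> is used. This is affordable, because the mass of the cell is at most of order
  \<open>1 / N\<close> times that of \<open>Hi\<close>.\<close>

lemma excursion_measure:
 assumes D: "D \<in> sets borel"
 shows "measure \<nu> D \<le> c2 * (2 + (\<Sum>j<N. vol ((f ^^ j) -` nbhd D (\<rho> s)))) * measure \<nu> Hi"
proof -
 let ?S = "\<Sum>j<N. vol ((f ^^ j) -` nbhd D (\<rho> s))"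
 have "measure \<nu> D \<le> N * measure \<nu> (cell k) + (c2 * ?S) * measure \<nu> Hi"
 proof (rule measure_le[OF D])
  fix x
  have "(\<Sum>j<N. Pt (v D j) x) \<le> (\<Sum>j<N. 1)" by (intro sum_mono Pt_le_1 v_le_1)
  thus "(\<Sum>j<N. Pt (v D j) x) \<le> ennreal (real N)"
   unfolding ennreal_of_nat_eq_real_of_nat[symmetric] by (simp only: sum_constant card_lessThan mult_1_right)
 qed (use sum_Pt_Hi[OF D] c2_nonneg in \<open>auto intro!: mult_nonneg_nonneg sum_nonneg\<close>)
 also have "N * measure \<nu> (cell k) \<le> 2 * c2 * measure \<nu> Hi"
  using mult_left_mono[OF cell_measure, of "real N"] by simp
 finally show ?thesis by (simp add: algebra_simps)
qed

lemma v_UNIV: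
 assumes "\<And>X. X 0 = x \<Longrightarrow> (\<And>i. i < j \<Longrightarrow> dist (X (Suc i)) (f (X i)) < \<eta> s) \<Longrightarrow> (\<And>i. i < j \<Longrightarrow> X i \<in> Lo)"
 shows "v UNIV j x = 1"
 using assms
proof (induction j arbitrary: x)
 case (Suc j)
 have \<eta>: "0 < \<eta> s" by (rule stageD(3))
 have "(\<lambda>i. (f ^^ i) x) 0 \<in> Lo" by (rule Suc.prems) (use \<eta> in auto)
 hence x: "x \<in> Lo" by simp
 have "Pt (v UNIV j) x = 1"
 proof (rule Pt_one, rule Suc.IH)
  fix y X i assume y: "dist y (f x) < \<zeta> x * \<epsilon>" and X: "X 0 = y" "\<And>i. i < j \<Longrightarrow> dist (X (Suc i)) (f (X i)) < \<eta> s" and i: "i < j"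
  have "case_nat x X (Suc i) \<in> Lo"
  proof (rule Suc.prems)
   show "dist (case_nat x X (Suc i')) (f (case_nat x X i')) < \<eta> s" if "i' < Suc j" for i'
    using X y Lo_small[OF x] that by (cases i') auto
  qed (use i in auto)
  thus "X i \<in> Lo" by simp
 qed
 thus ?case using x by (simp add: v_Suc)
qed (simp add: v_0)

text \<open>An argument in the manner of Kac: from \<open>Hi\<close> the orbit falls into
  \<open>Y\<close> with probability at least \<open>(1 / 2) ^ CARD('n) * vol Y\<close>, its
  excursion then lasts at least \<open>J\<close> steps, and the time spent in all excursions adds up
  to the total mass \<open>1\<close>.\<close>

lemma Hi_measure:
 assumes J: "J \<le> N"
 shows "measure \<nu> Hi * J * vol {x. \<forall>i<J. (f ^^ i) x \<notin> nbhd (A s) (\<rho> s)} \<le> 2 ^ CARD('n)"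
proof -
 define Y where "Y = {x. \<forall>i<J. (f ^^ i) x \<notin> nbhd (A s) (\<rho> s)}"
 have Yb [measurable]: "Y \<in> sets borel"
 proof -
  have "Y = {x \<in> space borel. \<forall>i<J. (f ^^ i) x \<notin> nbhd (A s) (\<rho> s)}" by (simp add: Y_def)
  also have "\<dots> \<in> sets borel" by measurable
  finally show ?thesis .
 qed
 have vY: "v UNIV j x = 1" if x: "x \<in> Y" and j: "j < J" for x j
 proof (rule v_UNIV)
  fix X i assume X: "X 0 = x" "\<And>i. i < j \<Longrightarrow> dist (X (Suc i)) (f (X i)) < \<eta> s" and i: "i < j"
  have "dist (X i) ((f ^^ i) (X 0)) < \<rho> s" by (rule stageD(6)) (use X(2) i j J in auto)
  moreover have "(f ^^ i) x \<notin> nbhd (A s) (\<rho> s)" using x i j by (auto simp: Y_def)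
  ultimately have "X i \<notin> A s" using X(1) by (auto simp: nbhd_def dist_commute)
  thus "X i \<in> Lo" by (rule not_A_Lo)
 qed
 let ?a = "(1 / 2) ^ CARD('n) * vol Y"
 have P: "ennreal ?a \<le> Pt (v UNIV j) x" if x: "x \<in> Hi" and j: "j < J" for x j
 proof -
  have "ennreal ?a = ennreal ((1 / 2) ^ CARD('n)) * (\<integral>\<^sup>+y. indicator Y y \<partial>leb)"
   by (simp add: leb.emeasure_eq_measure ennreal_mult)
  also have "\<dots> \<le> ennreal ((1 / 2) ^ CARD('n)) * (\<integral>\<^sup>+y. v UNIV j y \<partial>leb)"
   by (intro mult_left_mono nn_integral_mono) (use vY[OF _ j] in \<open>auto simp: indicator_def\<close>)
  also have "\<dots> \<le> Pt (v UNIV j) x"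
   unfolding Pt_def by (rule noise_law_lower[OF v_measurable \<zeta>(2) \<epsilon> Hi_large[OF x]]) simp
  finally show ?thesis .
 qed
 have "ennreal (J * ?a) * emeasure \<nu> Hi = (\<integral>\<^sup>+x\<in>Hi. ennreal (J * ?a) \<partial>\<nu>)"
  by (rule nn_integral_cmult_indicator[symmetric]) simp
 also have "\<dots> \<le> (\<integral>\<^sup>+x. indicator (- Lo) x * (\<Sum>j<N. Pt (v UNIV j) x) \<partial>\<nu>)"
 proof (rule nn_integral_mono)
  fix x
  show "ennreal (J * ?a) * indicator Hi x \<le> indicator (- Lo) x * (\<Sum>j<N. Pt (v UNIV j) x)"
  proof (cases "x \<in> Hi")
   case True
   have "ennreal (J * ?a) = (\<Sum>j<J. ennreal ?a)" by (simp add: ennreal_mult ennreal_of_nat_eq_real_of_nat)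
   also have "\<dots> \<le> (\<Sum>j<J. Pt (v UNIV j) x)" by (intro sum_mono P True) simp
   also have "\<dots> \<le> (\<Sum>j<N. Pt (v UNIV j) x)" using J by (intro sum_mono2) auto
   finally show ?thesis using True Hi_not_Lo[OF True] by (simp add: indicator_def)
  qed simp
 qed
 also have "\<dots> = emeasure \<nu> UNIV" by (rule decomposition[symmetric]) simp
 finally have "ennreal (J * ?a * measure \<nu> Hi) \<le> ennreal 1"
  using nu.emeasure_space_1 sets_eq_imp_space_eq[OF nu(1)] by (simp add: nu.emeasure_eq_measure ennreal_mult[symmetric])
 hence "J * ?a * measure \<nu> Hi \<le> 1" by simp
 thus ?thesis unfolding Y_def[symmetric] by (simp add: power_divide field_simps)
qed

lemma Hi_le:
 assumes d: "0 < d" "P < s" "d \<le> vol {x. \<forall>i<2 ^ (s - Suc P). (f ^^ i) x \<notin> nbhd (A s) (\<rho> s)}"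
 shows "measure \<nu> Hi \<le> 2 ^ CARD('n) * 2 ^ (P + 2) / d / 2 ^ Suc s"
proof -
 define J :: nat where "J = 2 ^ (s - Suc P)"
 have "measure \<nu> Hi * J * d \<le> measure \<nu> Hi * J * vol {x. \<forall>i<J. (f ^^ i) x \<notin> nbhd (A s) (\<rho> s)}"
  using d(3) by (intro mult_left_mono) (auto simp: J_def)
 also have "\<dots> \<le> 2 ^ CARD('n)" by (rule Hi_measure) (unfold J_def, rule power_increasing, auto)
 finally have "measure \<nu> Hi * J * d \<le> 2 ^ CARD('n)" .
 moreover have "(2::real) ^ Suc s = J * 2 ^ (P + 2)"
 proof -
  have "Suc s = (s - Suc P) + (P + 2)" using d(2) by simp
  hence "(2::real) ^ Suc s = 2 ^ (s - Suc P) * 2 ^ (P + 2)" by (metis power_add)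
  thus ?thesis by (simp add: J_def)
 qed
 ultimately show ?thesis using d(1) by (simp add: J_def field_simps)
qed

text \<open>Two facts that survive the limit: up to multiples of \<open>1 / 2 ^ Suc s\<close>,
  \<open>\<nu>\<close> is absolutely continuous and invariant. In the first, \<open>N\<close> terms
  of size \<open>q\<close> meet the mass of \<open>Hi\<close>, which is of order
  \<open>1 / N\<close>. In the second, the noise moves points of \<open>f Lo\<close> by less than
  \<open>\<eta> s\<close>, and the complement of \<open>Lo\<close> has small mass.\<close>

lemma estimates:
 assumes d: "0 < d" "P < s" "d \<le> vol {x. \<forall>i<2 ^ (s - Suc P). (f ^^ i) x \<notin> nbhd (A s) (\<rho> s)}"
 defines "C \<equiv> (2 * law_const CARD('n) (2 * CARD('n)) + 1) * (2 ^ CARD('n) * 2 ^ (P + 2) / d)"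
 shows "\<And>D q. D \<in> sets borel \<Longrightarrow> 0 \<le> q \<Longrightarrow> (\<And>j. vol ((f ^^ j) -` nbhd D (\<rho> s)) \<le> q) \<Longrightarrow>
   measure \<nu> D \<le> C / 2 ^ Suc s + C * q"
  and "\<And>\<phi> b e. continuous_on UNIV \<phi> \<Longrightarrow> (\<And>x. 0 \<le> \<phi> x) \<Longrightarrow> (\<And>x. \<phi> x \<le> b) \<Longrightarrow> 0 \<le> e \<Longrightarrow>
   (\<And>x y. dist x y < \<eta> s \<Longrightarrow> \<phi> x \<le> \<phi> y + e) \<Longrightarrow>
   (\<integral>x. \<phi> x \<partial>\<nu>) \<le> (\<integral>x. \<phi> (f x) \<partial>\<nu>) + e + b * (C / 2 ^ Suc s)"
proof -
 define c3 where "c3 = 2 ^ CARD('n) * 2 ^ (P + 2) / d"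
 have c3: "0 \<le> c3" using d(1) by (simp add: c3_def)
 have C: "C = (2 * c2 + 1) * c3" by (simp add: C_def c2_def c3_def)
 have H: "measure \<nu> Hi \<le> c3 / 2 ^ Suc s" using Hi_le[OF d] by (simp add: c3_def)
 have N2: "(2::real) ^ Suc s = real N" by simp
 show "measure \<nu> D \<le> C / 2 ^ Suc s + C * q"
  if D: "D \<in> sets borel" and q: "0 \<le> q" "\<And>j. vol ((f ^^ j) -` nbhd D (\<rho> s)) \<le> q" for D q
 proof -
  have "(\<Sum>j<N. vol ((f ^^ j) -` nbhd D (\<rho> s))) \<le> (\<Sum>j<N. q)" by (intro sum_mono q(2))
  also have "\<dots> = real N * q" by simp
  finally have "measure \<nu> D \<le> c2 * (2 + real N * q) * measure \<nu> Hi"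
   using excursion_measure[OF D] c2_nonneg
   by (meson add_left_mono measure_nonneg mult_left_mono mult_right_mono order_trans)
  also have "\<dots> \<le> c2 * (2 + real N * q) * (c3 / real N)"
   using H q(1) c2_nonneg unfolding N2 by (intro mult_left_mono mult_nonneg_nonneg) auto
  also have "\<dots> = 2 * c2 * c3 / real N + c2 * c3 * q" by (simp add: field_simps)
  also have "\<dots> \<le> C / real N + C * q"
  proof (intro add_mono divide_right_mono mult_right_mono q(1))
   have "0 \<le> c2 * c3" using c2_nonneg c3 by simp
   thus "2 * c2 * c3 \<le> C" "c2 * c3 \<le> C" using c3 unfolding C by (auto simp: algebra_simps)
  qed simp
  finally show ?thesis unfolding N2 .
 qed
 fix \<phi> :: "'n torus \<Rightarrow> real" and b e
 assume \<phi>: "continuous_on UNIV \<phi>" "\<And>x. 0 \<le> \<phi> x" "\<And>x. \<phi> x \<le> b" and e: "0 \<le> e"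
  and osc: "\<And>x y. dist x y < \<eta> s \<Longrightarrow> \<phi> x \<le> \<phi> y + e"
 have \<phi>m [measurable]: "\<phi> \<in> borel_measurable borel" by (rule borel_measurable_continuous_onI[OF \<phi>(1)])
 have b: "0 \<le> b" using \<phi>(2,3) order_trans by blast
 let ?\<phi> = "\<lambda>x. ennreal (\<phi> x)"
 have "measure \<nu> (- Lo) \<le> C / 2 ^ Suc s"
 proof -
  have "measure \<nu> (- Lo) \<le> measure \<nu> (cell k \<union> Hi)"
   by (rule nu.finite_measure_mono_AE) (use outside in \<open>auto elim!: eventually_mono\<close>)
  also have "\<dots> \<le> measure \<nu> (cell k) + measure \<nu> Hi" by (rule measure_Un_le) auto
  also have "measure \<nu> (cell k) \<le> 2 * c2 * measure \<nu> Hi"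
  proof -
   have "1 \<le> real N" using one_le_power[of "2::real" "Suc s"] by simp
   hence "2 * c2 / real N \<le> 2 * c2 / 1" using c2_nonneg by (intro divide_left_mono) auto
   hence "2 * c2 / real N * measure \<nu> Hi \<le> 2 * c2 / 1 * measure \<nu> Hi" by (rule mult_right_mono) simp
   thus ?thesis using cell_measure by simp
  qed
  also have "2 * c2 * measure \<nu> Hi + measure \<nu> Hi = (2 * c2 + 1) * measure \<nu> Hi" by (simp add: algebra_simps)
  also have "\<dots> \<le> (2 * c2 + 1) * (c3 / 2 ^ Suc s)" using H c2_nonneg by (intro mult_left_mono) auto
  finally show ?thesis by (simp add: C)
 qed
 hence L: "b * measure \<nu> (- Lo) \<le> b * (C / 2 ^ Suc s)" using b by (rule mult_left_mono)
 have Pb: "Pt ?\<phi> x \<le> ennreal (\<phi> (f x) + e) + ennreal b * indicator (- Lo) x" for x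
 proof (cases "x \<in> Lo")
  case True
  have "Pt ?\<phi> x \<le> (\<integral>\<^sup>+t. ennreal (\<phi> (f x) + e) \<partial>(noise \<epsilon> :: (real^'n) measure))"
   unfolding Pt_def
  proof (rule nn_integral_mono_AE, use Pt_AE[of x] in eventually_elim)
   fix t :: "real^'n" assume "dist (f x + torus_of (\<zeta> x *\<^sub>R t)) (f x) < \<zeta> x * \<epsilon>"
   thus "ennreal (\<phi> (f x + torus_of (\<zeta> x *\<^sub>R t))) \<le> ennreal (\<phi> (f x) + e)"
    using Lo_small[OF True] by (intro ennreal_leI osc) simp
  qed
  thus ?thesis using True noise.emeasure_space_1 by simp
 next
  case False
  have "Pt ?\<phi> x \<le> (\<integral>\<^sup>+t. ennreal b \<partial>(noise \<epsilon> :: (real^'n) measure))"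
   unfolding Pt_def by (intro nn_integral_mono ennreal_leI \<phi>(3))
  thus ?thesis using False noise.emeasure_space_1 by (simp add: add_increasing)
 qed
 have i: "integrable \<nu> \<phi>" "integrable \<nu> (\<lambda>x. \<phi> (f x))"
  by (rule nu.integrable_const_bound[of _ b]; use \<phi>(2,3) in auto)+
 have "ennreal (\<integral>x. \<phi> x \<partial>\<nu>) = (\<integral>\<^sup>+x. ?\<phi> x \<partial>\<nu>)" by (rule nn_integral_eq_integral[symmetric, OF i(1)]) (use \<phi>(2) in auto)
 also have "\<dots> = (\<integral>\<^sup>+x. Pt ?\<phi> x \<partial>\<nu>)" by (rule Pt_stationary) measurable
 also have "\<dots> \<le> (\<integral>\<^sup>+x. ennreal (\<phi> (f x) + e) + ennreal b * indicator (- Lo) x \<partial>\<nu>)" by (intro nn_integral_mono Pb)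
 also have "\<dots> = (\<integral>\<^sup>+x. ennreal (\<phi> (f x) + e) \<partial>\<nu>) + ennreal b * emeasure \<nu> (- Lo)"
  by (subst nn_integral_add) (auto simp: nn_integral_cmult_indicator)
 also have "(\<integral>\<^sup>+x. ennreal (\<phi> (f x) + e) \<partial>\<nu>) = ennreal (\<integral>x. \<phi> (f x) + e \<partial>\<nu>)"
  by (rule nn_integral_eq_integral) (use i \<phi>(2) e in auto)
 also have "(\<integral>x. \<phi> (f x) + e \<partial>\<nu>) = (\<integral>x. \<phi> (f x) \<partial>\<nu>) + e" using i(2) nu.prob_space by simp
 also have "ennreal ((\<integral>x. \<phi> (f x) \<partial>\<nu>) + e) + ennreal b * emeasure \<nu> (- Lo) = ennreal ((\<integral>x. \<phi> (f x) \<partial>\<nu>) + e + b * measure \<nu> (- Lo))"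
  using b e \<phi>(2) by (simp add: nu.emeasure_eq_measure ennreal_mult[symmetric] ennreal_plus[symmetric] integral_nonneg_AE del: ennreal_plus)
 finally have "(\<integral>x. \<phi> x \<partial>\<nu>) \<le> (\<integral>x. \<phi> (f x) \<partial>\<nu>) + e + b * measure \<nu> (- Lo)"
  using b e \<phi>(2) by (subst (asm) ennreal_le_iff) (auto intro!: add_nonneg_nonneg integral_nonneg_AE)
 thus "(\<integral>x. \<phi> x \<partial>\<nu>) \<le> (\<integral>x. \<phi> (f x) \<partial>\<nu>) + e + b * (C / 2 ^ Suc s)" using L by linarith
qed

end

end

section \<open>Limits as the noise vanishes\<close>

context perturbation begin

text \<open>\<open>k\<close> is the least index for which \<open>z (Suc k) * \<epsilon>\<close>
  reaches the wrapping threshold. By minimality the noise on cell \<open>k\<close> is still below it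
  if \<open>k > 0\<close>, and the growth of \<open>z\<close> makes the noise on all earlier cells
  negligible. For \<open>\<epsilon>\<close> tending to \<open>0\<close> this \<open>k\<close> tends
  to infinity.\<close>

lemma small_noise:
 "\<forall>\<^sub>F \<epsilon> in at_right 0. \<epsilon> > 0 \<and> (\<exists>k. s0 \<le> st k \<and> 2 * CARD('n) \<le> z (Suc k) * \<epsilon> \<and> (\<forall>i<k. z i * \<epsilon> \<le> \<eta> (st k)))"
proof -
 obtain k0 where k0: "s0 \<le> st k0" using st(2) by blast
 have zp: "0 < z k" for k using z_ge[of k] zero_less_power[of "2::real" k] by linarith
 have "\<forall>\<^sub>F \<epsilon> in at_right 0. \<epsilon> \<in> {0<..<2 * CARD('n) / z k0}"
  using zp[of k0] by (intro eventually_at_right_real) simp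
 thus ?thesis
 proof eventually_elim
  case (elim \<epsilon>)
  hence e: "\<epsilon> > 0" "z k0 * \<epsilon> < 2 * CARD('n)" using zp[of k0] by (auto simp: field_simps)
  define P where "P k \<longleftrightarrow> 2 * CARD('n) \<le> z (Suc k) * \<epsilon>" for k
  obtain q where "2 * CARD('n) / \<epsilon> < 2 ^ q" using real_arch_pow[of 2 "2 * CARD('n) / \<epsilon>"] by auto
  hence "2 * CARD('n) \<le> z (Suc q) * \<epsilon>"
   using e(1) z_ge[of q] z_mono[of q "Suc q"] by (simp add: pos_divide_less_eq) (meson le_SucI less_imp_le mult_right_mono order_refl order_trans)
  hence "P q" by (simp add: P_def)
  define k where "k = (LEAST k. P k)"
  have k: "P k" unfolding k_def by (rule LeastI) fact
  have kmin: "\<not> P i" if "i < k" for i using that unfolding k_def by (rule not_less_Least)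
  have "k0 \<le> k"
  proof (rule ccontr)
   assume "\<not> k0 \<le> k"
   hence "z (Suc k) * \<epsilon> \<le> z k0 * \<epsilon>" using e(1) by (intro mult_right_mono z_mono) auto
   thus False using k e(2) by (simp add: P_def)
  qed
  hence "s0 \<le> st k" using k0 st(1)[of k0 k] by simp
  moreover have "z i * \<epsilon> \<le> \<eta> (st k)" if i: "i < k" for i
  proof -
   obtain j where j: "k = Suc j" "i \<le> j" using i by (cases k) auto
   have \<eta>: "0 < \<eta> (st k)" by (rule stageD(3))
   have ij: "z i * \<epsilon> \<le> z j * \<epsilon>" using e(1) j(2) by (intro mult_right_mono z_mono) auto
   have "z j * \<epsilon> * (2 * CARD('n)) \<le> \<eta> (st k) * (z k * \<epsilon>)"
    using mult_right_mono[OF z(3)[of j], of \<epsilon>] e(1) unfolding j(1) by (simp add: mult_ac)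
   also have "\<dots> \<le> \<eta> (st k) * (2 * CARD('n))"
    using kmin[of j] \<eta> unfolding P_def j(1) by (intro mult_left_mono) auto
   finally have "z j * \<epsilon> * (2 * CARD('n)) \<le> \<eta> (st k) * (2 * CARD('n))" .
   hence "z j * \<epsilon> \<le> \<eta> (st k)" by (rule mult_right_le_imp_le) simp
   with ij show ?thesis by (rule order_trans)
  qed
  ultimately show ?case using e(1) k by (auto simp: P_def)
 qed
qed

theorem stable:
 assumes conv: "\<And>\<mu>0. acip f \<mu>0 \<Longrightarrow> convex_combination_of (physical_measures f) \<mu>0"
 shows "stochastically_stable f (adapted_perturbation f \<zeta>)"
 unfolding stochastically_stable_def
proof (intro allI impI)
 fix \<nu> :: "real \<Rightarrow> 'n torus measure" and \<mu>0
 assume st_ev: "\<forall>\<^sub>F \<epsilon> in at_right 0. stationary_measure (adapted_perturbation f \<zeta>) (noise \<epsilon>) (\<nu> \<epsilon>)"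
  and acc: "weak_star_accumulation \<nu> \<mu>0"
 define near where "near e \<Phi> \<epsilon> \<longleftrightarrow> (\<forall>\<phi>\<in>\<Phi>. \<bar>(\<integral>x. \<phi> x \<partial>\<nu> \<epsilon>) - (\<integral>x. \<phi> x \<partial>\<mu>0)\<bar> < e)" for e \<epsilon> and \<Phi> :: "('n torus \<Rightarrow> real) set"
 have \<mu>0: "sets \<mu>0 = sets borel" "prob_space \<mu>0"
  and acc': "\<And>(\<Phi>::('n torus \<Rightarrow> real) set) e. 0 < e \<Longrightarrow> finite \<Phi> \<Longrightarrow> (\<And>\<phi>. \<phi> \<in> \<Phi> \<Longrightarrow> continuous_on UNIV \<phi>) \<Longrightarrow>
   \<exists>\<^sub>F \<epsilon> in at_right 0. near e \<Phi> \<epsilon>"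
  using acc unfolding weak_star_accumulation_def near_def by blast+
 interpret \<mu>0: prob_space \<mu>0 by fact
 note [simp, measurable_cong] = \<mu>0(1)
 obtain d P where dP: "d > 0" "\<And>s. P < s \<Longrightarrow> d \<le> vol {x. \<forall>i<2 ^ (s - Suc P). (f ^^ i) x \<notin> nbhd (A s) (\<rho> s)}"
  using good_points by blast
 define C where "C = (2 * law_const CARD('n) (2 * CARD('n)) + 1) * (2 ^ CARD('n) * 2 ^ (P + 2) / d)"
 have C: "C > 0" unfolding C_def using dP(1) by (intro mult_pos_pos divide_pos_pos) (auto intro!: add_nonneg_pos)
 \<comment> \<open>The outcome of \<open>estimates\<close> with \<open>\<epsilon>\<close> and
   \<open>k\<close> removed: what is left is the stage \<open>s\<close>, which is arbitrarily large
   for small noise.\<close>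
 define good where "good s \<nu> \<longleftrightarrow> prob_space \<nu> \<and> sets \<nu> = sets borel \<and>
  (\<forall>D q. D \<in> sets borel \<longrightarrow> 0 \<le> q \<longrightarrow> (\<forall>j. vol ((f ^^ j) -` nbhd D (\<rho> s)) \<le> q) \<longrightarrow> measure \<nu> D \<le> C / 2 ^ Suc s + C * q) \<and>
  (\<forall>\<phi> b e. continuous_on UNIV \<phi> \<longrightarrow> (\<forall>x. 0 \<le> \<phi> x) \<longrightarrow> (\<forall>x. \<phi> x \<le> b) \<longrightarrow> 0 \<le> e \<longrightarrow>
   (\<forall>x y. dist x y < \<eta> s \<longrightarrow> \<phi> x \<le> \<phi> y + e) \<longrightarrow> (\<integral>x. \<phi> x \<partial>\<nu>) \<le> (\<integral>x. \<phi> (f x) \<partial>\<nu>) + e + b * (C / 2 ^ Suc s))"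
  for s and \<nu> :: "'n torus measure"
 have ev: "\<forall>\<^sub>F \<epsilon> in at_right 0. \<exists>s\<ge>s0. good s (\<nu> \<epsilon>)" for s0
  using small_noise[of "max s0 (Suc P)"] st_ev
 proof eventually_elim
  case (elim \<epsilon>)
  then obtain k where e: "\<epsilon> > 0" and k: "max s0 (Suc P) \<le> st k" "2 * CARD('n) \<le> z (Suc k) * \<epsilon>" "\<And>i. i < k \<Longrightarrow> z i * \<epsilon> \<le> \<eta> (st k)"
   by blast
  have "P < st k" using k(1) by simp
  note est = estimates[OF e elim(2) k(2,3) dP(1) this dP(2)[OF this], folded C_def]
  have "good (st k) (\<nu> \<epsilon>)" unfolding good_def using est elim(2) unfolding stationary_measure_def by blast
  thus ?case using k(1) by (intro exI[of _ "st k"]) auto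
 qed
 have tail: "\<exists>s0. \<forall>s\<ge>s0. t / 2 ^ Suc s < e \<and> 1 / 2 ^ s < e" if e: "e > 0" for t e :: real
 proof -
  have "(\<lambda>s. t / 2 ^ Suc s) \<longlonglongrightarrow> 0" "(\<lambda>s. 1 / 2 ^ s :: real) \<longlonglongrightarrow> 0" by real_asymp+
  hence "\<forall>\<^sub>F s in sequentially. t / 2 ^ Suc s < e \<and> 1 / 2 ^ s < e"
   using e by (intro eventually_conj order_tendstoD(2)) auto
  thus ?thesis unfolding eventually_sequentially .
 qed
 have ex: "\<exists>\<epsilon> s. s0 \<le> s \<and> good s (\<nu> \<epsilon>) \<and> near e \<Phi> \<epsilon>"
  if "0 < e" "finite \<Phi>" "\<And>\<phi>. \<phi> \<in> \<Phi> \<Longrightarrow> continuous_on UNIV \<phi>" for s0 e and \<Phi> :: "('n torus \<Rightarrow> real) set"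
 proof -
  have "\<exists>\<^sub>F \<epsilon> in at_right 0. near e \<Phi> \<epsilon>"
   by (rule acc'[OF that(1,2)]) (rule that(3))
  from frequently_eventually_frequently[OF this ev[of s0]]
  have "\<exists>\<^sub>F \<epsilon> in at_right 0. near e \<Phi> \<epsilon> \<and> (\<exists>s\<ge>s0. good s (\<nu> \<epsilon>))" .
  then obtain \<epsilon> where "near e \<Phi> \<epsilon> \<and> (\<exists>s\<ge>s0. good s (\<nu> \<epsilon>))"
   using frequently_ex by blast
  thus ?thesis by blast
 qed
 have le: "(\<integral>x. \<phi> x \<partial>\<mu>0) \<le> (\<integral>x. \<phi> (f x) \<partial>\<mu>0)"
  if \<phi>: "continuous_on UNIV \<phi>" "\<And>x. 0 \<le> \<phi> x" "\<And>x. \<phi> x \<le> b" for \<phi> :: "'n torus \<Rightarrow> real" and b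
 proof (rule field_le_epsilon)
  fix e :: real assume e: "e > 0"
  have "uniformly_continuous_on UNIV \<phi>" by (rule compact_uniformly_continuous[OF \<phi>(1) compact_torus])
  then obtain t where t: "t > 0" "\<And>x y. dist y x < t \<Longrightarrow> dist (\<phi> y) (\<phi> x) < e / 4"
   unfolding uniformly_continuous_on_def using e by (metis UNIV_I zero_less_divide_iff zero_less_numeral)
  obtain s1 where s1: "\<And>s. s \<ge> s1 \<Longrightarrow> b * C / 2 ^ Suc s < min t (e / 4) \<and> 1 / 2 ^ s < min t (e / 4)"
   using tail[of "min t (e / 4)" "b * C"] t(1) e by auto
  have cf: "continuous_on UNIV (\<lambda>x. \<phi> (f x))" by (rule continuous_on_compose2[OF \<phi>(1) cont]) auto
  obtain \<epsilon> s where s: "s1 \<le> s" "good s (\<nu> \<epsilon>)" and close: "near (e / 4) {\<phi>, \<lambda>x. \<phi> (f x)} \<epsilon>"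
   using ex[of "e / 4" "{\<phi>, \<lambda>x. \<phi> (f x)}" s1] e \<phi>(1) cf by auto
  have "(\<integral>x. \<phi> x \<partial>\<nu> \<epsilon>) \<le> (\<integral>x. \<phi> (f x) \<partial>\<nu> \<epsilon>) + e / 4 + b * (C / 2 ^ Suc s)"
  proof -
   have "\<phi> x \<le> \<phi> y + e / 4" if "dist x y < \<eta> s" for x y
   proof -
    have "dist x y < t" using that stageD(4)[of s] s1[OF s(1)] by simp
    hence "dist (\<phi> x) (\<phi> y) < e / 4" by (rule t(2))
    thus ?thesis unfolding dist_real_def by linarith
   qed
   thus ?thesis using s(2) \<phi> e unfolding good_def by (auto simp del: power_Suc)
  qed
  moreover have "b * (C / 2 ^ Suc s) < e / 4" using s1[OF s(1)] by simp
  moreover have "\<bar>(\<integral>x. \<phi> x \<partial>\<nu> \<epsilon>) - (\<integral>x. \<phi> x \<partial>\<mu>0)\<bar> < e / 4" "\<bar>(\<integral>x. \<phi> (f x) \<partial>\<nu> \<epsilon>) - (\<integral>x. \<phi> (f x) \<partial>\<mu>0)\<bar> < e / 4"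
   using close by (auto simp: near_def)
  ultimately show "(\<integral>x. \<phi> x \<partial>\<mu>0) \<le> (\<integral>x. \<phi> (f x) \<partial>\<mu>0) + e" by linarith
 qed
 have bounded: "\<exists>b. \<forall>x. \<bar>\<phi> x\<bar> \<le> b" if "continuous_on UNIV \<phi>" for \<phi> :: "'n torus \<Rightarrow> real"
  using compact_imp_bounded[OF compact_continuous_image[OF that compact_torus]] unfolding bounded_iff by auto
 have int: "integrable \<mu>0 \<phi>" if c: "continuous_on UNIV \<phi>" for \<phi> :: "'n torus \<Rightarrow> real"
 proof -
  obtain b where "\<And>x. \<bar>\<phi> x\<bar> \<le> b" using bounded[OF c] by blast
  moreover have "\<phi> \<in> borel_measurable \<mu>0"
   unfolding measurable_cong_sets[OF \<mu>0(1) refl] by (rule borel_measurable_continuous_onI[OF c])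
  ultimately show ?thesis by (intro \<mu>0.integrable_const_bound[of _ b]) auto
 qed
 \<comment> \<open>The inequality \<open>le\<close> is for nonnegative functions; applied to
   \<open>\<phi> + b\<close> and to \<open>b - \<phi>\<close> it gives both directions.\<close>
 have eq: "(\<integral>x. \<phi> x \<partial>\<mu>0) = (\<integral>x. \<phi> (f x) \<partial>\<mu>0)" if c: "continuous_on UNIV \<phi>" for \<phi> :: "'n torus \<Rightarrow> real"
 proof -
  obtain b where b: "\<And>x. \<bar>\<phi> x\<bar> \<le> b" using bounded[OF c] by blast
  have cf: "continuous_on UNIV (\<lambda>x. \<phi> (f x))" by (rule continuous_on_compose2[OF c cont]) auto
  have bb: "0 \<le> \<phi> x + b" "\<phi> x + b \<le> 2 * b" "0 \<le> b - \<phi> x" "b - \<phi> x \<le> 2 * b" for x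
   using b[of x] unfolding abs_le_iff by linarith+
  have "(\<integral>x. \<phi> x + b \<partial>\<mu>0) \<le> (\<integral>x. \<phi> (f x) + b \<partial>\<mu>0)"
   by (rule le[of _ "2 * b"]) (intro continuous_intros c bb)+
  moreover have "(\<integral>x. b - \<phi> x \<partial>\<mu>0) \<le> (\<integral>x. b - \<phi> (f x) \<partial>\<mu>0)"
   by (rule le[of _ "2 * b"]) (intro continuous_intros c bb)+
  ultimately show ?thesis using int[OF c] int[OF cf] \<mu>0.prob_space by simp
 qed
 show "convex_combination_of (physical_measures f) \<mu>0"
 proof (rule conv, unfold acip_def, intro conjI ballI impI)
  show "sets \<mu>0 = sets borel" "prob_space \<mu>0" by (rule \<mu>0)+
  have fm: "f \<in> measurable \<mu>0 borel" unfolding measurable_cong_sets[OF \<mu>0(1) refl] by (rule f_measurable)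
  have "distr \<mu>0 borel f = \<mu>0"
  proof (rule borel_measure_eqI_continuous)
   show "finite_measure (distr \<mu>0 borel f)" by (rule \<mu>0.finite_measure_distr[OF fm])
   fix \<phi> :: "'n torus \<Rightarrow> real" assume c: "continuous_on UNIV \<phi>"
   have "(\<integral>x. \<phi> x \<partial>distr \<mu>0 borel f) = (\<integral>x. \<phi> (f x) \<partial>\<mu>0)"
    by (rule integral_distr[OF fm borel_measurable_continuous_onI[OF c]])
   thus "(\<integral>x. \<phi> x \<partial>distr \<mu>0 borel f) = (\<integral>x. \<phi> x \<partial>\<mu>0)" using eq[OF c] by simp
  qed (use \<mu>0.finite_measure_axioms in auto)
  thus "measure \<mu>0 (f -` S) = measure \<mu>0 S" if S: "S \<in> sets borel" for S
   using measure_distr[OF fm S] sets_eq_imp_space_eq[OF \<mu>0(1)] by simp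
  fix S :: "'n torus set" assume S: "S \<in> sets borel" "vol S = 0"
  show "measure \<mu>0 S = 0"
  proof (rule ccontr)
   assume "measure \<mu>0 S \<noteq> 0"
   hence pos: "measure \<mu>0 S > 0" by (simp add: less_le)
   hence "measure \<mu>0 S / 2 > 0" by simp
   then obtain K where K: "compact K" "K \<subseteq> S" "measure \<mu>0 S < measure \<mu>0 K + measure \<mu>0 S / 2"
    by (rule inner_approximation[OF \<mu>0.finite_measure_axioms \<mu>0(1) S(1)])
   define e where "e = measure \<mu>0 K"
   have e: "e > 0" using K(3) pos by (simp add: e_def)
   have Kne: "K \<noteq> {}" using e by (auto simp: e_def)
   have Kb: "K \<in> sets borel" using K(1) by (simp add: compact_imp_closed)
   have K0: "vol K = 0" using leb.finite_measure_mono[OF K(2)] S by (simp add: measure_le_0_iff)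
   \<comment> \<open>The function \<open>g\<close> below lies between the indicators of
     \<open>K\<close> and of a neighbourhood \<open>D\<close>: weak convergence applies to
     \<open>g\<close>, the first estimate to \<open>D\<close>. The errors
     \<open>C / 2 ^ Suc s\<close> and \<open>C * q\<close> are each held to at most a quarter of
     \<open>e\<close>.\<close>
   define q where "q = e / (4 * C)"
   have q: "q > 0" using e C by (simp add: q_def)
   obtain \<delta> where \<delta>: "\<delta> > 0" "\<And>D j. D \<in> sets borel \<Longrightarrow> vol D < \<delta> \<Longrightarrow> vol ((f ^^ j) -` D) < q"
    using UA[OF q] by blast
   obtain U where U: "open U" "K \<subseteq> U" "vol U < vol K + \<delta>"
    by (rule outer_approximation[OF leb.finite_measure_axioms sets_torus_lebesgue Kb \<delta>(1)])
   obtain t where t: "t > 0" "\<And>x y. x \<in> K \<Longrightarrow> dist x y < t \<Longrightarrow> y \<in> U"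
    using compact_in_open[OF K(1) U(1,2)] by blast
   define g where "g x = max 0 (1 - infdist x K / (t / 2))" for x
   have g: "continuous_on UNIV g" "\<And>x. 0 \<le> g x" "\<And>x. g x \<le> 1"
    using t(1) by (auto simp: g_def[abs_def] infdist_nonneg intro!: continuous_intros)
   define D where "D = {x. infdist x K < t / 2}"
   have Do: "open D" unfolding D_def by (intro open_Collect_less continuous_intros)
   have gD: "g x \<le> indicator D x" for x using t(1) by (auto simp: g_def D_def indicator_def infdist_nonneg field_simps)
   obtain s1 where s1: "\<And>s. s \<ge> s1 \<Longrightarrow> C / 2 ^ Suc s < min (t / 2) (e / 4) \<and> 1 / 2 ^ s < min (t / 2) (e / 4)"
    using tail[of "min (t / 2) (e / 4)" C] t(1) e by auto
   obtain \<epsilon> s where s: "s1 \<le> s" "good s (\<nu> \<epsilon>)" and close: "near (e / 4) {g} \<epsilon>"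
    using ex[of "e / 4" "{g}" s1] e g(1) by auto
   have nu: "prob_space (\<nu> \<epsilon>)" "sets (\<nu> \<epsilon>) = sets borel" using s(2) by (auto simp: good_def)
   interpret nu: prob_space "\<nu> \<epsilon>" by (rule nu(1))
   have nD: "nbhd D (\<rho> s) \<subseteq> U"
   proof
    fix x assume "x \<in> nbhd D (\<rho> s)"
    then obtain y where y: "infdist y K < t / 2" "dist x y < \<rho> s" by (auto simp: nbhd_def D_def)
    obtain w where w: "w \<in> K" "infdist y K = dist y w"
     using infdist_attains_inf[OF compact_imp_closed[OF K(1)] Kne] by metis
    have "dist w x < t" using y w(2) stageD(2)[of s] s1[OF s(1)] dist_triangle[of w x y] by (simp add: dist_commute)
    thus "x \<in> U" by (rule t(2)[OF w(1)])
   qed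
   have "vol ((f ^^ j) -` nbhd D (\<rho> s)) \<le> q" for j
   proof -
    have "vol (nbhd D (\<rho> s)) \<le> vol U" using nD U(1) by (intro leb.finite_measure_mono) auto
    thus ?thesis using U(3) K0 by (intro less_imp_le \<delta>(2)) auto
   qed
   hence "measure (\<nu> \<epsilon>) D \<le> C / 2 ^ Suc s + C * q" using s(2) q Do unfolding good_def by (auto simp del: power_Suc)
   also have "\<dots> < e / 4 + e / 4" using s1[OF s(1)] C by (simp add: q_def)
   finally have nuD: "measure (\<nu> \<epsilon>) D < e / 2" by simp
   have "e \<le> (\<integral>x. g x \<partial>\<mu>0)"
   proof -
    have "e = (\<integral>x. indicator K x \<partial>\<mu>0)" using Kb by (simp add: e_def)
    also have "\<dots> \<le> (\<integral>x. g x \<partial>\<mu>0)"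
    proof (rule integral_mono[OF _ int[OF g(1)]])
     show "integrable \<mu>0 (\<lambda>x. indicator K x :: real)" using Kb by (simp add: less_top[symmetric])
     show "indicator K x \<le> g x" for x using g(2)[of x] by (simp add: indicator_def g_def)
    qed
    finally show ?thesis .
   qed
   also have "\<dots> < (\<integral>x. g x \<partial>\<nu> \<epsilon>) + e / 4" using bspec[OF close[unfolded near_def] insertI1] by linarith
   also have "(\<integral>x. g x \<partial>\<nu> \<epsilon>) \<le> (\<integral>x. indicator D x \<partial>\<nu> \<epsilon>)"
   proof (rule integral_mono[OF _ _ gD])
    have "g \<in> borel_measurable (\<nu> \<epsilon>)"
     unfolding measurable_cong_sets[OF nu(2) refl] by (rule borel_measurable_continuous_onI[OF g(1)])
    thus "integrable (\<nu> \<epsilon>) g" by (rule nu.integrable_const_bound[of _ 1, rotated]) (use g(2,3) in auto)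
    show "integrable (\<nu> \<epsilon>) (\<lambda>x. indicator D x :: real)" using Do nu(2) by (auto simp: less_top[symmetric])
   qed
   also have "(\<integral>x. indicator D x \<partial>\<nu> \<epsilon>) = measure (\<nu> \<epsilon>) D" using Do nu(2) by simp
   finally show False using nuD e by simp
  qed
 qed
qed

end

section \<open>Construction of the amplitude of the noise\<close>

context regular_dynamics begin

lemma perturbation_exists:
 obtains A \<rho> \<eta> r st cell p z \<zeta> where "perturbation f Q \<mu> A \<rho> \<eta> r st cell p z \<zeta>"
  "AE x in leb. \<exists>U. open U \<and> x \<in> U \<and> (\<forall>y\<in>U. \<zeta> y = \<zeta> x)"
proof -
 obtain A where A: "A 0 = UNIV" "\<And>s. A (Suc s) \<subseteq> A s" "\<And>s. open (A s)" "\<And>s. vol (frontier (A s)) = 0"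
  "\<And>s. sweeping (2 ^ s) (A s)" "\<And>s. m (A s) \<le> (m UNIV + 1) / 2 ^ s"
 proof (rule sweeping_sequence, goal_cases)
  case (1 A) show ?case by (rule 1(1)[OF 1(2-7)])
 qed
 have anti: "s \<le> t \<Longrightarrow> A t \<subseteq> A s" for s t using A(2) by (rule lift_Suc_antimono_le)
 have "\<exists>\<rho> \<eta> r. stage (A s) (A (Suc s)) (2 ^ Suc s) (1 / 2 ^ s) \<rho> \<eta> r" for s
  by (rule stage_exists[OF A(3,4,2,3,5), of "1 / 2 ^ s" s]) (simp, blast)
 then obtain \<rho> \<eta> r where stage: "\<And>s. stage (A s) (A (Suc s)) (2 ^ Suc s) (1 / 2 ^ s) (\<rho> s) (\<eta> s) (r s)" by metis
 hence pos: "\<And>s. 0 < \<rho> s" "\<And>s. 0 < \<eta> s" unfolding stage_def by blast+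
 define S where "S s = A s - A (Suc s)" for s
 have S: "S s \<in> sets borel" "nullf (S s)" for s
  using A(3,4) by (auto simp: S_def nullf_def intro!: nullf_Diff[unfolded nullf_def])
 have "\<exists>c::nat. \<exists>cl pt. c \<ge> 1 \<and> (\<forall>l. cl l \<in> sets borel) \<and> (\<forall>l. nullf (cl l)) \<and> (\<Union>l<c. cl l) = S s \<and>
  (\<forall>l l'. l < l' \<longrightarrow> cl l \<inter> cl l' = {}) \<and> (\<forall>l. cl l \<subseteq> ball (pt l) (\<rho> s))" for s
  by (rule cells_exist[OF S pos(1)]) blast
 then obtain c cl pt where cc: "\<And>s. (c s :: nat) \<ge> 1 \<and> (\<forall>l. cl s l \<in> sets borel) \<and> (\<forall>l. nullf (cl s l)) \<and> (\<Union>l<c s. cl s l) = S s \<and>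
  (\<forall>l l'. l < l' \<longrightarrow> cl s l \<inter> cl s l' = {}) \<and> (\<forall>l. cl s l \<subseteq> ball (pt s l) (\<rho> s))"
  by metis
 have c1: "c s \<ge> 1" for s using cc[of s] by simp
 have clb: "cl s l \<in> sets borel" "nullf (cl s l)" "cl s l \<subseteq> ball (pt s l) (\<rho> s)" for s l using cc[of s] by auto
 have clU: "(\<Union>l<c s. cl s l) = S s" for s using cc[of s] by simp
 have cld: "l < l' \<Longrightarrow> cl s l \<inter> cl s l' = {}" for s l l' using cc[of s] by simp
 obtain st ix :: "nat \<Rightarrow> nat" where ix: "\<And>k. ix k < c (st k)" "\<And>i k. i < k \<Longrightarrow> st i < st k \<or> st i = st k \<and> ix i < ix k"
  "\<And>s l. l < c s \<Longrightarrow> \<exists>k. st k = s \<and> ix k = l"   proof (rule lexicographic_enumeration[of c, OF c1], goal_cases)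
  case (1 st ix) show ?case by (rule 1(1)[OF 1(2-4)])
 qed
 define cell where "cell k = cl (st k) (ix k)" for k
 define p where "p k = pt (st k) (ix k)" for k
 have cellS: "cell k \<subseteq> S (st k)" for k unfolding cell_def clU[symmetric] using ix(1)[of k] by (intro UN_upper) simp
 have cellb: "cell k \<in> sets borel" for k using clb(1) by (simp add: cell_def)
 have disj: "cell i \<inter> cell k = {}" if ik: "i < k" for i k using ix(2)[OF ik]
 proof
  assume "st i < st k"
  hence "A (st k) \<subseteq> A (Suc (st i))" by (intro anti) simp
  thus ?thesis using cellS[of i] cellS[of k] unfolding S_def by blast
 next
  assume "st i = st k \<and> ix i < ix k"
  thus ?thesis using cld[of "ix i" "ix k" "st k"] by (simp add: cell_def)
 qed
 have unique: "i = k" if "x \<in> cell i" "x \<in> cell k" for x i k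
  using disj[of i k] disj[of k i] that by (cases i k rule: linorder_cases) auto
 have cover: "\<exists>i. st i < s \<and> x \<in> cell i" if x: "x \<notin> A s" for x s
 proof -
  define t where "t = (LEAST t. x \<notin> A t)"
  have t: "x \<notin> A t" "t \<le> s"
   unfolding t_def using LeastI[of "\<lambda>t. x \<notin> A t", OF x] Least_le[of "\<lambda>t. x \<notin> A t", OF x] by auto
  have "t \<noteq> 0" using t(1) A(1) by (cases t) auto
  then obtain t' where t': "t = Suc t'" by (cases t) auto
  have "x \<in> A t'" using not_less_Least[of t' "\<lambda>t. x \<notin> A t"] t' unfolding t_def by auto
  hence "x \<in> S t'" using t(1) t' by (simp add: S_def)
  then obtain l where l: "l < c t'" "x \<in> cl t' l" unfolding clU[symmetric] by blast
  obtain k where "st k = t'" "ix k = l" using ix(3)[OF l(1)] by blast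
  thus ?thesis using l(2) t(2) t' by (intro exI[of _ k]) (auto simp: cell_def)
 qed
 have rest: "vol (- (\<Union>k. cell k)) = 0"
 proof -
  have "vol (- (\<Union>k. cell k)) \<le> (m UNIV + 1) / 2 ^ s" for s
  proof -
   have "- (\<Union>k. cell k) \<subseteq> A s" using cover by blast
   hence "vol (- (\<Union>k. cell k)) \<le> vol (A s)" using A(3) by (intro leb.finite_measure_mono) auto
   also have "\<dots> \<le> m (A s)" by (simp add: m_def)
   finally show ?thesis using A(6)[of s] by simp
  qed
  moreover have "(\<lambda>s. (m UNIV + 1) / 2 ^ s) \<longlonglongrightarrow> 0" by real_asymp
  ultimately have "vol (- (\<Union>k. cell k)) \<le> 0" by (intro LIMSEQ_le_const) auto
  thus ?thesis by (simp add: measure_le_0_iff)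
 qed
 \<comment> \<open>The two arguments of the maximum are the two growth conditions in
   \<open>perturbation\<close>: the doubling, and the jump from noise within the tracking error to
   noise that wraps around.\<close>
 define z where "z = rec_nat 1 (\<lambda>k w. w * max 2 (2 * CARD('n) / \<eta> (st (Suc k))))"
 have z0: "z 0 = 1" and zS: "z (Suc k) = z k * max 2 (2 * CARD('n) / \<eta> (st (Suc k)))" for k by (simp_all add: z_def)
 have zp: "0 < z k" for k
 proof (induction k)
  case (Suc k) thus ?case unfolding zS by (intro mult_pos_pos) auto
 qed (simp add: z0)
 \<comment> \<open>Outside the cells, on a null set, the value \<open>1\<close> keeps
   \<open>\<zeta>\<close> positive.\<close>
 define \<zeta> where "\<zeta> x = (if x \<in> (\<Union>k. cell k) then z (LEAST k. x \<in> cell k) else 1)" for x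
 have \<zeta>: "\<zeta> x = z k" if x: "x \<in> cell k" for x k
 proof -
  have "(LEAST k. x \<in> cell k) = k" by (rule unique[OF LeastI[of "\<lambda>k. x \<in> cell k", OF x] x])
  thus ?thesis using x by (auto simp: \<zeta>_def)
 qed
 have \<zeta>m: "\<zeta> \<in> borel_measurable borel"
 proof (rule borel_measurableI)
  fix T :: "real set" assume "open T"
  have "\<zeta> -` T = (\<Union>k\<in>{k. z k \<in> T}. cell k) \<union> (if 1 \<in> T then - (\<Union>k. cell k) else {})"
  proof (rule set_eqI)
   fix x
   show "x \<in> \<zeta> -` T \<longleftrightarrow> x \<in> (\<Union>k\<in>{k. z k \<in> T}. cell k) \<union> (if 1 \<in> T then - (\<Union>k. cell k) else {})"
   proof (cases "x \<in> (\<Union>k. cell k)")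
    case True
    then obtain k where k: "x \<in> cell k" by blast
    have "x \<in> (\<Union>k\<in>{k. z k \<in> T}. cell k) \<longleftrightarrow> z k \<in> T"
    proof
     assume "x \<in> (\<Union>k\<in>{k. z k \<in> T}. cell k)"
     then obtain i where i: "z i \<in> T" "x \<in> cell i" by (elim UN_E) simp
     show "z k \<in> T" using i(1) unfolding unique[OF i(2) k] .
    next
     assume "z k \<in> T" thus "x \<in> (\<Union>k\<in>{k. z k \<in> T}. cell k)" using k by (intro UN_I[of k]) simp_all
    qed
    thus ?thesis using True \<zeta>[OF k] unfolding Un_iff vimage_eq by (cases "1 \<in> T") (simp_all, blast)
   next
    case False
    hence "\<zeta> x = 1" unfolding \<zeta>_def by (rule if_not_P)
    moreover have "x \<notin> (\<Union>k\<in>{k. z k \<in> T}. cell k)" using False by blast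
    ultimately show ?thesis using False unfolding Un_iff vimage_eq by (cases "1 \<in> T") simp_all
   qed
  qed
  moreover have "(\<Union>k\<in>{k. z k \<in> T}. cell k) \<union> (if 1 \<in> T then - (\<Union>k. cell k) else {}) \<in> sets borel"
   using cellb by auto
  ultimately show "\<zeta> -` T \<inter> space borel \<in> sets borel" by simp
 qed
 have "perturbation f Q \<mu> A \<rho> \<eta> r st cell p z \<zeta>"
 proof unfold_locales
  show "st i \<le> st k" if "i \<le> k" for i k using that ix(2)[of i k] by (cases "i = k") auto
  show "\<exists>k. s \<le> st k" for s using ix(3)[of 0 s] c1[of s] by fastforce
  show "2 * z k \<le> z (Suc k)" for k unfolding zS using zp[of k] by (simp add: mult.commute)
  show "z k * (2 * CARD('n)) \<le> \<eta> (st (Suc k)) * z (Suc k)" for k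
  proof -
   have "z k * (2 * CARD('n)) = \<eta> (st (Suc k)) * (z k * (2 * CARD('n) / \<eta> (st (Suc k))))"
    using pos(2)[of "st (Suc k)"] by simp
   also have "\<dots> \<le> \<eta> (st (Suc k)) * z (Suc k)"
    unfolding zS using zp[of k] pos(2)[of "st (Suc k)"] by (intro mult_left_mono) auto
   finally show ?thesis .
  qed
  show "cell k \<subseteq> A (st k) - A (Suc (st k))" for k using cellS[of k] by (simp add: S_def)
  show "cell k \<subseteq> ball (p k) (\<rho> (st k))" for k unfolding cell_def p_def by (rule clb(3))
  show "- A s \<subseteq> (\<Union>i\<in>{i. st i < s}. cell i)" for s using cover by blast
  show "0 < \<zeta> x" for x using zp by (simp add: \<zeta>_def)
  show "\<zeta> x = z k" if "x \<in> cell k" for k x by (rule \<zeta>[OF that])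
 qed (fact anti A(3) A(6) stage cellb disj rest z0 \<zeta>m)+
 moreover have "AE x in leb. \<exists>U. open U \<and> x \<in> U \<and> (\<forall>y\<in>U. \<zeta> y = \<zeta> x)"
 proof -
  have "frontier (cell k) \<in> null_sets leb" for k
   using clb(2)[of "st k" "ix k"] by (simp add: nullf_def cell_def null_sets_def leb.emeasure_eq_measure)
  hence "(\<Union>k. frontier (cell k)) \<in> null_sets leb" by (intro null_sets_UN') auto
  hence 1: "AE x in leb. x \<notin> (\<Union>k. frontier (cell k))" by (rule AE_not_in)
  have "- (\<Union>k. cell k) \<in> null_sets leb" using rest cellb by (simp add: null_sets_def leb.emeasure_eq_measure)
  hence 2: "AE x in leb. x \<notin> - (\<Union>k. cell k)" by (rule AE_not_in)
  from 1 2 show ?thesis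
  proof eventually_elim
   case (elim x)
   then obtain k where k: "x \<in> cell k" by blast
   hence "x \<in> interior (cell k)" using elim(1) closure_subset[of "cell k"] by (auto simp: frontier_def)
   thus ?case using \<zeta>[OF k] \<zeta>[of _ k] interior_subset[of "cell k"]
    by (intro exI[of _ "interior (cell k)"]) auto
  qed
 qed
 ultimately show thesis by (rule that)
qed

end

theorem theorem2:
  fixes f :: "'n::finite torus \<Rightarrow> 'n torus"
    and B \<beta> \<sigma> \<delta> :: real
  assumes "CARD('n) > 1"
    and "C2_local_diffeo_away_from_critical f B \<beta>"
    and "nonuniformly_expanding f"
    and "slow_recurrence f"
    and "0 < \<sigma>" "\<sigma> < 1" "0 < \<delta>" "\<delta> < 1"
    and "AE x in torus_lebesgue. first_hyperbolic_time f \<beta> \<sigma> \<delta> x < \<infinity>"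
    and "(\<Sum>m. \<Sum>j<Suc m. emeasure torus_lebesgue
            ((f ^^ j) ` (first_hyperbolic_time f \<beta> \<sigma> \<delta> -` {enat (Suc m)}))) < \<infinity>"
  shows "\<exists>\<zeta> :: 'n torus \<Rightarrow> real.
           \<zeta> \<in> borel_measurable borel \<and>
           (\<forall>x. \<zeta> x > 0) \<and>
           (AE x in torus_lebesgue. \<exists>U. open U \<and> x \<in> U \<and> (\<forall>y\<in>U. \<zeta> y = \<zeta> x)) \<and>
           stochastically_stable f (adapted_perturbation f \<zeta>)"
proof -
 interpret torus_map f B \<beta> by unfold_locales (rule assms(2))
 have empty: "critical_set f = {}" by (rule no_critical_points[OF assms(5-10)])
 obtain H :: "nat \<Rightarrow> 'n torus set" and \<theta> C0 c0 :: real where "expanding f B \<beta> H \<theta> C0 c0"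
 proof (rule hyperbolic_sets[OF empty assms(3)], goal_cases)
  case (1 H \<theta> C0 c0)
  have "expanding f B \<beta> H \<theta> C0 c0" by unfold_locales (use empty 1 in auto)
  thus ?case by (rule 1(1))
 qed
 then interpret expanding f B \<beta> H \<theta> C0 c0 .
 obtain Q \<mu> where Q: "Q \<subseteq> physical_measures f" "\<And>\<nu>. acip f \<nu> \<Longrightarrow> convex_combination_of Q \<nu>"
  and dyn: "regular_dynamics f Q \<mu>" by (rule physical_structure) (rule that)
 interpret dyn: regular_dynamics f Q \<mu> by (rule dyn)
 obtain A \<rho> \<eta> r st cell p z \<zeta> where pert: "perturbation f Q \<mu> A \<rho> \<eta> r st cell p z \<zeta>"
  and const: "AE x in torus_lebesgue. \<exists>U. open U \<and> x \<in> U \<and> (\<forall>y\<in>U. \<zeta> y = \<zeta> x)"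
  by (rule dyn.perturbation_exists)
 interpret perturbation f Q \<mu> A \<rho> \<eta> r st cell p z \<zeta> by (rule pert)
 have "stochastically_stable f (adapted_perturbation f \<zeta>)"
 proof (rule stable)
  fix \<mu>0 assume "acip f \<mu>0"
  hence "convex_combination_of Q \<mu>0" by (rule Q(2))
  thus "convex_combination_of (physical_measures f) \<mu>0"
   using Q(1) unfolding convex_combination_of_def by (meson order_trans)
 qed
 thus ?thesis using \<zeta>(1,2) const by blast
qed

end
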